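(* Let $r<2$ be fixed. For $z\in\mathbb{C}$ with $|z|\leqslant r$ and $\tfrac32\leqslant y\leqslant x$, $$\Phi_\nu(x,y,z)=x(\log x)^{z-1}\Big\{h_\nu(y,z)\Big(1+\frac{z-1}{\log x}J_\nu(y,z)\Big)+O\Big(\frac{(\log y)^7}{(\log x)^2}\Big)\Big\}.$$
   Context: $\nu$ denotes either $\Omega$ for all $n$ or $\omega$ for all $n$. $P^-(n)$ is the smallest prime factor of $n>1$, $P^-(1):=\infty$; $\Phi_\nu(x,y,z):=\sum_{n\leqslant x,\ P^-(n)>y}z^{\nu(n)}$. Define $H_\Omega(s,z):=\prod_p(1-z/p^s)^{-1}(1-1/p^s)^z$, $H_\omega(s,z):=\prod_p(1+z/(p^s-1))(1-1/p^s)^z$, and $G_\Omega(s,y,z):=\prod_{p\leqslant y}(1-z/p^s)$, $G_\omega(s,y,z):=\prod_{p\leqslant y}(1+z/(p^s-1))^{-1}$ (products over primes; empty product $=1$). Put $h_\nu(s,y,z):=H_\nu(s,z)G_\nu(s,y,z)/\Gamma(z)$, $h_\nu(y,z):=h_\nu(1,y,z)$, and $J_\nu(y,z):=\frac{H_\nu'(1,z)}{H_\nu(1,z)}+\frac{G_\nu'(1,y,z)}{G_\nu(1,y,z)}+\gamma z-1$, where $'$ denotes $\partial/\partial s$ and $\gamma$ is Euler's constant. *)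

theory Defs
  imports "HOL-Analysis.Analysis" "HOL-Computational_Algebra.Primes"
begin

datatype prime_counter = Big_Omega | Small_Omega

fun nu :: "prime_counter \<Rightarrow> nat \<Rightarrow> nat" where
  "nu Big_Omega n = size (prime_factorization n)"
| "nu Small_Omega n = card (prime_factors n)"

text \<open>Extended-real valued, so that it can be compared with a real \<^term>\<open>y\<close> also at \<open>n = 1\<close>.\<close>

definition P_minus :: "nat \<Rightarrow> ereal" where
  "P_minus n = (if n = 1 then \<infinity> else ereal (real (Min (prime_factors n))))"

definition Phi :: "prime_counter \<Rightarrow> real \<Rightarrow> real \<Rightarrow> complex \<Rightarrow> complex" where
  "Phi \<nu> x y z = (\<Sum>n | 1 \<le> n \<and> real n \<le> x \<and> P_minus n > ereal y. z ^ nu \<nu> n)"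

text \<open>Products over all primes are taken in increasing order. For \<open>Re s > 0\<close> the number
  \<open>1 - p\<^bsup>-s\<^esup>\<close> lies in the right half-plane, so the principal branch used by \<open>powr\<close> is the
  intended one.\<close>

fun H :: "prime_counter \<Rightarrow> complex \<Rightarrow> complex \<Rightarrow> complex" where
  "H Big_Omega s z =
     (\<Prod>p. if prime p
           then inverse (1 - z / of_nat p powr s) * (1 - 1 / of_nat p powr s) powr z
           else 1)"
| "H Small_Omega s z =
     (\<Prod>p. if prime p
           then (1 + z / (of_nat p powr s - 1)) * (1 - 1 / of_nat p powr s) powr z
           else 1)"

fun G :: "prime_counter \<Rightarrow> complex \<Rightarrow> real \<Rightarrow> complex \<Rightarrow> complex" where
  "G Big_Omega s y z = (\<Prod>p | prime p \<and> real p \<le> y. 1 - z / of_nat p powr s)"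
| "G Small_Omega s y z =
     (\<Prod>p | prime p \<and> real p \<le> y. inverse (1 + z / (of_nat p powr s - 1)))"

text \<open>The factor \<open>1 / \<Gamma>(z)\<close> is the entire function \<^const>\<open>rGamma\<close>, which vanishes at
  \<open>z = 0, -1, -2, \<dots>\<close>.

  For \<^const>\<open>Small_Omega\<close> at \<open>s = 1\<close>, \<open>z = -1\<close> the factor of \<^const>\<open>H\<close> at \<open>p = 2\<close> vanishes,
  so \<open>J\<close> divides by zero, and if \<open>y \<ge> 2\<close> then \<^const>\<open>G\<close> has a pole. This is the only such point
  with \<open>\<bar>z\<bar> < 2\<close>. There the continuous extensions in \<open>z\<close> of \<open>h\<close> and of the product \<open>h * J\<close>
  are both \<open>0\<close>, because of the zero of \<open>1 / \<Gamma>\<close>, and \<open>0\<close> is also the value that \<open>h\<close> and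
  \<open>h * J\<close> take below under the convention that dividing by zero gives zero.\<close>

definition h :: "prime_counter \<Rightarrow> complex \<Rightarrow> real \<Rightarrow> complex \<Rightarrow> complex" where
  "h \<nu> s y z = H \<nu> s z * G \<nu> s y z * rGamma z"

definition h1 :: "prime_counter \<Rightarrow> real \<Rightarrow> complex \<Rightarrow> complex" where
  "h1 \<nu> y z = h \<nu> 1 y z"

definition J :: "prime_counter \<Rightarrow> real \<Rightarrow> complex \<Rightarrow> complex" where
  "J \<nu> y z = deriv (\<lambda>s. H \<nu> s z) 1 / H \<nu> 1 z + deriv (\<lambda>s. G \<nu> s y z) 1 / G \<nu> 1 y z
              + euler_mascheroni * z - 1"

end

theory Submission
  imports Defs "HOL-Complex_Analysis.Complex_Analysis" "HOL-Probability.Probability"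
begin

text \<open>
  Selberg--Delange without a contour shift. The Dirichlet series \<open>F\<close> of \<open>z ^ \<nu>(n)\<close> over integers free of primes \<open>\<le> y\<close>
  is \<open>\<zeta>(s) powr z\<close> times a product that is holomorphic slightly to the left of \<open>Re s = 1\<close> and \<open>O((ln y) ^ 3)\<close> there.
  Near \<open>s = 1\<close> this gives \<open>F(s) = (s - 1) powr (- z) * (c\<^sub>0 + c\<^sub>1 (s - 1) + \<dots>)\<close> with \<open>c\<^sub>j = O((ln y) ^ (3 + j))\<close>.
  Write \<open>X = ln x\<close>. On the line \<open>Re s = 1 + 1 / X\<close> the \<open>k\<close>-th derivative of \<open>F\<close>, which belongs to the coefficients weighted
  by \<open>(ln n) ^ k\<close>, is large only near \<open>s = 1\<close>: elsewhere Cauchy's inequality and a zero-free region from \<open>3 + 4 cos \<theta> + cos 2\<theta> \<ge> 0\<close>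
  bound it by \<open>(ln y) ^ (k + 5)\<close> times a power of \<open>ln \<bar>Im s\<bar>\<close>, whereas the peak has order \<open>X powr (k + Re z)\<close>. So for large \<open>k\<close>
  a Gaussian-smoothed Perron formula compares the weighted sum with the integral of an explicit density, with
  a saving of \<open>X ^ 5\<close>, as long as \<open>ln y \<le> X powr \<tau>\<close> with \<open>\<tau> < 1\<close>. Removing the smoothing and, by partial summation, the weight
  leaves \<open>\<Sum>j. c\<^sub>j / \<Gamma>(z - j) * \<integral> e ^ v * v powr (z - 1 - j)\<close>, and two integrations by parts yield the main term, where
  \<open>c\<^sub>0 / \<Gamma>(z) = h\<close> and \<open>(c\<^sub>1 - c\<^sub>0) / \<Gamma>(z) = h * J\<close>. If \<open>ln y\<close> exceeds a constant times \<open>X powr ((2 * r + 3) / 7)\<close>,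
  the error term already dominates the trivial bound for \<open>\<Phi>\<close>.
\<close>


section \<open>Euler products\<close>

text \<open>With no contour to the left of the line, decay has to come from differentiation. Away
  from 1 the function varies on the scale \<open>1 / ln y\<close> (up to powers of the logarithm of
  the height), so each derivative costs a factor \<open>ln y\<close>; at the peak it gains a factor
  \<open>X\<close>. Under \<open>ln y \<le> X powr \<tau>\<close> every derivative thus saves
  \<open>X powr (1 - \<tau>)\<close>, and \<open>k\<close> is fixed last, when the fineness of the
  smoothing, also a power of \<open>X\<close>, is known. All bounds must be uniform in
  \<open>y\<close> and \<open>z\<close>, hence the explicit powers of \<open>ln y\<close>. As
  \<open>ln y\<close> can be as small as about \<open>1/3\<close>, raising such a power costs a
  power of 3. The exponent \<open>(2 * r + 3) / 7\<close> balances the two ranges. The trivial bound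
  is \<open>x * X powr r\<close>, the error allowed is
  \<open>x * (ln y) ^ 7 * X powr (Re z - 3)\<close> with \<open>Re z \<ge> - r\<close>, so the
  second dominates once \<open>(ln y) ^ 7 \<ge> X powr (2 * r + 3)\<close>; and
  \<open>(2 * r + 3) / 7 < 1\<close> says exactly \<open>r < 2\<close>. The same condition keeps the
  Euler factor at \<open>p = 2\<close> finite.\<close>

definition smooth_numbers :: "nat \<Rightarrow> nat set" where
  "smooth_numbers N = {n. n > 0 \<and> (\<forall>p. prime p \<longrightarrow> p dvd n \<longrightarrow> p < N)}"

lemma smooth_numbers_0: "smooth_numbers 0 = {1}"
  unfolding smooth_numbers_def using prime_factor_nat by fastforce

lemma smooth_numbers_Suc_nonprime: "\<not> prime N \<Longrightarrow> smooth_numbers (Suc N) = smooth_numbers N"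
  unfolding smooth_numbers_def by (auto simp: less_Suc_eq)

lemma smooth_numbers_not_dvd: "m \<in> smooth_numbers N \<Longrightarrow> prime N \<Longrightarrow> \<not> N dvd m"
  unfolding smooth_numbers_def by auto

text \<open>Unique factorization: \<open>k\<close> is the multiplicity of \<open>N\<close> and
  \<open>m\<close> the cofactor. It lets the Euler product be built by induction, one prime at a
  time.\<close>

lemma bij_smooth_numbers_Suc:
  assumes "prime N"
  shows "bij_betw (\<lambda>(m,k). m * N ^ k) (smooth_numbers N \<times> UNIV) (smooth_numbers (Suc N))"
proof (rule bij_betw_imageI)
  have mult: "multiplicity N (m * N ^ k) = k" if "m \<in> smooth_numbers N" for m k
  proof -
    have m: "m > 0" "\<not> N dvd m"
      using that smooth_numbers_not_dvd[OF that assms] by (auto simp: smooth_numbers_def)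
    have "multiplicity N (m * N ^ k) = multiplicity N m + multiplicity N (N ^ k)"
      using assms m by (intro prime_elem_multiplicity_mult_distrib) auto
    thus ?thesis using assms m by (simp add: not_dvd_imp_multiplicity_0 prime_elem_multiplicity_power_distrib)
  qed
  have N0: "N > 0" using assms by (simp add: prime_gt_0_nat)
  show "inj_on (\<lambda>(m,k). m * N ^ k) (smooth_numbers N \<times> UNIV)"
  proof (rule inj_onI, clarify)
    fix m k m' k' assume *: "m \<in> smooth_numbers N" "m' \<in> smooth_numbers N" "m * N ^ k = m' * N ^ k'"
    hence "k = k'" using mult by metis
    thus "m = m' \<and> k = k'" using * N0 by simp
  qed
  show "(\<lambda>(m,k). m * N ^ k) ` (smooth_numbers N \<times> UNIV) = smooth_numbers (Suc N)"
  proof (intro equalityI subsetI)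
    fix n assume "n \<in> (\<lambda>(m,k). m * N ^ k) ` (smooth_numbers N \<times> UNIV)"
    then obtain m k where n: "n = m * N ^ k" "m \<in> smooth_numbers N" by auto
    have "p < Suc N" if "prime p" "p dvd n" for p
    proof -
      have "p dvd m \<or> p dvd N" using that n prime_dvd_mult_iff prime_dvd_power by blast
      thus ?thesis using n that assms unfolding smooth_numbers_def
        by (auto dest: primes_dvd_imp_eq intro: less_SucI)
    qed
    thus "n \<in> smooth_numbers (Suc N)" using n N0 unfolding smooth_numbers_def by auto
  next
    fix n assume n: "n \<in> smooth_numbers (Suc N)"
    hence n0: "n \<noteq> 0" by (auto simp: smooth_numbers_def)
    have "\<not> is_unit N" using assms by auto
    then obtain m where m: "n = N ^ multiplicity N n * m" "\<not> N dvd m"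
      using multiplicity_decompose'[of n N] n0 by metis
    have "m \<in> smooth_numbers N"
    proof -
      have "m > 0" using m n0 by (cases m) auto
      moreover have "p < N" if "prime p" "p dvd m" for p
      proof -
        have "p dvd n" using m that by (metis dvd_mult)
        hence "p < Suc N" using n that by (auto simp: smooth_numbers_def)
        moreover have "p \<noteq> N" using m that by auto
        ultimately show ?thesis by simp
      qed
      ultimately show ?thesis by (auto simp: smooth_numbers_def)
    qed
    thus "n \<in> (\<lambda>(m,k). m * N ^ k) ` (smooth_numbers N \<times> UNIV)"
      using m by (intro image_eqI[of _ _ "(m, multiplicity N n)"]) (auto simp: mult.commute)
  qed
qed

lemma coprime_smooth_numbers_power:
  assumes "prime N" "m \<in> smooth_numbers N"
  shows "coprime m (N ^ k)"
proof -
  have "coprime N m" using prime_imp_coprime[OF assms(1)] smooth_numbers_not_dvd[OF assms(2,1)] by auto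
  thus ?thesis by (simp add: coprime_commute coprime_power_left_iff)
qed

text \<open>One induction serves both claims: at a prime \<open>N\<close> the sum over
  \<open>smooth_numbers (Suc N)\<close> becomes a double sum over a smooth cofactor and an exponent,
  and splitting it into a product needs the absolute summability that the other claim carries
  along.\<close>

lemma
  fixes a :: "nat \<Rightarrow> 'a :: {real_normed_field, banach}"
  assumes one: "a 1 = 1" and mult: "\<And>m n. coprime m n \<Longrightarrow> a (m * n) = a m * a n"
    and summ: "\<And>p. prime p \<Longrightarrow> summable (\<lambda>k. norm (a (p ^ k)))"
  shows abs_summable_on_smooth_numbers: "(\<lambda>n. norm (a n)) summable_on smooth_numbers N"
    and infsum_smooth_numbers: 
      "infsum a (smooth_numbers N) = (\<Prod>p<N. if prime p then (\<Sum>k. a (p ^ k)) else 1)"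
proof (induction N)
  case 0
  {case 1 show ?case by (simp add: smooth_numbers_0)}
  {case 2 show ?case using one by (simp add: smooth_numbers_0)}
next
  case (Suc N)
  have *: "(\<lambda>n. norm (a n)) summable_on smooth_numbers (Suc N) \<and>
     infsum a (smooth_numbers (Suc N)) = (\<Prod>p<Suc N. if prime p then (\<Sum>k. a (p ^ k)) else 1)"
  proof (cases "prime N")
    case False
    thus ?thesis using Suc by (simp add: smooth_numbers_Suc_nonprime)
  next
    case True
    let ?S = "smooth_numbers N"
    let ?f = "\<lambda>(m,k). a m * a (N ^ k)"
    have eq: "?f x = a (case x of (m,k) \<Rightarrow> m * N ^ k)" if "x \<in> ?S \<times> UNIV" for x
      using that mult coprime_smooth_numbers_power[OF True] by (auto split: prod.splits)
    have s1: "(\<lambda>k. norm (a (N ^ k))) summable_on UNIV"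
      using norm_summable_imp_has_sum[of "\<lambda>k. norm (a (N ^ k))"] summ[OF True]
      by (auto simp: summable_on_def summable_sums)
    have hs: "infsum (\<lambda>k. a (N ^ k)) UNIV = (\<Sum>k. a (N ^ k))"
      using norm_summable_imp_has_sum[of "\<lambda>k. a (N ^ k)"] summ[OF True]
      by (metis infsumI summable_norm_cancel summable_sums)
    have fs: "(\<lambda>x. norm (?f x)) summable_on (?S \<times> UNIV)"
    proof (subst Infinite_Sum.abs_summable_on_Sigma_iff, intro conjI ballI)
      show "(\<lambda>k. norm (case (m, k) of (m, k) \<Rightarrow> a m * a (N ^ k))) summable_on UNIV" for m
        using summable_on_cmult_right[OF s1, of "norm (a m)"] by (simp add: norm_mult)
      have "(\<lambda>m. norm (a m) * (\<Sum>\<^sub>\<infinity>k. norm (a (N ^ k)))) summable_on ?S"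
        using Suc(1) by (intro summable_on_cmult_left)
      moreover have "(\<Sum>\<^sub>\<infinity>k. norm (a (N ^ k))) \<ge> 0" by (intro infsum_nonneg) auto
      ultimately show "(\<lambda>m. norm (\<Sum>\<^sub>\<infinity>k. norm (case (m, k) of (m, k) \<Rightarrow> a m * a (N ^ k)))) summable_on ?S"
        by (simp add: norm_mult infsum_cmult_right')
    qed
    have "(\<lambda>x. norm (a (case x of (m,k) \<Rightarrow> m * N ^ k))) summable_on (?S \<times> UNIV)"
      by (rule summable_on_cong[THEN iffD1, OF _ fs]) (use eq in auto)
    hence A: "(\<lambda>n. norm (a n)) summable_on smooth_numbers (Suc N)"
      using summable_on_reindex_bij_betw[OF bij_smooth_numbers_Suc[OF True], of "\<lambda>n. norm (a n)"] by simp
    have "infsum a (smooth_numbers (Suc N)) = infsum (\<lambda>x. a (case x of (m,k) \<Rightarrow> m * N ^ k)) (?S \<times> UNIV)"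
      using infsum_reindex_bij_betw[OF bij_smooth_numbers_Suc[OF True], of a] by simp
    also have "\<dots> = infsum ?f (?S \<times> UNIV)" using eq by (intro infsum_cong) auto
    also have "\<dots> = infsum (\<lambda>m. infsum (\<lambda>k. a m * a (N ^ k)) UNIV) ?S"
      using infsum_Sigma'_banach[of "\<lambda>m k. a m * a (N ^ k)" ?S "\<lambda>_. UNIV"] abs_summable_summable[OF fs] by simp
    also have "\<dots> = infsum a ?S * (\<Sum>k. a (N ^ k))"
      by (simp add: infsum_cmult_right' infsum_cmult_left' hs)
    finally show ?thesis using A Suc(2) True by simp
  qed
  {case 1 show ?case using * by simp}
  {case 2 show ?case using * by simp}
qed

lemma lessThan_subset_smooth_numbers: "{0<..<N} \<subseteq> smooth_numbers N"
  unfolding smooth_numbers_def by (auto dest: dvd_imp_le)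

text \<open>The integers from 1 to \<open>n\<close> are among the \<open>Suc n\<close>-smooth ones,
  so a partial sum of norms is at most a finite Euler product of norms.\<close>

lemma summable_multiplicative:
  fixes a :: "nat \<Rightarrow> 'a :: {real_normed_field, banach}"
  assumes zero: "a 0 = 0" and one: "a 1 = 1" and mult: "\<And>m n. coprime m n \<Longrightarrow> a (m * n) = a m * a n"
    and summ: "\<And>p. prime p \<Longrightarrow> summable (\<lambda>k. norm (a (p ^ k)))"
    and bound: "\<And>N. (\<Prod>p<N. if prime p then (\<Sum>k. norm (a (p ^ k))) else 1) \<le> K"
  shows "summable (\<lambda>n. norm (a n))"
proof (rule bounded_imp_summable)
  fix n
  have "(\<Sum>k\<le>n. norm (a k)) = (\<Sum>k\<in>{0<..<Suc n}. norm (a k))"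
    by (rule sum.mono_neutral_right) (auto simp: zero)
  also have "\<dots> = infsum (\<lambda>k. norm (a k)) {0<..<Suc n}" by simp
  also have "\<dots> \<le> infsum (\<lambda>k. norm (a k)) (smooth_numbers (Suc n))"
    using abs_summable_on_smooth_numbers[of a "Suc n"] lessThan_subset_smooth_numbers[of "Suc n"] one mult summ
    by (intro infsum_mono_neutral) (auto dest: subsetD)
  also have "\<dots> = (\<Prod>p<Suc n. if prime p then (\<Sum>k. norm (a (p ^ k))) else 1)"
    by (rule infsum_smooth_numbers) (use one mult summ in \<open>auto simp: norm_mult\<close>)
  also have "\<dots> \<le> K" by (rule bound)
  finally show "(\<Sum>k\<le>n. norm (a k)) \<le> K" .
qed auto

text \<open>The \<open>N\<close>-th partial product is the sum over \<open>N\<close>-smooth numbers,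
  which include all \<open>0 < n < N\<close>; what is missing is bounded by a tail of the norm
  series. A limit of partial products, rather than a convergent product, leaves room for vanishing
  factors.\<close>

lemma euler_product_tendsto:
  fixes a :: "nat \<Rightarrow> 'a :: {real_normed_field, banach}"
  assumes zero: "a 0 = 0" and one: "a 1 = 1" and mult: "\<And>m n. coprime m n \<Longrightarrow> a (m * n) = a m * a n"
    and summ: "summable (\<lambda>n. norm (a n))"
  shows "(\<lambda>N. \<Prod>p<N. if prime p then (\<Sum>k. a (p ^ k)) else 1) \<longlonglongrightarrow> suminf a"
proof -
  have sp: "summable (\<lambda>k. norm (a (p ^ k)))" if "prime p" for p
  proof -
    have "summable ((\<lambda>n. norm (a n)) \<circ> (\<lambda>k. p ^ k))"
      by (rule summable_reindex[OF summ]) (use that prime_gt_1_nat[OF that] in \<open>auto simp: inj_on_def\<close>)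
    thus ?thesis by (simp add: o_def)
  qed
  have hs: "(a has_sum suminf a) UNIV"
    using norm_summable_imp_has_sum[OF summ] summ by (metis summable_norm_cancel summable_sums)
  have hn: "((\<lambda>n. norm (a n)) has_sum suminf (\<lambda>n. norm (a n))) UNIV"
    using norm_summable_imp_has_sum[of "\<lambda>n. norm (a n)"] summ by (auto simp: summable_sums)
  have sN: "(\<lambda>n. norm (a n)) summable_on A" for A
    using hn by (meson summable_on_def summable_on_subset_banach subset_UNIV)
  have sA: "a summable_on A" for A
    using sN abs_summable_summable by blast
  have bound: "norm (suminf a - infsum a (smooth_numbers N)) \<le> suminf (\<lambda>n. norm (a n)) - (\<Sum>n<N. norm (a n))" for N
  proof -
    have "suminf a - infsum a (smooth_numbers N) = infsum a (UNIV - smooth_numbers N)"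
      using infsum_Diff[OF sA sA, of "smooth_numbers N" UNIV] infsumI[OF hs] by simp
    also have "norm \<dots> \<le> infsum (\<lambda>n. norm (a n)) (UNIV - smooth_numbers N)"
      by (rule norm_infsum_bound[OF sN])
    also have "\<dots> \<le> infsum (\<lambda>n. norm (a n)) (UNIV - {..<N})"
      using lessThan_subset_smooth_numbers[of N] zero
      by (intro infsum_mono_neutral sN) (auto simp: subset_iff, metis neq0_conv)
    also have "\<dots> = suminf (\<lambda>n. norm (a n)) - (\<Sum>n<N. norm (a n))"
      using infsum_Diff[OF sN sN, of "{..<N}" UNIV] infsumI[OF hn] by simp
    finally show ?thesis .
  qed
  have "(\<lambda>N. suminf (\<lambda>n. norm (a n)) - (\<Sum>n<N. norm (a n))) \<longlonglongrightarrow> 0"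
    using tendsto_diff[OF tendsto_const summable_LIMSEQ[OF summ]] by (metis diff_self)
  from Lim_null_comparison[OF always_eventually[OF allI[OF bound]] this]
  have "(\<lambda>N. suminf a - infsum a (smooth_numbers N)) \<longlonglongrightarrow> 0" .
  hence "(\<lambda>N. infsum a (smooth_numbers N)) \<longlonglongrightarrow> suminf a"
    using tendsto_diff[OF tendsto_const[of "suminf a"], of "\<lambda>N. suminf a - infsum a (smooth_numbers N)" 0] by simp
  moreover have "infsum a (smooth_numbers N) = (\<Prod>p<N. if prime p then (\<Sum>k. a (p ^ k)) else 1)" for N
    by (rule infsum_smooth_numbers) (use one mult sp in auto)
  ultimately show ?thesis by (simp only:)
qed

section \<open>Holomorphy of infinite series and products; Cauchy and Taylor estimates\<close>

lemma holomorphic_suminf: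
  fixes f :: "nat \<Rightarrow> complex \<Rightarrow> complex"
  assumes S: "open S" and hol: "\<And>n. f n holomorphic_on S"
    and bnd: "\<And>x. x \<in> S \<Longrightarrow> \<exists>d M. 0 < d \<and> cball x d \<subseteq> S \<and> summable M \<and> (\<forall>n. \<forall>w\<in>cball x d. norm (f n w) \<le> M n)"
  shows "(\<lambda>s. \<Sum>n. f n s) holomorphic_on S"
proof (rule holomorphic_uniform_sequence[OF S, of "\<lambda>N s. \<Sum>n<N. f n s"])
  show "(\<lambda>s. \<Sum>n<N. f n s) holomorphic_on S" for N by (intro holomorphic_intros hol)
  fix x assume "x \<in> S"
  then obtain d M where d: "0 < d" "cball x d \<subseteq> S" "summable M" "\<And>n w. w\<in>cball x d \<Longrightarrow> norm (f n w) \<le> M n"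
    using bnd by metis
  have "uniform_limit (cball x d) (\<lambda>n w. \<Sum>i<n. f i w) (\<lambda>w. suminf (\<lambda>i. f i w)) sequentially"
    by (rule Weierstrass_m_test) (use d in auto)
  thus "\<exists>d>0. cball x d \<subseteq> S \<and> uniform_limit (cball x d) (\<lambda>N s. \<Sum>n<N. f n s) (\<lambda>s. \<Sum>n. f n s) sequentially"
    using d by auto
qed

lemma holomorphic_prodinf:
  fixes f :: "nat \<Rightarrow> complex \<Rightarrow> complex"
  assumes S: "open S" and hol: "\<And>n. f n holomorphic_on S"
    and bnd: "\<And>x. x \<in> S \<Longrightarrow> \<exists>d M. 0 < d \<and> cball x d \<subseteq> S \<and> summable M \<and> (\<forall>n. \<forall>w\<in>cball x d. norm (f n w - 1) \<le> M n)"
  shows "(\<lambda>s. \<Prod>n. f n s) holomorphic_on S"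
proof (rule holomorphic_uniform_sequence[OF S, of "\<lambda>N s. \<Prod>n<N. f n s"])
  show "(\<lambda>s. \<Prod>n<N. f n s) holomorphic_on S" for N by (intro holomorphic_intros hol)
  fix x assume "x \<in> S"
  then obtain d M where d: "0 < d" "cball x d \<subseteq> S" "summable M" "\<And>n w. w\<in>cball x d \<Longrightarrow> norm (f n w - 1) \<le> M n"
    using bnd by metis
  have "uniformly_convergent_on (cball x d) (\<lambda>n w. \<Sum>i<n. norm (f i w - 1))"
    by (rule Weierstrass_m_test'[of _ _ M]) (use d in auto)
  hence "uniformly_convergent_on (cball x d) (\<lambda>N w. \<Prod>n<N. f n w)"
    by (intro uniformly_convergent_on_prod' holomorphic_on_imp_continuous_on holomorphic_on_subset[OF hol d(2)]) auto
  then obtain g where g: "uniform_limit (cball x d) (\<lambda>N w. \<Prod>n<N. f n w) g sequentially"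
    by (auto simp: uniformly_convergent_on_def)
  have "g w = (\<Prod>n. f n w)" if "w \<in> cball x d" for w
  proof -
    have "summable (\<lambda>n. norm (f n w - 1))"
      by (rule summable_comparison_test[OF _ d(3)]) (use d(4) that in auto)
    hence "convergent_prod (\<lambda>n. f n w)"
      by (intro abs_convergent_prod_imp_convergent_prod summable_imp_abs_convergent_prod)
    hence "(\<lambda>N. \<Prod>n\<le>N. f n w) \<longlonglongrightarrow> (\<Prod>n. f n w)" by (rule convergent_prod_LIMSEQ)
    moreover have "(\<lambda>N. \<Prod>n<Suc N. f n w) \<longlonglongrightarrow> g w"
      by (rule LIMSEQ_Suc) (rule tendsto_uniform_limitI[OF g that])
    ultimately show ?thesis using LIMSEQ_unique by (metis (no_types, lifting) ext lessThan_Suc_atMost)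
  qed
  hence "uniform_limit (cball x d) (\<lambda>N w. \<Prod>n<N. f n w) (\<lambda>w. \<Prod>n. f n w) sequentially"
    using g by (subst uniform_limit_cong'[where g = "\<lambda>N w. \<Prod>n<N. f n w" and i = g]) auto
  thus "\<exists>d>0. cball x d \<subseteq> S \<and> uniform_limit (cball x d) (\<lambda>N s. \<Prod>n<N. f n s) (\<lambda>s. \<Prod>n. f n s) sequentially"
    using d by auto
qed

text \<open>The inequality on closed discs of radius \<open>\<rho> < R\<close>, with
  \<open>\<rho>\<close> tending to \<open>R\<close>, so that nothing is assumed on the boundary
  circle.\<close>

lemma Cauchy_inequality_ball:
  assumes hol: "f holomorphic_on ball a R" and "0 < R" and bnd: "\<And>w. w \<in> ball a R \<Longrightarrow> norm (f w) \<le> M"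
  shows "norm ((deriv ^^ n) f a) \<le> fact n * M / R ^ n"
proof -
  have le: "norm ((deriv ^^ n) f a) * \<rho> ^ n \<le> fact n * M" if "0 < \<rho>" "\<rho> < R" for \<rho>
  proof -
    have "norm ((deriv ^^ n) f a) \<le> fact n * M / \<rho> ^ n"
    proof (rule Cauchy_inequality)
      show "f holomorphic_on ball a \<rho>" using that by (intro holomorphic_on_subset[OF hol]) auto
      show "continuous_on (cball a \<rho>) f"
        by (rule continuous_on_subset[OF holomorphic_on_imp_continuous_on[OF hol]]) (use that in auto)
    qed (use that bnd in \<open>auto simp: dist_norm\<close>)
    thus ?thesis using that by (simp add: pos_le_divide_eq)
  qed
  have "((\<lambda>\<rho>. norm ((deriv ^^ n) f a) * \<rho> ^ n) \<longlongrightarrow> norm ((deriv ^^ n) f a) * R ^ n) (at_left R)"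
    by (intro tendsto_intros)
  moreover have "eventually (\<lambda>\<rho>. norm ((deriv ^^ n) f a) * \<rho> ^ n \<le> fact n * M) (at_left R)"
    using eventually_at_left_real[OF \<open>0 < R\<close>] by eventually_elim (use le in auto)
  ultimately have "norm ((deriv ^^ n) f a) * R ^ n \<le> fact n * M"
    by (intro tendsto_upperbound) auto
  thus ?thesis using \<open>0 < R\<close> by (simp add: pos_le_divide_eq)
qed

text \<open>With \<open>u = norm (w - a) / R\<close>, Cauchy's inequality bounds the
  \<open>j\<close>-th Taylor term by \<open>M * u ^ j\<close>; the tail from \<open>m\<close> on is
  geometric with ratio \<open>u \<le> q\<close>.\<close>

lemma taylor_remainder_bound:
  assumes hol: "f holomorphic_on ball a R" and R: "0 < R" and bnd: "\<And>w. w \<in> ball a R \<Longrightarrow> norm (f w) \<le> M"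
    and w: "norm (w - a) \<le> q * R" "0 \<le> q" "q < 1"
  shows "norm (f w - (\<Sum>j<m. (deriv ^^ j) f a / fact j * (w - a) ^ j)) \<le> M / (1 - q) * (norm (w - a) / R) ^ m"
proof -
  define u where "u = norm (w - a) / R"
  have u: "0 \<le> u" "u \<le> q" using w R by (auto simp: u_def field_simps)
  have M: "M \<ge> 0" using bnd[of a] R by (metis centre_in_ball norm_ge_zero order_trans)
  have "norm (w - a) < R" using w R by (smt (verit) mult_less_cancel_right2)
  hence wb: "w \<in> ball a R" by (simp add: dist_norm norm_minus_commute)
  let ?c = "\<lambda>j. (deriv ^^ j) f a / fact j * (w - a) ^ j"
  have s: "?c sums f w" by (rule holomorphic_power_series[OF hol wb])
  have cb: "norm (?c j) \<le> M * u ^ j" for j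
  proof -
    have "norm (?c j) = norm ((deriv ^^ j) f a) * norm (w - a) ^ j / fact j"
      by (simp add: norm_mult norm_divide norm_power)
    also have "\<dots> \<le> (fact j * M / R ^ j) * norm (w - a) ^ j / fact j"
      by (intro divide_right_mono mult_right_mono Cauchy_inequality_ball[OF hol R bnd]) auto
    also have "\<dots> = M * u ^ j" by (simp add: u_def power_divide)
    finally show ?thesis .
  qed
  have "f w - (\<Sum>j<m. ?c j) = (\<Sum>j. ?c (j + m))"
    using suminf_minus_initial_segment[OF sums_summable[OF s], of m] sums_unique[OF s] by simp
  also have "norm \<dots> \<le> (\<Sum>j. M * u ^ m * u ^ j)"
  proof (rule norm_suminf_le)
    show "norm (?c (j + m)) \<le> M * u ^ m * u ^ j" for j using cb[of "j + m"] by (simp add: power_add mult_ac)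
    show "summable (\<lambda>j. M * u ^ m * u ^ j)" using u w by (intro summable_mult summable_geometric) auto
  qed
  also have "\<dots> = M * u ^ m * (1 / (1 - u))"
    using u w by (subst suminf_mult) (auto simp: suminf_geometric summable_geometric)
  also have "\<dots> \<le> M * u ^ m * (1 / (1 - q))" using u w M by (intro mult_left_mono frac_le) auto
  finally show ?thesis by (simp add: u_def)
qed

section \<open>Local Euler factors as functions of \<open>w = p powr (- s)\<close>\<close>

fun euler_factor :: "prime_counter \<Rightarrow> complex \<Rightarrow> complex \<Rightarrow> complex" where
  "euler_factor Big_Omega z w = inverse (1 - z * w)"
| "euler_factor Small_Omega z w = 1 + z * w / (1 - w)"

text \<open>For \<open>w = p powr (- s)\<close>, \<open>euler_factor\<close> is the sum of
  \<open>z ^ \<nu>(p ^ k) * w ^ k\<close> over \<open>k\<close>. Dividing by the corresponding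
  factor \<open>(1 - w) powr (- z)\<close> of \<open>\<zeta>(s) powr z\<close> removes the linear
  term and leaves \<open>1 + O(w ^ 2)\<close>.\<close>

definition twisted_factor :: "prime_counter \<Rightarrow> complex \<Rightarrow> complex \<Rightarrow> complex" where
  "twisted_factor \<nu> z w = euler_factor \<nu> z w * (1 - w) powr z"

lemma one_minus_not_nonpos:
  assumes "norm (w::complex) < 1" shows "1 - w \<notin> \<real>\<^sub>\<le>\<^sub>0" "1 - w \<noteq> 0"
proof -
  have "Re w < 1" using abs_Re_le_cmod[of w] assms by linarith
  thus "1 - w \<notin> \<real>\<^sub>\<le>\<^sub>0" by (auto simp: complex_nonpos_Reals_iff)
  thus "1 - w \<noteq> 0" by auto
qed

lemma one_minus_mult_nonzero:
  assumes "norm z \<le> r" "norm w \<le> \<kappa>" "r * \<kappa> < 1" "0 \<le> r"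
  shows "1 - z * (w::complex) \<noteq> 0" "norm (1 - z * w) \<ge> 1 - r * \<kappa>"
proof -
  have "norm (z * w) \<le> r * \<kappa>" using assms by (simp add: norm_mult mult_mono)
  thus "norm (1 - z * w) \<ge> 1 - r * \<kappa>" using norm_triangle_ineq2[of 1 "z * w"] by simp
  thus "1 - z * w \<noteq> 0" using assms by auto
qed

lemma norm_Ln_one_minus_le:
  assumes "norm w < 1"
  shows "norm (Ln (1 - w)) \<le> - ln (1 - norm w)"
proof -
  have 1: "(\<lambda>n. - (w ^ n) / of_nat n) sums Ln (1 - w)" using Ln_series'[of "- w"] assms by simp
  have 2: "(\<lambda>n. norm w ^ n / of_nat n) sums (- ln (1 - norm w))"
    using sums_minus[OF ln_series'[of "- norm w"]] assms by simp
  have "norm (suminf (\<lambda>n. - (w ^ n) / of_nat n)) \<le> suminf (\<lambda>n. norm w ^ n / of_nat n)"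
    by (rule norm_suminf_le) (use 2 in \<open>auto simp: norm_divide norm_power sums_iff\<close>)
  thus ?thesis using 1 2 by (simp add: sums_iff)
qed

text \<open>Second-order Taylor expansion at \<open>w = 0\<close>, where value and derivative of
  both functions are known. The disc must stay clear of the pole \<open>1 / z\<close> of the factor
  for \<open>\<Omega>\<close>, so its radius is below \<open>1 / r\<close>; and
  \<open>\<kappa> > 1/2\<close> is wanted so that \<open>w = 2 powr (- s)\<close> is still covered
  slightly to the left of \<open>Re s = 1\<close>. Both fit because \<open>r < 2\<close>.\<close>

lemma twisted_factor_bounds:
  assumes "1 \<le> r" "r < 2"
  shows "\<exists>C \<kappa>. 0 \<le> C \<and> 1/2 < \<kappa> \<and> \<kappa> < 1 \<and> r * \<kappa> < 1 \<and> (\<forall>\<nu> z w. norm z \<le> r \<longrightarrow> norm w \<le> \<kappa> \<longrightarrow>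
    norm (twisted_factor \<nu> z w - 1) \<le> C * norm w ^ 2 \<and> norm ((1 - w) powr z - (1 - z * w)) \<le> C * norm w ^ 2)"
proof -
  \<comment> \<open>Two successive midpoints give \<open>1/2 < \<kappa> < R < 1/r\<close>: the
    functions are bounded on the disc of radius \<open>R\<close> and expanded on that of radius
    \<open>\<kappa>\<close>.\<close>
  define \<kappa> where "\<kappa> = (1/2 + 1/r) / 2"
  define R where "R = (\<kappa> + 1/r) / 2"
  have kk: "1/2 < \<kappa>" "\<kappa> < R" "R < 1/r" "0 < R" "R < 1" "r * R < 1" "r * \<kappa> < 1"
  proof -
    have "1/2 < 1/r" "1/r \<le> 1" using assms by (auto simp: field_simps)
    thus *: "1/2 < \<kappa>" "\<kappa> < R" "R < 1/r" by (auto simp: \<kappa>_def R_def field_simps)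
    thus "0 < R" "R < 1" using \<open>1/r \<le> 1\<close> by auto
    show "r * R < 1" using * assms by (auto simp: field_simps)
    moreover have "r * \<kappa> < r * R" using * assms by (intro mult_strict_left_mono) auto
    ultimately show "r * \<kappa> < 1" by simp
  qed
  define L where "L = exp (r * (- ln (1 - R)))"
  define M where "M = (1 / (1 - r * R) + 1 + r * R / (1 - R)) * L"
  define q where "q = \<kappa> / R"
  have q: "0 \<le> q" "q < 1" "\<kappa> = q * R" using kk by (auto simp: q_def)
  have L: "norm ((1 - w) powr z) \<le> L" if "norm z \<le> r" "norm w < R" for z w :: complex
  proof -
    have "norm ((1 - w) powr z) \<le> exp (norm (z * Ln (1 - w)))"
    proof -
      have "1 - w \<noteq> 0" using one_minus_not_nonpos(2)[of w] that kk by simp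
      thus ?thesis by (metis norm_exp powr_def)
    qed
    also have "norm (z * Ln (1 - w)) \<le> r * (- ln (1 - R))"
      unfolding norm_mult
    proof (rule mult_mono)
      have "norm (Ln (1 - w)) \<le> - ln (1 - norm w)" using that kk by (intro norm_Ln_one_minus_le) auto
      also have "\<dots> \<le> - ln (1 - R)" using that kk by simp
      finally show "norm (Ln (1 - w)) \<le> - ln (1 - R)" .
    qed (use that assms in auto)
    finally show ?thesis by (simp add: L_def)
  qed
  have L1: "L \<ge> 1" using assms kk by (simp add: L_def mult_nonneg_nonpos)
  have E: "norm (euler_factor \<nu> z w) \<le> 1 / (1 - r * R) + 1 + r * R / (1 - R)" if "norm z \<le> r" "norm w < R" for \<nu> z w
  proof (cases \<nu>)
    case Big_Omega
    have "norm (euler_factor \<nu> z w) \<le> 1 / (1 - r * R)"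
      using one_minus_mult_nonzero[of z r w R] that kk assms Big_Omega
      by (auto simp: norm_divide inverse_eq_divide intro!: frac_le)
    moreover have "r * R / (1 - R) \<ge> 0" using kk assms by simp
    ultimately show ?thesis by simp
  next
    case Small_Omega
    have "norm (1 - w) \<ge> 1 - R" using norm_triangle_ineq2[of 1 w] that by simp
    hence "norm (z * w / (1 - w)) \<le> r * R / (1 - R)"
      unfolding norm_divide norm_mult using that kk assms by (intro frac_le mult_mono) auto
    hence "norm (euler_factor \<nu> z w) \<le> 1 + r * R / (1 - R)"
      using Small_Omega norm_triangle_ineq[of 1 "z * w / (1 - w)"] by simp
    moreover have "1 / (1 - r * R) \<ge> 0" using kk by simp
    ultimately show ?thesis by linarith
  qed
  have E0: "1 / (1 - r * R) + 1 + r * R / (1 - R) \<ge> 1" using kk assms by simp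
  have M0: "L \<le> M" using mult_right_mono[OF E0, of L] L1 by (simp add: M_def)
  have nz: "1 - z * w \<noteq> 0" "1 - w \<noteq> 0" "1 - w \<notin> \<real>\<^sub>\<le>\<^sub>0" if "norm z \<le> r" "norm w < R" for z w :: complex
    using one_minus_mult_nonzero(1)[of z r w R] one_minus_not_nonpos[of w] that kk assms by auto
  define C where "C = M / (1 - q) / R ^ 2"
  have main: "norm (f w - (f 0 + deriv f 0 * w)) \<le> C * norm w ^ 2"
    if "f holomorphic_on ball 0 R" "\<And>w. norm w < R \<Longrightarrow> norm (f w) \<le> M" "norm w \<le> \<kappa>" for f and w :: complex
    using taylor_remainder_bound[of f 0 R M w q 2] that kk q
    by (simp add: C_def power_divide lessThan_Suc numeral_2_eq_2 add.commute)
  have powr_deriv: "((\<lambda>w. (1 - w) powr z) has_field_derivative (- z)) (at 0)" for z :: complex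
    by (auto intro!: derivative_eq_intros)
  have t1: "norm ((1 - w) powr z - (1 - z * w)) \<le> C * norm w ^ 2" if "norm z \<le> r" "norm w \<le> \<kappa>" for z w :: complex
  proof -
    have "norm ((1 - w) powr z - ((1 - 0) powr z + deriv (\<lambda>w. (1 - w) powr z) 0 * w)) \<le> C * norm w ^ 2"
    proof (rule main)
      show "(\<lambda>w. (1 - w) powr z) holomorphic_on ball 0 R"
        using nz that by (intro holomorphic_intros) auto
      show "norm ((1 - w) powr z) \<le> M" if "norm w < R" for w
        using L[OF \<open>norm z \<le> r\<close> that] M0 by simp
    qed (use that in auto)
    thus ?thesis using DERIV_imp_deriv[OF powr_deriv[of z]] by simp
  qed
  have t2: "norm (twisted_factor \<nu> z w - 1) \<le> C * norm w ^ 2" if "norm z \<le> r" "norm w \<le> \<kappa>" for \<nu> z w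
  proof -
    have d: "((\<lambda>w. twisted_factor \<nu> z w) has_field_derivative 0) (at 0)"
    proof -
      have "((\<lambda>w. euler_factor \<nu> z w) has_field_derivative z) (at 0)"
        by (cases \<nu>) (auto intro!: derivative_eq_intros)
      from DERIV_mult[OF this powr_deriv[of z]] show ?thesis
        by (cases \<nu>) (auto simp: twisted_factor_def)
    qed
    have "norm (twisted_factor \<nu> z w - (twisted_factor \<nu> z 0 + deriv (twisted_factor \<nu> z) 0 * w)) \<le> C * norm w ^ 2"
    proof (rule main)
      have "euler_factor \<nu> z holomorphic_on ball 0 R"
        using nz that by (cases \<nu>) (auto intro!: holomorphic_intros simp: euler_factor.simps[abs_def])
      thus "twisted_factor \<nu> z holomorphic_on ball 0 R"
        unfolding twisted_factor_def using nz that by (intro holomorphic_intros) auto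
      show "norm (twisted_factor \<nu> z w) \<le> M" if "norm w < R" for w
        unfolding twisted_factor_def norm_mult M_def
        using E[OF \<open>norm z \<le> r\<close> that, of \<nu>] L[OF \<open>norm z \<le> r\<close> that] E0 by (intro mult_mono) auto
    qed (use that in auto)
    moreover have "twisted_factor \<nu> z 0 = 1" by (cases \<nu>) (auto simp: twisted_factor_def)
    ultimately show ?thesis using DERIV_imp_deriv[OF d] by simp
  qed
  have "C \<ge> 0" using M0 L1 q kk by (simp add: C_def)
  thus ?thesis using t1 t2 kk by (intro exI[of _ C] exI[of _ \<kappa>]) auto
qed

section \<open>The multiplicative coefficients and the factorization of their Dirichlet
  series\<close>

definition rough_coeff :: "prime_counter \<Rightarrow> real \<Rightarrow> complex \<Rightarrow> nat \<Rightarrow> complex" where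
  "rough_coeff \<nu> y z n = (if n > 0 \<and> P_minus n > ereal y then z ^ nu \<nu> n else 0)"

lemma P_minus_gt_iff:
  assumes "n > 0"
  shows "P_minus n > ereal y \<longleftrightarrow> (\<forall>p\<in>prime_factors n. real p > y)"
proof (cases "n = 1")
  case False
  hence "prime_factors n \<noteq> {}" using assms by (simp add: prime_factorization_empty_iff)
  hence "y < real (Min (prime_factors n)) \<longleftrightarrow> (\<forall>p\<in>prime_factors n. real p > y)"
    by (metis (no_types, lifting) Min_in Min_le finite_set_mset less_le_trans of_nat_le_iff)
  thus ?thesis using False by (simp add: P_minus_def)
qed (simp add: P_minus_def)

lemma nu_mult:
  assumes "coprime m n" "m > 0" "n > 0"
  shows "nu \<nu> (m * n) = nu \<nu> m + nu \<nu> n"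
proof (cases \<nu>)
  case Small_Omega
  have "prime_factors m \<inter> prime_factors n = {}"
    using assms by (auto simp: in_prime_factors_iff dest: coprime_common_divisor)
  thus ?thesis using Small_Omega assms
    by (simp add: prime_factorization_mult card_Un_disjoint)
qed (use assms in \<open>simp add: prime_factorization_mult\<close>)

lemma rough_coeff_mult:
  assumes "coprime m n"
  shows "rough_coeff \<nu> y z (m * n) = rough_coeff \<nu> y z m * rough_coeff \<nu> y z n"
proof (cases "m > 0 \<and> n > 0")
  case True
  hence "P_minus (m * n) > ereal y \<longleftrightarrow> P_minus m > ereal y \<and> P_minus n > ereal y"
    by (subst (1 2 3) P_minus_gt_iff) (auto simp: prime_factorization_mult)
  thus ?thesis using True assms by (simp add: rough_coeff_def nu_mult power_add)
qed (auto simp: rough_coeff_def)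

lemma rough_coeff_0 [simp]: "rough_coeff \<nu> y z 0 = 0" by (simp add: rough_coeff_def)

lemma rough_coeff_1 [simp]: "rough_coeff \<nu> y z (Suc 0) = 1"
  by (cases \<nu>) (simp_all add: rough_coeff_def P_minus_def)

lemma rough_coeff_prime_power:
  assumes "prime p"
  shows "rough_coeff \<nu> y z (p ^ k) = (if k = 0 then 1 else if real p \<le> y then 0 else
           (case \<nu> of Big_Omega \<Rightarrow> z ^ k | Small_Omega \<Rightarrow> z))"
proof (cases "k = 0")
  case False
  have "prime_factorization (p ^ k) = replicate_mset k p"
    using assms by (rule prime_factorization_prime_power)
  moreover have "p ^ k > 0" using assms by (simp add: prime_gt_0_nat)
  ultimately show ?thesis using False
    by (cases \<nu>) (auto simp: rough_coeff_def P_minus_gt_iff set_mset_replicate_mset_subset)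
qed auto

text \<open>Since \<open>\<omega> \<le> \<Omega>\<close> and \<open>r \<ge> 1\<close>, a single
  majorant serves both counting functions.\<close>

lemma norm_rough_coeff_le:
  assumes "norm z \<le> r" "1 \<le> r"
  shows "norm (rough_coeff \<nu> y z n) \<le> r ^ size (prime_factorization n)"
proof -
  have "nu \<nu> n \<le> size (prime_factorization n)"
  proof (cases \<nu>)
    case Small_Omega
    have "size (mset_set (set_mset (prime_factorization n))) \<le> size (prime_factorization n)"
      by (intro size_mset_mono mset_set_set_mset_msubset)
    thus ?thesis using Small_Omega by simp
  qed simp
  hence "norm z ^ nu \<nu> n \<le> r ^ size (prime_factorization n)"
    by (meson assms norm_ge_zero order_trans power_increasing power_mono)
  thus ?thesis using assms by (auto simp: rough_coeff_def norm_power)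
qed

lemma of_nat_powr_mult: "of_nat (m * n) powr (w::complex) = of_nat m powr w * of_nat n powr w"
proof (cases "m = 0 \<or> n = 0")
  case False
  hence "Ln (of_nat (m * n)) = Ln (of_nat m) + Ln (of_nat n)"
    by (subst (1 2 3) Ln_of_nat) (auto simp: ln_mult)
  thus ?thesis using False by (simp add: powr_def exp_add ring_distribs del: of_nat_mult)
qed auto

lemma of_nat_powr_power: "p > 0 \<Longrightarrow> of_nat (p ^ k) powr (w::complex) = (of_nat p powr w) ^ k"
  by (induction k) (use of_nat_powr_mult in \<open>auto simp del: of_nat_mult of_nat_power\<close>)

lemma norm_of_nat_powr: "norm (of_nat n powr (w::complex)) = real n powr Re w"
  by (cases "n = 0") (auto simp: norm_powr_real_powr)

definition prime_recip :: "nat \<Rightarrow> complex \<Rightarrow> complex" where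
  "prime_recip p s = of_nat p powr (- s)"

lemma prime_recip_altdef: "prime_recip p s = 1 / of_nat p powr s"
  by (simp add: prime_recip_def powr_minus_divide)

lemma norm_prime_recip: "norm (prime_recip p s) = real p powr (- Re s)"
  by (simp add: prime_recip_def norm_of_nat_powr)

lemma norm_prime_recip_less: "prime p \<Longrightarrow> Re s > 0 \<Longrightarrow> norm (prime_recip p s) < 1"
  using prime_gt_1_nat[of p] by (auto simp: norm_prime_recip powr_minus_divide)

lemma norm_prime_recip_le:
  assumes "prime p" "Re s \<ge> \<sigma>" "\<sigma> \<ge> 0"
  shows "norm (prime_recip p s) \<le> 2 powr (- \<sigma>)"
proof -
  have "real p powr (- Re s) \<le> real p powr (- \<sigma>)"
    using prime_ge_2_nat[OF assms(1)] assms by (intro powr_mono) auto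
  also have "\<dots> \<le> 2 powr (-\<sigma>)" using prime_ge_2_nat[OF assms(1)] assms by (intro powr_mono2') auto
  finally show ?thesis by (simp add: norm_prime_recip)
qed

definition rough_series :: "prime_counter \<Rightarrow> real \<Rightarrow> complex \<Rightarrow> complex \<Rightarrow> complex" where
  "rough_series \<nu> y z s = (\<Sum>n. rough_coeff \<nu> y z n * of_nat n powr (- s))"

text \<open>The branch of \<open>log \<zeta>\<close> that is assembled from principal logarithms of
  the Euler factors and is real on the real axis. \<open>exp (z * log_zeta s)\<close> is what
  \<open>\<zeta>(s) powr z\<close> means throughout.\<close>

definition log_zeta :: "complex \<Rightarrow> complex" where
  "log_zeta s = (\<Sum>p. if prime p then - Ln (1 - prime_recip p s) else 0)"

text \<open>The Euler factors of the quotient of \<^const>\<open>rough_series\<close> by \<open>\<zeta>(s) powr z\<close>.\<close>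

definition corr_factor :: "prime_counter \<Rightarrow> real \<Rightarrow> complex \<Rightarrow> nat \<Rightarrow> complex \<Rightarrow> complex" where
  "corr_factor \<nu> y z p s = (if prime p then if real p \<le> y then (1 - prime_recip p s) powr z
       else twisted_factor \<nu> z (prime_recip p s) else 1)"

definition correction :: "prime_counter \<Rightarrow> real \<Rightarrow> complex \<Rightarrow> complex \<Rightarrow> complex" where
  "correction \<nu> y z s = (\<Prod>p. corr_factor \<nu> y z p s)"

lemma summable_powr_neg: "\<sigma> > 1 \<Longrightarrow> summable (\<lambda>n. real n powr (- \<sigma>))"
  by (simp add: summable_real_powr_iff)

text \<open>The local sum at \<open>p\<close> is geometric with ratio
  \<open>r * p powr (- \<sigma>) \<le> r / 2 < 1\<close>, and each is at most
  \<open>exp (c * p powr (- \<sigma>))\<close>, so the finite Euler products stay bounded. The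
  condition \<open>r < 2\<close> is what makes this work at \<open>p = 2\<close> for all
  \<open>\<sigma> > 1\<close>.\<close>

lemma summable_omega_powr:
  assumes r: "1 \<le> r" "r < 2" and \<sigma>: "\<sigma> > 1"
  shows "summable (\<lambda>n. r ^ size (prime_factorization n) * real n powr (- \<sigma>))"
proof -
  define a where "a n = r ^ size (prime_factorization n) * real n powr (- \<sigma>)" for n
  have pp: "a (p ^ k) = (r * real p powr (- \<sigma>)) ^ k" if "prime p" for p k
  proof -
    have "prime_factorization (p ^ k) = replicate_mset k p"
      using that by (rule prime_factorization_prime_power)
    moreover have "(real p ^ k) powr (- \<sigma>) = (real p powr (- \<sigma>)) ^ k"
      using prime_gt_0_nat[OF that] by (simp add: powr_realpow[symmetric] powr_powr mult.commute)
    ultimately show ?thesis by (simp add: a_def power_mult_distrib)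
  qed
  have u: "0 \<le> r * real p powr (- \<sigma>)" "r * real p powr (- \<sigma>) \<le> r / 2" if "prime p" for p
  proof -
    have "real p powr (- \<sigma>) \<le> 2 powr (- \<sigma>)"
      using prime_ge_2_nat[OF that] \<sigma> by (intro powr_mono2') auto
    also have "\<dots> \<le> 2 powr (- 1)" using \<sigma> by (intro powr_mono) auto
    finally have "real p powr (- \<sigma>) \<le> 1 / 2" by (simp add: powr_minus_divide)
    thus "r * real p powr (- \<sigma>) \<le> r / 2" using r mult_left_mono[of "real p powr (- \<sigma>)" "1/2" r] by simp
  qed (use r in auto)
  have u1: "r * real p powr (- \<sigma>) < 1" if "prime p" for p using u(2)[OF that] r by linarith
  \<comment> \<open>For \<open>v = r * p powr (- \<sigma>) \<le> r / 2\<close> this gives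
    \<open>v / (1 - v) \<le> c * p powr (- \<sigma>)\<close>.\<close>
  define c where "c = r / (1 - r / 2)"
  have c: "c \<ge> 0" using r by (simp add: c_def)
  have sm: "summable (\<lambda>n. norm (a n))"
  proof (rule summable_multiplicative)
    show "a (m * n) = a m * a n" if "coprime m n" for m n
    proof (cases "m = 0 \<or> n = 0")
      case False
      thus ?thesis by (simp add: a_def prime_factorization_mult power_add powr_mult)
    qed (auto simp: a_def)
    show "summable (\<lambda>k. norm (a (p ^ k)))" if "prime p" for p
      using u1[OF that] r by (auto simp: pp[OF that] norm_power intro!: summable_geometric)
    show "(\<Prod>p<N. if prime p then \<Sum>k. norm (a (p ^ k)) else 1) \<le> exp (c * (\<Sum>n. real n powr (- \<sigma>)))" for N
    proof -
      have "(\<Prod>p<N. if prime p then \<Sum>k. norm (a (p ^ k)) else 1) \<le> (\<Prod>p<N. exp (c * real p powr (- \<sigma>)))"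
      proof (intro prod_mono conjI)
        fix p
        show "0 \<le> (if prime p then \<Sum>k. norm (a (p ^ k)) else 1)"
          using u1[of p] r by (auto simp: pp norm_power intro!: suminf_nonneg summable_geometric)
        show "(if prime p then \<Sum>k. norm (a (p ^ k)) else 1) \<le> exp (c * real p powr (- \<sigma>))"
        proof (cases "prime p")
          case True
          define v where "v = r * real p powr (- \<sigma>)"
          have v: "0 \<le> v" "v \<le> r / 2" "v < 1" using u[OF True] r unfolding v_def by linarith+
          have "(\<Sum>k. norm (a (p ^ k))) = 1 / (1 - v)"
            using v by (simp add: pp[OF True] v_def[symmetric] norm_power suminf_geometric)
          also have "\<dots> = 1 + v / (1 - v)" using v by (simp add: field_simps)
          also have "\<dots> \<le> exp (v / (1 - v))" by (rule exp_ge_add_one_self)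
          also have "\<dots> \<le> exp (v / (1 - r / 2))"
            using v r by (intro iffD2[OF exp_le_cancel_iff] divide_left_mono) auto
          finally show ?thesis using True by (simp add: v_def c_def)
        qed (use c in auto)
      qed
      also have "\<dots> = exp (c * (\<Sum>p<N. real p powr (- \<sigma>)))" by (simp add: exp_sum sum_distrib_left)
      also have "\<dots> \<le> exp (c * (\<Sum>n. real n powr (- \<sigma>)))"
        using c summable_powr_neg[OF \<sigma>]
        by (intro iffD2[OF exp_le_cancel_iff] mult_left_mono sum_le_suminf) auto
      finally show ?thesis .
    qed
  qed (auto simp: a_def)
  thus ?thesis using r by (simp add: a_def abs_mult)
qed

lemma summable_rough_series:
  assumes r: "1 \<le> r" "r < 2" and z: "norm z \<le> r" and s: "Re s > 1"
  shows "summable (\<lambda>n. norm (rough_coeff \<nu> y z n * of_nat n powr (- s)))"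
  by (rule summable_comparison_test[OF _ summable_omega_powr[OF r s]])
     (use norm_rough_coeff_le[OF z r(1)] in \<open>auto simp: norm_mult norm_of_nat_powr intro!: mult_right_mono\<close>)

lemma euler_product_rough_series:
  assumes r: "1 \<le> r" "r < 2" and z: "norm z \<le> r" and s: "Re s > 1"
  shows "(\<lambda>N. \<Prod>p<N. if prime p \<and> real p > y then euler_factor \<nu> z (prime_recip p s) else 1)
            \<longlonglongrightarrow> rough_series \<nu> y z s"
proof -
  let ?a = "\<lambda>n. rough_coeff \<nu> y z n * of_nat n powr (- s)"
  have lim: "(\<lambda>N. \<Prod>p<N. if prime p then (\<Sum>k. ?a (p ^ k)) else 1) \<longlonglongrightarrow> suminf ?a"
    using summable_rough_series[OF r z s]
    by (intro euler_product_tendsto) (auto simp: rough_coeff_mult of_nat_powr_mult simp del: of_nat_mult)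
  have loc: "(\<Sum>k. ?a (p ^ k)) = (if real p > y then euler_factor \<nu> z (prime_recip p s) else 1)"
    if p: "prime p" for p
  proof -
    define w where "w = prime_recip p s"
    have eq: "?a (p ^ k) = rough_coeff \<nu> y z (p ^ k) * w ^ k" for k
      using prime_gt_0_nat[OF p] by (simp add: of_nat_powr_power w_def prime_recip_def del: of_nat_power)
    have w: "norm w \<le> 1 / 2" using norm_prime_recip_le[OF p, of 1 s] s by (simp add: w_def powr_minus_divide)
    have zw: "norm (z * w) < 1"
    proof -
      have "norm (z * w) \<le> r * (1 / 2)" unfolding norm_mult using z w r by (intro mult_mono) auto
      thus ?thesis using r by simp
    qed
    show ?thesis
    proof (cases "real p \<le> y")
      case True
      have "(\<lambda>k. ?a (p ^ k)) = (\<lambda>k. if k = 0 then 1 else 0)"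
        unfolding eq unfolding rough_coeff_prime_power[OF p] using True by (auto simp: fun_eq_iff)
      thus ?thesis using True sums_unique[OF sums_single[of 0 "\<lambda>_. 1::complex"]] by simp
    next
      case False
      show ?thesis
      proof (cases \<nu>)
        case Big_Omega
        have "(\<lambda>k. ?a (p ^ k)) = (\<lambda>k. (z * w) ^ k)"
          unfolding eq unfolding rough_coeff_prime_power[OF p] using False Big_Omega
          by (auto simp: fun_eq_iff power_mult_distrib)
        thus ?thesis using False Big_Omega suminf_geometric[OF zw] by (simp add: w_def inverse_eq_divide)
      next
        case Small_Omega
        have "(\<lambda>k. z * w * w ^ k) sums (z * w * (1 / (1 - w)))"
          using w by (intro sums_mult geometric_sums) auto
        hence "(\<lambda>k. ?a (p ^ Suc k)) sums (z * w * (1 / (1 - w)))"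
          unfolding eq unfolding rough_coeff_prime_power[OF p] using False Small_Omega by (simp add: mult_ac)
        from sums_Suc[OF this] have "(\<lambda>k. ?a (p ^ k)) sums (z * w * (1 / (1 - w)) + 1)"
          by simp
        thus ?thesis using False Small_Omega by (simp add: sums_iff w_def add.commute)
      qed
    qed
  qed
  have "(\<Prod>p<N. if prime p then (\<Sum>k. ?a (p ^ k)) else 1) =
        (\<Prod>p<N. if prime p \<and> real p > y then euler_factor \<nu> z (prime_recip p s) else 1)" for N
    by (intro prod.cong refl) (simp add: loc del: of_nat_power)
  thus ?thesis using lim by (simp only: rough_series_def)
qed

lemma summable_log_zeta:
  assumes "Re s > 1"
  shows "summable (\<lambda>p. norm (if prime p then - Ln (1 - prime_recip p s) else 0))"
proof (rule summable_comparison_test[OF _ summable_mult[OF summable_powr_neg[OF assms], of 2]], intro exI allI impI)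
  fix p :: nat
  show "norm (norm (if prime p then - Ln (1 - prime_recip p s) else 0)) \<le> 2 * real p powr (- Re s)"
  proof (cases "prime p")
    case True
    have "norm (prime_recip p s) \<le> 2 powr (- Re s)" using norm_prime_recip_le[OF True, of "Re s" s] assms by simp
    also have "\<dots> < 2 powr (- 1)" using assms by (intro powr_less_mono) auto
    finally have "norm (- prime_recip p s) < 1 / 2" by (simp add: powr_minus_divide)
    from norm_Ln_le[OF this] show ?thesis using True by (simp add: norm_prime_recip)
  qed auto
qed

text \<open>For \<open>p > y\<close> only the quadratic term of the twisted factor remains. For
  \<open>p \<le> y\<close> the Euler factor is absent, nothing cancels the linear term
  \<open>z * p powr (- s)\<close> of \<open>(1 - w) powr z\<close>, and this term has to be
  kept.\<close>

lemma norm_corr_factor_bounds: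
  assumes r: "1 \<le> r" "r < 2"
  shows "\<exists>C \<eta>. 0 \<le> C \<and> 0 < \<eta> \<and> \<eta> \<le> 1/4 \<and> (\<forall>\<nu> y z p s. norm z \<le> r \<longrightarrow> 1 - \<eta> \<le> Re s \<longrightarrow> prime p \<longrightarrow>
     norm (corr_factor \<nu> y z p s - 1) \<le> (if real p \<le> y then r * real p powr (- Re s) else 0) + C * real p powr (- (3/2)) \<and>
     norm (prime_recip p s) < 1 \<and> norm (z * prime_recip p s) < 1)"
proof -
  obtain C \<kappa> where C: "0 \<le> C" "1/2 < \<kappa>" "\<kappa> < 1" "r * \<kappa> < 1" 
    and b1: "\<And>\<nu> z w. norm z \<le> r \<Longrightarrow> norm w \<le> \<kappa> \<Longrightarrow> norm (twisted_factor \<nu> z w - 1) \<le> C * norm w ^ 2"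
    and b2: "\<And>z w :: complex. norm z \<le> r \<Longrightarrow> norm w \<le> \<kappa> \<Longrightarrow> norm ((1 - w) powr z - (1 - z * w)) \<le> C * norm w ^ 2"
    using twisted_factor_bounds[OF r] by metis
  \<comment> \<open>The second entry makes \<open>2 powr (- (1 - \<eta>)) \<le> \<kappa>\<close>, so
    that every prime lies in the disc of the local estimates; the first makes
    \<open>2 * (1 - \<eta>) \<ge> 3/2\<close>, whence the convergent series of
    \<open>p powr (- (3/2))\<close>.\<close>
  define \<eta> where "\<eta> = min (1/4) (1 + log 2 \<kappa>)"
  have "log 2 \<kappa> > -1" using C by (subst less_log_iff) (auto simp: powr_minus_divide)
  hence \<eta>: "0 < \<eta>" "\<eta> \<le> 1/4" "\<eta> \<le> 1 + log 2 \<kappa>" unfolding \<eta>_def by linarith+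
  have "2 powr (- (1 - \<eta>)) \<le> 2 powr (log 2 \<kappa>)" using \<eta> by (intro powr_mono) auto
  hence 2: "2 powr (- (1 - \<eta>)) \<le> \<kappa>" using C by simp
  have main: "norm (corr_factor \<nu> y z p s - 1) \<le> (if real p \<le> y then r * real p powr (- Re s) else 0) + C * real p powr (- (3/2))
     \<and> norm (prime_recip p s) < 1 \<and> norm (z * prime_recip p s) < 1"
    if z: "norm z \<le> r" and s: "1 - \<eta> \<le> Re s" and p: "prime p" for \<nu> y z p s
  proof -
    define w where "w = prime_recip p s"
    have w: "norm w \<le> \<kappa>" using norm_prime_recip_le[OF p s] \<eta> 2 by (simp add: w_def)
    have "norm w ^ 2 = real p powr (- Re s * 2)"
      by (simp add: w_def norm_prime_recip power2_eq_square powr_add[symmetric] mult.commute)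
    also have "\<dots> \<le> real p powr (- (3/2))" using prime_ge_2_nat[OF p] s \<eta> by (intro powr_mono) auto
    finally have w2: "C * norm w ^ 2 \<le> C * real p powr (- (3/2))" using C by (intro mult_left_mono) auto
    have *: "norm (z * w) \<le> r * real p powr (- Re s)"
      using z r by (simp add: norm_mult w_def norm_prime_recip mult_right_mono)
    have zw: "norm (z * w) < 1"
    proof -
      have "norm (z * w) \<le> r * \<kappa>" unfolding norm_mult using z w r by (intro mult_mono) auto
      thus ?thesis using C by simp
    qed
    have "norm (corr_factor \<nu> y z p s - 1) \<le> (if real p \<le> y then r * real p powr (- Re s) else 0) + C * norm w ^ 2"
    proof (cases "real p \<le> y")
      case True
      have "norm (((1 - w) powr z - (1 - z * w)) - z * w) \<le> C * norm w ^ 2 + r * real p powr (- Re s)"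
        by (intro order_trans[OF norm_triangle_ineq4] add_mono b2[OF z w] *)
      thus ?thesis using True p by (simp add: corr_factor_def w_def algebra_simps)
    next
      case False
      thus ?thesis using b1[OF z w] p by (simp add: corr_factor_def w_def)
    qed
    thus ?thesis using w2 w C zw unfolding w_def by auto
  qed
  show ?thesis by (rule exI[of _ C], rule exI[of _ \<eta>]) (use main C \<eta> in blast)
qed

definition zeta_series :: "complex \<Rightarrow> complex" where
  "zeta_series s = (\<Sum>n. of_nat n powr (- s))"

lemma prime_recip_holomorphic: "prime p \<Longrightarrow> prime_recip p holomorphic_on A"
  unfolding prime_recip_def using prime_gt_0_nat[of p] by (intro holomorphic_intros) auto

lemma log_zeta_holomorphic: "log_zeta holomorphic_on {s. Re s > 1}"
proof -
  have "(\<lambda>s. \<Sum>p. if prime p then - Ln (1 - prime_recip p s) else 0) holomorphic_on {s. Re s > 1}"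
  proof (rule holomorphic_suminf)
    show "open {s. 1 < Re s}" by (rule open_halfspace_Re_gt)
    show "(\<lambda>s. if prime p then - Ln (1 - prime_recip p s) else 0) holomorphic_on {s. 1 < Re s}" for p
    proof (cases "prime p")
      case True
      thus ?thesis using one_minus_not_nonpos(1)[OF norm_prime_recip_less[OF True]]
        by (auto intro!: holomorphic_intros prime_recip_holomorphic)
    qed auto
    fix x :: complex assume "x \<in> {s. 1 < Re s}"
    hence x: "Re x > 1" by simp
    define d where "d = (Re x - 1) / 2"
    have Re_ge: "Re w \<ge> 1 + d" if "w \<in> cball x d" for w
      using abs_Re_le_cmod[of "x - w"] that by (simp add: dist_norm d_def field_simps)
    have "norm (if prime p then - Ln (1 - prime_recip p w) else 0) \<le> 2 * real p powr (- (1 + d))"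
      if w: "w \<in> cball x d" for p w
    proof (cases "prime p")
      case True
      have d: "d > 0" using x by (simp add: d_def)
      have "norm (prime_recip p w) \<le> 2 powr (- (1 + d))"
        using norm_prime_recip_le[OF True, of "1 + d" w] d Re_ge[OF w] by simp
      also have "\<dots> < 2 powr (- 1)" using d by (intro powr_less_mono) auto
      finally have "norm (- prime_recip p w) < 1 / 2" by (simp add: powr_minus_divide)
      from norm_Ln_le[OF this] have "norm (Ln (1 - prime_recip p w)) \<le> 2 * real p powr (- Re w)"
        by (simp add: norm_prime_recip)
      also have "real p powr (- Re w) \<le> real p powr (- (1 + d))"
        using Re_ge[OF w] prime_ge_1_nat[OF True] by (intro powr_mono) auto
      finally show ?thesis using True by simp
    qed auto
    moreover have "summable (\<lambda>p. 2 * real p powr (- (1 + d)))"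
      using x by (intro summable_mult summable_powr_neg) (auto simp: d_def)
    moreover have d0: "d > 0" using x by (simp add: d_def)
    moreover have "cball x d \<subseteq> {s. 1 < Re s}"
    proof
      fix w assume "w \<in> cball x d"
      from Re_ge[OF this] show "w \<in> {s. 1 < Re s}" using d0 by simp
    qed
    ultimately show "\<exists>d M. 0 < d \<and> cball x d \<subseteq> {s. 1 < Re s} \<and> summable M \<and>
         (\<forall>n. \<forall>w\<in>cball x d. norm (if prime n then - Ln (1 - prime_recip n w) else 0) \<le> M n)"
      by (intro exI[of _ d] exI[of _ "\<lambda>p. 2 * real p powr (- (1 + d))"]) auto
  qed
  thus ?thesis by (simp add: log_zeta_def[abs_def])
qed

text \<open>From \<open>1 + t \<le> exp t\<close> factor by factor. The quadratic terms sum to a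
  constant; the sum over \<open>p \<le> y\<close> is left explicit because its size depends on
  \<open>y\<close> and on how far \<open>s\<close> lies to the left of 1.\<close>

lemma correction_facts:
  assumes r: "1 \<le> r" "r < 2"
  shows "\<exists>C \<eta>. 0 \<le> C \<and> 0 < \<eta> \<and> \<eta> \<le> 1/4 \<and> (\<forall>\<nu> y z. norm z \<le> r \<longrightarrow>
     correction \<nu> y z holomorphic_on {s. Re s > 1 - \<eta>} \<and>
     (\<forall>s. Re s > 1 - \<eta> \<longrightarrow>
        convergent_prod (\<lambda>p. corr_factor \<nu> y z p s) \<and>
        norm (correction \<nu> y z s) \<le> exp (r * (\<Sum>p | prime p \<and> real p \<le> y. real p powr (- Re s)) + C)))"
proof -
  obtain C \<eta> where C: "0 \<le> C" and \<eta>: "0 < \<eta>" "\<eta> \<le> 1/4"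
    and bnd: "\<And>\<nu> y z p s. norm z \<le> r \<Longrightarrow> 1 - \<eta> \<le> Re s \<Longrightarrow> prime p \<Longrightarrow>
     norm (corr_factor \<nu> y z p s - 1) \<le> (if real p \<le> y then r * real p powr (- Re s) else 0) + C * real p powr (- (3/2))"
    and small: "\<And>z p s. norm z \<le> r \<Longrightarrow> 1 - \<eta> \<le> Re s \<Longrightarrow> prime p \<Longrightarrow>
      norm (prime_recip p s) < 1 \<and> norm (z * prime_recip p s) < 1"
    using norm_corr_factor_bounds[OF r] by metis
  let ?S = "{s. Re s > 1 - \<eta>}"
  define u where "u y s p = (if prime p \<and> real p \<le> y then r * real p powr (- Re s) else 0)" for y s and p :: nat
  define M where "M y p = (if real p \<le> y then r else 0) + C * real p powr (- (3/2))" for y and p :: nat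
  have fin: "finite {p::nat. real p \<le> y}" for y
    by (rule finite_subset[of _ "{..nat \<lfloor>y\<rfloor>}"]) (auto simp: le_nat_floor)
  have sumM: "summable (M y)" for y
    unfolding M_def using fin[of y]
    by (intro summable_add summable_mult summable_powr_neg summable_If_finite) auto
  have bu: "norm (corr_factor \<nu> y z p s - 1) \<le> u y s p + C * real p powr (- (3/2))"
    if "norm z \<le> r" "Re s \<ge> 1 - \<eta>" for \<nu> y z p s
  proof (cases "prime p")
    case True
    thus ?thesis using bnd[OF that True, of \<nu> y] by (auto simp: u_def)
  qed (use C in \<open>auto simp: u_def corr_factor_def\<close>)
  have uM: "u y s p + C * real p powr (- (3/2)) \<le> M y p" if "Re s \<ge> 1 - \<eta>" for y s p
  proof -
    have "r * real p powr (- Re s) \<le> r * 1" if "prime p"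
      using r \<open>Re s \<ge> 1 - \<eta>\<close> \<eta> prime_ge_1_nat[OF that] powr_mono[of "- Re s" 0 "real p"] by (intro mult_left_mono) auto
    thus ?thesis using r by (auto simp: u_def M_def)
  qed
  have bM: "norm (corr_factor \<nu> y z p s - 1) \<le> M y p" if "norm z \<le> r" "Re s \<ge> 1 - \<eta>" for \<nu> y z p s
    using bu[OF that] uM[OF that(2)] by (rule order_trans)
  have hol: "corr_factor \<nu> y z p holomorphic_on ?S" if z: "norm z \<le> r" for \<nu> y z p
  proof (cases "prime p")
    case True
    have nz: "1 - prime_recip p s \<notin> \<real>\<^sub>\<le>\<^sub>0" "1 - prime_recip p s \<noteq> 0" "1 - z * prime_recip p s \<noteq> 0" if "s \<in> ?S" for s
      using small[OF z _ True, of s] that one_minus_not_nonpos[of "prime_recip p s"]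
        one_minus_not_nonpos[of "z * prime_recip p s"] by auto
    have h1: "(\<lambda>s. (1 - prime_recip p s) powr z) holomorphic_on ?S"
      using nz by (intro holomorphic_intros prime_recip_holomorphic True) auto
    have h2: "(\<lambda>s. euler_factor \<nu> z (prime_recip p s)) holomorphic_on ?S"
      using nz by (cases \<nu>) (auto intro!: holomorphic_intros prime_recip_holomorphic True)
    show ?thesis unfolding corr_factor_def twisted_factor_def
      using True by (cases "real p \<le> y") (auto intro!: holomorphic_on_mult h1 h2)
  qed (auto simp: corr_factor_def[abs_def])
  define C' where "C' = C * (\<Sum>p. real p powr (- (3/2)))"
  have s32: "summable (\<lambda>p. real p powr (- (3/2)))" by (rule summable_powr_neg) auto
  have "C' \<ge> 0" unfolding C'_def using C s32 by (intro mult_nonneg_nonneg suminf_nonneg) auto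
  moreover have "correction \<nu> y z holomorphic_on ?S" if z: "norm z \<le> r" for \<nu> y z
  proof -
    have "(\<lambda>s. \<Prod>p. corr_factor \<nu> y z p s) holomorphic_on ?S"
    proof (rule holomorphic_prodinf)
      show op: "open ?S" by (rule open_halfspace_Re_gt)
      show "corr_factor \<nu> y z p holomorphic_on ?S" for p by (rule hol[OF z])
      fix x assume "x \<in> ?S"
      then obtain d where "d > 0" "cball x d \<subseteq> ?S" using op open_contains_cball by blast
      moreover have "norm (corr_factor \<nu> y z n w - 1) \<le> M y n" if "w \<in> ?S" for n w
        using bM[OF z] that by auto
      ultimately show "\<exists>d M. 0 < d \<and> cball x d \<subseteq> ?S \<and> summable M \<and>
            (\<forall>n. \<forall>w\<in>cball x d. norm (corr_factor \<nu> y z n w - 1) \<le> M n)"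
        using sumM[of y] by (intro exI[of _ d] exI[of _ "M y"]) auto
    qed
    thus ?thesis by (simp add: correction_def[abs_def])
  qed
  moreover have conv: "convergent_prod (\<lambda>p. corr_factor \<nu> y z p s)" if "norm z \<le> r" "Re s > 1 - \<eta>" for \<nu> y z s
  proof -
    have "summable (\<lambda>p. norm (corr_factor \<nu> y z p s - 1))"
      by (rule summable_comparison_test[OF _ sumM[of y]]) (use bM that in auto)
    thus ?thesis by (intro abs_convergent_prod_imp_convergent_prod summable_imp_abs_convergent_prod)
  qed
  moreover have "norm (correction \<nu> y z s) \<le> exp (r * (\<Sum>p | prime p \<and> real p \<le> y. real p powr (- Re s)) + C')"
    if z: "norm z \<le> r" and s: "Re s > 1 - \<eta>" for \<nu> y z s
  proof -
    define U where "U = r * (\<Sum>p | prime p \<and> real p \<le> y. real p powr (- Re s))"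
    have lim: "(\<lambda>N. norm (\<Prod>p\<le>N. corr_factor \<nu> y z p s)) \<longlonglongrightarrow> norm (correction \<nu> y z s)"
      unfolding correction_def by (intro tendsto_norm convergent_prod_LIMSEQ conv z s)
    have "norm (\<Prod>p\<le>N. corr_factor \<nu> y z p s) \<le> exp (U + C')" for N
    proof -
      have "norm (\<Prod>p\<le>N. corr_factor \<nu> y z p s) \<le> (\<Prod>p\<le>N. exp (u y s p + C * real p powr (- (3/2))))"
        unfolding prod_norm[symmetric]
      proof (intro prod_mono conjI)
        fix p
        have "norm (corr_factor \<nu> y z p s) \<le> 1 + norm (corr_factor \<nu> y z p s - 1)"
          using norm_triangle_ineq[of 1 "corr_factor \<nu> y z p s - 1"] by simp
        also have "\<dots> \<le> 1 + (u y s p + C * real p powr (- (3/2)))"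
          using bu[OF z, of s] s by (intro add_left_mono) auto
        also have "\<dots> \<le> exp (u y s p + C * real p powr (- (3/2)))" by (rule exp_ge_add_one_self)
        finally show "norm (corr_factor \<nu> y z p s) \<le> exp (u y s p + C * real p powr (- (3/2)))" .
      qed auto
      also have "\<dots> = exp ((\<Sum>p\<le>N. u y s p) + C * (\<Sum>p\<le>N. real p powr (- (3/2))))"
        by (simp add: exp_sum[symmetric] sum.distrib sum_distrib_left)
      also have "\<dots> \<le> exp (U + C')"
      proof (intro iffD2[OF exp_le_cancel_iff] add_mono)
        have "(\<Sum>p\<le>N. u y s p) = (\<Sum>p | p \<le> N \<and> prime p \<and> real p \<le> y. r * real p powr (- Re s))"
          by (intro sum.mono_neutral_cong_right) (auto simp: u_def)
        also have "\<dots> \<le> (\<Sum>p | prime p \<and> real p \<le> y. r * real p powr (- Re s))"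
          using r by (intro sum_mono2 finite_subset[OF _ fin[of y]]) auto
        finally show "(\<Sum>p\<le>N. u y s p) \<le> U" by (simp add: U_def sum_distrib_left)
        show "C * (\<Sum>p\<le>N. real p powr (- (3/2))) \<le> C'"
          unfolding C'_def using C s32 by (intro mult_left_mono sum_le_suminf) auto
      qed
      finally show ?thesis .
    qed
    hence "norm (correction \<nu> y z s) \<le> exp (U + C')"
      by (intro LIMSEQ_le_const2[OF lim]) auto
    thus ?thesis by (simp add: U_def)
  qed
  ultimately show ?thesis using \<eta> by (intro exI[of _ C'] exI[of _ \<eta>]) auto
qed

text \<open>Already the partial products agree: \<open>exp (- z * Ln (1 - w))\<close> cancels
  \<open>(1 - w) powr z\<close>, leaving the Euler factor for \<open>p > y\<close> and 1 for
  \<open>p \<le> y\<close>.\<close>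

lemma rough_series_eq:
  assumes r: "1 \<le> r" "r < 2" and z: "norm z \<le> r" and s: "Re s > 1"
  shows "rough_series \<nu> y z s = exp (z * log_zeta s) * correction \<nu> y z s"
proof -
  obtain \<eta> where \<eta>: "0 < \<eta>" and conv: "\<And>s. Re s > 1 - \<eta> \<Longrightarrow> convergent_prod (\<lambda>p. corr_factor \<nu> y z p s)"
    using correction_facts[OF r] z by blast
  let ?l = "\<lambda>p. if prime p then - Ln (1 - prime_recip p s) else 0"
  let ?E = "\<lambda>p. if prime p \<and> real p > y then euler_factor \<nu> z (prime_recip p s) else 1"
  have "(\<lambda>N. \<Prod>p\<le>N. corr_factor \<nu> y z p s) \<longlonglongrightarrow> correction \<nu> y z s"
    unfolding correction_def by (intro convergent_prod_LIMSEQ conv) (use s \<eta> in auto)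
  moreover have "(\<lambda>N. \<Sum>p\<le>N. ?l p) \<longlonglongrightarrow> log_zeta s"
    unfolding log_zeta_def by (rule summable_LIMSEQ'[OF summable_norm_cancel[OF summable_log_zeta[OF s]]])
  ultimately have "(\<lambda>N. exp (z * (\<Sum>p\<le>N. ?l p)) * (\<Prod>p\<le>N. corr_factor \<nu> y z p s))
           \<longlonglongrightarrow> exp (z * log_zeta s) * correction \<nu> y z s"
    by (intro tendsto_intros)
  moreover have "exp (z * (\<Sum>p\<le>N. ?l p)) * (\<Prod>p\<le>N. corr_factor \<nu> y z p s) = (\<Prod>p\<le>N. ?E p)" for N
  proof -
    have "exp (z * ?l p) * corr_factor \<nu> y z p s = ?E p" for p
    proof (cases "prime p")
      case True
      have "1 - prime_recip p s \<noteq> 0"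
        using one_minus_not_nonpos(2)[OF norm_prime_recip_less[OF True]] s by simp
      hence "exp (z * - Ln (1 - prime_recip p s)) * (1 - prime_recip p s) powr z = 1"
        by (simp add: powr_def flip: exp_add)
      thus ?thesis using True by (simp add: corr_factor_def twisted_factor_def mult_ac)
    qed (auto simp: corr_factor_def)
    thus ?thesis by (simp add: sum_distrib_left exp_sum prod.distrib[symmetric])
  qed
  moreover have "(\<lambda>N. \<Prod>p\<le>N. ?E p) \<longlonglongrightarrow> rough_series \<nu> y z s"
    using LIMSEQ_Suc[OF euler_product_rough_series[OF r z s, of y \<nu>]] by (simp only: lessThan_Suc_atMost)
  ultimately show ?thesis using LIMSEQ_unique by (metis (no_types, lifting) ext)
qed

text \<open>The factorization for \<open>\<Omega>\<close> at \<open>z = 1\<close> and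
  \<open>y = 1\<close>, where all coefficients of positive index and all correction factors are
  1.\<close>

lemma exp_log_zeta:
  assumes s: "Re s > 1"
  shows "exp (log_zeta s) = zeta_series s"
proof -
  have "corr_factor Big_Omega 1 1 p s = 1" for p
  proof (cases "prime p")
    case True
    have "1 - prime_recip p s \<noteq> 0"
      using one_minus_not_nonpos(2)[OF norm_prime_recip_less[OF True]] s by simp
    thus ?thesis using True prime_gt_1_nat[OF True] by (simp add: corr_factor_def twisted_factor_def)
  qed (simp add: corr_factor_def)
  hence "correction Big_Omega 1 1 s = 1" by (simp add: correction_def)
  moreover have "rough_coeff Big_Omega 1 1 n * of_nat n powr (- s) = of_nat n powr (- s)" for n
    by (cases "n = 0") (auto simp: rough_coeff_def P_minus_gt_iff in_prime_factors_iff prime_gt_Suc_0_nat)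
  hence "rough_series Big_Omega 1 1 s = zeta_series s" by (simp only: rough_series_def zeta_series_def)
  ultimately show ?thesis using rough_series_eq[of 1 1 s Big_Omega 1] s by simp
qed

section \<open>The zeta function near the line \<open>Re s = 1\<close>\<close>

text \<open>This is \<open>s - 1\<close> times the difference between \<open>n powr (- s)\<close>
  and the integral of \<open>u powr (- s)\<close> from \<open>n\<close> to
  \<open>n + 1\<close>.\<close>

definition zeta_term :: "nat \<Rightarrow> complex \<Rightarrow> complex" where
  "zeta_term n s = (if n = 0 then 0 else
     (s - 1) * of_nat n powr (- s) + of_nat (Suc n) powr (1 - s) - of_nat n powr (1 - s))"

text \<open>Summation by parts turns \<open>(s - 1) * \<zeta>(s)\<close> into a series that converges for \<open>Re s > 0\<close>.\<close>

definition zeta_reg :: "complex \<Rightarrow> complex" where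
  "zeta_reg s = 1 + (\<Sum>n. zeta_term n s)"

lemma powr_segment_bound:
  assumes "n > 0" "Re w \<le> 0" "u \<in> closed_segment (of_nat n) (of_nat (Suc n))"
  shows "norm (u powr w :: complex) \<le> real n powr Re w" "u \<notin> \<real>\<^sub>\<le>\<^sub>0"
proof -
  have "closed_segment (complex_of_real (real n)) (complex_of_real (real (Suc n))) = of_real ` closed_segment (real n) (real (Suc n))"
    by (rule closed_segment_of_real)
  then obtain t where t: "u = of_real t" "real n \<le> t" "t \<le> real (Suc n)"
    using assms(3) by (auto simp: closed_segment_eq_real_ivl simp del: of_nat_Suc)
  have "t > 0" using t assms(1) by linarith
  thus "u \<notin> \<real>\<^sub>\<le>\<^sub>0" using t by (auto simp: complex_nonpos_Reals_iff)
  have "norm (u powr w) = t powr Re w" using \<open>t > 0\<close> t by (simp add: norm_powr_real_powr)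
  also have "\<dots> \<le> real n powr Re w" using t assms by (intro powr_mono2') auto
  finally show "norm (u powr w) \<le> real n powr Re w" .
qed

text \<open>The mean value inequality used twice: for
  \<open>(s - 1) * n powr (- s) * u + u powr (1 - s)\<close>, whose derivative in \<open>u\<close>
  is \<open>(1 - s) * (u powr (- s) - n powr (- s))\<close>, and for \<open>u powr (- s)\<close>
  inside that derivative. The second use gains the extra power of \<open>n\<close>.\<close>

lemma norm_zeta_term_le:
  assumes s: "Re s > 0" and n: "n > 0"
  shows "norm (zeta_term n s) \<le> norm (s - 1) * norm s * real n powr (- Re s - 1)"
proof -
  let ?S = "closed_segment (of_nat n :: complex) (of_nat (Suc n))"
  let ?B = "norm s * real n powr (- Re s - 1)"
  have len: "norm (u - of_nat n) \<le> 1" if "u \<in> ?S" for u :: complex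
  proof -
    have "norm (u - of_nat n) \<le> norm (of_nat (Suc n) - of_nat n :: complex)" by (rule segment_bound[OF that])
    thus ?thesis by simp
  qed
  have 1: "norm (u powr (- s) - of_nat n powr (- s)) \<le> ?B" if u: "u \<in> ?S" for u :: complex
  proof -
    have "norm (u powr (- s) - of_nat n powr (- s)) \<le> ?B * norm (u - of_nat n)"
    proof (rule field_differentiable_bound[of ?S _ "\<lambda>u. (- s) * u powr (- s - 1)"])
      show "((\<lambda>u. u powr (- s)) has_field_derivative (- s) * u powr (- s - 1)) (at u within ?S)" if "u \<in> ?S" for u
        using powr_segment_bound(2)[OF n _ that, of 0] by (auto intro!: derivative_eq_intros)
      show "norm (- s * u powr (- s - 1)) \<le> ?B" if "u \<in> ?S" for u
        using powr_segment_bound(1)[OF n _ that, of "- s - 1"] s by (auto simp: norm_mult intro!: mult_left_mono)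
    qed (use u in auto)
    also have "\<dots> \<le> ?B * 1" using len[OF u] by (intro mult_left_mono) auto
    finally show ?thesis by simp
  qed
  let ?F = "\<lambda>u. (s - 1) * of_nat n powr (- s) * u + u powr (1 - s)"
  have "norm (?F (of_nat (Suc n)) - ?F (of_nat n)) \<le> (norm (s - 1) * ?B) * norm (of_nat (Suc n) - of_nat n :: complex)"
  proof (rule field_differentiable_bound[of ?S _ "\<lambda>u. (s - 1) * of_nat n powr (- s) + (1 - s) * u powr (- s)"])
    show "(?F has_field_derivative (s - 1) * of_nat n powr (- s) + (1 - s) * u powr (- s)) (at u within ?S)" if "u \<in> ?S" for u
      using powr_segment_bound(2)[OF n _ that, of 0] by (auto intro!: derivative_eq_intros)
    show "norm ((s - 1) * of_nat n powr (- s) + (1 - s) * u powr (- s)) \<le> norm (s - 1) * ?B" if "u \<in> ?S" for u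
    proof -
      have "(s - 1) * of_nat n powr (- s) + (1 - s) * u powr (- s) = (1 - s) * (u powr (- s) - of_nat n powr (- s))"
        by (simp add: algebra_simps)
      thus ?thesis using 1[OF that] by (simp add: norm_mult norm_minus_commute mult_left_mono)
    qed
  qed auto
  moreover have "?F (of_nat (Suc n)) - ?F (of_nat n) = zeta_term n s"
    using n by (simp add: zeta_term_def algebra_simps)
  ultimately show ?thesis by (simp add: mult_ac)
qed

lemma sum_zeta_term:
  "N > 0 \<Longrightarrow> (\<Sum>n<N. zeta_term n s) = (s - 1) * (\<Sum>n<N. of_nat n powr (- s)) + of_nat N powr (1 - s) - 1"
proof (induction N)
  case (Suc N)
  show ?case
  proof (cases "N = 0")
    case True
    thus ?thesis by (simp add: zeta_term_def)
  next
    case False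
    thus ?thesis using Suc by (simp add: zeta_term_def algebra_simps)
  qed
qed auto

lemma norm_zeta_term_le':
  assumes "Re s \<ge> \<sigma>" "\<sigma> > 0"
  shows "norm (zeta_term n s) \<le> norm (s - 1) * norm s * real n powr (- \<sigma> - 1)"
proof (cases "n = 0")
  case False
  have "norm (zeta_term n s) \<le> norm (s - 1) * norm s * real n powr (- Re s - 1)"
    using norm_zeta_term_le[of s n] False assms by simp
  also have "\<dots> \<le> norm (s - 1) * norm s * real n powr (- \<sigma> - 1)"
    using assms False by (intro mult_left_mono powr_mono) auto
  finally show ?thesis .
qed (simp add: zeta_term_def)

lemma summable_zeta_term:
  assumes "Re s > 0" shows "summable (\<lambda>n. norm (zeta_term n s))"
proof (rule summable_comparison_test[of _ "\<lambda>n. norm (s - 1) * norm s * real n powr (- (Re s + 1))"])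
  show "summable (\<lambda>n. norm (s - 1) * norm s * real n powr (- (Re s + 1)))"
    using assms by (intro summable_mult summable_powr_neg) auto
qed (use norm_zeta_term_le'[OF order_refl assms] in auto)

lemma zeta_term_holomorphic: "zeta_term n holomorphic_on A"
proof (cases "n = 0")
  case False
  have "(\<lambda>s. (s - 1) * a powr (- s) + b powr (1 - s) - a powr (1 - s)) holomorphic_on A"
    if "a \<noteq> 0" "b \<noteq> 0" for a b :: complex
    using that by (intro holomorphic_intros)
  from this[of "of_nat n" "of_nat (Suc n)", OF _ of_nat_neq_0] False
  have "(\<lambda>s. (s - 1) * of_nat n powr (- s) + of_nat (Suc n) powr (1 - s) - of_nat n powr (1 - s)) holomorphic_on A"
    by (simp del: of_nat_Suc)
  thus ?thesis using False by (simp add: zeta_term_def[abs_def])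
qed (simp add: zeta_term_def[abs_def])

lemma zeta_term_local_bound:
  assumes "Re x > 0"
  shows "\<exists>d M. 0 < d \<and> cball x d \<subseteq> {s. 0 < Re s} \<and> summable M \<and> (\<forall>n. \<forall>w\<in>cball x d. norm (zeta_term n w) \<le> M n)"
proof -
  define d where "d = Re x / 2"
  define K where "K = (norm x + d + 1) * (norm x + d)"
  have d: "d > 0" using assms by (simp add: d_def)
  have Re_ge: "Re w \<ge> d" if "w \<in> cball x d" for w
    using abs_Re_le_cmod[of "x - w"] that by (simp add: dist_norm d_def field_simps)
  have "norm (zeta_term n w) \<le> K * real n powr (- d - 1)" if w: "w \<in> cball x d" for n w
  proof -
    have nw: "norm w \<le> norm x + d"
      using norm_triangle_ineq4[of x "x - w"] w by (simp add: dist_norm)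
    have "norm (zeta_term n w) \<le> norm (w - 1) * norm w * real n powr (- d - 1)"
      by (rule norm_zeta_term_le'[OF Re_ge[OF w] d])
    also have "\<dots> \<le> K * real n powr (- d - 1)"
      unfolding K_def using nw norm_triangle_ineq4[of w 1] d
      by (intro mult_right_mono mult_mono) auto
    finally show ?thesis .
  qed
  moreover have "summable (\<lambda>n. K * real n powr (- d - 1))"
    using d by (intro summable_mult) (simp add: summable_real_powr_iff)
  moreover have "cball x d \<subseteq> {s. 0 < Re s}"
  proof
    fix w assume "w \<in> cball x d"
    from Re_ge[OF this] show "w \<in> {s. 0 < Re s}" using d by simp
  qed
  ultimately show ?thesis using d by (intro exI[of _ d] exI[of _ "\<lambda>n. K * real n powr (- d - 1)"]) auto
qed

lemma zeta_reg_holomorphic: "zeta_reg holomorphic_on {s. Re s > 0}"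
proof -
  have "(\<lambda>s. \<Sum>n. zeta_term n s) holomorphic_on {s. Re s > 0}"
    by (rule holomorphic_suminf[OF open_halfspace_Re_gt zeta_term_holomorphic]) (rule zeta_term_local_bound, simp)
  thus ?thesis unfolding zeta_reg_def by (intro holomorphic_intros)
qed

lemma zeta_reg_1 [simp]: "zeta_reg 1 = 1"
proof -
  have "zeta_term n 1 = 0" for n by (simp add: zeta_term_def del: of_nat_Suc)
  thus ?thesis by (simp add: zeta_reg_def)
qed

lemma zeta_reg_eq:
  assumes s: "Re s > 1"
  shows "zeta_reg s = (s - 1) * zeta_series s"
proof -
  have "summable (\<lambda>n. norm (of_nat n powr (- s) :: complex))"
    using summable_powr_neg[OF s] by (simp add: norm_of_nat_powr)
  hence A: "(\<lambda>N. \<Sum>n<N. of_nat n powr (- s)) \<longlonglongrightarrow> zeta_series s"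
    unfolding zeta_series_def by (rule summable_LIMSEQ[OF summable_norm_cancel])
  have B: "(\<lambda>N. of_nat N powr (1 - s) :: complex) \<longlonglongrightarrow> 0"
  proof (rule tendsto_norm_zero_cancel)
    have "(\<lambda>N. real N powr (1 - Re s)) \<longlonglongrightarrow> 0"
      using s by (intro tendsto_neg_powr filterlim_real_sequentially) simp
    moreover have "norm (of_nat N powr (1 - s) :: complex) = real N powr (1 - Re s)" for N
      unfolding norm_of_nat_powr by simp
    ultimately show "(\<lambda>N. norm (of_nat N powr (1 - s) :: complex)) \<longlonglongrightarrow> 0" by (simp only:)
  qed
  have "(\<lambda>N. (s - 1) * (\<Sum>n<N. of_nat n powr (- s)) + of_nat N powr (1 - s) - 1) \<longlonglongrightarrow>
       (s - 1) * zeta_series s + 0 - 1" by (intro tendsto_add tendsto_diff tendsto_mult tendsto_const A B)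
  moreover have "eventually (\<lambda>N. (s - 1) * (\<Sum>n<N. of_nat n powr (- s)) + of_nat N powr (1 - s) - 1
        = (\<Sum>n<N. zeta_term n s)) sequentially"
    using eventually_gt_at_top[of 0] by eventually_elim (simp add: sum_zeta_term)
  ultimately have "(\<lambda>N. \<Sum>n<N. zeta_term n s) \<longlonglongrightarrow> (s - 1) * zeta_series s - 1"
    by (simp add: tendsto_cong)
  moreover have "(\<lambda>N. \<Sum>n<N. zeta_term n s) \<longlonglongrightarrow> (\<Sum>n. zeta_term n s)"
    using s by (intro summable_LIMSEQ summable_norm_cancel[OF summable_zeta_term]) auto
  ultimately show ?thesis unfolding zeta_reg_def by (metis LIMSEQ_unique add.commute diff_add_cancel)
qed

text \<open>Differentiating termwise at 1 gives \<open>1 / n - ln (n + 1) + ln n\<close>, and these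
  sum to Euler's constant. This is the origin of the summand \<open>\<gamma> z\<close> in
  \<open>J\<close>.\<close>

lemma zeta_reg_deriv_1: "(zeta_reg has_field_derivative of_real euler_mascheroni) (at 1)"
proof -
  obtain d M where d: "0 < d" "cball 1 d \<subseteq> {s. 0 < Re s}" and M: "summable M" "\<And>n w. w\<in>cball 1 d \<Longrightarrow> norm (zeta_term n w) \<le> M n"
    using zeta_term_local_bound[of 1] by force
  have "uniform_limit (cball 1 d) (\<lambda>N s. \<Sum>n<N. zeta_term n s) (\<lambda>s. \<Sum>n. zeta_term n s) sequentially"
    by (rule Weierstrass_m_test[OF M(2,1)])
  hence ul: "uniform_limit (ball 1 d) (\<lambda>N s. \<Sum>n<N. zeta_term n s) (\<lambda>s. \<Sum>n. zeta_term n s) sequentially"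
    by (rule uniform_limit_on_subset) auto
  have "((\<lambda>N. (deriv ^^ 1) (\<lambda>s. \<Sum>n<N. zeta_term n s) 1) \<longlongrightarrow> (deriv ^^ 1) (\<lambda>s. \<Sum>n. zeta_term n s) 1) sequentially"
    by (rule higher_deriv_complex_uniform_limit[OF ul])
       (use d in \<open>auto intro!: always_eventually holomorphic_intros zeta_term_holomorphic\<close>)
  moreover define g where "g n = (if n = 0 then 0 else inverse (of_nat n) - ln (real (Suc n)) + ln (real n))" for n
  have "(zeta_term n has_field_derivative of_real (g n)) (at 1)" for n
  proof (cases "n = 0")
    case False
    have "((\<lambda>s::complex. (s - 1) * of_nat n powr (- s) + of_nat (Suc n) powr (1 - s) - of_nat n powr (1 - s))
        has_field_derivative of_real (g n)) (at 1)"
    proof -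
      have e: "of_nat m powr w = exp (w * of_real (ln (real m)))" if "m > 0" for m and w :: complex
        using that by (simp add: powr_def Ln_of_nat)
      have "exp (- of_real (ln (real n))) = (inverse (of_nat n) :: complex)"
        using False by (simp add: exp_minus exp_of_real)
      thus ?thesis using False unfolding e[OF zero_less_Suc] e[of n, OF False[THEN neq0_conv[THEN iffD1]]]
        by (auto intro!: derivative_eq_intros simp: g_def simp del: of_nat_Suc)
    qed
    thus ?thesis using False by (simp add: zeta_term_def[abs_def])
  qed (simp add: zeta_term_def[abs_def] g_def)
  hence "((\<lambda>s. \<Sum>n<N. zeta_term n s) has_field_derivative (\<Sum>n<N. of_real (g n))) (at 1)" for N
    by (intro DERIV_sum) auto
  hence "(deriv ^^ 1) (\<lambda>s. \<Sum>n<N. zeta_term n s) 1 = of_real (\<Sum>n<N. g n)" for N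
    by (simp add: DERIV_imp_deriv)
  ultimately have lim: "(\<lambda>N. of_real (\<Sum>n<N. g n)) \<longlonglongrightarrow> deriv (\<lambda>s. \<Sum>n. zeta_term n s) 1"
    by simp
  have "(\<lambda>n. g (Suc n)) sums euler_mascheroni"
    using euler_mascheroni_sum_real by (simp add: g_def algebra_simps)
  hence "g sums euler_mascheroni" using sums_Suc[of g euler_mascheroni] by (simp add: g_def)
  hence "(\<lambda>N. of_real (\<Sum>n<N. g n)) \<longlonglongrightarrow> (of_real euler_mascheroni :: complex)"
    unfolding sums_def by (rule tendsto_of_real)
  with lim have eq: "deriv (\<lambda>s. \<Sum>n. zeta_term n s) 1 = of_real euler_mascheroni" by (rule LIMSEQ_unique)
  have "(\<lambda>s. \<Sum>n. zeta_term n s) holomorphic_on {s. Re s > 0}"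
    by (rule holomorphic_suminf[OF open_halfspace_Re_gt zeta_term_holomorphic]) (rule zeta_term_local_bound, simp)
  hence "((\<lambda>s. \<Sum>n. zeta_term n s) has_field_derivative of_real euler_mascheroni) (at 1)"
    unfolding eq[symmetric] by (rule holomorphic_derivI) (auto intro: open_halfspace_Re_gt)
  from DERIV_add[OF DERIV_const[of 1] this] show ?thesis by (simp add: zeta_reg_def[abs_def])
qed

section \<open>Upper bounds for zeta and its derivative close to the line Re s = 1\<close>

definition log_height :: "complex \<Rightarrow> real" where
  "log_height s = ln (\<bar>Im s\<bar> + 3)"

lemma log_height_ge_1: "log_height s \<ge> 1"
proof -
  have "1 \<le> ln (3::real)" using exp_le by (subst ln_ge_iff) auto
  also have "\<dots> \<le> log_height s" by (simp add: log_height_def)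
  finally show ?thesis .
qed

text \<open>Serves two purposes: comparing the height across a small disc around \<open>s\<close>,
  and passing to the doubled ordinate in the 3-4-1 inequality.\<close>

lemma log_height_double:
  assumes "\<bar>Im w\<bar> \<le> 2 * \<bar>Im s\<bar> + 3"
  shows "log_height w \<le> 2 * log_height s"
proof -
  have "log_height w \<le> ln ((\<bar>Im s\<bar> + 3) ^ 2)"
    unfolding log_height_def
  proof (rule ln_mono)
    have "(\<bar>Im s\<bar> + 3) ^ 2 = \<bar>Im s\<bar> * \<bar>Im s\<bar> + 6 * \<bar>Im s\<bar> + 9" by (simp add: power2_eq_square algebra_simps)
    thus "\<bar>Im w\<bar> + 3 \<le> (\<bar>Im s\<bar> + 3) ^ 2" using assms zero_le_square[of "\<bar>Im s\<bar>"] by linarith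
  qed auto
  also have "\<dots> = 2 * log_height s" unfolding log_height_def by (subst ln_realpow) auto
  finally show ?thesis .
qed

lemma sum_inverse_le: "N > 0 \<Longrightarrow> (\<Sum>n\<le>N. 1 / real n) \<le> 1 + ln (real N)"
proof (induction N rule: nat_induct_non_zero)
  case (Suc N)
  have "ln (real N / real (Suc N)) \<le> real N / real (Suc N) - 1"
    using Suc.hyps by (intro ln_le_minus_one) auto
  also have "\<dots> = - (1 / real (Suc N))" by (simp add: field_simps)
  finally have "1 / real (Suc N) \<le> ln (real (Suc N)) - ln (real N)"
    using Suc.hyps by (simp add: ln_div)
  thus ?case using Suc.IH by simp
qed auto

text \<open>The series is cut at \<open>N\<close>, about the square of the height. In the stated
  region \<open>n powr (1 - \<sigma>) \<le> exp (3/4) \<le> 3\<close> for \<open>n \<le> N\<close>,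
  so the head is a harmonic sum of order \<open>L\<close>; in the tail
  \<open>n powr (- (1/2)) \<le> 1 / T\<close> absorbs the factor \<open>norm s\<close>, and a
  convergent series is left.\<close>

lemma norm_zeta_reg_le:
  "\<exists>C>0. \<forall>s. 1 - 1 / (4 * log_height s) \<le> Re s \<longrightarrow> Re s \<le> 3 \<longrightarrow>
     norm (zeta_reg s) \<le> C * (log_height s * norm (s - 1) + 1)"
proof -
  define S where "S = (\<Sum>n. real n powr (- (5/4)))"
  have sS: "summable (\<lambda>n. real n powr (- (5/4)))" by (rule summable_powr_neg) auto
  have S0: "S \<ge> 0" unfolding S_def by (intro suminf_nonneg sS) auto
  have "norm (zeta_reg s) \<le> (15 + S) * (log_height s * norm (s - 1) + 1)"
    if s: "1 - 1 / (4 * log_height s) \<le> Re s" "Re s \<le> 3" for s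
  proof -
    define L where "L = log_height s"
    define \<sigma> where "\<sigma> = Re s"
    define T where "T = \<bar>Im s\<bar> + 3"
    \<comment> \<open>Large enough for the tail to absorb \<open>norm s\<close>, yet at most
      \<open>T ^ 3\<close>, so that \<open>ln N \<le> 3 * L\<close>.\<close>
    define N where "N = nat \<lceil>T ^ 2\<rceil>"
    have L1: "L \<ge> 1" unfolding L_def by (rule log_height_ge_1)
    have T: "T \<ge> 3" by (simp add: T_def)
    have LT: "L = ln T" by (simp add: L_def T_def log_height_def)
    have "1 / (4 * L) \<le> 1 / 4" using L1 by (simp add: field_simps)
    hence \<sigma>: "\<sigma> \<ge> 3/4" "1 - \<sigma> \<le> 1 / (4 * L)" using s by (auto simp: \<sigma>_def L_def)
    have "0 \<le> \<lceil>T ^ 2\<rceil>" using zero_le_power2[of T] by linarith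
    hence N: "T ^ 2 \<le> real N" "real N \<le> T ^ 2 + 1"
      unfolding N_def using of_int_ceiling_le_add_one[of "T ^ 2"] by (simp_all add: real_nat_ceiling_ge)
    have "T ^ 2 \<ge> 9" using power_mono[OF T, of 2] by simp
    hence N0: "N > 0" using N by linarith
    have "real N \<le> T ^ 3"
    proof -
      have "T ^ 3 = T * T ^ 2" by (simp add: power3_eq_cube power2_eq_square)
      also have "\<dots> \<ge> 3 * T ^ 2" using T by (intro mult_right_mono) auto
      finally show ?thesis using N \<open>T ^ 2 \<ge> 9\<close> by linarith
    qed
    hence lnN: "ln (real N) \<le> 3 * L"
    proof -
      have "ln (real N) \<le> ln (T ^ 3)" using \<open>real N \<le> T ^ 3\<close> N0 T by (intro ln_mono) auto
      thus ?thesis using T by (simp add: LT ln_realpow)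
    qed
    have pw: "real n powr (1 - \<sigma>) \<le> 3" if "n > 0" "n \<le> N" for n
    proof (cases "1 - \<sigma> \<le> 0")
      case True
      have "real n powr (1 - \<sigma>) \<le> real n powr 0" using that True by (intro powr_mono) auto
      thus ?thesis using that by simp
    next
      case False
      have "real n powr (1 - \<sigma>) = exp ((1 - \<sigma>) * ln (real n))" using that by (simp add: powr_def)
      also have "(1 - \<sigma>) * ln (real n) \<le> (1 / (4 * L)) * (3 * L)"
        using False \<sigma> lnN that L1 by (intro mult_mono order_trans[OF _ lnN]) auto
      also have "\<dots> \<le> 1" using L1 by simp
      finally show ?thesis using exp_le by (meson exp_le_cancel_iff order_trans)
    qed
    have "norm (\<Sum>n<N. of_nat n powr (- s) :: complex) \<le> (\<Sum>n<N. 3 * (1 / real n))"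
    proof (rule sum_norm_le)
      fix n assume "n \<in> {..<N}"
      show "norm (of_nat n powr (- s) :: complex) \<le> 3 * (1 / real n)"
      proof (cases "n = 0")
        case False
        have "real n powr (- \<sigma>) = real n powr (1 - \<sigma>) * (1 / real n)"
          using False by (simp add: powr_diff powr_minus_divide)
        also have "\<dots> \<le> 3 * (1 / real n)"
          using pw[of n] \<open>n \<in> _\<close> False by (intro mult_right_mono) auto
        finally show ?thesis by (simp add: norm_of_nat_powr \<sigma>_def)
      qed auto
    qed
    also have "\<dots> \<le> 3 * (\<Sum>n\<le>N. 1 / real n)"
      unfolding sum_distrib_left by (intro sum_mono2) auto
    also have "\<dots> \<le> 3 * (1 + ln (real N))" using sum_inverse_le[OF N0] by simp
    also have "\<dots> \<le> 12 * L" using lnN L1 by simp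
    finally have A: "norm ((s - 1) * (\<Sum>n<N. of_nat n powr (- s))) \<le> norm (s - 1) * (12 * L)"
      unfolding norm_mult by (intro mult_left_mono) auto
    have B: "norm (of_nat N powr (1 - s) :: complex) \<le> 3"
      using pw[OF N0] by (simp add: norm_of_nat_powr \<sigma>_def)
    have s0: "Re s > 0" using \<sigma> by (simp add: \<sigma>_def)
    have sm: "summable (\<lambda>n. norm (zeta_term n s))" by (rule summable_zeta_term[OF s0])
    have "norm (\<Sum>n. zeta_term (n + N) s) \<le> (\<Sum>n. norm (s - 1) * real (n + N) powr (- (5/4)))"
    proof (rule norm_suminf_le)
      show "summable (\<lambda>n. norm (s - 1) * real (n + N) powr (- (5/4)))"
        using summable_ignore_initial_segment[OF sS, of N] by (intro summable_mult) auto
      fix n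
      have "norm (zeta_term (n + N) s) \<le> norm (s - 1) * norm s * real (n + N) powr (- (3/4) - 1)"
        using \<sigma> by (intro norm_zeta_term_le') (auto simp: \<sigma>_def)
      also have "\<dots> = norm (s - 1) * (norm s * real (n + N) powr (- (1/2))) * real (n + N) powr (- (5/4))"
        using N0 by (simp add: powr_add[symmetric])
      also have "norm s * real (n + N) powr (- (1/2)) \<le> T * (1 / T)"
      proof (rule mult_mono)
        have "norm s \<le> \<bar>Re s\<bar> + \<bar>Im s\<bar>" by (rule cmod_le)
        thus "norm s \<le> T" using s s0 by (simp add: T_def)
        have "real (n + N) powr (- (1/2)) \<le> (T ^ 2) powr (- (1/2))"
          using N T by (intro powr_mono2') auto
        also have "\<dots> = 1 / T" using T by (simp add: powr_minus_divide powr_half_sqrt)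
        finally show "real (n + N) powr (- (1/2)) \<le> 1 / T" .
      qed (use T in auto)
      also have "T * (1 / T) = 1" using T by simp
      finally show "norm (zeta_term (n + N) s) \<le> norm (s - 1) * real (n + N) powr (- (5/4))"
        by (simp add: mult_left_mono mult_right_mono)
    qed
    also have "\<dots> = norm (s - 1) * (\<Sum>n. real (n + N) powr (- (5/4)))"
      using summable_ignore_initial_segment[OF sS, of N] by (intro suminf_mult) auto
    also have "\<dots> \<le> norm (s - 1) * S"
      unfolding S_def using suminf_split_initial_segment[OF sS, of N]
      by (intro mult_left_mono) (auto simp: sum_nonneg)
    finally have C: "norm (\<Sum>n. zeta_term (n + N) s) \<le> norm (s - 1) * S" .
    have "zeta_reg s = (s - 1) * (\<Sum>n<N. of_nat n powr (- s)) + of_nat N powr (1 - s) + (\<Sum>n. zeta_term (n + N) s)"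
      unfolding zeta_reg_def suminf_split_initial_segment[OF summable_norm_cancel[OF sm], of N]
        sum_zeta_term[OF N0] by simp
    hence "norm (zeta_reg s) \<le> norm (s - 1) * (12 * L) + 3 + norm (s - 1) * S"
      using A B C by (smt (verit) norm_triangle_ineq)
    also have "\<dots> \<le> (15 + S) * (L * norm (s - 1) + 1)"
    proof -
      have "norm (s - 1) * S \<le> L * norm (s - 1) * S"
        using mult_right_mono[OF L1, of "norm (s - 1) * S"] S0 by simp
      moreover have "L * norm (s - 1) \<ge> 0" using L1 by simp
      ultimately show ?thesis using S0 by (simp add: algebra_simps)
    qed
    finally show ?thesis by (simp add: L_def)
  qed
  thus ?thesis using S0 by (intro exI[of _ "15 + S"]) auto
qed

definition zeta :: "complex \<Rightarrow> complex" where
  "zeta s = zeta_reg s / (s - 1)"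

lemma zeta_eq_exp: "Re s > 1 \<Longrightarrow> zeta s = exp (log_zeta s)"
  by (auto simp: zeta_def zeta_reg_eq exp_log_zeta)

lemma zeta_holomorphic: "zeta holomorphic_on {s. Re s > 0} - {1}"
  unfolding zeta_def
  by (intro holomorphic_intros holomorphic_on_subset[OF zeta_reg_holomorphic]) auto

lemma zeta_domain_open: "open ({s. Re s > 0} - {1})"
  by (intro open_Diff open_halfspace_Re_gt) auto

lemma norm_zeta_le:
  assumes "\<delta> > 0"
  shows "\<exists>C>0. \<forall>s. 1 - 1 / (4 * log_height s) \<le> Re s \<longrightarrow> Re s \<le> 3 \<longrightarrow> norm (s - 1) \<ge> \<delta> \<longrightarrow>
     norm (zeta s) \<le> C * log_height s"
proof -
  obtain C where C: "C > 0" "\<And>s. 1 - 1 / (4 * log_height s) \<le> Re s \<Longrightarrow> Re s \<le> 3 \<Longrightarrow>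
     norm (zeta_reg s) \<le> C * (log_height s * norm (s - 1) + 1)" using norm_zeta_reg_le by metis
  have "norm (zeta s) \<le> (C + C / \<delta>) * log_height s"
    if s: "1 - 1 / (4 * log_height s) \<le> Re s" "Re s \<le> 3" "norm (s - 1) \<ge> \<delta>" for s
  proof -
    have pos: "norm (s - 1) > 0" using s assms by linarith
    have "norm (zeta s) \<le> C * (log_height s * norm (s - 1) + 1) / norm (s - 1)"
      unfolding zeta_def norm_divide using C(2)[OF s(1,2)] by (intro divide_right_mono) auto
    also have "\<dots> = C * log_height s + C / norm (s - 1)" using pos by (simp add: field_simps)
    also have "C / norm (s - 1) \<le> C / \<delta>" using s assms C pos by (intro divide_left_mono mult_pos_pos) auto
    also have "C / \<delta> \<le> C / \<delta> * log_height s"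
      using mult_left_mono[OF log_height_ge_1[of s], of "C / \<delta>"] C assms by simp
    finally show ?thesis by (simp add: algebra_simps)
  qed
  thus ?thesis using C assms by (intro exI[of _ "C + C / \<delta>"]) (auto intro: add_pos_pos)
qed

text \<open>Cauchy's inequality on a disc of radius of order \<open>1 / L\<close>. The height at
  most doubles there, so the disc stays inside the region of \<open>norm_zeta_le\<close>, and
  \<open>\<delta>\<close> keeps it away from the pole; the price is one more factor
  \<open>L\<close>.\<close>

lemma norm_deriv_zeta_le:
  assumes "\<delta> > 0"
  shows "\<exists>C>0. \<forall>s. 1 - 1 / (16 * log_height s) \<le> Re s \<longrightarrow> Re s \<le> 2 \<longrightarrow> \<bar>Im s\<bar> \<ge> \<delta> \<longrightarrow>
     norm (deriv zeta s) \<le> C * log_height s ^ 2"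
proof -
  define e where "e = min (\<delta> / 2) 1"
  have e: "0 < e" "e \<le> 1" "e \<le> \<delta> / 2" using assms by (auto simp: e_def)
  obtain C where C: "C > 0" "\<And>s. 1 - 1 / (4 * log_height s) \<le> Re s \<Longrightarrow> Re s \<le> 3 \<Longrightarrow>
     norm (s - 1) \<ge> \<delta> / 2 \<Longrightarrow> norm (zeta s) \<le> C * log_height s" using norm_zeta_le[of "\<delta> / 2"] assms by (metis half_gt_zero)
  have "norm (deriv zeta s) \<le> (32 * C / e) * log_height s ^ 2"
    if s: "1 - 1 / (16 * log_height s) \<le> Re s" "Re s \<le> 2" "\<bar>Im s\<bar> \<ge> \<delta>" for s
  proof -
    define L where "L = log_height s"
    define R where "R = e / (16 * L)"
    have L: "L \<ge> 1" unfolding L_def by (rule log_height_ge_1)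
    have R: "0 < R" "R \<le> 1 / (16 * L)" "R \<le> e"
    proof -
      show "0 < R" using e L by (simp add: R_def)
      show "R \<le> 1 / (16 * L)" unfolding R_def using e L by (intro divide_right_mono) auto
      show "R \<le> e" unfolding R_def using e L by (simp add: field_simps)
    qed
    have "1 / (16 * L) \<le> 1 / 16" using L by (simp add: field_simps)
    have w: "Re w > 0" "w \<noteq> 1" "norm (zeta w) \<le> 2 * C * L" if "w \<in> ball s R" for w
    proof -
      have d: "\<bar>Im w - Im s\<bar> \<le> R" "\<bar>Re w - Re s\<bar> \<le> R"
        using that abs_Im_le_cmod[of "w - s"] abs_Re_le_cmod[of "w - s"] by (auto simp: dist_norm norm_minus_commute)
      have Lw: "log_height w \<le> 2 * L" unfolding L_def
        using d R e by (intro log_height_double) linarith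
      have "1 / (8 * L) \<le> 1 / (4 * log_height w)"
        using Lw log_height_ge_1[of w] L by (simp add: field_simps)
      moreover have "1 / (8 * L) = 1 / (16 * L) + 1 / (16 * L)" by simp
      ultimately have 1: "1 - 1 / (4 * log_height w) \<le> Re w" using d R s unfolding L_def by linarith
      have "1 / (16 * L) \<le> 1 / 16" by fact
      hence 2: "Re w \<le> 3" "Re w > 0" using d R s unfolding L_def by linarith+
      have "\<bar>Im w\<bar> \<ge> \<delta> / 2" using d R e s by linarith
      hence 3: "norm (w - 1) \<ge> \<delta> / 2" using abs_Im_le_cmod[of "w - 1"] by simp
      show "Re w > 0" "w \<noteq> 1" using 2 3 assms by auto
      have "norm (zeta w) \<le> C * log_height w" by (rule C(2)[OF 1 2(1) 3])
      also have "\<dots> \<le> C * (2 * L)" using Lw C by (intro mult_left_mono) auto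
      finally show "norm (zeta w) \<le> 2 * C * L" by simp
    qed
    have "norm ((deriv ^^ 1) zeta s) \<le> fact 1 * (2 * C * L) / R ^ 1"
    proof (rule Cauchy_inequality_ball)
      show "zeta holomorphic_on ball s R" using w(1,2) by (intro holomorphic_on_subset[OF zeta_holomorphic]) blast
    qed (use R w in auto)
    thus ?thesis using L e by (simp add: R_def L_def power2_eq_square field_simps)
  qed
  thus ?thesis using C e by (intro exI[of _ "32 * C / e"]) auto
qed

section \<open>The 3-4-1 inequality, a zero-free region and the logarithm of zeta\<close>

lemma prime_recip_polar:
  assumes "p > 0"
  shows "prime_recip p s = of_real (real p powr (- Re s)) * cis (- Im s * ln (real p))"
  using assms unfolding prime_recip_def
  by (simp add: powr_def Ln_of_nat exp_eq_polar mult.commute)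

text \<open>\<open>Re (- Ln (1 - u * cis \<theta>))\<close> is the sum of
  \<open>u ^ n * cos (n * \<theta>) / n\<close>, and termwise \<open>3 + 4 * cos \<phi> + cos (2 *
  \<phi>) = 2 * (1 + cos \<phi>) ^ 2\<close>.\<close>

lemma three_four_one:
  assumes u: "0 \<le> u" "u < 1"
  shows "0 \<le> 3 * Re (- Ln (1 - of_real u)) + 4 * Re (- Ln (1 - of_real u * cis \<theta>)) + Re (- Ln (1 - of_real u * cis (2 * \<theta>)))"
proof -
  have sm: "(\<lambda>n. u ^ n * cos (real n * t) / real n) sums Re (- Ln (1 - of_real u * cis t))" for t
  proof -
    have "norm (- (of_real u * cis t)) < 1" using u by (simp add: norm_mult)
    from sums_Re[OF sums_minus[OF Ln_series'[OF this]]]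
    show ?thesis using u by (simp add: power_mult_distrib Complex.DeMoivre flip: of_real_power)
  qed
  have "(\<lambda>n. 3 * (u ^ n * cos (real n * 0) / real n) + 4 * (u ^ n * cos (real n * \<theta>) / real n) + u ^ n * cos (real n * (2 * \<theta>)) / real n)
      sums (3 * Re (- Ln (1 - of_real u * cis 0)) + 4 * Re (- Ln (1 - of_real u * cis \<theta>)) + Re (- Ln (1 - of_real u * cis (2 * \<theta>))))"
    by (intro sums_add sums_mult sm)
  moreover have "0 \<le> 3 * (u ^ n * cos (real n * 0) / real n) + 4 * (u ^ n * cos (real n * \<theta>) / real n) + u ^ n * cos (real n * (2 * \<theta>)) / real n" for n
  proof -
    have "cos (real n * (2 * \<theta>)) = 2 * cos (real n * \<theta>) ^ 2 - 1"
      using cos_double_cos[of "real n * \<theta>"] by (simp add: mult_ac)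
    hence "3 + 4 * cos (real n * \<theta>) + cos (real n * (2 * \<theta>)) = 2 * (1 + cos (real n * \<theta>)) ^ 2"
      by (simp add: power2_eq_square algebra_simps)
    hence "0 \<le> u ^ n / real n * (3 + 4 * cos (real n * \<theta>) + cos (real n * (2 * \<theta>)))"
      using u by simp
    thus ?thesis by (simp add: algebra_simps add_divide_distrib)
  qed
  ultimately show ?thesis using sums_le[OF _ sums_zero] by (metis (no_types, lifting) cis_zero mult.right_neutral)
qed

lemma Re_log_zeta_sums:
  assumes "Re s > 1"
  shows "(\<lambda>p. if prime p then Re (- Ln (1 - prime_recip p s)) else 0) sums Re (log_zeta s)"
proof -
  have "(\<lambda>p. if prime p then - Ln (1 - prime_recip p s) else 0) sums log_zeta s"
    unfolding log_zeta_def by (intro summable_sums summable_norm_cancel[OF summable_log_zeta[OF assms]])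
  from sums_Re[OF this] show ?thesis by (simp add: if_distrib cong: if_cong)
qed

lemma zeta_three_four_one:
  assumes "\<sigma> > 1"
  shows "1 \<le> norm (zeta (of_real \<sigma>)) ^ 3 * norm (zeta (Complex \<sigma> t)) ^ 4 * norm (zeta (Complex \<sigma> (2 * t)))"
proof -
  let ?f = "\<lambda>t p. if prime p then Re (- Ln (1 - prime_recip p (Complex \<sigma> t))) else 0"
  have "(\<lambda>p. 3 * ?f 0 p + 4 * ?f t p + ?f (2 * t) p) sums
      (3 * Re (log_zeta (Complex \<sigma> 0)) + 4 * Re (log_zeta (Complex \<sigma> t)) + Re (log_zeta (Complex \<sigma> (2 * t))))"
    using assms by (intro sums_add sums_mult Re_log_zeta_sums) auto
  moreover have "0 \<le> 3 * ?f 0 p + 4 * ?f t p + ?f (2 * t) p" for p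
  proof (cases "prime p")
    case True
    have "real p powr (- \<sigma>) < 1" using prime_gt_1_nat[OF True] assms by (simp add: powr_minus_divide)
    from three_four_one[OF _ this, of "- t * ln (real p)"] show ?thesis
      using True prime_gt_0_nat[OF True] by (simp add: prime_recip_polar mult.assoc)
  qed auto
  ultimately have "0 \<le> 3 * Re (log_zeta (Complex \<sigma> 0)) + 4 * Re (log_zeta (Complex \<sigma> t)) + Re (log_zeta (Complex \<sigma> (2 * t)))"
    using sums_le[OF _ sums_zero] by (metis (no_types, lifting))
  hence "1 \<le> exp (3 * Re (log_zeta (Complex \<sigma> 0)) + 4 * Re (log_zeta (Complex \<sigma> t)) + Re (log_zeta (Complex \<sigma> (2 * t))))"
    by simp
  also have "\<dots> = exp (Re (log_zeta (Complex \<sigma> 0))) ^ 3 * exp (Re (log_zeta (Complex \<sigma> t))) ^ 4 * exp (Re (log_zeta (Complex \<sigma> (2 * t))))"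
    by (simp add: exp_add exp_of_nat_mult[symmetric])
  finally show ?thesis using assms by (simp add: zeta_eq_exp complex_of_real_def)
qed

lemma Im_Re_ball:
  assumes "w \<in> ball s R"
  shows "\<bar>Im w - Im s\<bar> \<le> R" "\<bar>Re w - Re s\<bar> \<le> R"
  using assms abs_Im_le_cmod[of "w - s"] abs_Re_le_cmod[of "w - s"] by (auto simp: dist_norm norm_minus_commute)

lemma horizontal_segment:
  assumes "u \<in> closed_segment s (Complex x (Im s))" "Re s \<le> x"
  shows "Im u = Im s" "Re s \<le> Re u" "Re u \<le> x"
proof -
  from assms(1) obtain t where t: "0 \<le> t" "t \<le> 1" "u = (1 - t) *\<^sub>R s + t *\<^sub>R Complex x (Im s)"
    by (auto simp: closed_segment_def)
  have Re_u: "Re u = Re s + t * (x - Re s)" unfolding t(3) by (simp add: algebra_simps)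
  have "t * (x - Re s) \<le> 1 * (x - Re s)" using t assms by (intro mult_right_mono) auto
  thus "Re u \<le> x" using Re_u by simp
  have "0 \<le> t * (x - Re s)" using t assms by (intro mult_nonneg_nonneg) auto
  thus "Re s \<le> Re u" using Re_u by simp
  show "Im u = Im s" unfolding t(3) by (simp add: algebra_simps)
qed

lemma norm_zeta_real_le: "\<exists>C>0. \<forall>\<sigma>. 1 < \<sigma> \<longrightarrow> \<sigma> \<le> 2 \<longrightarrow> norm (zeta (of_real \<sigma>)) \<le> C / (\<sigma> - 1)"
proof -
  obtain C where C: "C > 0" "\<And>s. 1 - 1 / (4 * log_height s) \<le> Re s \<Longrightarrow> Re s \<le> 3 \<Longrightarrow>
     norm (zeta_reg s) \<le> C * (log_height s * norm (s - 1) + 1)" using norm_zeta_reg_le by metis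
  have "norm (zeta (of_real \<sigma>)) \<le> (C * (ln 3 + 1)) / (\<sigma> - 1)" if "1 < \<sigma>" "\<sigma> \<le> 2" for \<sigma>
  proof -
    have n: "norm (of_real \<sigma> - 1 :: complex) = \<sigma> - 1"
      using that norm_of_real[of "\<sigma> - 1", where 'a = complex] by (simp only: of_real_diff of_real_1)
    have "0 \<le> 1 / (4 * log_height (of_real \<sigma>))" using log_height_ge_1[of "of_real \<sigma>"] by simp
    hence "1 - 1 / (4 * log_height (of_real \<sigma>)) \<le> \<sigma>" using that by linarith
    hence "norm (zeta_reg (of_real \<sigma>)) \<le> C * (ln 3 * (\<sigma> - 1) + 1)"
      using C(2)[of "of_real \<sigma>"] that n by (simp add: log_height_def)
    also have "ln 3 * (\<sigma> - 1) \<le> ln 3 * 1" using that by (intro mult_left_mono) auto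
    finally show ?thesis using that C(1) unfolding zeta_def norm_divide n by (simp add: divide_right_mono)
  qed
  thus ?thesis using C(1) by (intro exI[of _ "C * (ln 3 + 1)"]) (auto intro!: mult_pos_pos add_pos_pos)
qed

definition log_zeta_real :: "real \<Rightarrow> real" where
  "log_zeta_real \<sigma> = (\<Sum>p. if prime p then - ln (1 - real p powr (- \<sigma>)) else 0)"

lemma log_zeta_real_props:
  assumes "\<sigma> > 1"
  shows "summable (\<lambda>p. if prime p then - ln (1 - real p powr (- \<sigma>)) else 0)"
    and "log_zeta (of_real \<sigma>) = of_real (log_zeta_real \<sigma>)"
proof -
  have eq: "(if prime p then - Ln (1 - prime_recip p (of_real \<sigma>)) else 0)
     = of_real (if prime p then - ln (1 - real p powr (- \<sigma>)) else 0)" for p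
  proof (cases "prime p")
    case True
    have lt: "real p powr (- \<sigma>) < 1" using prime_gt_1_nat[OF True] assms by (simp add: powr_minus_divide)
    have "prime_recip p (of_real \<sigma>) = of_real (real p powr (- \<sigma>))"
      using prime_gt_0_nat[OF True] by (simp add: prime_recip_polar)
    hence "1 - prime_recip p (of_real \<sigma>) = of_real (1 - real p powr (- \<sigma>))" by simp
    hence "Ln (1 - prime_recip p (of_real \<sigma>)) = of_real (ln (1 - real p powr (- \<sigma>)))"
      using lt by (simp only: Ln_of_real)
    thus ?thesis using True by simp
  qed auto
  have sm: "summable (\<lambda>p. if prime p then - Ln (1 - prime_recip p (of_real \<sigma>)) else 0)"
    using assms by (intro summable_norm_cancel[OF summable_log_zeta]) auto
  thus sm': "summable (\<lambda>p. if prime p then - ln (1 - real p powr (- \<sigma>)) else 0)"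
    unfolding eq by (simp only: summable_of_real_iff)
  show "log_zeta (of_real \<sigma>) = of_real (log_zeta_real \<sigma>)"
    unfolding log_zeta_def log_zeta_real_def eq by (rule suminf_of_real[OF sm', symmetric])
qed

lemma exp_log_zeta_real: "\<sigma> > 1 \<Longrightarrow> exp (log_zeta_real \<sigma>) = norm (zeta (of_real \<sigma>))"
  by (simp add: zeta_eq_exp log_zeta_real_props(2))

lemma norm_log_zeta_le:
  assumes "Re s > 1"
  shows "norm (log_zeta s) \<le> log_zeta_real (Re s)"
  unfolding log_zeta_def log_zeta_real_def
proof (rule norm_suminf_le)
  fix p
  show "norm (if prime p then - Ln (1 - prime_recip p s) else 0) \<le> (if prime p then - ln (1 - real p powr (- Re s)) else 0)"
    using norm_Ln_one_minus_le[of "prime_recip p s"] norm_prime_recip_less[of p s] assms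
    by (auto simp: norm_prime_recip)
qed (rule log_zeta_real_props(1)[OF assms])

lemma log_zeta_real_le: "\<exists>C>0. \<forall>\<sigma>. 1 < \<sigma> \<longrightarrow> \<sigma> \<le> 2 \<longrightarrow> log_zeta_real \<sigma> \<le> ln (C / (\<sigma> - 1))"
proof -
  obtain C where C: "C > 0" "\<And>\<sigma>. 1 < \<sigma> \<Longrightarrow> \<sigma> \<le> 2 \<Longrightarrow> norm (zeta (of_real \<sigma>)) \<le> C / (\<sigma> - 1)"
    using norm_zeta_real_le by metis
  have "log_zeta_real \<sigma> \<le> ln (C / (\<sigma> - 1))" if "1 < \<sigma>" "\<sigma> \<le> 2" for \<sigma>
  proof -
    have "exp (log_zeta_real \<sigma>) \<le> C / (\<sigma> - 1)" using C(2)[OF that] exp_log_zeta_real that by simp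
    thus ?thesis using C that by (subst ln_ge_iff) auto
  qed
  thus ?thesis using C(1) by blast
qed

lemma deriv_log_zeta:
  assumes "Re s > 1"
  shows "deriv log_zeta s = deriv zeta s / zeta s"
proof -
  have op: "open {s. Re s > 1}" by (rule open_halfspace_Re_gt)
  have d: "(log_zeta has_field_derivative deriv log_zeta s) (at s)"
    using assms by (intro holomorphic_derivI[OF log_zeta_holomorphic op]) auto
  hence "((\<lambda>s. exp (log_zeta s)) has_field_derivative exp (log_zeta s) * deriv log_zeta s) (at s)"
    by (rule DERIV_fun_exp)
  hence "(zeta has_field_derivative exp (log_zeta s) * deriv log_zeta s) (at s)"
    by (rule has_field_derivative_transform_within_open[OF _ op]) (use assms zeta_eq_exp in auto)
  hence "deriv zeta s = zeta s * deriv log_zeta s" using DERIV_imp_deriv zeta_eq_exp[OF assms] by metis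
  thus ?thesis using zeta_eq_exp[OF assms] by simp
qed

text \<open>On \<open>Re s = 1 + \<eta>\<close> with \<open>\<eta> = a / L ^ 9\<close> the 3-4-1
  inequality gives \<open>norm (zeta s) ^ 4\<close> at least of order \<open>\<eta> ^ 3 / L\<close>,
  hence \<open>norm (zeta s)\<close> at least of order \<open>a powr (3/4) / L ^ 7\<close>. Moving
  left by at most \<open>2 * \<eta>\<close> changes \<open>zeta\<close> by at most
  \<open>D * L ^ 2 * 2 * \<eta>\<close>, of order \<open>a / L ^ 7\<close>, so a small
  \<open>a\<close> suffices. The exponent 9 is the one that makes both sides of order
  \<open>L\<close> to the power \<open>-7\<close>, and it returns as \<open>2 + 7\<close> in the
  quotient \<open>zeta' / zeta\<close>.\<close>

lemma zeta_lower_bound: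
  assumes "0 < \<delta>"
  shows "\<exists>a B. 0 < a \<and> a \<le> 1/16 \<and> 0 < B \<and> (\<forall>s. \<bar>Im s\<bar> \<ge> \<delta> \<longrightarrow> 1 - a / log_height s ^ 9 \<le> Re s \<longrightarrow> Re s \<le> 2 \<longrightarrow>
     zeta s \<noteq> 0 \<and> norm (deriv zeta s / zeta s) \<le> B * log_height s ^ 9)"
proof -
  obtain D where D: "D > 0" "\<And>s. 1 - 1 / (16 * log_height s) \<le> Re s \<Longrightarrow> Re s \<le> 2 \<Longrightarrow> \<bar>Im s\<bar> \<ge> \<delta> \<Longrightarrow>
     norm (deriv zeta s) \<le> D * log_height s ^ 2" using norm_deriv_zeta_le[OF assms] by metis
  obtain K where K: "K > 0" "\<And>s. 1 - 1 / (4 * log_height s) \<le> Re s \<Longrightarrow> Re s \<le> 3 \<Longrightarrow> norm (s - 1) \<ge> \<delta> \<Longrightarrow>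
     norm (zeta s) \<le> K * log_height s" using norm_zeta_le[OF assms] by metis
  obtain E where E: "E > 0" "\<And>\<sigma>. 1 < \<sigma> \<Longrightarrow> \<sigma> \<le> 2 \<Longrightarrow> norm (zeta (of_real \<sigma>)) \<le> E / (\<sigma> - 1)"
    using norm_zeta_real_le by metis
  \<comment> \<open>The 3-4-1 inequality solved for \<open>norm (zeta s) ^ 4\<close>; the factor 2
    is the possible doubling of \<open>log_height\<close> at the ordinate
    \<open>2 * Im s\<close>.\<close>
  define c where "c = 1 / (2 * E ^ 3 * K)"
  have c: "c > 0" using E K by (simp add: c_def)
  have lower: "c * (Re s - 1) ^ 3 / log_height s \<le> norm (zeta s) ^ 4"
    if s: "Re s > 1" "Re s \<le> 2" "\<bar>Im s\<bar> \<ge> \<delta>" for s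
  proof -
    define L where "L = log_height s"
    have L: "L \<ge> 1" unfolding L_def by (rule log_height_ge_1)
    let ?w = "Complex (Re s) (2 * Im s)"
    have Lw: "log_height ?w \<le> 2 * L" unfolding L_def by (rule log_height_double) auto
    have "norm (zeta ?w) \<le> K * log_height ?w"
    proof (rule K(2))
      have "0 \<le> 1 / (4 * log_height ?w)" using log_height_ge_1[of ?w] by simp
      thus "1 - 1 / (4 * log_height ?w) \<le> Re ?w" using s(1) by (simp only: complex.sel)
      show "\<delta> \<le> norm (?w - 1)" using abs_Im_le_cmod[of "?w - 1"] s by simp
    qed (use s in auto)
    also have "\<dots> \<le> K * (2 * L)" using Lw K by (intro mult_left_mono) auto
    finally have zw: "norm (zeta ?w) \<le> 2 * K * L" by simp
    have "1 \<le> norm (zeta (of_real (Re s))) ^ 3 * norm (zeta s) ^ 4 * norm (zeta ?w)"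
      using zeta_three_four_one[OF s(1), of "Im s"] by simp
    also have "\<dots> \<le> (E / (Re s - 1)) ^ 3 * norm (zeta s) ^ 4 * (2 * K * L)"
      using E s zw by (intro mult_mono power_mono mult_nonneg_nonneg) auto
    also have "\<dots> = norm (zeta s) ^ 4 / (c * (Re s - 1) ^ 3 / L)"
      using E K s L by (simp add: c_def power_divide field_simps)
    finally show ?thesis using c s L by (simp add: L_def field_simps)
  qed
  \<comment> \<open>\<open>256 * a * D ^ 4 \<le> c\<close> is the same as
    \<open>(4 * a * D) ^ 4 \<le> c * a ^ 3\<close>: the lower bound at distance
    \<open>\<eta>\<close> becomes twice the loss along the horizontal segment.\<close>
  define a where "a = min (1/16) (c / (256 * D ^ 4))"
  have a: "0 < a" "a \<le> 1/16" "a * 256 * D ^ 4 \<le> c"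
  proof -
    show "0 < a" "a \<le> 1/16" using c D by (auto simp: a_def)
    have "a \<le> c / (256 * D ^ 4)" by (simp add: a_def)
    thus "a * 256 * D ^ 4 \<le> c" using D by (simp add: field_simps)
  qed
  have main: "2 * a * D / log_height s ^ 7 \<le> norm (zeta s)"
    if s: "\<bar>Im s\<bar> \<ge> \<delta>" "1 - a / log_height s ^ 9 \<le> Re s" "Re s \<le> 2" for s
  proof -
    define L where "L = log_height s"
    define \<eta> where "\<eta> = a / L ^ 9"
    have L: "L \<ge> 1" unfolding L_def by (rule log_height_ge_1)
    have L9: "L ^ 9 \<ge> L" using power_increasing[of 1 9 L] L by simp
    have \<eta>: "0 < \<eta>" "\<eta> \<le> 1 / (16 * L)"
    proof -
      show "\<eta> \<le> 1 / (16 * L)" unfolding \<eta>_def using frac_le[of "1/16" a L "L ^ 9"] a L L9 by simp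
    qed (use a L in \<open>auto simp: \<eta>_def\<close>)
    have \<eta>1: "\<eta> \<le> 1/16"
    proof -
      have "1 / (16 * L) \<le> 1 / 16" using L by (simp add: field_simps)
      thus ?thesis using \<eta> by linarith
    qed
    have big: "4 * a * D / L ^ 7 \<le> norm (zeta w)" if w: "Re w \<ge> 1 + \<eta>" "Re w \<le> 2" "Im w = Im s" for w
    proof -
      have Lw: "log_height w = L" using w by (simp add: L_def log_height_def)
      have "(4 * a * D / L ^ 7) ^ 4 = (a * 256 * D ^ 4) * a ^ 3 / L ^ 28"
        using power_Suc[of a 3] by (simp add: power_mult_distrib power_divide flip: power_mult)
      also have "\<dots> \<le> c * a ^ 3 / L ^ 28" using a L by (intro divide_right_mono mult_right_mono) auto
      also have "\<dots> = c * \<eta> ^ 3 / L" using L by (simp add: \<eta>_def power_divide power_mult[symmetric] eval_nat_numeral)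
      also have "\<dots> \<le> c * (Re w - 1) ^ 3 / L"
        using w \<eta> c L by (intro divide_right_mono mult_left_mono power_mono) auto
      also have "\<dots> \<le> norm (zeta w) ^ 4" using lower[of w] w \<eta> s Lw by simp
      finally show ?thesis using power_mono_iff[of "4 * a * D / L ^ 7" "norm (zeta w)" 4] a D L by simp
    qed
    show ?thesis
    proof (cases "Re s \<ge> 1 + \<eta>")
      case True
      have "2 * a * D / L ^ 7 \<le> 4 * a * D / L ^ 7" using a D L by (intro divide_right_mono) auto
      thus ?thesis using big[of s] True s by (simp add: L_def)
    next
      case False
      let ?w = "Complex (1 + \<eta>) (Im s)"
      have seg: "Im u = Im s \<and> Re s \<le> Re u \<and> Re u \<le> 1 + \<eta>" if "u \<in> closed_segment s ?w" for u
        using horizontal_segment[OF that] False by simp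
      have "norm (zeta ?w - zeta s) \<le> (D * L ^ 2) * norm (?w - s)"
      proof (rule field_differentiable_bound[of "closed_segment s ?w" _ "deriv zeta"])
        fix u assume u: "u \<in> closed_segment s ?w"
        have Lu: "log_height u = L" using seg[OF u] by (simp add: L_def log_height_def)
        have Ru: "Re u \<ge> 1 - \<eta>" using seg[OF u] s by (simp add: \<eta>_def L_def)
        have "u \<noteq> 1" using seg[OF u] s assms by auto
        hence "(zeta has_field_derivative deriv zeta u) (at u)"
          using Ru \<eta>1 by (intro holomorphic_derivI[OF zeta_holomorphic zeta_domain_open]) auto
        thus "(zeta has_field_derivative deriv zeta u) (at u within closed_segment s ?w)"
          by (rule has_field_derivative_at_within)
        show "norm (deriv zeta u) \<le> D * L ^ 2"
          using D(2)[of u] Lu Ru \<eta> \<eta>1 seg[OF u] s by (simp add: L_def)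
      qed auto
      also have "norm (?w - s) \<le> 2 * \<eta>"
        using cmod_le[of "?w - s"] False s by (simp add: \<eta>_def L_def)
      also have "D * L ^ 2 * (2 * \<eta>) = 2 * a * D / L ^ 7"
        using L by (simp add: \<eta>_def eval_nat_numeral field_simps)
      finally have "norm (zeta ?w - zeta s) \<le> 2 * a * D / L ^ 7" using D L by (simp add: mult_left_mono)
      moreover have "4 * a * D / L ^ 7 \<le> norm (zeta ?w)" by (rule big) (use \<eta>1 in auto)
      moreover have "4 * a * D / L ^ 7 = 2 * (2 * a * D / L ^ 7)" by simp
      ultimately have "2 * a * D / L ^ 7 \<le> norm (zeta s)"
        using norm_triangle_ineq2[of "zeta ?w" "zeta s"] by (smt (verit))
      thus ?thesis by (simp add: L_def)
    qed
  qed
  have "zeta s \<noteq> 0 \<and> norm (deriv zeta s / zeta s) \<le> 1 / (2 * a) * log_height s ^ 9"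
    if s: "\<bar>Im s\<bar> \<ge> \<delta>" "1 - a / log_height s ^ 9 \<le> Re s" "Re s \<le> 2" for s
  proof -
    define L where "L = log_height s"
    have L: "L \<ge> 1" unfolding L_def by (rule log_height_ge_1)
    have L9: "L ^ 9 \<ge> L" using power_increasing[of 1 9 L] L by simp
    have pos: "2 * a * D / L ^ 7 > 0" using a D L by simp
    have m: "2 * a * D / L ^ 7 \<le> norm (zeta s)" using main[OF s] by (simp add: L_def)
    have "a / L ^ 9 \<le> 1 / (16 * L)" using frac_le[of "1/16" a L "L ^ 9"] a L L9 by simp
    hence "norm (deriv zeta s) \<le> D * L ^ 2" using D(2)[of s] s by (simp add: L_def)
    hence "norm (deriv zeta s / zeta s) \<le> (D * L ^ 2) / (2 * a * D / L ^ 7)"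
      unfolding norm_divide using m pos D L by (intro frac_le) auto
    also have "\<dots> = 1 / (2 * a) * L ^ 9" using a D L by (simp add: field_simps eval_nat_numeral)
    finally show ?thesis using m pos by (auto simp: L_def)
  qed
  thus ?thesis using a by (intro exI[of _ a] exI[of _ "1 / (2 * a)"]) auto
qed

text \<open>To the right of \<open>1 + \<eta>\<close> the value on the real axis dominates, which
  gives \<open>ln (1 / \<eta>) = 9 * ln L + O(1)\<close>; closer to the line
  \<open>zeta' / zeta = O(L ^ 9)\<close> is integrated over a length at most
  \<open>a / L ^ 9\<close> and adds only a constant. Growth no faster than \<open>ln L\<close> is
  what makes \<open>\<zeta>(s) powr z\<close> polynomial in \<open>L\<close>.\<close>

lemma norm_log_zeta_le_height:
  assumes "0 < \<delta>"
  shows "\<exists>A. \<forall>s. 1 < Re s \<longrightarrow> Re s \<le> 2 \<longrightarrow> \<bar>Im s\<bar> \<ge> \<delta> \<longrightarrow> norm (log_zeta s) \<le> A + 9 * ln (log_height s)"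
proof -
  obtain a B where a: "0 < a" "a \<le> 1/16" and B: "0 < B"
    and zb: "\<And>s. \<bar>Im s\<bar> \<ge> \<delta> \<Longrightarrow> 1 - a / log_height s ^ 9 \<le> Re s \<Longrightarrow> Re s \<le> 2 \<Longrightarrow>
     zeta s \<noteq> 0 \<and> norm (deriv zeta s / zeta s) \<le> B * log_height s ^ 9"
    using zeta_lower_bound[OF assms] by metis
  obtain C where C: "C > 0" "\<And>\<sigma>. 1 < \<sigma> \<Longrightarrow> \<sigma> \<le> 2 \<Longrightarrow> log_zeta_real \<sigma> \<le> ln (C / (\<sigma> - 1))"
    using log_zeta_real_le by metis
  have "norm (log_zeta s) \<le> (ln (C / a) + B * a) + 9 * ln (log_height s)"
    if s: "1 < Re s" "Re s \<le> 2" "\<bar>Im s\<bar> \<ge> \<delta>" for s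
  proof -
    define L where "L = log_height s"
    define \<eta> where "\<eta> = a / L ^ 9"
    have L: "L \<ge> 1" unfolding L_def by (rule log_height_ge_1)
    have \<eta>: "0 < \<eta>" using a L by (simp add: \<eta>_def)
    have "L ^ 9 \<ge> 1" using L by simp
    hence \<eta>1: "\<eta> \<le> 1/16" unfolding \<eta>_def using a frac_le[of "1/16" a 1 "L ^ 9"] by simp
    have big: "norm (log_zeta w) \<le> ln (C / a) + 9 * ln L" if "Re w \<ge> 1 + \<eta>" "Re w \<le> 2" for w
    proof -
      have "norm (log_zeta w) \<le> log_zeta_real (Re w)" using that \<eta> by (intro norm_log_zeta_le) auto
      also have "\<dots> \<le> ln (C / (Re w - 1))" using that \<eta> by (intro C(2)) auto
      also have "\<dots> \<le> ln (C / \<eta>)" using that \<eta> C by (intro ln_mono divide_left_mono mult_pos_pos divide_pos_pos) auto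
      also have "\<dots> = ln ((C / a) * L ^ 9)" by (simp add: \<eta>_def)
      also have "\<dots> = ln (C / a) + 9 * ln L" using C a L by (subst ln_mult) (auto simp: ln_realpow)
      finally show ?thesis .
    qed
    show ?thesis
    proof (cases "Re s \<ge> 1 + \<eta>")
      case True
      moreover have "0 \<le> B * a" using B a by simp
      ultimately show ?thesis using big[of s] s unfolding L_def by linarith
    next
      case False
      let ?w = "Complex (1 + \<eta>) (Im s)"
      have seg: "Im u = Im s \<and> Re s \<le> Re u \<and> Re u \<le> 1 + \<eta>" if "u \<in> closed_segment s ?w" for u
        using horizontal_segment[OF that] False by simp
      have "norm (log_zeta ?w - log_zeta s) \<le> (B * L ^ 9) * norm (?w - s)"
      proof (rule field_differentiable_bound[of "closed_segment s ?w" _ "deriv log_zeta"])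
        fix u assume u: "u \<in> closed_segment s ?w"
        have Lu: "log_height u = L" using seg[OF u] by (simp add: L_def log_height_def)
        have Ru: "Re u > 1" using seg[OF u] s by simp
        hence "(log_zeta has_field_derivative deriv log_zeta u) (at u)"
          by (intro holomorphic_derivI[OF log_zeta_holomorphic open_halfspace_Re_gt]) auto
        thus "(log_zeta has_field_derivative deriv log_zeta u) (at u within closed_segment s ?w)"
          by (rule has_field_derivative_at_within)
        have "0 \<le> a / L ^ 9" using a L by simp
        thus "norm (deriv log_zeta u) \<le> B * L ^ 9"
          using zb[of u] deriv_log_zeta[OF Ru] Lu Ru \<eta>1 seg[OF u] s by simp
      qed auto
      also have "norm (?w - s) \<le> \<eta>" using cmod_le[of "?w - s"] False s by simp
      also have "B * L ^ 9 * \<eta> = B * a" using L by (simp add: \<eta>_def)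
      finally have "norm (log_zeta ?w - log_zeta s) \<le> B * a" using B L by (simp add: mult_left_mono)
      moreover have "norm (log_zeta ?w) \<le> ln (C / a) + 9 * ln L" by (rule big) (use \<eta>1 in auto)
      ultimately show ?thesis using norm_triangle_ineq2[of "log_zeta s" "log_zeta ?w"] 
        unfolding L_def by (simp add: norm_minus_commute)
    qed
  qed
  thus ?thesis by blast
qed

text \<open>On a disc without zeros or pole \<open>zeta' / zeta\<close> has a primitive. Normalized
  at the centre, where \<open>Re s0 > 1\<close>, it agrees with \<open>log_zeta\<close> on the
  convex part \<open>Re w > 1\<close> since the difference has derivative 0. The radius
  \<open>a / L ^ 9\<close> matches the bound \<open>O(L ^ 9)\<close> on the derivative, so the
  values vary by \<open>O(1)\<close> over the disc.\<close>

lemma log_zeta_extension: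
  assumes "0 < \<delta>"
  shows "\<exists>a A. 0 < a \<and> a \<le> 1/16 \<and> a \<le> \<delta> \<and> (\<forall>s0 R. 1 < Re s0 \<longrightarrow> Re s0 \<le> 3/2 \<longrightarrow> \<bar>Im s0\<bar> \<ge> 2 * \<delta> \<longrightarrow> 0 < R \<longrightarrow>
     R \<le> a / log_height s0 ^ 9 \<longrightarrow> (\<exists>g. g holomorphic_on ball s0 R \<and>
       (\<forall>w\<in>ball s0 R. (Re w > 1 \<longrightarrow> g w = log_zeta w) \<and> norm (g w) \<le> A + 9 * ln (log_height s0))))"
proof -
  obtain a B where a: "0 < a" "a \<le> 1/16" and B: "0 < B"
    and zb: "\<And>s. \<bar>Im s\<bar> \<ge> \<delta> \<Longrightarrow> 1 - a / log_height s ^ 9 \<le> Re s \<Longrightarrow> Re s \<le> 2 \<Longrightarrow>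
     zeta s \<noteq> 0 \<and> norm (deriv zeta s / zeta s) \<le> B * log_height s ^ 9"
    using zeta_lower_bound[OF assms] by metis
  obtain A where A: "\<And>s. 1 < Re s \<Longrightarrow> Re s \<le> 2 \<Longrightarrow> \<bar>Im s\<bar> \<ge> \<delta> \<Longrightarrow> norm (log_zeta s) \<le> A + 9 * ln (log_height s)"
    using norm_log_zeta_le_height[OF assms] by metis
  \<comment> \<open>\<open>512 = 2 ^ 9\<close> allows for the doubling of \<open>log_height\<close>
    inside the disc; \<open>b \<le> \<delta>\<close> keeps the ordinates at least
    \<open>\<delta>\<close> away from 0.\<close>
  define b where "b = min (a / 512) \<delta>"
  have b: "0 < b" "b \<le> a / 512" "b \<le> \<delta>" using a assms by (auto simp: b_def)
  have "\<exists>g. g holomorphic_on ball s0 R \<and>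
       (\<forall>w\<in>ball s0 R. (Re w > 1 \<longrightarrow> g w = log_zeta w) \<and> norm (g w) \<le> (A + 512 * B * b) + 9 * ln (log_height s0))"
    if s0: "1 < Re s0" "Re s0 \<le> 3/2" "\<bar>Im s0\<bar> \<ge> 2 * \<delta>" and R: "0 < R" "R \<le> b / log_height s0 ^ 9" for s0 R
  proof -
    define L where "L = log_height s0"
    have L: "L \<ge> 1" unfolding L_def by (rule log_height_ge_1)
    have "L ^ 9 \<ge> 1" using L by simp
    hence Rb: "R \<le> b" using R frac_le[of b b 1 "L ^ 9"] b by (simp add: L_def)
    let ?S = "ball s0 R"
    have w: "zeta w \<noteq> 0" "norm (deriv zeta w / zeta w) \<le> 512 * B * L ^ 9" "w \<in> {s. Re s > 0} - {1}" if "w \<in> ?S" for w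
    proof -
      have d: "\<bar>Im w - Im s0\<bar> \<le> R" "\<bar>Re w - Re s0\<bar> \<le> R" using Im_Re_ball[OF that] by auto
      have Lw: "log_height w \<le> 2 * L" unfolding L_def
        using d Rb b a by (intro log_height_double) linarith
      have Lw9: "log_height w ^ 9 \<le> 512 * L ^ 9"
        using power_mono[OF Lw, of 9] log_height_ge_1[of w] by (simp add: power_mult_distrib)
      have "b / L ^ 9 \<le> a / (512 * L ^ 9)" using b L by (simp add: field_simps)
      also have "\<dots> \<le> a / log_height w ^ 9"
        using Lw9 a log_height_ge_1[of w] L by (intro divide_left_mono mult_pos_pos) auto
      finally have 1: "1 - a / log_height w ^ 9 \<le> Re w" using d R s0 unfolding L_def by linarith
      have 2: "\<bar>Im w\<bar> \<ge> \<delta>" "Re w \<le> 2" using d Rb b s0 a by linarith+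
      show "zeta w \<noteq> 0" using zb[OF 2(1) 1 2(2)] by simp
      have "norm (deriv zeta w / zeta w) \<le> B * log_height w ^ 9" using zb[OF 2(1) 1 2(2)] by simp
      also have "\<dots> \<le> B * (512 * L ^ 9)" using Lw9 B by (intro mult_left_mono) auto
      finally show "norm (deriv zeta w / zeta w) \<le> 512 * B * L ^ 9" by simp
      have "Re w > 0" using d Rb b a s0 by linarith
      thus "w \<in> {s. Re s > 0} - {1}" using 2 assms by auto
    qed
    have zh: "zeta holomorphic_on ?S" using w(3) by (intro holomorphic_on_subset[OF zeta_holomorphic]) blast
    have "(\<lambda>w. deriv zeta w / zeta w) holomorphic_on ?S"
      using w by (intro holomorphic_intros zh holomorphic_deriv) auto
    then obtain g0 where g0: "\<And>x. x \<in> ?S \<Longrightarrow> (g0 has_field_derivative deriv zeta x / zeta x) (at x within ?S)"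
      using holomorphic_convex_primitive'[of ?S "\<lambda>w. deriv zeta w / zeta w"] by auto
    define g where "g w = log_zeta s0 + (g0 w - g0 s0)" for w
    have c: "s0 \<in> ?S" using R by simp
    have gd: "(g has_field_derivative deriv zeta x / zeta x) (at x)" if "x \<in> ?S" for x
      unfolding g_def using g0[OF that] at_within_open[OF that] by (auto intro!: derivative_eq_intros)
    have gh: "g holomorphic_on ?S" unfolding holomorphic_on_open[OF open_ball] using gd by blast
    have eq: "g w = log_zeta w" if "w \<in> ?S" "Re w > 1" for w
    proof -
      let ?T = "?S \<inter> {s. Re s > 1}"
      have "open ?T" "convex ?T" by (auto intro!: open_Int open_halfspace_Re_gt convex_Int convex_halfspace_Re_gt)
      moreover have "((\<lambda>w. g w - log_zeta w) has_field_derivative 0) (at x within ?T)" if "x \<in> ?T" for x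
      proof -
        have "(log_zeta has_field_derivative deriv zeta x / zeta x) (at x)"
          using that deriv_log_zeta[of x] holomorphic_derivI[OF log_zeta_holomorphic open_halfspace_Re_gt, of x] by auto
        from DERIV_diff[OF gd this] show ?thesis using that by (auto intro: has_field_derivative_at_within)
      qed
      ultimately obtain k where "\<And>x. x \<in> ?T \<Longrightarrow> g x - log_zeta x = k"
        using has_field_derivative_zero_constant[of ?T "\<lambda>w. g w - log_zeta w"] by auto
      from this[of w] this[of s0] show ?thesis using that c s0 by (simp add: g_def)
    qed
    have gb: "norm (g w) \<le> (A + 512 * B * b) + 9 * ln (log_height s0)" if "w \<in> ?S" for w
    proof -
      have "norm (g w - g s0) \<le> (512 * B * L ^ 9) * norm (w - s0)"
        by (rule field_differentiable_bound[of ?S _ "\<lambda>x. deriv zeta x / zeta x"])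
           (use gd w that c in \<open>auto intro: has_field_derivative_at_within\<close>)
      also have "norm (w - s0) \<le> b / L ^ 9" using that R by (simp add: dist_norm norm_minus_commute L_def)
      also have "512 * B * L ^ 9 * (b / L ^ 9) = 512 * B * b" using L by simp
      finally have "norm (g w - g s0) \<le> 512 * B * b" using B L by (simp add: mult_left_mono)
      moreover have "norm (g s0) \<le> A + 9 * ln (log_height s0)" using A[of s0] s0 assms by (simp add: g_def)
      ultimately show ?thesis using norm_triangle_ineq2[of "g w" "g s0"] by linarith
    qed
    show ?thesis using gh eq gb by blast
  qed
  thus ?thesis using b a by (intro exI[of _ b] exI[of _ "A + 512 * B * b"]) auto
qed

text \<open>\<open>zeta_reg\<close> equals 1 at 1, hence stays in the domain of the principal
  logarithm nearby. Both sides of the identity have the same exponential, so their difference is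
  constant on the convex region, and it vanishes at a real point, where all logarithms are
  real.\<close>

lemma log_zeta_near_1:
  "\<exists>\<delta>. 0 < \<delta> \<and> \<delta> \<le> 1/2 \<and> (\<lambda>s. Ln (zeta_reg s)) holomorphic_on ball 1 \<delta> \<and>
     (\<forall>s\<in>ball 1 \<delta>. norm (Ln (zeta_reg s)) \<le> 1 \<and> (Re s > 1 \<longrightarrow> log_zeta s = Ln (zeta_reg s) - Ln (s - 1)))"
proof -
  have "continuous_on {s. Re s > 0} zeta_reg" by (intro holomorphic_on_imp_continuous_on zeta_reg_holomorphic)
  hence "isCont zeta_reg 1" using continuous_on_eq_continuous_at[OF open_halfspace_Re_gt, of 0 zeta_reg] by simp
  then obtain d where d: "d > 0" "\<And>s. dist s 1 < d \<Longrightarrow> dist (zeta_reg s) (zeta_reg 1) < 1/2"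
    unfolding continuous_at_eps_delta by (metis half_gt_zero zero_less_one)
  define \<delta> where "\<delta> = min d (1/2)"
  have \<delta>: "0 < \<delta>" "\<delta> \<le> 1/2" using d by (auto simp: \<delta>_def)
  have near: "norm (zeta_reg s - 1) < 1/2" if "s \<in> ball 1 \<delta>" for s
    using d(2)[of s] that by (simp add: \<delta>_def dist_norm norm_minus_commute)
  have nonpos: "zeta_reg s \<notin> \<real>\<^sub>\<le>\<^sub>0" if "s \<in> ball 1 \<delta>" for s
    using one_minus_not_nonpos(1)[of "1 - zeta_reg s"] near[OF that] by (simp add: norm_minus_commute)
  have Re: "Re s > 0" if "s \<in> ball 1 \<delta>" for s using Im_Re_ball(2)[OF that] \<delta> by simp
  have lh: "(\<lambda>s. Ln (zeta_reg s)) holomorphic_on ball 1 \<delta>"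
    using nonpos Re by (intro holomorphic_intros holomorphic_on_subset[OF zeta_reg_holomorphic]) auto
  have bd: "norm (Ln (zeta_reg s)) \<le> 1" if "s \<in> ball 1 \<delta>" for s
    using norm_Ln_le[OF near[OF that]] near[OF that] by simp
  have eq: "log_zeta s = Ln (zeta_reg s) - Ln (s - 1)" if s: "s \<in> ball 1 \<delta>" "Re s > 1" for s
  proof -
    let ?T = "ball 1 \<delta> \<inter> {s. Re s > 1}"
    let ?f = "\<lambda>s. log_zeta s - (Ln (zeta_reg s) - Ln (s - 1))"
    have op: "open ?T" and "convex ?T" by (auto intro!: open_Int open_halfspace_Re_gt convex_Int convex_halfspace_Re_gt)
    have nz: "zeta_reg x \<noteq> 0" "x \<noteq> 1" if "x \<in> ?T" for x using nonpos[of x] that by auto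
    have Lnh: "(\<lambda>s. Ln (s - 1)) holomorphic_on ?T"
      by (intro holomorphic_intros) (auto simp: complex_nonpos_Reals_iff)
    have fh: "?f holomorphic_on ?T"
      by (intro holomorphic_on_diff holomorphic_on_subset[OF log_zeta_holomorphic] holomorphic_on_subset[OF lh] Lnh) auto
    have ef: "exp (?f x) = 1" if "x \<in> ?T" for x
      using that nz[OF that] by (simp add: exp_diff exp_log_zeta zeta_reg_eq)
    have "(?f has_field_derivative 0) (at x within ?T)" if "x \<in> ?T" for x
    proof -
      have d: "(?f has_field_derivative deriv ?f x) (at x)" by (rule holomorphic_derivI[OF fh op that])
      have "((\<lambda>s. exp (?f s)) has_field_derivative exp (?f x) * deriv ?f x) (at x)" by (rule DERIV_fun_exp[OF d])
      hence "((\<lambda>s. 1) has_field_derivative exp (?f x) * deriv ?f x) (at x)"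
        by (rule has_field_derivative_transform_within_open[OF _ op that]) (use ef in auto)
      hence "exp (?f x) * deriv ?f x = 0" using DERIV_unique DERIV_const by blast
      thus ?thesis using d by (auto intro: has_field_derivative_at_within)
    qed
    then obtain k where k: "\<And>x. x \<in> ?T \<Longrightarrow> ?f x = k"
      using has_field_derivative_zero_constant[OF \<open>convex ?T\<close>, of ?f] by auto
    \<comment> \<open>A real base point in the region, at which the constant is seen to be
      0.\<close>
    define \<sigma> where "\<sigma> = 1 + \<delta> / 2"
    have \<sigma>: "\<sigma> > 1" "of_real \<sigma> \<in> ?T" using \<delta> by (auto simp: \<sigma>_def dist_norm)
    have m1: "of_real \<sigma> - 1 = (of_real (\<sigma> - 1) :: complex)" by simp
    have "zeta_reg (of_real \<sigma>) = (of_real \<sigma> - 1) * exp (log_zeta (of_real \<sigma>))"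
      using \<sigma> by (simp add: zeta_reg_eq exp_log_zeta)
    also have "\<dots> = of_real ((\<sigma> - 1) * exp (log_zeta_real \<sigma>))"
      using \<sigma> by (simp add: log_zeta_real_props(2) exp_of_real)
    finally have "Ln (zeta_reg (of_real \<sigma>)) = of_real (ln ((\<sigma> - 1) * exp (log_zeta_real \<sigma>)))"
      using \<sigma> by (metis Ln_of_real mult_pos_pos exp_gt_zero diff_gt_0_iff_gt)
    also have "ln ((\<sigma> - 1) * exp (log_zeta_real \<sigma>)) = ln (\<sigma> - 1) + log_zeta_real \<sigma>"
      using \<sigma> by (subst ln_mult) auto
    finally have "?f (of_real \<sigma>) = 0" unfolding m1 using \<sigma>
      by (subst Ln_of_real) (auto simp: log_zeta_real_props(2))
    with k[OF \<sigma>(2)] k[of s] s show ?thesis by simp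
  qed
  show ?thesis using \<delta> lh bd eq by (intro exI[of _ \<delta>]) auto
qed

section \<open>The Dirichlet series near the line \<open>Re s = 1\<close>\<close>

lemma sum_prime_powr_le:
  assumes "finite A" "\<And>p. p \<in> A \<Longrightarrow> prime p" "\<sigma> > 1"
  shows "(\<Sum>p\<in>A. real p powr (- \<sigma>)) \<le> log_zeta_real \<sigma>"
proof -
  have nn: "real p powr (- \<sigma>) \<le> - ln (1 - real p powr (- \<sigma>))" if "prime p" for p
  proof -
    have "real p powr (- \<sigma>) < 1" using prime_gt_1_nat[OF that] assms by (simp add: powr_minus_divide)
    thus ?thesis using ln_le_minus_one[of "1 - real p powr (- \<sigma>)"] by simp
  qed
  have nn0: "0 \<le> - ln (1 - real p powr (- \<sigma>))" if "prime p" for p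
    using nn[OF that] powr_ge_zero[of "real p" "- \<sigma>"] by linarith
  have "(\<Sum>p\<in>A. real p powr (- \<sigma>)) \<le> (\<Sum>p\<in>A. if prime p then - ln (1 - real p powr (- \<sigma>)) else 0)"
    using assms(2) nn by (intro sum_mono) auto
  also have "\<dots> \<le> log_zeta_real \<sigma>"
    unfolding log_zeta_real_def
    by (rule sum_le_suminf[OF log_zeta_real_props(1)[OF assms(3)] assms(1)]) (use nn0 in auto)
  finally show ?thesis .
qed

lemma ln_ge_third: "3/2 \<le> (y::real) \<Longrightarrow> 1/3 \<le> ln y"
proof -
  assume y: "3/2 \<le> y"
  have "ln (2/3::real) \<le> 2/3 - 1" by (intro ln_le_minus_one) auto
  hence "1/3 \<le> ln (3/2::real)" by (simp add: ln_div)
  also have "\<dots> \<le> ln y" using y by (intro ln_mono) auto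
  finally show ?thesis .
qed

text \<open>With \<open>\<kappa> = c / ln y\<close> and \<open>p \<le> y\<close>, \<open>p powr (-
  Re s) \<le> y powr (2 * \<kappa>) * p powr (- (1 + \<kappa>))\<close>, and
  \<open>y powr (2 * \<kappa>) = exp (2 * c) \<le> 5/4\<close>. The primes then contribute at most
  \<open>5/4 * ln \<zeta>(1 + \<kappa>) \<le> 5/4 * ln Q\<close> with \<open>Q\<close> of order
  \<open>ln y\<close>, which takes the place of Mertens' theorem. As \<open>r * 5/4 < 5/2\<close>,
  the integral exponent 3 is enough.\<close>

lemma correction_log_bound:
  assumes r: "1 \<le> r" "r < 2"
  shows "\<exists>K c. 0 < K \<and> 0 < c \<and> c \<le> 1/10 \<and> (\<forall>\<nu> y z. norm z \<le> r \<longrightarrow> 3/2 \<le> y \<longrightarrow>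
     correction \<nu> y z holomorphic_on {s. Re s > 1 - c / ln y} \<and>
     (\<forall>s. Re s > 1 - c / ln y \<longrightarrow> norm (correction \<nu> y z s) \<le> K * ln y ^ 3))"
proof -
  obtain C \<eta> where C: "0 \<le> C" and \<eta>: "0 < \<eta>" "\<eta> \<le> 1/4"
    and facts: "\<forall>\<nu> y z. norm z \<le> r \<longrightarrow>
     correction \<nu> y z holomorphic_on {s. Re s > 1 - \<eta>} \<and>
     (\<forall>s. Re s > 1 - \<eta> \<longrightarrow>
        convergent_prod (\<lambda>p. corr_factor \<nu> y z p s) \<and>
        norm (correction \<nu> y z s) \<le> exp (r * (\<Sum>p | prime p \<and> real p \<le> y. real p powr (- Re s)) + C))"
    using correction_facts[OF r] by (elim exE conjE) (rule that; assumption)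
  have hol: "correction \<nu> y z holomorphic_on {s. Re s > 1 - \<eta>}" if "norm z \<le> r" for \<nu> y z
    using facts that by blast
  have bnd: "norm (correction \<nu> y z s) \<le> exp (r * (\<Sum>p | prime p \<and> real p \<le> y. real p powr (- Re s)) + C)"
    if "norm z \<le> r" "Re s > 1 - \<eta>" for \<nu> y z s
    using facts that by blast
  obtain D0 where D0: "D0 > 0" "\<And>\<sigma>. 1 < \<sigma> \<Longrightarrow> \<sigma> \<le> 2 \<Longrightarrow> log_zeta_real \<sigma> \<le> ln (D0 / (\<sigma> - 1))"
    using log_zeta_real_le by metis
  \<comment> \<open>\<open>D \<ge> 1\<close> ensures \<open>Q \<ge> 1\<close>, so that enlarging the
    factor of \<open>ln Q\<close> to 3 is legitimate.\<close>
  define D where "D = max D0 1"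
  define c where "c = min (1/10) (\<eta> / 3)"
  have c: "0 < c" "c \<le> 1/10" "c \<le> \<eta> / 3" using \<eta> by (auto simp: c_def)
  have D: "D \<ge> 1" "D0 \<le> D" by (auto simp: D_def)
  have exp2c: "exp (2 * c) \<le> 5/4"
  proof -
    have "exp (2 * c) \<le> exp (1/5)" using c by simp
    also have "\<dots> \<le> 1 + 1/5 + (1/5)^2" by (rule exp_bound) auto
    also have "\<dots> \<le> 5/4" by (simp add: power2_eq_square)
    finally show ?thesis .
  qed
  have kap: "c / ln y \<le> \<eta>" "c / ln y \<le> 3 * c" "0 < c / ln y" "1/3 \<le> ln y" if "3/2 \<le> y" for y
  proof -
    show l: "1/3 \<le> ln y" by (rule ln_ge_third[OF that])
    show "c / ln y \<le> 3 * c" "0 < c / ln y" using l c frac_le[of c c "1/3" "ln y"] by simp_all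
    thus "c / ln y \<le> \<eta>" using c by linarith
  qed
  have main: "norm (correction \<nu> y z s) \<le> (exp C * (D / c) ^ 3) * ln y ^ 3"
    if z: "norm z \<le> r" and y: "3/2 \<le> y" and s: "Re s > 1 - c / ln y" for \<nu> y z s
  proof -
    define \<kappa> where "\<kappa> = c / ln y"
    have \<kappa>: "0 < \<kappa>" "\<kappa> \<le> 3/10" "\<kappa> \<le> \<eta>" using kap[OF y] c unfolding \<kappa>_def by linarith+
    define Q where "Q = D * ln y / c"
    have ly: "ln y \<ge> 1/3" by (rule kap[OF y])
    have Q1: "1 \<le> Q"
    proof -
      have "1 * (1/3) \<le> D * ln y" using D ly by (intro mult_mono) auto
      thus ?thesis using c by (simp add: Q_def field_simps)
    qed
    have fin: "finite {p. prime p \<and> real p \<le> y}"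
      by (rule finite_subset[of _ "{..nat \<lfloor>y\<rfloor>}"]) (auto simp: le_nat_floor)
    have "(\<Sum>p | prime p \<and> real p \<le> y. real p powr (- Re s)) \<le> (\<Sum>p | prime p \<and> real p \<le> y. 5/4 * real p powr (- (1 + \<kappa>)))"
    proof (intro sum_mono)
      fix p assume "p \<in> {p. prime p \<and> real p \<le> y}"
      hence p: "prime p" "real p \<le> y" by auto
      have p2: "real p \<ge> 2" using prime_ge_2_nat[OF p(1)] by simp
      have "real p powr (- Re s) \<le> real p powr (2 * \<kappa> + (- (1 + \<kappa>)))"
        using s p2 by (intro powr_mono) (auto simp: \<kappa>_def)
      also have "\<dots> = real p powr (2 * \<kappa>) * real p powr (- (1 + \<kappa>))" by (rule powr_add)
      also have "real p powr (2 * \<kappa>) \<le> y powr (2 * \<kappa>)" using p p2 \<kappa> by (intro powr_mono2) auto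
      also have "y powr (2 * \<kappa>) = exp (2 * c)" using ly y by (simp add: powr_def \<kappa>_def)
      also note exp2c
      finally show "real p powr (- Re s) \<le> 5/4 * real p powr (- (1 + \<kappa>))" by (simp add: mult_right_mono)
    qed
    also have "\<dots> \<le> 5/4 * log_zeta_real (1 + \<kappa>)"
      unfolding sum_distrib_left[symmetric] using \<kappa> by (intro mult_left_mono sum_prime_powr_le fin) auto
    also have "log_zeta_real (1 + \<kappa>) \<le> ln Q"
    proof -
      have "log_zeta_real (1 + \<kappa>) \<le> ln (D0 / \<kappa>)" using D0(2)[of "1 + \<kappa>"] \<kappa> by simp
      also have "\<dots> \<le> ln (D / \<kappa>)" using D D0 \<kappa> by (intro ln_mono divide_right_mono) auto
      also have "D / \<kappa> = Q" by (simp add: \<kappa>_def Q_def)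
      finally show ?thesis .
    qed
    finally have S: "(\<Sum>p | prime p \<and> real p \<le> y. real p powr (- Re s)) \<le> 5/4 * ln Q" by simp
    have "norm (correction \<nu> y z s) \<le> exp (r * (\<Sum>p | prime p \<and> real p \<le> y. real p powr (- Re s)) + C)"
      using s \<kappa> by (intro bnd[OF z]) (auto simp: \<kappa>_def)
    also have "\<dots> \<le> exp (3 * ln Q + C)"
    proof -
      have "r * (\<Sum>p | prime p \<and> real p \<le> y. real p powr (- Re s)) \<le> r * (5/4 * ln Q)" using S r by (intro mult_left_mono) auto
      also have "\<dots> \<le> 2 * (5/4 * ln Q)" using r Q1 by (intro mult_right_mono) auto
      also have "\<dots> \<le> 3 * ln Q" using Q1 by simp
      finally show ?thesis by simp
    qed
    also have "\<dots> = exp C * Q ^ 3"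
    proof -
      have "exp (3 * ln Q) = Q ^ 3" using Q1 exp_of_nat_mult[of 3 "ln Q"] by simp
      thus ?thesis by (simp add: exp_add mult.commute)
    qed
    also have "\<dots> = (exp C * (D / c) ^ 3) * ln y ^ 3" by (simp add: Q_def power_mult_distrib power_divide)
    finally show ?thesis .
  qed
  have hol': "correction \<nu> y z holomorphic_on {s. Re s > 1 - c / ln y}" if "norm z \<le> r" "3/2 \<le> y" for \<nu> y z
    using kap(1)[OF that(2)] by (intro holomorphic_on_subset[OF hol[OF that(1)]]) auto
  show ?thesis
    by (rule exI[of _ "exp C * (D / c) ^ 3"], rule exI[of _ c]) (use main hol' c D in auto)
qed

text \<open>What multiplies \<open>(s - 1) powr (- z)\<close> in the Dirichlet series near 1.
  Written with \<open>zeta_reg\<close> instead of \<open>zeta\<close> it is holomorphic across the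
  point 1 itself.\<close>

definition near_factor :: "prime_counter \<Rightarrow> real \<Rightarrow> complex \<Rightarrow> complex \<Rightarrow> complex" where
  "near_factor \<nu> y z s = exp (z * Ln (zeta_reg s)) * correction \<nu> y z s"

definition sd_coeff :: "prime_counter \<Rightarrow> real \<Rightarrow> complex \<Rightarrow> nat \<Rightarrow> complex" where
  "sd_coeff \<nu> y z j = (deriv ^^ j) (near_factor \<nu> y z) 1 / fact j"

text \<open>Fixes one triple of constants for the expansion at 1 and for the estimates away from it,
  with the strip of width \<open>c / ln y\<close> well inside the disc of radius
  \<open>\<delta>\<close>.\<close>

lemma near_factor_facts:
  assumes r: "1 \<le> r" "r < 2"
  obtains K c \<delta> where "0 < K" "0 < c" "0 < \<delta>" "\<delta> \<le> 1/2" "\<And>y. 3/2 \<le> y \<Longrightarrow> c / ln y \<le> \<delta> / 4"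
    and "\<And>\<nu> y z. norm z \<le> r \<Longrightarrow> 3/2 \<le> y \<Longrightarrow> correction \<nu> y z holomorphic_on {s. Re s > 1 - c / ln y}"
    and "\<And>\<nu> y z s. norm z \<le> r \<Longrightarrow> 3/2 \<le> y \<Longrightarrow> Re s > 1 - c / ln y \<Longrightarrow> norm (correction \<nu> y z s) \<le> K * ln y ^ 3"
    and "\<And>\<nu> y z. norm z \<le> r \<Longrightarrow> 3/2 \<le> y \<Longrightarrow> near_factor \<nu> y z holomorphic_on (ball 1 \<delta> \<inter> {s. Re s > 1 - c / ln y})"
    and "\<And>\<nu> y z s. norm z \<le> r \<Longrightarrow> 3/2 \<le> y \<Longrightarrow> s \<in> ball 1 \<delta> \<Longrightarrow> Re s > 1 - c / ln y \<Longrightarrow>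
       norm (near_factor \<nu> y z s) \<le> K * ln y ^ 3"
    and "\<And>\<nu> y z s. norm z \<le> r \<Longrightarrow> s \<in> ball 1 \<delta> \<Longrightarrow> Re s > 1 \<Longrightarrow>
       rough_series \<nu> y z s = (s - 1) powr (- z) * near_factor \<nu> y z s"
proof -
  obtain K c0 where K: "0 < K" "0 < c0" "c0 \<le> 1/10" 
    and hol: "\<And>\<nu> y z. norm z \<le> r \<Longrightarrow> 3/2 \<le> y \<Longrightarrow> correction \<nu> y z holomorphic_on {s. Re s > 1 - c0 / ln y}"
    and bnd: "\<And>\<nu> y z s. norm z \<le> r \<Longrightarrow> 3/2 \<le> y \<Longrightarrow> Re s > 1 - c0 / ln y \<Longrightarrow> norm (correction \<nu> y z s) \<le> K * ln y ^ 3"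
    using correction_log_bound[OF r] by metis
  obtain \<delta> where \<delta>: "0 < \<delta>" "\<delta> \<le> 1/2" and Lh: "(\<lambda>s. Ln (zeta_reg s)) holomorphic_on ball 1 \<delta>"
    and Lb: "\<And>s. s\<in>ball 1 \<delta> \<Longrightarrow> norm (Ln (zeta_reg s)) \<le> 1"
    and Leq: "\<And>s. s\<in>ball 1 \<delta> \<Longrightarrow> Re s > 1 \<Longrightarrow> log_zeta s = Ln (zeta_reg s) - Ln (s - 1)"
    using log_zeta_near_1 by metis
  \<comment> \<open>Since \<open>ln y \<ge> 1/3\<close>, the bound
    \<open>c \<le> \<delta> / 12\<close> gives \<open>c / ln y \<le> \<delta> / 4\<close>.\<close>
  define c where "c = min c0 (\<delta> / 12)"
  have c: "0 < c" "c \<le> c0" "c \<le> \<delta> / 12" using K \<delta> by (auto simp: c_def)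
  have cl: "c / ln y \<le> \<delta> / 4" "c / ln y \<le> c0 / ln y" "0 < ln y" if "3/2 \<le> y" for y
  proof -
    have l: "1/3 \<le> ln y" by (rule ln_ge_third[OF that])
    show "c / ln y \<le> \<delta> / 4" using frac_le[of "\<delta>/12" c "1/3" "ln y"] l c \<delta> by simp
    show "c / ln y \<le> c0 / ln y" using l c by (intro divide_right_mono) auto
    show "0 < ln y" using l by simp
  qed
  have hol': "correction \<nu> y z holomorphic_on {s. Re s > 1 - c / ln y}" if "norm z \<le> r" "3/2 \<le> y" for \<nu> y z
    using cl(2)[OF that(2)] by (intro holomorphic_on_subset[OF hol[OF that]]) auto
  have eK: "exp r * K * ln y ^ 3 \<ge> K * ln y ^ 3" if "3/2 \<le> y" for y
  proof -
    have "1 * (K * ln y ^ 3) \<le> exp r * (K * ln y ^ 3)"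
      using K r cl(3)[OF that] by (intro mult_right_mono) auto
    thus ?thesis by simp
  qed
  have b: "norm (correction \<nu> y z s) \<le> K * ln y ^ 3" if "norm z \<le> r" "3/2 \<le> y" "Re s > 1 - c / ln y" for \<nu> y z s
  proof -
    have "Re s > 1 - c0 / ln y" using cl(2)[OF that(2)] that(3) by linarith
    thus ?thesis by (rule bnd[OF that(1,2)])
  qed
  have nf: "norm (near_factor \<nu> y z s) \<le> exp r * K * ln y ^ 3"
    if "norm z \<le> r" "3/2 \<le> y" "Re s > 1 - c / ln y" "s \<in> ball 1 \<delta>" for \<nu> y z s
  proof -
    have "norm (exp (z * Ln (zeta_reg s))) \<le> exp (norm (z * Ln (zeta_reg s)))" by (rule norm_exp)
    also have "norm (z * Ln (zeta_reg s)) \<le> r * 1" unfolding norm_mult using that Lb r by (intro mult_mono) auto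
    finally have "norm (exp (z * Ln (zeta_reg s))) \<le> exp r" by simp
    thus ?thesis unfolding near_factor_def norm_mult mult.assoc
      using b[OF that(1-3)] by (intro mult_mono) auto
  qed
  have eq: "rough_series \<nu> y z s = (s - 1) powr (- z) * near_factor \<nu> y z s"
    if "norm z \<le> r" "s \<in> ball 1 \<delta>" "Re s > 1" for \<nu> y z s
  proof -
    have "s - 1 \<noteq> 0" using that by auto
    hence "(s - 1) powr (- z) * exp (z * Ln (zeta_reg s)) = exp (z * log_zeta s)"
      using that by (simp add: powr_def Leq algebra_simps flip: exp_add)
    thus ?thesis unfolding rough_series_eq[OF r that(1,3)] near_factor_def by simp
  qed
  have nh: "near_factor \<nu> y z holomorphic_on (ball 1 \<delta> \<inter> {s. Re s > 1 - c / ln y})" if "norm z \<le> r" "3/2 \<le> y" for \<nu> y z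
    unfolding near_factor_def
    by (intro holomorphic_intros holomorphic_on_subset[OF Lh] holomorphic_on_subset[OF hol'[OF that]]) auto
  have b': "norm (correction \<nu> y z s) \<le> exp r * K * ln y ^ 3" if "norm z \<le> r" "3/2 \<le> y" "Re s > 1 - c / ln y" for \<nu> y z s
    using b[OF that] eK[OF that(2)] by (rule order_trans)
  have "exp r * K > 0" using K by simp
  from that[OF this c(1) \<delta> cl(1) hol' b' nh nf eq] show thesis by blast
qed

lemma rough_series_holomorphic:
  assumes r: "1 \<le> r" "r < 2" and z: "norm z \<le> r"
  shows "rough_series \<nu> y z holomorphic_on {s. Re s > 1}"
proof -
  obtain \<eta> where "0 < \<eta>" "correction \<nu> y z holomorphic_on {s. Re s > 1 - \<eta>}"
    using correction_facts[OF r] z by blast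
  hence "correction \<nu> y z holomorphic_on {s. Re s > 1}"
    by (elim holomorphic_on_subset) auto
  hence "(\<lambda>s. exp (z * log_zeta s) * correction \<nu> y z s) holomorphic_on {s. Re s > 1}"
    by (intro holomorphic_intros log_zeta_holomorphic)
  thus ?thesis by (rule holomorphic_transform) (use rough_series_eq[OF r z] in auto)
qed

lemma norm_powr_le:
  assumes "u \<noteq> (0::complex)" "\<bar>Im w\<bar> \<le> 2"
  shows "norm (u powr w) \<le> exp (2 * pi) * norm u powr Re w"
proof -
  have "\<bar>Im w * Im (Ln u)\<bar> \<le> 2 * pi"
    unfolding abs_mult using assms mpi_less_Im_Ln[of u] Im_Ln_le_pi[of u] by (intro mult_mono) auto
  hence "- (Im w * Im (Ln u)) \<le> 2 * pi" by linarith
  hence "exp (Re w * ln (norm u) - Im w * Im (Ln u)) \<le> exp (2 * pi + Re w * ln (norm u))" by simp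
  thus ?thesis using assms by (simp add: powr_def exp_add)
qed

lemma powr_comparable:
  fixes x y a M :: real
  assumes "0 < x" "x \<le> 2 * y" "y \<le> 2 * x" "\<bar>a\<bar> \<le> M"
  shows "x powr a \<le> 2 powr M * y powr a"
proof -
  have "x powr a = (x / y) powr a * y powr a" using assms by (simp add: powr_divide)
  also have "(x / y) powr a \<le> 2 powr M"
  proof (cases "a \<ge> 0")
    case True
    have "(x / y) powr a \<le> 2 powr a" using assms True by (intro powr_mono2) (auto simp: field_simps)
    also have "\<dots> \<le> 2 powr M" using assms by (intro powr_mono) auto
    finally show ?thesis .
  next
    case False
    have "(x / y) powr a \<le> (1/2) powr a" using assms False by (intro powr_mono2') (auto simp: field_simps)
    also have "\<dots> = 2 powr (- a)" by (simp add: powr_divide powr_minus_divide)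
    also have "\<dots> \<le> 2 powr M" using assms by (intro powr_mono) auto
    finally show ?thesis .
  qed
  finally show ?thesis by (simp add: mult_right_mono)
qed

lemma norm_pochhammer_le: "norm (pochhammer (w::complex) k) \<le> (norm w + real k) ^ k"
proof -
  have "norm (pochhammer w k) = (\<Prod>i<k. norm (w + of_nat i))"
    by (simp add: pochhammer_prod prod_norm atLeast0LessThan)
  also have "\<dots> \<le> (\<Prod>i<k. norm w + real k)"
  proof (intro prod_mono conjI)
    fix i assume "i \<in> {..<k}"
    have "norm (w + of_nat i) \<le> norm w + norm (of_nat i :: complex)" by (rule norm_triangle_ineq)
    thus "norm (w + of_nat i) \<le> norm w + real k" using \<open>i \<in> _\<close> by simp
  qed auto
  finally show ?thesis by simp
qed

lemma higher_deriv_shifted_powr: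
  assumes "Re s > 1"
  shows "(deriv ^^ k) (\<lambda>s. (s - 1) powr (- w)) s = (-1) ^ k * pochhammer w k * (s - 1) powr (- w - of_nat k)"
  using assms
proof (induction k arbitrary: s)
  case (Suc k)
  have "deriv ((deriv ^^ k) (\<lambda>s. (s - 1) powr (- w))) s = deriv (\<lambda>s. (-1) ^ k * pochhammer w k * (s - 1) powr (- w - of_nat k)) s"
    using eventually_nhds_in_open[OF open_halfspace_Re_gt, of s 1] Suc
    by (intro deriv_cong_ev refl) (auto elim!: eventually_mono)
  also have "\<dots> = (-1) ^ k * pochhammer w k * ((- w - of_nat k) * (s - 1) powr (- w - of_nat k - 1))"
    using Suc.prems by (intro DERIV_imp_deriv) (auto intro!: derivative_eq_intros simp: complex_nonpos_Reals_iff)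
  also have "\<dots> = (-1) ^ Suc k * pochhammer w (Suc k) * (s - 1) powr (- w - of_nat (Suc k))"
    by (simp add: pochhammer_Suc algebra_simps)
  finally show ?case by simp
qed auto

lemma higher_deriv_sum:
  assumes "open A" "s \<in> A" "\<And>i. i \<in> I \<Longrightarrow> f i holomorphic_on A"
  shows "(deriv ^^ k) (\<lambda>s. \<Sum>i\<in>I. f i s) s = (\<Sum>i\<in>I. (deriv ^^ k) (f i) s)"
  using assms(3)
proof (induction I rule: infinite_finite_induct)
  case (insert x F)
  have "(deriv ^^ k) (\<lambda>s. f x s + (\<Sum>i\<in>F. f i s)) s = (deriv ^^ k) (f x) s + (deriv ^^ k) (\<lambda>s. \<Sum>i\<in>F. f i s) s"
    using insert.prems assms(1,2) by (intro higher_deriv_add) (auto intro!: holomorphic_on_sum)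
  thus ?case using insert by simp
qed (auto simp: higher_deriv_const)

text \<open>Cauchy's inequality at 1 on the disc of radius \<open>c / ln y\<close>, where
  \<open>near_factor\<close> is \<open>O((ln y) ^ 3)\<close>; every further coefficient costs one
  more \<open>ln y\<close>.\<close>

lemma sd_coeff_bound:
  assumes r: "1 \<le> r" "r < 2"
  shows "\<exists>K. \<forall>\<nu> y z. norm z \<le> r \<longrightarrow> 3/2 \<le> y \<longrightarrow> norm (sd_coeff \<nu> y z j) \<le> K * ln y ^ (3 + j)"
proof -
  obtain K c \<delta> where K: "0 < K" "0 < c" "0 < \<delta>" and \<rho>: "\<And>y. 3/2 \<le> y \<Longrightarrow> c / ln y \<le> \<delta> / 4"
    and hol: "\<And>\<nu> y z. norm z \<le> r \<Longrightarrow> 3/2 \<le> y \<Longrightarrow> near_factor \<nu> y z holomorphic_on (ball 1 \<delta> \<inter> {s. Re s > 1 - c / ln y})"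
    and bnd: "\<And>\<nu> y z s. norm z \<le> r \<Longrightarrow> 3/2 \<le> y \<Longrightarrow> s \<in> ball 1 \<delta> \<Longrightarrow> Re s > 1 - c / ln y \<Longrightarrow>
       norm (near_factor \<nu> y z s) \<le> K * ln y ^ 3"
    and eq: "\<And>\<nu> y z s. norm z \<le> r \<Longrightarrow> s \<in> ball 1 \<delta> \<Longrightarrow> Re s > 1 \<Longrightarrow>
       rough_series \<nu> y z s = (s - 1) powr (- z) * near_factor \<nu> y z s"
    by (rule near_factor_facts[OF r]) (rule that; assumption)
  have "norm (sd_coeff \<nu> y z j) \<le> (K / c ^ j) * ln y ^ (3 + j)" if z: "norm z \<le> r" and y: "3/2 \<le> y" for \<nu> y z
  proof -
    have l: "1/3 \<le> ln y" by (rule ln_ge_third[OF y])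
    have sub: "ball 1 (c / ln y) \<subseteq> ball 1 \<delta> \<inter> {s. Re s > 1 - c / ln y}"
    proof
      fix w :: complex assume w: "w \<in> ball 1 (c / ln y)"
      have "\<bar>Re w - Re 1\<bar> < c / ln y" using w abs_Re_le_cmod[of "w - 1"] by (auto simp: dist_norm norm_minus_commute)
      moreover have "dist 1 w < \<delta>" using w \<rho>[OF y] K(3) by (simp only: mem_ball)
      ultimately show "w \<in> ball 1 \<delta> \<inter> {s. Re s > 1 - c / ln y}" by auto
    qed
    have "norm ((deriv ^^ j) (near_factor \<nu> y z) 1) \<le> fact j * (K * ln y ^ 3) / (c / ln y) ^ j"
      using sub bnd[OF z y] K l by (intro Cauchy_inequality_ball holomorphic_on_subset[OF hol[OF z y]]) (auto simp: subset_iff)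
    note D = this
    have "norm (sd_coeff \<nu> y z j) = norm ((deriv ^^ j) (near_factor \<nu> y z) 1) / fact j"
      by (simp add: sd_coeff_def norm_divide)
    also have "\<dots> \<le> fact j * (K * ln y ^ 3) / (c / ln y) ^ j / fact j"
      by (rule divide_right_mono[OF D]) simp
    finally have "norm (sd_coeff \<nu> y z j) \<le> fact j * (K * ln y ^ 3) / (c / ln y) ^ j / fact j" .
    thus ?thesis using l K by (simp add: power_divide power_add mult_ac)
  qed
  thus ?thesis by blast
qed

text \<open>The difference of the series and its \<open>m\<close>-term expansion is
  \<open>(s - 1) powr (- z)\<close> times a Taylor remainder of order
  \<open>(ln y) ^ 3 * (norm (s - 1) * ln y) ^ m\<close>. Instead of differentiating this product,
  Cauchy's inequality is applied on the disc of radius \<open>norm (s - 1) / 2\<close> around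
  \<open>s\<close>, which costs \<open>fact k * (2 / norm (s - 1)) ^ k\<close>.\<close>

lemma rough_series_deriv_near:
  assumes r: "1 \<le> r" "r < 2"
  shows "\<exists>K \<epsilon>. 0 < K \<and> 0 < \<epsilon> \<and> (\<forall>\<nu> y z s. norm z \<le> r \<longrightarrow> 3/2 \<le> y \<longrightarrow> 1 < Re s \<longrightarrow> norm (s - 1) \<le> \<epsilon> / ln y \<longrightarrow>
     norm ((deriv ^^ k) (rough_series \<nu> y z) s -
       (-1) ^ k * (\<Sum>j<m. sd_coeff \<nu> y z j * pochhammer (z - of_nat j) k * (s - 1) powr (of_nat j - z - of_nat k)))
       \<le> K * ln y ^ (3 + m) * norm (s - 1) powr (real m - Re z - real k))"
proof -
  obtain K c \<delta> where K: "0 < K" "0 < c" "0 < \<delta>" and \<rho>: "\<And>y. 3/2 \<le> y \<Longrightarrow> c / ln y \<le> \<delta> / 4"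
    and hol: "\<And>\<nu> y z. norm z \<le> r \<Longrightarrow> 3/2 \<le> y \<Longrightarrow> near_factor \<nu> y z holomorphic_on (ball 1 \<delta> \<inter> {s. Re s > 1 - c / ln y})"
    and bnd: "\<And>\<nu> y z s. norm z \<le> r \<Longrightarrow> 3/2 \<le> y \<Longrightarrow> s \<in> ball 1 \<delta> \<Longrightarrow> Re s > 1 - c / ln y \<Longrightarrow>
       norm (near_factor \<nu> y z s) \<le> K * ln y ^ 3"
    and eq: "\<And>\<nu> y z s. norm z \<le> r \<Longrightarrow> s \<in> ball 1 \<delta> \<Longrightarrow> Re s > 1 \<Longrightarrow>
       rough_series \<nu> y z s = (s - 1) powr (- z) * near_factor \<nu> y z s"
    by (rule near_factor_facts[OF r]) (rule that; assumption)
  define C where "C = exp (2 * pi) * (2 * K) / c ^ m * 2 powr (real m + 2)"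
  have C: "C > 0" using K by (simp add: C_def)
  have main: "norm ((deriv ^^ k) (rough_series \<nu> y z) s -
       (-1) ^ k * (\<Sum>j<m. sd_coeff \<nu> y z j * pochhammer (z - of_nat j) k * (s - 1) powr (of_nat j - z - of_nat k)))
       \<le> (fact k * C * 2 ^ k) * ln y ^ (3 + m) * norm (s - 1) powr (real m - Re z - real k)"
    if z: "norm z \<le> r" and y: "3/2 \<le> y" and s: "1 < Re s" "norm (s - 1) \<le> (c / 4) / ln y" for \<nu> y z s
  proof -
    define \<rho>' where "\<rho>' = c / ln y"
    define n where "n = norm (s - 1)"
    have l: "1/3 \<le> ln y" by (rule ln_ge_third[OF y])
    have r0: "0 < \<rho>'" "\<rho>' \<le> \<delta> / 4" using l K \<rho>[OF y] by (auto simp: \<rho>'_def)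
    have n: "0 < n" "n \<le> \<rho>' / 4" using s by (auto simp: n_def \<rho>'_def)
    have sub: "ball 1 \<rho>' \<subseteq> ball 1 \<delta> \<inter> {s. Re s > 1 - c / ln y}"
    proof
      fix w :: complex assume w: "w \<in> ball 1 \<rho>'"
      have "\<bar>Re w - Re 1\<bar> < \<rho>'" using w abs_Re_le_cmod[of "w - 1"] by (auto simp: dist_norm norm_minus_commute)
      moreover have "dist 1 w < \<delta>" using w r0(2) K(3) by (simp only: mem_ball)
      ultimately show "w \<in> ball 1 \<delta> \<inter> {s. Re s > 1 - c / ln y}" by (auto simp: \<rho>'_def)
    qed
    let ?B = "ball s (n / 2)"
    have wB: "norm (w - 1) \<le> 3/2 * n" "n / 2 \<le> norm (w - 1)" "w - 1 \<notin> \<real>\<^sub>\<le>\<^sub>0" "w \<in> ball 1 \<rho>'" if "w \<in> ?B" for w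
    proof -
      have d: "norm (w - s) < n / 2" using that by (simp add: dist_norm norm_minus_commute)
      show a: "norm (w - 1) \<le> 3/2 * n" using norm_triangle_ineq[of "w - s" "s - 1"] d by (simp add: n_def)
      show "n / 2 \<le> norm (w - 1)" using norm_triangle_ineq2[of "s - 1" "s - w"] d by (simp add: n_def norm_minus_commute)
      show "w \<in> ball 1 \<rho>'" using a n r0 by (simp add: dist_norm norm_minus_commute)
      \<comment> \<open>As \<open>Re s > 1\<close>, the point of the half-line \<open>1 + t\<close>,
        \<open>t \<le> 0\<close>, closest to \<open>s\<close> is 1 itself; a disc of half that
        distance misses the branch cut even where it crosses \<open>Re w = 1\<close>.\<close>
      show "w - 1 \<notin> \<real>\<^sub>\<le>\<^sub>0"
      proof
        assume "w - 1 \<in> \<real>\<^sub>\<le>\<^sub>0"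
        then obtain t where t: "t \<le> 0" "w - 1 = of_real t" by (auto elim!: nonpos_Reals_cases)
        have "norm (s - 1) \<le> norm ((s - 1) - of_real t)"
        proof (rule iffD1[OF power2_le_iff_abs_le] | rule power2_le_imp_le)
          have "(Re s - 1)\<^sup>2 \<le> (Re s - 1 - t)\<^sup>2" using t s by (intro power_mono) auto
          thus "(norm (s - 1))\<^sup>2 \<le> (norm ((s - 1) - of_real t))\<^sup>2" by (simp add: cmod_power2)
        qed auto
        also have "(s - 1) - of_real t = s - w" using t by (simp add: algebra_simps)
        finally have "n \<le> norm (w - s)" by (simp add: n_def norm_minus_commute)
        thus False using d n by linarith
      qed
    qed
    define T where "T w = near_factor \<nu> y z w - (\<Sum>j<m. sd_coeff \<nu> y z j * (w - 1) ^ j)" for w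
    define D where "D w = (w - 1) powr (- z) * T w" for w
    have Tb: "norm (T w) \<le> 2 * (K * ln y ^ 3) * (norm (w - 1) / \<rho>') ^ m" if "w \<in> ?B" for w
    proof -
      have nb: "norm (near_factor \<nu> y z u) \<le> K * ln y ^ 3" if "u \<in> ball 1 \<rho>'" for u
        using bnd[OF z y, of u] sub that by blast
      have "norm (w - 1) \<le> 1/2 * \<rho>'" using wB(1)[OF that] n r0 by linarith
      from taylor_remainder_bound[OF holomorphic_on_subset[OF hol[OF z y] sub] r0(1) nb this, of m]
      show ?thesis by (simp add: T_def sd_coeff_def mult_ac)
    qed
    have rez: "\<bar>Re z\<bar> \<le> 2" "\<bar>Im z\<bar> \<le> 2" using z r abs_Re_le_cmod[of z] abs_Im_le_cmod[of z] by linarith+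
    have Db: "norm (D w) \<le> C * ln y ^ (3 + m) * n powr (real m - Re z)" if w: "w \<in> ?B" for w
    proof -
      have w1: "w - 1 \<noteq> 0" "norm (w - 1) > 0" using wB[OF w] n by auto
      have "norm (D w) \<le> (exp (2 * pi) * norm (w - 1) powr (- Re z)) * (2 * (K * ln y ^ 3) * (norm (w - 1) / \<rho>') ^ m)"
        unfolding D_def norm_mult using norm_powr_le[OF w1(1), of "- z"] rez Tb[OF w] by (intro mult_mono) auto
      also have "\<dots> = exp (2 * pi) * (2 * K) / c ^ m * ln y ^ (3 + m) * (norm (w - 1) powr (- Re z) * norm (w - 1) powr real m)"
        using w1 by (simp add: \<rho>'_def power_divide power_mult_distrib power_add powr_realpow field_simps)
      also have "norm (w - 1) powr (- Re z) * norm (w - 1) powr real m = norm (w - 1) powr (real m - Re z)"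
        by (simp add: powr_add[symmetric])
      also have "exp (2 * pi) * (2 * K) / c ^ m * ln y ^ (3 + m) * \<dots> \<le>
          exp (2 * pi) * (2 * K) / c ^ m * ln y ^ (3 + m) * (2 powr (real m + 2) * n powr (real m - Re z))"
        using wB[OF w] w1 n rez K l by (intro mult_left_mono powr_comparable) auto
      finally show ?thesis by (simp add: C_def mult_ac)
    qed
    have Dh: "D holomorphic_on ?B" unfolding D_def T_def
      using wB(3) by (intro holomorphic_intros holomorphic_on_subset[OF hol[OF z y]] order_trans[OF _ sub]) (auto intro: wB(4))
    have Dd: "norm ((deriv ^^ k) D s) \<le> fact k * (C * ln y ^ (3 + m) * n powr (real m - Re z)) / (n / 2) ^ k"
      using n Db by (intro Cauchy_inequality_ball[OF Dh]) auto
    also have "\<dots> = (fact k * C * 2 ^ k) * ln y ^ (3 + m) * n powr (real m - Re z - real k)"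
      using n by (simp add: power_divide powr_diff powr_add powr_realpow field_simps)
    finally have Dd: "norm ((deriv ^^ k) D s) \<le> (fact k * C * 2 ^ k) * ln y ^ (3 + m) * n powr (real m - Re z - real k)" .
    let ?M = "\<lambda>w. \<Sum>j<m. sd_coeff \<nu> y z j * (w - 1) powr (- (z - of_nat j))"
    let ?S = "?B \<inter> {s. Re s > 1}"
    let ?H = "{s. Re s > 1}"
    have op: "open ?S" and oH: "open ?H" by (auto intro: open_halfspace_Re_gt)
    have pw: "(\<lambda>w. (w - 1) powr a) holomorphic_on ?H" for a
      by (intro holomorphic_intros) (auto simp: complex_nonpos_Reals_iff)
    have Mh: "?M holomorphic_on ?H" by (intro holomorphic_intros pw)
    have Fh: "rough_series \<nu> y z holomorphic_on ?H" by (rule rough_series_holomorphic[OF r z])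
    have "(deriv ^^ k) D s = (deriv ^^ k) (\<lambda>w. rough_series \<nu> y z w - ?M w) s"
    proof (rule higher_deriv_transform_within_open[OF _ _ op])
      show "D holomorphic_on ?S" by (rule holomorphic_on_subset[OF Dh]) auto
      show "(\<lambda>w. rough_series \<nu> y z w - ?M w) holomorphic_on ?S"
        by (intro holomorphic_on_diff holomorphic_on_subset[OF Fh] holomorphic_on_subset[OF Mh]) auto
      show "s \<in> ?S" using n s by auto
      fix w assume w: "w \<in> ?S"
      have w1: "w - 1 \<noteq> 0" using w by auto
      have "rough_series \<nu> y z w = (w - 1) powr (- z) * near_factor \<nu> y z w"
        using w wB(4)[of w] sub by (intro eq[OF z]) auto
      moreover have "(w - 1) powr (- z) * (w - 1) ^ j = (w - 1) powr (- (z - of_nat j))" for j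
      proof -
        have "(w - 1) powr (- z + of_nat j) = (w - 1) powr (- z) * (w - 1) ^ j"
          using w1 by (simp only: powr_add powr_nat if_False)
        moreover have "- z + of_nat j = - (z - of_nat j)" by simp
        ultimately show ?thesis by (simp only:)
      qed
      hence "(w - 1) powr (- z) * (\<Sum>j<m. sd_coeff \<nu> y z j * (w - 1) ^ j) = ?M w"
        unfolding sum_distrib_left by (intro sum.cong refl) (metis (no_types, lifting) mult.left_commute)
      ultimately show "D w = rough_series \<nu> y z w - ?M w"
        by (simp add: D_def T_def right_diff_distrib)
    qed
    also have "\<dots> = (deriv ^^ k) (rough_series \<nu> y z) s - (deriv ^^ k) ?M s"
      using s by (intro higher_deriv_diff[OF Fh Mh oH]) auto
    also have "(deriv ^^ k) ?M s = (\<Sum>j<m. (deriv ^^ k) (\<lambda>w. sd_coeff \<nu> y z j * (w - 1) powr (- (z - of_nat j))) s)"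
      using s by (intro higher_deriv_sum[OF oH]) (auto intro!: holomorphic_intros pw)
    also have "\<dots> = (\<Sum>j<m. sd_coeff \<nu> y z j * (deriv ^^ k) (\<lambda>w. (w - 1) powr (- (z - of_nat j))) s)"
      using s by (intro sum.cong refl higher_deriv_cmult[OF pw _ oH]) auto
    also have "\<dots> = (-1) ^ k * (\<Sum>j<m. sd_coeff \<nu> y z j * pochhammer (z - of_nat j) k * (s - 1) powr (of_nat j - z - of_nat k))"
      unfolding higher_deriv_shifted_powr[OF s(1)] sum_distrib_left
      by (intro sum.cong refl) (simp add: mult_ac)
    finally show ?thesis using Dd by (simp add: n_def)
  qed
  show ?thesis
    by (rule exI[of _ "fact k * C * 2 ^ k"], rule exI[of _ "c / 4"]) (use main C K in auto)
qed

lemma norm_exp_log_height: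
  fixes z g :: complex
  assumes "norm z \<le> 2" "norm g \<le> A + 9 * ln L" "L \<ge> 1"
  shows "norm (exp (z * g)) \<le> exp (2 * \<bar>A\<bar>) * L ^ 18"
proof -
  have "norm (exp (z * g)) \<le> exp (norm (z * g))" by (rule norm_exp)
  also have "norm (z * g) \<le> 2 * (\<bar>A\<bar> + 9 * ln L)"
    unfolding norm_mult using assms by (intro mult_mono) auto
  also have "exp (2 * (\<bar>A\<bar> + 9 * ln L)) = exp (2 * \<bar>A\<bar>) * exp (of_nat 18 * ln L)"
    by (simp add: exp_add[symmetric])
  also have "exp (of_nat 18 * ln L) = L ^ 18" unfolding exp_of_nat_mult using assms by simp
  finally show ?thesis by simp
qed

text \<open>Lets a continuation to a disc that crosses the line \<open>Re w = 1\<close> compute the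
  derivatives of the series at the centre.\<close>

lemma higher_deriv_eq_on_halfplane:
  assumes "f holomorphic_on {s. Re s > 1}" "g holomorphic_on ball s R" "0 < R" "1 < Re s"
    "\<And>w. w \<in> ball s R \<Longrightarrow> Re w > 1 \<Longrightarrow> f w = g w"
  shows "(deriv ^^ k) f s = (deriv ^^ k) g s"
  by (rule higher_deriv_transform_within_open[of _ "ball s R \<inter> {s. Re s > 1}"])
     (use assms in \<open>auto intro: holomorphic_on_subset open_halfspace_Re_gt\<close>)

text \<open>Cauchy's inequality with two continuations. For small \<open>Im s\<close> it is
  \<open>(w - 1) powr (- z) * near_factor\<close> on a disc of radius of order
  \<open>1 / ln y\<close>, where the power is at most of order \<open>(ln y) ^ 2\<close>: the
  exponent \<open>k + 5\<close> is \<open>3 + 2 + k\<close>. For larger \<open>Im s\<close> it is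
  \<open>exp (z * g) * correction\<close> with the continued logarithm \<open>g\<close>, on a disc
  of radius of order \<open>1 / (ln y * L ^ 9)\<close>: the exponent \<open>18 + 9 * k\<close> is
  \<open>norm z * 9 \<le> 18\<close> plus 9 for each derivative.\<close>

lemma rough_series_deriv_far:
  assumes r: "1 \<le> r" "r < 2" and \<epsilon>: "0 < \<epsilon>"
  shows "\<exists>K \<delta>0. 0 < K \<and> 0 < \<delta>0 \<and> \<delta>0 \<le> 1/2 \<and> (\<forall>\<nu> y z s. norm z \<le> r \<longrightarrow> 3/2 \<le> y \<longrightarrow> 1 < Re s \<longrightarrow> Re s \<le> 1 + \<delta>0 \<longrightarrow> norm (s - 1) > \<epsilon> / ln y \<longrightarrow>
     norm ((deriv ^^ k) (rough_series \<nu> y z) s) \<le> K * ln y ^ (k + 5) * log_height s ^ (18 + 9 * k))"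
proof -
  obtain K c \<delta> where K: "0 < K" "0 < c" "0 < \<delta>" "\<delta> \<le> 1/2" and \<rho>: "\<And>y. 3/2 \<le> y \<Longrightarrow> c / ln y \<le> \<delta> / 4"
    and ch: "\<And>\<nu> y z. norm z \<le> r \<Longrightarrow> 3/2 \<le> y \<Longrightarrow> correction \<nu> y z holomorphic_on {s. Re s > 1 - c / ln y}"
    and cb: "\<And>\<nu> y z s. norm z \<le> r \<Longrightarrow> 3/2 \<le> y \<Longrightarrow> Re s > 1 - c / ln y \<Longrightarrow> norm (correction \<nu> y z s) \<le> K * ln y ^ 3"
    and hol: "\<And>\<nu> y z. norm z \<le> r \<Longrightarrow> 3/2 \<le> y \<Longrightarrow> near_factor \<nu> y z holomorphic_on (ball 1 \<delta> \<inter> {s. Re s > 1 - c / ln y})"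
    and bnd: "\<And>\<nu> y z s. norm z \<le> r \<Longrightarrow> 3/2 \<le> y \<Longrightarrow> s \<in> ball 1 \<delta> \<Longrightarrow> Re s > 1 - c / ln y \<Longrightarrow>
       norm (near_factor \<nu> y z s) \<le> K * ln y ^ 3"
    and eq: "\<And>\<nu> y z s. norm z \<le> r \<Longrightarrow> s \<in> ball 1 \<delta> \<Longrightarrow> Re s > 1 \<Longrightarrow>
       rough_series \<nu> y z s = (s - 1) powr (- z) * near_factor \<nu> y z s"
    by (rule near_factor_facts[OF r]) (rule that; assumption)
  obtain a A where a: "0 < a" "a \<le> 1/16"
    and ext: "\<And>s0 R. 1 < Re s0 \<Longrightarrow> Re s0 \<le> 3/2 \<Longrightarrow> \<bar>Im s0\<bar> \<ge> 2 * (\<delta> / 8) \<Longrightarrow> 0 < R \<Longrightarrow>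
     R \<le> a / log_height s0 ^ 9 \<Longrightarrow> \<exists>g. g holomorphic_on ball s0 R \<and>
       (\<forall>w\<in>ball s0 R. (Re w > 1 \<longrightarrow> g w = log_zeta w) \<and> norm (g w) \<le> A + 9 * ln (log_height s0))"
    using log_zeta_extension[of "\<delta> / 8"] K by (metis divide_pos_pos zero_less_numeral)
  \<comment> \<open>The disc of radius \<open>e / ln y\<close> keeps at least its own radius away
    from 1, by the first entry, and stays in the strip of \<open>near_factor\<close>, by the
    second.\<close>
  define e where "e = min (\<epsilon> / 2) (c / 2)"
  have e: "0 < e" "e \<le> \<epsilon> / 2" "e \<le> c / 2" using K \<epsilon> by (auto simp: e_def)
  \<comment> \<open>The 3 offsets \<open>ln y \<ge> 1/3\<close>, so that
    \<open>b / ln y \<le> a\<close>.\<close>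
  define b where "b = min a c / 3"
  have b: "0 < b" "3 * b \<le> a" "3 * b \<le> c" using K a by (auto simp: b_def)
  define K1 where "K1 = fact k * exp (2 * pi) * K / e ^ (k + 2)"
  define K2 where "K2 = fact k * exp (2 * \<bar>A\<bar>) * K * 9 / b ^ k"
  have K12: "K1 > 0" "K2 > 0" using K e b by (auto simp: K1_def K2_def)
  have main: "norm ((deriv ^^ k) (rough_series \<nu> y z) s) \<le> (K1 + K2) * ln y ^ (k + 5) * log_height s ^ (18 + 9 * k)"
    if z: "norm z \<le> r" and y: "3/2 \<le> y" and s: "1 < Re s" "Re s \<le> 1 + \<delta> / 8" "norm (s - 1) > \<epsilon> / ln y" for \<nu> y z s
  proof -
    define L where "L = log_height s"
    have L: "L \<ge> 1" unfolding L_def by (rule log_height_ge_1)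
    have l: "1/3 \<le> ln y" by (rule ln_ge_third[OF y])
    have Fh: "rough_series \<nu> y z holomorphic_on {s. Re s > 1}" by (rule rough_series_holomorphic[OF r z])
    show ?thesis
    proof (cases "\<bar>Im s\<bar> < \<delta> / 4")
      case True
      define R where "R = e / ln y"
      have R: "0 < R" "2 * R \<le> \<epsilon> / ln y" "2 * R \<le> c / ln y"
        using e l by (auto simp: R_def field_simps)
      have R\<delta>: "R \<le> \<delta> / 8" using R \<rho>[OF y] by linarith
      have ns: "norm (s - 1) \<le> 3/8 * \<delta>" using cmod_le[of "s - 1"] s True by simp
      have wB: "w \<in> ball 1 \<delta>" "Re w > 1 - c / ln y" "w - 1 \<notin> \<real>\<^sub>\<le>\<^sub>0" "R \<le> norm (w - 1)" "norm (w - 1) \<le> 1" if "w \<in> ball s R" for w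
      proof -
        have d: "norm (w - s) < R" using that by (simp add: dist_norm norm_minus_commute)
        have n1: "norm (w - 1) \<le> norm (w - s) + norm (s - 1)" using norm_triangle_ineq[of "w - s" "s - 1"] by simp
        have n2: "norm (s - 1) \<le> norm (w - 1) + norm (w - s)" 
          using norm_triangle_ineq[of "w - 1" "s - w"] by (simp add: norm_minus_commute)
        have "norm (w - 1) < \<delta>" using n1 d ns R\<delta> K by linarith
        thus "w \<in> ball 1 \<delta>" "norm (w - 1) \<le> 1" using K by (auto simp: dist_norm norm_minus_commute)
        have "\<bar>Re w - Re s\<bar> \<le> norm (w - s)" using abs_Re_le_cmod[of "w - s"] by simp
        thus "Re w > 1 - c / ln y" using d R s by linarith
        show "R \<le> norm (w - 1)" using n2 d R s by linarith
        show "w - 1 \<notin> \<real>\<^sub>\<le>\<^sub>0"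
        proof
          assume "w - 1 \<in> \<real>\<^sub>\<le>\<^sub>0"
          hence im: "Im w = 0" "Re w \<le> 1" by (auto simp: complex_nonpos_Reals_iff)
          have "(norm (s - 1))\<^sup>2 \<le> (norm (s - w))\<^sup>2" unfolding cmod_power2 using im s
            by (auto intro!: power_mono)
          hence "norm (s - 1) \<le> norm (s - w)" by (rule power2_le_imp_le) auto
          thus False using d R s by (simp add: norm_minus_commute)
        qed
      qed
      define D where "D w = (w - 1) powr (- z) * near_factor \<nu> y z w" for w
      have Dh: "D holomorphic_on ball s R" unfolding D_def
        using wB(3) by (intro holomorphic_intros holomorphic_on_subset[OF hol[OF z y]]) (auto intro: wB(1,2))
      have Db: "norm (D w) \<le> exp (2 * pi) * (1 / R) ^ 2 * (K * ln y ^ 3)" if w: "w \<in> ball s R" for w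
      proof -
        have rez: "\<bar>Re z\<bar> \<le> 2" "\<bar>Im z\<bar> \<le> 2" using z r abs_Re_le_cmod[of z] abs_Im_le_cmod[of z] by linarith+
        have w0: "0 < norm (w - 1)" using wB(4)[OF w] R by linarith
        have "norm ((w - 1) powr (- z)) \<le> exp (2 * pi) * norm (w - 1) powr (Re (- z))"
          using w0 rez by (intro norm_powr_le) auto
        also have "norm (w - 1) powr (Re (- z)) \<le> norm (w - 1) powr (- 2)"
          using w0 wB(5)[OF w] rez by (intro powr_mono') auto
        also have "\<dots> \<le> R powr (- 2)" using wB(4)[OF w] R by (intro powr_mono2') auto
        also have "R powr (- 2) = (1 / R) ^ 2" using R by (simp add: powr_minus_divide powr_numeral power_divide)
        finally have "norm ((w - 1) powr (- z)) \<le> exp (2 * pi) * (1 / R) ^ 2" by simp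
        thus ?thesis unfolding D_def norm_mult using bnd[OF z y wB(1,2)[OF w]] by (intro mult_mono) auto
      qed
      have "(deriv ^^ k) (rough_series \<nu> y z) s = (deriv ^^ k) D s"
        by (rule higher_deriv_eq_on_halfplane[OF Fh Dh R(1) s(1)]) (use eq[OF z] wB(1) in \<open>auto simp: D_def\<close>)
      also have "norm \<dots> \<le> fact k * (exp (2 * pi) * (1 / R) ^ 2 * (K * ln y ^ 3)) / R ^ k"
        by (rule Cauchy_inequality_ball[OF Dh R(1) Db])
      also have "\<dots> = K1 * ln y ^ (k + 5) * 1"
        using l e by (simp add: K1_def R_def power_divide power_add field_simps eval_nat_numeral)
      also have "\<dots> \<le> (K1 + K2) * ln y ^ (k + 5) * L ^ (18 + 9 * k)"
        using K12 l L by (intro mult_mono mult_right_mono) auto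
      finally show ?thesis by (simp add: L_def)
    next
      case False
      define R where "R = b / (ln y * L ^ 9)"
      have L9: "L ^ 9 \<ge> 1" using L by simp
      have R0: "0 < R" using b l L by (simp add: R_def)
      have Ra: "R \<le> a / L ^ 9"
      proof -
        have "R = (b / ln y) / L ^ 9" by (simp add: R_def)
        also have "b / ln y \<le> b / (1/3)" using l b by (intro divide_left_mono) auto
        also have "\<dots> \<le> a" using b by simp
        finally show ?thesis using L by (simp add: divide_right_mono)
      qed
      have Rc: "R \<le> c / ln y"
      proof -
        have "R = (b / L ^ 9) / ln y" by (simp add: R_def)
        also have "b / L ^ 9 \<le> b / 1" using L9 b L by (intro divide_left_mono) auto
        also have "\<dots> \<le> c" using b by simp
        finally show ?thesis using l by (simp add: divide_right_mono)
      qed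
      obtain g where gh: "g holomorphic_on ball s R"
        and g: "\<And>w. w \<in> ball s R \<Longrightarrow> Re w > 1 \<Longrightarrow> g w = log_zeta w" "\<And>w. w \<in> ball s R \<Longrightarrow> norm (g w) \<le> A + 9 * ln L"
        using ext[of s R] s K False R0 Ra unfolding L_def by auto
      have Rew: "Re w > 1 - c / ln y" if "w \<in> ball s R" for w
        using abs_Re_le_cmod[of "w - s"] that s Rc by (auto simp: dist_norm norm_minus_commute)
      define D where "D w = exp (z * g w) * correction \<nu> y z w" for w
      have Dh: "D holomorphic_on ball s R" unfolding D_def
        by (intro holomorphic_intros gh holomorphic_on_subset[OF ch[OF z y]]) (auto intro: Rew)
      have Db: "norm (D w) \<le> exp (2 * \<bar>A\<bar>) * L ^ 18 * (K * ln y ^ 3)" if w: "w \<in> ball s R" for w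
        unfolding D_def norm_mult
        by (intro mult_mono norm_exp_log_height g(2)[OF w] L cb[OF z y Rew[OF w]]) (use z r in auto)
      have "(deriv ^^ k) (rough_series \<nu> y z) s = (deriv ^^ k) D s"
        by (rule higher_deriv_eq_on_halfplane[OF Fh Dh R0 s(1)]) (use rough_series_eq[OF r z] g(1) in \<open>auto simp: D_def\<close>)
      also have "norm \<dots> \<le> fact k * (exp (2 * \<bar>A\<bar>) * L ^ 18 * (K * ln y ^ 3)) / R ^ k"
        by (rule Cauchy_inequality_ball[OF Dh R0 Db])
      also have "\<dots> = (fact k * exp (2 * \<bar>A\<bar>) * K / b ^ k) * (ln y ^ (k + 3) * 1) * L ^ (18 + 9 * k)"
        using l b L by (simp add: R_def power_divide power_mult_distrib power_add power_mult[symmetric] field_simps)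
      \<comment> \<open>Raises the exponent from \<open>k + 3\<close> to \<open>k + 5\<close> to
        match the other case; the 9 is again due to \<open>ln y \<ge> 1/3\<close>.\<close>
      also have "\<dots> \<le> (fact k * exp (2 * \<bar>A\<bar>) * K / b ^ k) * (ln y ^ (k + 3) * (9 * ln y ^ 2)) * L ^ (18 + 9 * k)"
      proof (intro mult_right_mono mult_left_mono)
        have "(1/3) ^ 2 \<le> ln y ^ 2" using l by (intro power_mono) auto
        thus "1 \<le> 9 * ln y ^ 2" by (simp add: power2_eq_square)
      qed (use K b l L in auto)
      also have "\<dots> = K2 * ln y ^ (k + 5) * L ^ (18 + 9 * k)"
        by (simp add: K2_def power_add eval_nat_numeral)
      also have "\<dots> \<le> (K1 + K2) * ln y ^ (k + 5) * L ^ (18 + 9 * k)"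
        using K12 l L by (intro mult_right_mono) auto
      finally show ?thesis by (simp add: L_def)
    qed
  qed
  show ?thesis
    by (rule exI[of _ "K1 + K2"], rule exI[of _ "\<delta> / 8"]) (use main K12 K in auto)
qed

section \<open>Rankin's method and the logarithmically weighted coefficients\<close>

lemma power_le_fact_exp: "0 \<le> x \<Longrightarrow> x ^ k \<le> fact k * exp (x::real)"
proof -
  assume x: "0 \<le> x"
  have "(\<lambda>n. x ^ n / fact n) sums exp x" using exp_converges[of x] by (simp add: field_simps)
  moreover have "(\<Sum>n\<in>{k}. x ^ n / fact n) \<le> (\<Sum>n. x ^ n / fact n)"
    using x calculation by (intro sum_le_suminf) (auto simp: sums_iff)
  ultimately show ?thesis by (simp add: sums_iff field_simps)
qed

lemma ln_power_le:
  assumes "\<eta> > 0" "n > 0"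
  shows "ln (real n) ^ k \<le> fact k / \<eta> ^ k * real n powr \<eta>"
proof -
  have "(\<eta> * ln (real n)) ^ k \<le> fact k * exp (\<eta> * ln (real n))"
    using assms by (intro power_le_fact_exp) auto
  thus ?thesis using assms by (simp add: power_mult_distrib powr_def field_simps)
qed

text \<open>Half of the surplus \<open>1 / X\<close> in the exponent absorbs
  \<open>(ln n) ^ k\<close> at the price of \<open>fact k * (2 * X) ^ k\<close>. The series left at
  \<open>\<sigma> = 1 + 1 / (2 * X)\<close> is \<open>\<zeta>(\<sigma>) powr r\<close> times a
  bounded correction, hence \<open>O(X powr r)\<close>; this is the factorization at the real point
  \<open>z = r\<close> with \<open>y = 1\<close>, for which the sum over primes
  \<open>p \<le> y\<close> is empty.\<close>

lemma rankin_bound: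
  assumes r: "1 \<le> r" "r < 2"
  shows "\<exists>K>0. \<forall>X\<ge>1. summable (\<lambda>n. r ^ size (prime_factorization n) * ln (real n) ^ k * real n powr (- (1 + 1 / X))) \<and>
     (\<Sum>n. r ^ size (prime_factorization n) * ln (real n) ^ k * real n powr (- (1 + 1 / X))) \<le> K * X powr (r + real k)"
proof -
  obtain D where D: "D > 0" "\<And>\<sigma>. 1 < \<sigma> \<Longrightarrow> \<sigma> \<le> 2 \<Longrightarrow> log_zeta_real \<sigma> \<le> ln (D / (\<sigma> - 1))"
    using log_zeta_real_le by metis
  obtain C \<eta> where C: "0 \<le> C" and \<eta>: "0 < \<eta>" "\<eta> \<le> 1/4"
    and facts: "\<forall>\<nu> y z. norm z \<le> r \<longrightarrow>
     correction \<nu> y z holomorphic_on {s. Re s > 1 - \<eta>} \<and>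
     (\<forall>s. Re s > 1 - \<eta> \<longrightarrow>
        convergent_prod (\<lambda>p. corr_factor \<nu> y z p s) \<and>
        norm (correction \<nu> y z s) \<le> exp (r * (\<Sum>p | prime p \<and> real p \<le> y. real p powr (- Re s)) + C))"
    using correction_facts[OF r] by (elim exE conjE) (rule that; assumption)
  let ?z = "of_real r :: complex"
  have cb: "norm (correction Big_Omega 1 ?z s) \<le> exp C" if "Re s > 1 - \<eta>" for s
  proof -
    have "norm (correction Big_Omega 1 ?z s) \<le> exp (r * (\<Sum>p | prime p \<and> real p \<le> 1. real p powr (- Re s)) + C)"
    proof -
      have "norm ?z \<le> r" using r by simp
      thus ?thesis using facts that by blast
    qed
    also have "{p. prime p \<and> real p \<le> 1} = {}"
    proof -
      have "\<not> real p \<le> 1" if "prime p" for p using prime_gt_1_nat[OF that] by simp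
      thus ?thesis by blast
    qed
    finally show ?thesis by simp
  qed
  have rc: "rough_coeff Big_Omega 1 ?z n = of_real (r ^ size (prime_factorization n))" if "n > 0" for n
    using that by (auto simp: rough_coeff_def P_minus_gt_iff in_prime_factors_iff prime_gt_Suc_0_nat)
  have base: "(\<Sum>n. r ^ size (prime_factorization n) * real n powr (- \<sigma>)) \<le> exp C * (D / (\<sigma> - 1)) powr r"
    if \<sigma>: "1 < \<sigma>" "\<sigma> \<le> 2" for \<sigma>
  proof -
    have sm: "summable (\<lambda>n. r ^ size (prime_factorization n) * real n powr (- \<sigma>))"
      by (rule summable_omega_powr[OF r \<sigma>(1)])
    have "rough_coeff Big_Omega 1 ?z n * of_nat n powr (- of_real \<sigma>) = of_real (r ^ size (prime_factorization n) * real n powr (- \<sigma>))" for n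
    proof (cases "n = 0")
      case False
      have "of_nat n powr (- of_real \<sigma> :: complex) = of_real (real n powr (- \<sigma>))"
        using powr_of_real[of "real n" "- \<sigma>"] by simp
      thus ?thesis using False rc[of n] by simp
    qed simp
    hence "rough_series Big_Omega 1 ?z (of_real \<sigma>) = of_real (\<Sum>n. r ^ size (prime_factorization n) * real n powr (- \<sigma>))"
      unfolding rough_series_def by (simp only: suminf_of_real[OF sm])
    moreover have "0 \<le> (\<Sum>n. r ^ size (prime_factorization n) * real n powr (- \<sigma>))"
      using r by (intro suminf_nonneg sm) auto
    ultimately have "(\<Sum>n. r ^ size (prime_factorization n) * real n powr (- \<sigma>)) = norm (rough_series Big_Omega 1 ?z (of_real \<sigma>))"
      by simp
    also have "\<dots> = norm (exp (?z * log_zeta (of_real \<sigma>))) * norm (correction Big_Omega 1 ?z (of_real \<sigma>))"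
      using r \<sigma> by (subst rough_series_eq[OF r]) (auto simp: norm_mult)
    also have "\<dots> \<le> (D / (\<sigma> - 1)) powr r * exp C"
    proof (intro mult_mono cb)
      have "norm (exp (?z * log_zeta (of_real \<sigma>))) = exp (r * log_zeta_real \<sigma>)"
        using \<sigma> by (simp add: log_zeta_real_props(2))
      also have "\<dots> \<le> exp (r * ln (D / (\<sigma> - 1)))" using D(2)[OF \<sigma>] r by simp
      also have "\<dots> = (D / (\<sigma> - 1)) powr r" using D \<sigma> by (simp add: powr_def)
      finally show "norm (exp (?z * log_zeta (of_real \<sigma>))) \<le> (D / (\<sigma> - 1)) powr r" .
    qed (use \<sigma> \<eta> in auto)
    finally show ?thesis by (simp add: mult.commute)
  qed
  define K where "K = fact k * 2 ^ k * exp C * (2 * D) powr r"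
  have K: "K > 0" using D by (simp add: K_def)
  have "summable (\<lambda>n. r ^ size (prime_factorization n) * ln (real n) ^ k * real n powr (- (1 + 1 / X))) \<and>
     (\<Sum>n. r ^ size (prime_factorization n) * ln (real n) ^ k * real n powr (- (1 + 1 / X))) \<le> K * X powr (r + real k)"
    if X: "X \<ge> 1" for X
  proof -
    let ?\<sigma> = "1 + 1 / (2 * X)"
    have \<sigma>: "1 < ?\<sigma>" "?\<sigma> \<le> 2" using X by auto
    let ?t = "\<lambda>n. r ^ size (prime_factorization n) * ln (real n) ^ k * real n powr (- (1 + 1 / X))"
    let ?u = "\<lambda>n. fact k * (2 * X) ^ k * (r ^ size (prime_factorization n) * real n powr (- ?\<sigma>))"
    have le: "0 \<le> ?t n" "?t n \<le> ?u n" for n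
    proof -
      show "0 \<le> ?t n" using r by (cases "n = 0") auto
      show "?t n \<le> ?u n"
      proof (cases "n = 0")
        case False
        have "ln (real n) ^ k * real n powr (- (1 + 1 / X)) \<le> (fact k / (1 / (2 * X)) ^ k * real n powr (1 / (2 * X))) * real n powr (- (1 + 1 / X))"
          using False X by (intro mult_right_mono ln_power_le) auto
        also have "\<dots> = fact k * (2 * X) ^ k * (real n powr (1 / (2 * X)) * real n powr (- (1 + 1 / X)))"
          using X by (simp add: power_divide)
        also have "real n powr (1 / (2 * X)) * real n powr (- (1 + 1 / X)) = real n powr (- ?\<sigma>)"
        proof -
          have "1 / (2 * X) + - (1 + 1 / X) = - ?\<sigma>" using X by (simp add: field_simps)
          thus ?thesis by (simp only: powr_add[symmetric])
        qed
        finally have "r ^ size (prime_factorization n) * (ln (real n) ^ k * real n powr (- (1 + 1 / X))) \<le>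
           r ^ size (prime_factorization n) * (fact k * (2 * X) ^ k * real n powr (- ?\<sigma>))"
          using r by (intro mult_left_mono) auto
        thus ?thesis by (simp add: mult_ac)
      qed auto
    qed
    have su: "summable ?u" by (intro summable_mult summable_omega_powr[OF r \<sigma>(1)])
    have st: "summable ?t" by (rule summable_comparison_test[OF _ su]) (use le in auto)
    have "suminf ?t \<le> suminf ?u" by (rule suminf_le[OF le(2) st su])
    also have "\<dots> = fact k * (2 * X) ^ k * (\<Sum>n. r ^ size (prime_factorization n) * real n powr (- ?\<sigma>))"
      by (rule suminf_mult[OF summable_omega_powr[OF r \<sigma>(1)]])
    also have "\<dots> \<le> fact k * (2 * X) ^ k * (exp C * (D / (?\<sigma> - 1)) powr r)"
      using X by (intro mult_left_mono base \<sigma>) auto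
    also have "D / (?\<sigma> - 1) = (2 * D) * X" using X by (simp add: field_simps)
    also have "fact k * (2 * X) ^ k * (exp C * ((2 * D) * X) powr r) = K * X powr (r + real k)"
      using X D by (simp add: K_def powr_mult powr_add powr_realpow power_mult_distrib mult_ac)
    finally show ?thesis using st by simp
  qed
  thus ?thesis using K by blast
qed

lemma higher_deriv_nat_powr:
  fixes c s :: complex
  assumes "n > 0"
  shows "(deriv ^^ k) (\<lambda>s. c * of_nat n powr (- s)) s = (-1) ^ k * (c * of_real (ln (real n) ^ k) * of_nat n powr (- s))"
proof (induction k arbitrary: s)
  case (Suc k)
  have e: "of_nat n powr (- s) = exp (- s * of_real (ln (real n)))" for s :: complex
    using assms by (simp add: powr_def Ln_of_nat)
  have "deriv ((deriv ^^ k) (\<lambda>s. c * of_nat n powr (- s))) s = deriv (\<lambda>s. (-1) ^ k * (c * of_real (ln (real n) ^ k) * of_nat n powr (- s))) s"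
    by (rule arg_cong[where f = "\<lambda>f. deriv f s"]) (use Suc in auto)
  also have "\<dots> = (-1) ^ Suc k * (c * of_real (ln (real n) ^ Suc k) * of_nat n powr (- s))"
    unfolding e by (intro DERIV_imp_deriv) (auto intro!: derivative_eq_intros simp: mult_ac)
  finally show ?case by simp
qed simp

text \<open>Termwise differentiation, justified by uniform convergence on a disc of radius
  \<open>(Re s - 1) / 2\<close>. The weight \<open>(ln n) ^ k\<close> is thus the same thing as a
  \<open>k\<close>-th derivative.\<close>

lemma weighted_rough_series:
  assumes r: "1 \<le> r" "r < 2" and z: "norm z \<le> r" and s: "Re s > 1"
  shows "(\<lambda>n. rough_coeff \<nu> y z n * of_real (ln (real n) ^ k) * of_nat n powr (- s)) sums ((-1) ^ k * (deriv ^^ k) (rough_series \<nu> y z) s)"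
proof -
  define d where "d = (Re s - 1) / 2"
  have d: "d > 0" using s by (simp add: d_def)
  let ?f = "\<lambda>n s. rough_coeff \<nu> y z n * of_nat n powr (- s)"
  have "uniform_limit (ball s d) (\<lambda>N s. \<Sum>n<N. ?f n s) (\<lambda>s. \<Sum>n. ?f n s) sequentially"
  proof (rule Weierstrass_m_test)
    show "summable (\<lambda>n. r ^ size (prime_factorization n) * real n powr (- (1 + d)))"
      by (rule summable_omega_powr[OF r]) (use d in auto)
    fix n w assume w: "w \<in> ball s d"
    have Rew: "Re w \<ge> 1 + d" using abs_Re_le_cmod[of "s - w"] w by (simp add: dist_norm d_def field_simps)
    show "norm (?f n w) \<le> r ^ size (prime_factorization n) * real n powr (- (1 + d))"
    proof (cases "n = 0")
      case False
      thus ?thesis unfolding norm_mult norm_of_nat_powr using Rew r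
        by (intro mult_mono norm_rough_coeff_le[OF z] powr_mono) auto
    qed auto
  qed
  hence "((\<lambda>N. (deriv ^^ k) (\<lambda>s. \<Sum>n<N. ?f n s) s) \<longlongrightarrow> (deriv ^^ k) (\<lambda>s. \<Sum>n. ?f n s) s) sequentially"
  proof (rule higher_deriv_complex_uniform_limit)
    have "?f n holomorphic_on ball s d" for n
      by (cases "n = 0") (auto intro!: holomorphic_intros)
    thus "\<forall>\<^sub>F N in sequentially. (\<lambda>s. \<Sum>n<N. ?f n s) holomorphic_on ball s d"
      by (intro always_eventually allI holomorphic_on_sum)
  qed (use d in auto)
  moreover have "(deriv ^^ k) (\<lambda>s. \<Sum>n<N. ?f n s) s = (-1) ^ k * (\<Sum>n<N. rough_coeff \<nu> y z n * of_real (ln (real n) ^ k) * of_nat n powr (- s))" for N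
  proof -
    have "(deriv ^^ k) (\<lambda>s. \<Sum>n<N. ?f n s) s = (\<Sum>n<N. (deriv ^^ k) (?f n) s)"
    proof (rule higher_deriv_sum[of UNIV])
      show "?f n holomorphic_on UNIV" for n by (cases "n = 0") (auto intro!: holomorphic_intros)
    qed auto
    also have "\<dots> = (\<Sum>n<N. (-1) ^ k * (rough_coeff \<nu> y z n * of_real (ln (real n) ^ k) * of_nat n powr (- s)))"
    proof (intro sum.cong refl)
      fix n
      show "(deriv ^^ k) (?f n) s = (-1) ^ k * (rough_coeff \<nu> y z n * of_real (ln (real n) ^ k) * of_nat n powr (- s))"
      proof (cases "n = 0")
        case True
        thus ?thesis by (cases k) (simp_all add: higher_deriv_const del: funpow.simps)
      next
        case False
        thus ?thesis using higher_deriv_nat_powr[of n k "rough_coeff \<nu> y z n" s] by blast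
      qed
    qed
    finally show ?thesis by (simp add: sum_distrib_left)
  qed
  ultimately have "(\<lambda>N. (-1) ^ k * (\<Sum>n<N. rough_coeff \<nu> y z n * of_real (ln (real n) ^ k) * of_nat n powr (- s)))
      \<longlonglongrightarrow> (deriv ^^ k) (rough_series \<nu> y z) s" unfolding rough_series_def[abs_def] by simp
  from tendsto_mult[OF tendsto_const[of "(-1) ^ k"] this]
  have "(\<lambda>N. (-1) ^ k * ((-1) ^ k * (\<Sum>n<N. rough_coeff \<nu> y z n * of_real (ln (real n) ^ k) * of_nat n powr (- s))))
      \<longlonglongrightarrow> (-1) ^ k * (deriv ^^ k) (rough_series \<nu> y z) s" .
  thus ?thesis unfolding sums_def by (simp add: mult.assoc[symmetric] flip: power_add)
qed

text \<open>\<open>(-1) ^ k\<close> times the \<open>k\<close>-th derivative of the first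
  \<open>m\<close> terms of the expansion at 1, the quantity to which the transform of the weighted
  coefficients is compared. It is used on the whole line, not only near 1.\<close>

definition model_transform :: "prime_counter \<Rightarrow> real \<Rightarrow> complex \<Rightarrow> nat \<Rightarrow> nat \<Rightarrow> complex \<Rightarrow> complex" where
  "model_transform \<nu> y z k m s =
     (\<Sum>j<m. sd_coeff \<nu> y z j * pochhammer (z - of_nat j) k * (s - 1) powr (of_nat j - z - of_nat k))"

text \<open>With \<open>norm (s - 1) > \<epsilon> / ln y\<close>, the \<open>j\<close>-th term is of
  order \<open>(ln y) ^ (3 + j)\<close> times \<open>ln y powr (k + Re z - j)\<close>, so the
  dependence on \<open>j\<close> cancels and \<open>Re z \<le> 2\<close> gives the exponent
  \<open>k + 5\<close>. The condition on \<open>m\<close> and \<open>k\<close> keeps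
  \<open>k + Re z - j\<close> non-negative. The constant 81 bounds
  \<open>ln y powr (Re z - 2)\<close>, as \<open>ln y \<ge> 1/3\<close> and
  \<open>Re z \<ge> - 2\<close>.\<close>

lemma model_transform_far:
  assumes r: "1 \<le> r" "r < 2" and \<epsilon>: "0 < \<epsilon>" and km: "m + 3 \<le> k"
  shows "\<exists>K>0. \<forall>\<nu> y z s. norm z \<le> r \<longrightarrow> 3/2 \<le> y \<longrightarrow> 1 < Re s \<longrightarrow> norm (s - 1) > \<epsilon> / ln y \<longrightarrow>
     norm (model_transform \<nu> y z k m s) \<le> K * ln y ^ (k + 5)"
proof -
  have "\<exists>K. \<forall>j. \<forall>\<nu> y z. norm z \<le> r \<longrightarrow> 3/2 \<le> y \<longrightarrow> norm (sd_coeff \<nu> y z j) \<le> K j * ln y ^ (3 + j)"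
    by (rule choice) (use sd_coeff_bound[OF r] in blast)
  then obtain K where K: "\<And>j \<nu> y z. norm z \<le> r \<Longrightarrow> 3/2 \<le> y \<Longrightarrow> norm (sd_coeff \<nu> y z j) \<le> K j * ln y ^ (3 + j)"
    by blast
  define E where "E = max 1 (1 / \<epsilon>) ^ (k + 2)"
  define P where "P = (r + real m + real k) ^ k"
  define C where "C = (\<Sum>j<m. \<bar>K j\<bar> * P * (exp (2 * pi) * E * 81)) + 1"
  have pos: "P \<ge> 0" "E \<ge> 0" using r by (auto simp: P_def E_def)
  have C: "C > 0" unfolding C_def using pos by (intro add_nonneg_pos sum_nonneg) auto
  have main: "norm (model_transform \<nu> y z k m s) \<le> C * ln y ^ (k + 5)"
    if z: "norm z \<le> r" and y: "3/2 \<le> y" and s: "1 < Re s" "norm (s - 1) > \<epsilon> / ln y" for \<nu> y z s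
  proof -
    have l: "1/3 \<le> ln y" by (rule ln_ge_third[OF y])
    have rez: "\<bar>Re z\<bar> \<le> 2" "\<bar>Im z\<bar> \<le> 2" using z r abs_Re_le_cmod[of z] abs_Im_le_cmod[of z] by linarith+
    have tb: "norm (sd_coeff \<nu> y z j * pochhammer (z - of_nat j) k * (s - 1) powr (of_nat j - z - of_nat k))
        \<le> \<bar>K j\<bar> * P * (exp (2 * pi) * E * 81) * ln y ^ (k + 5)" if j: "j < m" for j
    proof -
      have "norm (sd_coeff \<nu> y z j) \<le> K j * ln y ^ (3 + j)" by (rule K[OF z y])
      also have "\<dots> \<le> \<bar>K j\<bar> * ln y ^ (3 + j)" using l by (intro mult_right_mono) auto
      finally have a: "norm (sd_coeff \<nu> y z j) \<le> \<bar>K j\<bar> * ln y ^ (3 + j)" .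
      have "norm (pochhammer (z - of_nat j) k) \<le> (norm (z - of_nat j) + real k) ^ k" by (rule norm_pochhammer_le)
      also have "\<dots> \<le> P" unfolding P_def
      proof (intro power_mono add_mono order_refl)
        have "norm (z - of_nat j) \<le> norm z + norm (of_nat j :: complex)" by (rule norm_triangle_ineq4)
        thus "norm (z - of_nat j) \<le> r + real m" using z j by simp
      qed auto
      finally have b: "norm (pochhammer (z - of_nat j) k) \<le> P" .
      define e where "e = real k + Re z - real j"
      have e: "0 \<le> e" "e \<le> real (k + 2)" using rez j km by (auto simp: e_def)
      have "s - 1 \<noteq> 0" using s by auto
      hence "norm ((s - 1) powr (of_nat j - z - of_nat k)) \<le> exp (2 * pi) * norm (s - 1) powr (Re (of_nat j - z - of_nat k))"
        using rez by (intro norm_powr_le) auto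
      also have "Re (of_nat j - z - of_nat k) = - e" by (simp add: e_def)
      also have "norm (s - 1) powr (- e) \<le> (\<epsilon> / ln y) powr (- e)"
        using s e l \<epsilon> by (intro powr_mono2') auto
      also have "\<dots> = (1 / \<epsilon> * ln y) powr e" using l \<epsilon> by (simp add: powr_minus powr_divide powr_mult field_simps)
      also have "\<dots> = (1 / \<epsilon>) powr e * ln y powr e" using l \<epsilon> by (intro powr_mult)
      also have "(1 / \<epsilon>) powr e \<le> E"
      proof -
        have "(1 / \<epsilon>) powr e \<le> max 1 (1 / \<epsilon>) powr e" using e \<epsilon> by (intro powr_mono2) auto
        also have "\<dots> \<le> max 1 (1 / \<epsilon>) powr real (k + 2)" using e by (intro powr_mono) auto
        also have "\<dots> = E" unfolding E_def by (rule powr_realpow) auto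
        finally show ?thesis .
      qed
      finally have c: "norm ((s - 1) powr (of_nat j - z - of_nat k)) \<le> exp (2 * pi) * (E * ln y powr e)"
        using l by (simp add: mult_right_mono)
      have "norm (sd_coeff \<nu> y z j * pochhammer (z - of_nat j) k * (s - 1) powr (of_nat j - z - of_nat k))
        \<le> (\<bar>K j\<bar> * ln y ^ (3 + j)) * P * (exp (2 * pi) * (E * ln y powr e))"
        unfolding norm_mult using a b c pos l by (intro mult_mono) auto
      also have "\<dots> = \<bar>K j\<bar> * P * (exp (2 * pi) * E) * (ln y ^ (3 + j) * ln y powr e)" by simp
      also have "ln y ^ (3 + j) * ln y powr e = ln y powr (real (k + 5) + (Re z - 2))"
      proof -
        have "ln y ^ (3 + j) = ln y powr real (3 + j)" using l by (intro powr_realpow[symmetric]) auto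
        moreover have "real (3 + j) + e = real (k + 5) + (Re z - 2)" by (simp add: e_def)
        ultimately show ?thesis by (simp only: powr_add[symmetric])
      qed
      also have "\<dots> = ln y ^ (k + 5) * ln y powr (Re z - 2)" using l powr_realpow[of "ln y" "k + 5"] by (simp only: powr_add)
      also have "\<bar>K j\<bar> * P * (exp (2 * pi) * E) * (ln y ^ (k + 5) * ln y powr (Re z - 2))
          \<le> \<bar>K j\<bar> * P * (exp (2 * pi) * E) * (ln y ^ (k + 5) * 81)"
      proof (intro mult_left_mono)
        have "ln y powr (Re z - 2) \<le> (1/3) powr (Re z - 2)" using l rez by (intro powr_mono2') auto
        also have "\<dots> \<le> (1/3) powr (- 4)" using rez by (intro powr_mono') auto
        also have "\<dots> = 81" by (simp add: powr_minus_divide powr_numeral power_divide)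
        finally show "ln y powr (Re z - 2) \<le> 81" .
      qed (use pos l in auto)
      finally show ?thesis by (simp add: mult_ac)
    qed
    have "norm (model_transform \<nu> y z k m s) \<le> (\<Sum>j<m. \<bar>K j\<bar> * P * (exp (2 * pi) * E * 81) * ln y ^ (k + 5))"
      unfolding model_transform_def by (rule sum_norm_le) (use tb in auto)
    also have "\<dots> = (\<Sum>j<m. \<bar>K j\<bar> * P * (exp (2 * pi) * E * 81)) * ln y ^ (k + 5)" by (rule sum_distrib_right[symmetric])
    also have "\<dots> \<le> C * ln y ^ (k + 5)" unfolding C_def using l by (intro mult_right_mono) auto
    finally show ?thesis .
  qed
  show ?thesis by (rule exI[of _ C]) (use main C in auto)
qed

text \<open>The first summand comes from the neighbourhood of 1, the second from the rest. Adding
  them removes the case distinction, so the bound can be integrated along the whole line.\<close>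

lemma transform_difference_bound:
  assumes r: "1 \<le> r" "r < 2" and km: "m + 3 \<le> k"
  shows "\<exists>K \<delta>0. 0 < K \<and> 0 < \<delta>0 \<and> \<delta>0 \<le> 1/2 \<and> (\<forall>\<nu> y z s. norm z \<le> r \<longrightarrow> 3/2 \<le> y \<longrightarrow> 1 < Re s \<longrightarrow> Re s \<le> 1 + \<delta>0 \<longrightarrow>
     norm ((-1) ^ k * (deriv ^^ k) (rough_series \<nu> y z) s - model_transform \<nu> y z k m s)
       \<le> K * (ln y ^ (3 + m) * norm (s - 1) powr (real m - Re z - real k) + ln y ^ (k + 5) * log_height s ^ (18 + 9 * k)))"
proof -
  obtain K1 \<epsilon> where K1: "0 < K1" "0 < \<epsilon>" and near: "\<forall>\<nu> y z s. norm z \<le> r \<longrightarrow> 3/2 \<le> y \<longrightarrow> 1 < Re s \<longrightarrow> norm (s - 1) \<le> \<epsilon> / ln y \<longrightarrow>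
     norm ((deriv ^^ k) (rough_series \<nu> y z) s -
       (-1) ^ k * (\<Sum>j<m. sd_coeff \<nu> y z j * pochhammer (z - of_nat j) k * (s - 1) powr (of_nat j - z - of_nat k)))
       \<le> K1 * ln y ^ (3 + m) * norm (s - 1) powr (real m - Re z - real k)"
    using rough_series_deriv_near[OF r, of k m] by (elim exE conjE) (rule that; assumption)
  obtain K2 where K2: "0 < K2" and mf: "\<forall>\<nu> y z s. norm z \<le> r \<longrightarrow> 3/2 \<le> y \<longrightarrow> 1 < Re s \<longrightarrow> norm (s - 1) > \<epsilon> / ln y \<longrightarrow>
     norm (model_transform \<nu> y z k m s) \<le> K2 * ln y ^ (k + 5)"
    using model_transform_far[OF r K1(2) km] by (elim exE conjE) (rule that; assumption)
  obtain K3 \<delta>0 where K3: "0 < K3" "0 < \<delta>0" "\<delta>0 \<le> 1/2" and far: "\<forall>\<nu> y z s. norm z \<le> r \<longrightarrow> 3/2 \<le> y \<longrightarrow> 1 < Re s \<longrightarrow> Re s \<le> 1 + \<delta>0 \<longrightarrow> norm (s - 1) > \<epsilon> / ln y \<longrightarrow>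
     norm ((deriv ^^ k) (rough_series \<nu> y z) s) \<le> K3 * ln y ^ (k + 5) * log_height s ^ (18 + 9 * k)"
    using rough_series_deriv_far[OF r K1(2), of k] by (elim exE conjE) (rule that; assumption)
  have main: "norm ((-1) ^ k * (deriv ^^ k) (rough_series \<nu> y z) s - model_transform \<nu> y z k m s)
       \<le> (K1 + K2 + K3) * (ln y ^ (3 + m) * norm (s - 1) powr (real m - Re z - real k) + ln y ^ (k + 5) * log_height s ^ (18 + 9 * k))"
    if z: "norm z \<le> r" and y: "3/2 \<le> y" and s: "1 < Re s" "Re s \<le> 1 + \<delta>0" for \<nu> y z s
  proof -
    define A where "A = ln y ^ (3 + m) * norm (s - 1) powr (real m - Re z - real k)"
    define B where "B = ln y ^ (k + 5) * log_height s ^ (18 + 9 * k)"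
    have l: "1/3 \<le> ln y" by (rule ln_ge_third[OF y])
    have L: "1 \<le> log_height s ^ (18 + 9 * k)" using log_height_ge_1[of s] by simp
    have AB: "0 \<le> A" "0 \<le> B" using l log_height_ge_1[of s] by (auto simp: A_def B_def)
    show ?thesis
    proof (cases "norm (s - 1) \<le> \<epsilon> / ln y")
      case True
      let ?F = "(deriv ^^ k) (rough_series \<nu> y z) s"
      have "(-1) ^ k * ?F - model_transform \<nu> y z k m s = (-1) ^ k * (?F - (-1) ^ k * model_transform \<nu> y z k m s)"
        by (simp add: right_diff_distrib mult.assoc[symmetric] flip: power_add)
      hence "norm ((-1) ^ k * ?F - model_transform \<nu> y z k m s) = norm (?F - (-1) ^ k * model_transform \<nu> y z k m s)"
        by (simp add: norm_mult norm_power)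
      also have "\<dots> \<le> K1 * ln y ^ (3 + m) * norm (s - 1) powr (real m - Re z - real k)"
        using near z y s True unfolding model_transform_def by blast
      also have "\<dots> = K1 * A" by (simp add: A_def)
      also have "\<dots> \<le> (K1 + K2 + K3) * (A + B)" using AB K1 K2 K3 by (intro mult_mono) auto
      finally show ?thesis by (simp add: A_def B_def)
    next
      case False
      hence fs: "norm (s - 1) > \<epsilon> / ln y" by simp
      have "norm ((-1) ^ k * (deriv ^^ k) (rough_series \<nu> y z) s - model_transform \<nu> y z k m s)
         \<le> norm ((deriv ^^ k) (rough_series \<nu> y z) s) + norm (model_transform \<nu> y z k m s)"
        using norm_triangle_ineq4[of "(-1) ^ k * (deriv ^^ k) (rough_series \<nu> y z) s" "model_transform \<nu> y z k m s"]
        by (simp add: norm_mult norm_power)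
      also have "\<dots> \<le> K3 * B + K2 * B"
      proof (rule add_mono)
        show "norm ((deriv ^^ k) (rough_series \<nu> y z) s) \<le> K3 * B"
          using far z y s fs unfolding B_def mult.assoc[symmetric] by blast
        have "norm (model_transform \<nu> y z k m s) \<le> K2 * (ln y ^ (k + 5) * 1)"
          using mf z y s fs by simp
        also have "\<dots> \<le> K2 * B" unfolding B_def using l L K2 by (intro mult_left_mono) auto
        finally show "norm (model_transform \<nu> y z k m s) \<le> K2 * B" .
      qed
      also have "\<dots> = (K3 + K2) * B" by (simp add: distrib_right)
      also have "\<dots> \<le> (K1 + K2 + K3) * (A + B)" using AB K1 K2 K3 by (intro mult_mono) auto
      finally show ?thesis by (simp add: A_def B_def)
    qed
  qed
  show ?thesis by (rule exI[of _ "K1 + K2 + K3"], rule exI[of _ \<delta>0]) (use main K1 K2 K3 in auto)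
qed

section \<open>A smoothed Perron formula\<close>

text \<open>The characteristic function of the standard normal law, after the substitution
  \<open>x = l * t\<close>.\<close>

lemma gauss_fourier:
  assumes "l > 0"
  shows "(LINT t|lborel. exp (\<i> * of_real (t * w)) * of_real (exp (- (l * t)\<^sup>2 / 2))) = of_real (2 * pi * normal_density 0 l w)"
    and "integrable lborel (\<lambda>t. exp (- (l * t)\<^sup>2 / 2) :: real)"
proof -
  have "char std_normal_distribution (w / l) = of_real (exp (- (w / l)\<^sup>2 / 2))"
    by (simp add: char_std_normal_distribution)
  also have "char std_normal_distribution (w / l) = (LINT x|lborel. std_normal_density x *\<^sub>R exp (\<i> * of_real (w / l * x)))"
    unfolding char_def by (subst integral_density) (auto simp: normal_density_nonneg)
  also have "\<dots> = \<bar>l\<bar> *\<^sub>R (LINT t|lborel. std_normal_density (0 + l * t) *\<^sub>R exp (\<i> * of_real (w / l * (0 + l * t))))"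
    using assms by (intro lborel_integral_real_affine) auto
  also have "(LINT t|lborel. std_normal_density (0 + l * t) *\<^sub>R exp (\<i> * of_real (w / l * (0 + l * t))))
     = (LINT t|lborel. of_real (1 / sqrt (2 * pi)) * (exp (\<i> * of_real (t * w)) * of_real (exp (- (l * t)\<^sup>2 / 2))))"
    using assms by (intro Bochner_Integration.integral_cong refl) (simp add: std_normal_density_def scaleR_conv_of_real mult_ac)
  also have "\<dots> = of_real (1 / sqrt (2 * pi)) * (LINT t|lborel. exp (\<i> * of_real (t * w)) * of_real (exp (- (l * t)\<^sup>2 / 2)))"
    by simp
  finally have "of_real (exp (- (w / l)\<^sup>2 / 2)) = of_real (l / sqrt (2 * pi)) * (LINT t|lborel. exp (\<i> * of_real (t * w)) * of_real (exp (- (l * t)\<^sup>2 / 2)))"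
    using assms by (simp add: scaleR_conv_of_real)
  hence "(LINT t|lborel. exp (\<i> * of_real (t * w)) * of_real (exp (- (l * t)\<^sup>2 / 2))) = of_real (sqrt (2 * pi) / l * exp (- (w / l)\<^sup>2 / 2))"
    using assms by (simp add: field_simps)
  also have "sqrt (2 * pi) / l * exp (- (w / l)\<^sup>2 / 2) = 2 * pi * normal_density 0 l w"
  proof -
    have "2 * pi / (sqrt (2 * pi) * l) = (2 * pi / sqrt (2 * pi)) / l" by simp
    also have "2 * pi / sqrt (2 * pi) = sqrt (2 * pi)" by (rule real_div_sqrt) simp
    finally have "2 * pi / (sqrt (2 * pi) * l) = sqrt (2 * pi) / l" .
    moreover have "sqrt (2 * pi * l\<^sup>2) = sqrt (2 * pi) * l" using assms by (simp add: real_sqrt_mult)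
    moreover have "- (w / l)\<^sup>2 / 2 = - (w - 0)\<^sup>2 / (2 * l\<^sup>2)" by (simp add: power_divide)
    moreover have "2 * pi * (1 / b * E) = 2 * pi / b * E" for b E :: real by simp
    ultimately show ?thesis unfolding normal_density_def by (simp only:)
  qed
  finally show "(LINT t|lborel. exp (\<i> * of_real (t * w)) * of_real (exp (- (l * t)\<^sup>2 / 2))) = of_real (2 * pi * normal_density 0 l w)" .
  have "integrable lborel (\<lambda>t. sqrt (2 * pi) / l * normal_density 0 (1 / l) t)"
    using assms by (intro integrable_mult_right integrable_normal_density) auto
  also have "(\<lambda>t. sqrt (2 * pi) / l * normal_density 0 (1 / l) t) = (\<lambda>t. exp (- (l * t)\<^sup>2 / 2))"
    using assms by (auto simp: fun_eq_iff normal_density_def real_sqrt_divide power_divide power_mult_distrib field_simps)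
  finally show "integrable lborel (\<lambda>t. exp (- (l * t)\<^sup>2 / 2) :: real)" .
qed

text \<open>Completing the square: tilting by \<open>exp (a * w)\<close> shifts the mean to
  \<open>a * l ^ 2\<close>.\<close>

lemma normal_exp_moment:
  assumes "l > 0"
  shows "has_bochner_integral lborel (\<lambda>w. exp (a * w) * normal_density 0 l w) (exp ((a * l)\<^sup>2 / 2))"
proof -
  have "exp (a * w) * normal_density 0 l w = exp ((a * l)\<^sup>2 / 2) * normal_density (a * l\<^sup>2) l w" for w
  proof -
    have "a * w + - (w\<^sup>2) / (2 * l\<^sup>2) = (a * l)\<^sup>2 / 2 + - ((w - a * l\<^sup>2)\<^sup>2) / (2 * l\<^sup>2)"
      using assms by (simp add: field_simps power2_eq_square)
    hence "exp (a * w) * exp (- (w\<^sup>2) / (2 * l\<^sup>2)) = exp ((a * l)\<^sup>2 / 2) * exp (- ((w - a * l\<^sup>2)\<^sup>2) / (2 * l\<^sup>2))"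
      by (simp only: exp_add[symmetric])
    thus ?thesis by (simp add: normal_density_def)
  qed
  moreover have "has_bochner_integral lborel (\<lambda>w. exp ((a * l)\<^sup>2 / 2) * normal_density (a * l\<^sup>2) l w) (exp ((a * l)\<^sup>2 / 2) * 1)"
    using assms integrable_normal_density integral_normal_density
    by (intro has_bochner_integral_mult_right) (auto simp: has_bochner_integral_iff)
  ultimately show ?thesis by simp
qed

text \<open>The function \<open>exp (c * w)\<close> on \<open>w < u\<close>, averaged over a Gaussian of width \<open>l\<close>. It approximates \<open>1\<close> for \<open>u > 0\<close>
  and \<open>0\<close> for \<open>u < 0\<close> when \<open>l\<close> is small.\<close>

definition smooth_cutoff :: "real \<Rightarrow> real \<Rightarrow> real \<Rightarrow> real" where
  "smooth_cutoff l c u = (LINT w|lborel. indicator {..<u} w * (exp (c * w) * normal_density 0 l w))"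

lemma integrable_smooth_cutoff:
  assumes "l > 0" "A \<in> sets borel"
  shows "integrable lborel (\<lambda>w. indicator A w * (exp (c * w) * normal_density 0 l w))"
  using integrable_mult_indicator[of A lborel "\<lambda>w. exp (c * w) * normal_density 0 l w"]
    normal_exp_moment[OF assms(1), of c] assms by (simp add: has_bochner_integral_iff)

text \<open>Exponential tilting: on the ray in question
  \<open>1 \<le> exp (\<theta> * (u - w))\<close>, with \<open>\<theta> = 1 / l\<close> for the ray
  below a negative \<open>u\<close> and \<open>\<theta> = - 1 / l\<close> for the ray above a
  non-negative \<open>u\<close>. The Gaussian moment that appears is \<open>O(1)\<close>. The full
  mass is \<open>exp ((c * l) ^ 2 / 2)\<close> and not 1, which explains the extra
  \<open>l ^ 2\<close> for \<open>u \<ge> 0\<close>.\<close>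

lemma smooth_cutoff_bound:
  assumes l: "0 < l" "l \<le> 1" and c: "1 \<le> c" "c \<le> 2"
  shows "\<bar>smooth_cutoff l c u - (if u \<ge> 0 then 1 else 0)\<bar> \<le> exp 5 * (exp (- \<bar>u\<bar> / l) + (if u \<ge> 0 then l\<^sup>2 else 0))"
proof -
  let ?g = "\<lambda>w. exp (c * w) * normal_density 0 l w"
  have gi: "integrable lborel (\<lambda>w. indicator A w * ?g w)" if "A \<in> sets borel" for A
    by (rule integrable_smooth_cutoff[OF l(1) that])
  have g0: "0 \<le> ?g w" for w by (simp add: normal_density_nonneg)
  have nn: "0 \<le> smooth_cutoff l c u"
    unfolding smooth_cutoff_def using g0 by (intro Bochner_Integration.integral_nonneg) (auto simp: indicator_def)
  have moment: "integrable lborel (\<lambda>w. exp (a * w) * normal_density 0 l w)" 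
    "(LINT w|lborel. exp (a * w) * normal_density 0 l w) = exp ((a * l)\<^sup>2 / 2)" for a
    using normal_exp_moment[OF l(1), of a] by (auto simp: has_bochner_integral_iff)
  have tilt: "(LINT w|lborel. indicator A w * ?g w) \<le> exp (\<theta> * u) * exp (((c - \<theta>) * l)\<^sup>2 / 2)"
    if A: "A \<in> sets borel" and le: "\<And>w. w \<in> A \<Longrightarrow> \<theta> * w \<le> \<theta> * u" for A \<theta>
  proof -
    have "(LINT w|lborel. indicator A w * ?g w) \<le> (LINT w|lborel. exp (\<theta> * u) * (exp ((c - \<theta>) * w) * normal_density 0 l w))"
    proof (rule integral_mono)
      show "integrable lborel (\<lambda>w. indicator A w * ?g w)" by (rule gi[OF A])
      show "integrable lborel (\<lambda>w. exp (\<theta> * u) * (exp ((c - \<theta>) * w) * normal_density 0 l w))"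
        by (intro integrable_mult_right moment)
      fix w
      show "indicator A w * ?g w \<le> exp (\<theta> * u) * (exp ((c - \<theta>) * w) * normal_density 0 l w)"
      proof (cases "w \<in> A")
        case True
        have "exp (c * w) = exp (\<theta> * w) * exp ((c - \<theta>) * w)" by (simp add: exp_add[symmetric] algebra_simps)
        also have "\<dots> \<le> exp (\<theta> * u) * exp ((c - \<theta>) * w)" using le[OF True] by (intro mult_right_mono) auto
        finally have "exp (c * w) * normal_density 0 l w \<le> exp (\<theta> * u) * exp ((c - \<theta>) * w) * normal_density 0 l w"
          by (intro mult_right_mono normal_density_nonneg)
        thus ?thesis using True by (simp add: mult.assoc)
      qed (simp add: normal_density_nonneg)
    qed
    thus ?thesis using moment by simp
  qed
  have e5: "exp (x / 2) \<le> exp 5" if "x \<le> 10" for x :: real using that by simp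
  show ?thesis
  proof (cases "u \<ge> 0")
    case False
    have "smooth_cutoff l c u \<le> exp ((1 / l) * u) * exp (((c - 1 / l) * l)\<^sup>2 / 2)"
      unfolding smooth_cutoff_def using l by (intro tilt) (auto intro: divide_right_mono)
    also have "((c - 1 / l) * l)\<^sup>2 = (c * l - 1)\<^sup>2" using l by (simp add: algebra_simps)
    also have "(c * l - 1)\<^sup>2 \<le> 10"
    proof -
      have "0 < c * l" "c * l \<le> 2 * 1" using l c mult_mono[of c 2 l 1] by auto
      hence "\<bar>c * l - 1\<bar> \<le> 1" by linarith
      hence "(c * l - 1)\<^sup>2 \<le> 1" by (simp add: abs_square_le_1)
      thus ?thesis by simp
    qed
    finally have "smooth_cutoff l c u \<le> exp ((1 / l) * u) * exp 5" by simp
    thus ?thesis using False nn by (simp add: mult.commute)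
  next
    case True
    have split: "smooth_cutoff l c u + (LINT w|lborel. indicator {u..} w * ?g w) = exp ((c * l)\<^sup>2 / 2)"
    proof -
      have "smooth_cutoff l c u + (LINT w|lborel. indicator {u..} w * ?g w) =
        (LINT w|lborel. indicator {..<u} w * ?g w + indicator {u..} w * ?g w)"
        unfolding smooth_cutoff_def by (intro Bochner_Integration.integral_add[symmetric] gi) auto
      also have "\<dots> = (LINT w|lborel. ?g w)"
        by (intro Bochner_Integration.integral_cong refl) (auto simp: indicator_def)
      finally show ?thesis using moment by simp
    qed
    have t0: "0 \<le> (LINT w|lborel. indicator {u..} w * ?g w)"
      using g0 by (intro Bochner_Integration.integral_nonneg) (auto simp: indicator_def)
    have "(LINT w|lborel. indicator {u..} w * ?g w) \<le> exp ((- 1 / l) * u) * exp (((c - (- 1 / l)) * l)\<^sup>2 / 2)"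
      using l by (intro tilt) (auto intro: divide_right_mono)
    also have "((c - (- 1 / l)) * l)\<^sup>2 = (c * l + 1)\<^sup>2" using l by (simp add: algebra_simps)
    also have "(c * l + 1)\<^sup>2 \<le> 10"
    proof -
      have "0 < c * l" "c * l \<le> 2 * 1" using l c mult_mono[of c 2 l 1] by auto
      hence "(c * l + 1)\<^sup>2 \<le> 3\<^sup>2" by (intro power_mono) auto
      thus ?thesis by simp
    qed
    finally have t1: "(LINT w|lborel. indicator {u..} w * ?g w) \<le> exp (- u / l) * exp 5" by simp
    have x: "exp ((c * l)\<^sup>2 / 2) - 1 \<le> exp 5 * l\<^sup>2"
    proof -
      define q where "q = (c * l)\<^sup>2 / 2"
      have "c\<^sup>2 \<le> 2\<^sup>2" using c by (intro power_mono) auto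
      hence q: "0 \<le> q" "q \<le> 2 * l\<^sup>2" using mult_right_mono[of "c\<^sup>2" 4 "l\<^sup>2"] by (auto simp: q_def power_mult_distrib)
      have l2: "l\<^sup>2 \<le> 1" using l by (simp add: power_le_one)
      have "1 - q \<le> exp (- q)" using exp_ge_add_one_self[of "- q"] by simp
      hence "exp q * (1 - q) \<le> exp q * exp (- q)" by (intro mult_left_mono) auto
      hence "exp q - 1 \<le> exp q * q" by (simp add: algebra_simps exp_minus)
      also have "\<dots> \<le> exp 2 * (2 * l\<^sup>2)" using q l2 by (intro mult_mono) auto
      also have "\<dots> \<le> exp 2 * (exp 3 * l\<^sup>2)"
        using exp_ge_add_one_self[of 3] by (intro mult_left_mono mult_right_mono) auto
      also have "\<dots> = exp 5 * l\<^sup>2" by (simp add: mult.assoc[symmetric] exp_add[symmetric])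
      finally show ?thesis by (simp add: q_def)
    qed
    have x0: "0 \<le> exp ((c * l)\<^sup>2 / 2) - 1" by simp
    have "0 \<le> exp 5 * l\<^sup>2" "0 \<le> exp (- u / l) * exp 5" by simp_all
    hence "\<bar>smooth_cutoff l c u - 1\<bar> \<le> exp (- u / l) * exp 5 + exp 5 * l\<^sup>2"
      using split t0 t1 x x0 by linarith
    thus ?thesis using True by (simp add: algebra_simps)
  qed
qed

section \<open>Laplace transforms of powers\<close>

lemma laplace_holomorphic:
  fixes a :: "real \<Rightarrow> complex"
  assumes meas: "a \<in> borel_measurable lborel" and supp: "\<And>v. v \<le> 0 \<Longrightarrow> a v = 0"
    and int: "\<And>\<sigma>. \<sigma> > 0 \<Longrightarrow> integrable lborel (\<lambda>v. norm (a v) * exp (- \<sigma> * v))"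
  shows "(\<lambda>s. LINT v|lborel. a v * exp (- s * of_real v)) holomorphic_on {s. Re s > 0}"
proof -
  note [measurable] = meas
  have "(\<lambda>s. LINT v|lborel. a v * exp (- s * of_real v)) holomorphic_on ball z (Re z / 2)" if z: "Re z > 0" for z
  proof (rule power_series_holomorphic)
    fix s assume s: "s \<in> ball z (Re z / 2)"
    define d where "d = norm (s - z)"
    have d: "0 \<le> d" "d < Re z / 2" using s by (auto simp: d_def dist_norm norm_minus_commute)
    \<comment> \<open>The terms of the expansion of \<open>a v * exp (- s * v)\<close> in powers of
      \<open>s - z\<close>. Their norms add up to
      \<open>norm (a v) * exp (- (Re z - d) * v)\<close>, which is integrable since
      \<open>d < Re z / 2\<close>; so summation and integration may be exchanged.\<close>
    define F where "F n v = a v * exp (- z * of_real v) * ((- (s - z) * of_real v) ^ n / fact n)" for n v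
    have nF: "norm (F n v) = norm (a v) * exp (- Re z * v) * ((d * v) ^ n / fact n)" for n v
    proof (cases "v > 0")
      case True
      thus ?thesis by (simp add: F_def norm_mult norm_divide norm_power d_def norm_minus_commute)
    qed (use supp in \<open>auto simp: F_def\<close>)
    have sm: "(\<lambda>n. norm (F n v)) sums (norm (a v) * exp (- (Re z - d) * v))" for v
    proof -
      have "(\<lambda>n. (d * v) ^ n / fact n) sums exp (d * v)"
        using exp_converges[of "d * v"] by (simp add: field_simps)
      hence "(\<lambda>n. norm (F n v)) sums (norm (a v) * exp (- Re z * v) * exp (d * v))"
        unfolding nF by (rule sums_mult)
      thus ?thesis by (simp add: mult.assoc exp_add[symmetric] algebra_simps)
    qed
    have dom: "integrable lborel (\<lambda>v. norm (a v) * exp (- (Re z - d) * v))" using d z by (intro int) auto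
    have Fi: "integrable lborel (F n)" for n
    proof (rule Bochner_Integration.integrable_bound[OF dom])
      show "F n \<in> borel_measurable lborel" unfolding F_def by measurable
      show "AE v in lborel. norm (F n v) \<le> norm (norm (a v) * exp (- (Re z - d) * v))"
      proof (rule AE_I2)
        fix v
        have "norm (F n v) = (\<Sum>i\<in>{n}. norm (F i v))" by simp
        also have "\<dots> \<le> (\<Sum>i. norm (F i v))" by (rule sum_le_suminf) (use sm in \<open>auto simp: sums_iff\<close>)
        finally show "norm (F n v) \<le> norm (norm (a v) * exp (- (Re z - d) * v))" using sm[of v] by (simp add: sums_iff)
      qed
    qed
    have bnd: "(\<Sum>i\<le>n. LINT v|lborel. norm (F i v)) \<le> (LINT v|lborel. norm (a v) * exp (- (Re z - d) * v))" for n
    proof -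
      have "(\<Sum>i\<le>n. LINT v|lborel. norm (F i v)) = (LINT v|lborel. (\<Sum>i\<le>n. norm (F i v)))"
        using Fi by (intro Bochner_Integration.integral_sum[symmetric]) auto
      also have "\<dots> \<le> (LINT v|lborel. norm (a v) * exp (- (Re z - d) * v))"
      proof (rule integral_mono[OF _ dom])
        show "integrable lborel (\<lambda>v. \<Sum>i\<le>n. norm (F i v))" using Fi by auto
        fix v
        have "(\<Sum>i\<le>n. norm (F i v)) \<le> (\<Sum>i. norm (F i v))" by (rule sum_le_suminf) (use sm in \<open>auto simp: sums_iff\<close>)
        thus "(\<Sum>i\<le>n. norm (F i v)) \<le> norm (a v) * exp (- (Re z - d) * v)" using sm[of v] by (simp add: sums_iff)
      qed
      finally show ?thesis .
    qed
    have sums: "(\<lambda>n. LINT v|lborel. F n v) sums (LINT v|lborel. (\<Sum>n. F n v))"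
    proof (rule sums_integral[OF Fi])
      show "AE v in lborel. summable (\<lambda>n. norm (F n v))" using sm by (auto simp: sums_iff)
      show "summable (\<lambda>n. LINT v|lborel. norm (F n v))" by (rule bounded_imp_summable[OF _ bnd]) auto
    qed
    have "(\<Sum>n. F n v) = a v * exp (- s * of_real v)" for v
    proof -
      have "(\<lambda>n. (- (s - z) * of_real v) ^ n / fact n) sums exp (- (s - z) * of_real v)"
        using exp_converges[of "- (s - z) * of_real v"] by (simp add: scaleR_conv_of_real field_simps)
      from sums_mult[OF this, of "a v * exp (- z * of_real v)"]
      have "(\<lambda>n. F n v) sums (a v * exp (- z * of_real v) * exp (- (s - z) * of_real v))"
        unfolding F_def .
      thus ?thesis by (simp add: sums_iff mult.assoc exp_add[symmetric] algebra_simps)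
    qed
    hence "(\<lambda>n. LINT v|lborel. F n v) sums (LINT v|lborel. a v * exp (- s * of_real v))" using sums by simp
    moreover have "(LINT v|lborel. F n v) = (LINT v|lborel. a v * exp (- z * of_real v) * ((- of_real v) ^ n / fact n)) * (s - z) ^ n" for n
    proof -
      have "F n v = (a v * exp (- z * of_real v) * ((- of_real v) ^ n / fact n)) * (s - z) ^ n" for v
      proof -
        have "- (s - z) * of_real v = (- of_real v) * (s - z)" by (simp add: algebra_simps)
        thus ?thesis unfolding F_def by (simp only: power_mult_distrib) (simp add: mult_ac)
      qed
      thus ?thesis by simp
    qed
    ultimately show "(\<lambda>n. (LINT v|lborel. a v * exp (- z * of_real v) * ((- of_real v) ^ n / fact n)) * (s - z) ^ n)
        sums (LINT v|lborel. a v * exp (- s * of_real v))" by simp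
  qed
  hence "(\<lambda>s. LINT v|lborel. a v * exp (- s * of_real v)) field_differentiable (at z)" if "Re z > 0" for z
    using that by (auto intro: holomorphic_on_imp_differentiable_at[of _ "ball z (Re z / 2)"])
  thus ?thesis by (auto simp: holomorphic_on_def intro: field_differentiable_at_within)
qed

text \<open>A power extended by 0 to \<open>v \<le> 0\<close>, so that one-sided transforms become
  integrals over the whole line. The exponential factor of the Gamma law is left to the transform
  variable.\<close>

definition gamma_density :: "complex \<Rightarrow> real \<Rightarrow> complex" where
  "gamma_density w v = (if v > 0 then of_real v powr (w - 1) else 0)"

lemma gamma_density_altdef: "gamma_density w v = (if v > 0 then exp ((w - 1) * of_real (ln v)) else 0)"
  by (simp add: gamma_density_def powr_def Ln_of_real)

lemma gamma_density_measurable [measurable]: "gamma_density w \<in> borel_measurable borel"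
  unfolding gamma_density_altdef[abs_def] by measurable

lemma norm_gamma_density: "norm (gamma_density w v) = (if v > 0 then v powr (Re w - 1) else 0)"
  by (simp add: gamma_density_def norm_powr_real_powr)

lemma integrable_gamma_density:
  assumes "Re w > 0" "\<sigma> > 0"
  shows "integrable lborel (\<lambda>v. norm (gamma_density w v) * exp (- \<sigma> * v))"
proof -
  have "(\<lambda>t. complex_of_real t powr (w - 1) / of_real (exp (\<sigma> * t))) absolutely_integrable_on {0<..}"
    by (rule absolutely_integrable_Gamma_integral[OF assms])
  hence "integrable lebesgue (\<lambda>t. indicator {0<..} t *\<^sub>R (complex_of_real t powr (w - 1) / of_real (exp (\<sigma> * t))))"
    by (simp add: set_integrable_def)
  also have "(\<lambda>t. indicator {0<..} t *\<^sub>R (complex_of_real t powr (w - 1) / of_real (exp (\<sigma> * t))))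
     = (\<lambda>t. gamma_density w t * of_real (exp (- \<sigma> * t)))"
    by (auto simp: fun_eq_iff gamma_density_def indicator_def exp_minus field_simps)
  finally have "integrable lborel (\<lambda>t. gamma_density w t * of_real (exp (- \<sigma> * t)))"
    by (subst (asm) integrable_completion) auto
  hence "integrable lborel (\<lambda>t. norm (gamma_density w t * of_real (exp (- \<sigma> * t))))" by (rule integrable_norm)
  thus ?thesis by (simp add: norm_mult)
qed

lemma integrable_gamma_laplace:
  assumes "Re w > 0" "Re s > 0"
  shows "integrable lborel (\<lambda>v. gamma_density w v * exp (- s * of_real v))"
proof -
  have "(\<lambda>v. gamma_density w v * exp (- s * of_real v)) \<in> borel_measurable lborel" by measurable
  thus ?thesis
    by (rule Bochner_Integration.integrable_bound[OF integrable_gamma_density[OF assms]]) (simp add: norm_mult)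
qed

lemma gamma_laplace_real:
  assumes w: "Re w > 0" and \<sigma>: "\<sigma> > 0"
  shows "(LINT v|lborel. gamma_density w v * exp (- of_real \<sigma> * of_real v)) = Gamma w * of_real \<sigma> powr (- w)"
proof -
  have one: "(LINT v|lborel. gamma_density w v * exp (- of_real v)) = Gamma w"
  proof -
    have "((\<lambda>v. gamma_density w v * exp (- of_real v)) has_integral (LINT v|lborel. gamma_density w v * exp (- of_real v))) UNIV"
      using integrable_gamma_laplace[OF w, of 1] by (intro has_integral_integral_lborel) simp
    moreover have "((\<lambda>v. gamma_density w v * exp (- of_real v)) has_integral Gamma w) UNIV"
    proof -
      have "((\<lambda>t. if t \<in> {0..} then complex_of_real t powr (w - 1) / of_real (exp t) else 0) has_integral Gamma w) UNIV"
        using Gamma_integral_complex[OF w] by (simp only: has_integral_restrict_UNIV)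
      also have "(\<lambda>t. if t \<in> {0..} then complex_of_real t powr (w - 1) / of_real (exp t) else 0) = (\<lambda>v. gamma_density w v * exp (- of_real v))"
        by (auto simp: fun_eq_iff gamma_density_def exp_minus exp_of_real field_simps)
      finally show ?thesis .
    qed
    ultimately show ?thesis by (rule has_integral_unique)
  qed
  have "(LINT v|lborel. gamma_density w v * exp (- of_real \<sigma> * of_real v)) =
     \<bar>1 / \<sigma>\<bar> *\<^sub>R (LINT v|lborel. gamma_density w (0 + 1 / \<sigma> * v) * exp (- of_real \<sigma> * of_real (0 + 1 / \<sigma> * v)))"
    using \<sigma> by (intro lborel_integral_real_affine) auto
  also have "(\<lambda>v. gamma_density w (0 + 1 / \<sigma> * v) * exp (- of_real \<sigma> * of_real (0 + 1 / \<sigma> * v))) =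
     (\<lambda>v. of_real \<sigma> powr (1 - w) * (gamma_density w v * exp (- of_real v)))"
  proof
    fix v :: real
    show "gamma_density w (0 + 1 / \<sigma> * v) * exp (- of_real \<sigma> * of_real (0 + 1 / \<sigma> * v)) =
       of_real \<sigma> powr (1 - w) * (gamma_density w v * exp (- of_real v))"
    proof (cases "v > 0")
      case True
      have "exp ((w - 1) * of_real (ln (v / \<sigma>))) = exp ((1 - w) * of_real (ln \<sigma>)) * exp ((w - 1) * of_real (ln v))"
        using True \<sigma> by (simp add: ln_div exp_add[symmetric] algebra_simps)
      thus ?thesis using True \<sigma> by (simp add: gamma_density_altdef powr_def Ln_of_real mult_ac)
    qed (use \<sigma> in \<open>auto simp: gamma_density_def zero_less_divide_iff\<close>)
  qed
  also have "\<bar>1 / \<sigma>\<bar> *\<^sub>R (LINT v|lborel. of_real \<sigma> powr (1 - w) * (gamma_density w v * exp (- of_real v))) = Gamma w * of_real \<sigma> powr (- w)"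
    using \<sigma> one by (simp add: scaleR_conv_of_real powr_diff powr_minus field_simps)
  finally show ?thesis .
qed

text \<open>For real \<open>s\<close> it is the Gamma integral after rescaling; both sides are
  holomorphic in the half-plane, so the identity theorem extends it.\<close>

lemma gamma_laplace:
  assumes w: "Re w > 0" and s: "Re s > 0"
  shows "(LINT v|lborel. gamma_density w v * exp (- s * of_real v)) = Gamma w * s powr (- w)"
proof -
  let ?S = "{s. Re s > 0}"
  let ?f = "\<lambda>s. (LINT v|lborel. gamma_density w v * exp (- s * of_real v)) - Gamma w * s powr (- w)"
  have h1: "(\<lambda>s. LINT v|lborel. gamma_density w v * exp (- s * of_real v)) holomorphic_on ?S"
    by (rule laplace_holomorphic) (use integrable_gamma_density[OF w] in \<open>auto simp: gamma_density_def[of w]\<close>)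
  have "?f holomorphic_on ?S"
    by (intro holomorphic_on_diff h1 holomorphic_intros) (auto simp: complex_nonpos_Reals_iff)
  moreover have "open ?S" "connected ?S" by (auto intro: open_halfspace_Re_gt convex_connected convex_halfspace_Re_gt)
  moreover have "of_real ` {0<..} \<subseteq> ?S" "(1::complex) \<in> ?S" by auto
  moreover have "(1::complex) islimpt of_real ` {0<..}"
  proof (rule islimpt_approachable[THEN iffD2], intro allI impI)
    fix e :: real assume "e > 0"
    thus "\<exists>x'\<in>complex_of_real ` {0<..}. x' \<noteq> 1 \<and> dist x' 1 < e"
      by (intro bexI[of _ "of_real (1 + e / 2)"] imageI) (auto simp: dist_norm)
  qed
  ultimately have "?f s = 0"
    by (rule analytic_continuation[of ?f ?S "of_real ` {0<..}" 1]) (use gamma_laplace_real[OF w] s in auto)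
  thus ?thesis by simp
qed

lemma exp_integral_lessThan:
  fixes s :: complex
  assumes s: "Re s > 0"
  shows "(LINT w|lborel. indicator {..<u} w *\<^sub>R exp (s * of_real w)) = exp (s * of_real u) / s"
proof -
  have "(LINT w|lborel. indicator {..<u} w *\<^sub>R exp (s * of_real w)) =
     \<bar>-1\<bar> *\<^sub>R (LINT v|lborel. indicator {..<u} (u + (-1) * v) *\<^sub>R exp (s * of_real (u + (-1) * v)))"
    by (rule lborel_integral_real_affine) simp
  also have "\<dots> = (LINT v|lborel. exp (s * of_real u) * (gamma_density 1 v * exp (- s * of_real v)))"
  proof -
    have "indicator {..<u} (u + (-1) * v) *\<^sub>R exp (s * of_real (u + (-1) * v)) =
        exp (s * of_real u) * (gamma_density 1 v * exp (- s * of_real v))" for v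
      by (auto simp: gamma_density_def indicator_def exp_add[symmetric] algebra_simps)
    thus ?thesis by (simp only:) simp
  qed
  also have "\<dots> = exp (s * of_real u) * (Gamma 1 * s powr (- 1))"
    using gamma_laplace[of 1 s] s by simp
  also have "\<dots> = exp (s * of_real u) / s" using s by (auto simp: powr_minus field_simps)
  finally show ?thesis .
qed

text \<open>A majorant of product form is available in every exchange of integrals below.\<close>

lemma (in pair_sigma_finite) integrable_product_bound:
  fixes f :: "'a \<times> 'b \<Rightarrow> 'c::{banach, second_countable_topology}"
  assumes f: "f \<in> borel_measurable (M1 \<Otimes>\<^sub>M M2)"
    and F: "integrable M1 F" "\<And>x. 0 \<le> F x" and G: "integrable M2 K" "\<And>y. 0 \<le> K y"
    and le: "\<And>x y. norm (f (x, y)) \<le> F x * (K y :: real)"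
  shows "integrable (M1 \<Otimes>\<^sub>M M2) f"
proof -
  have [measurable]: "F \<in> borel_measurable M1" "K \<in> borel_measurable M2" using F G by auto
  have "integrable (M1 \<Otimes>\<^sub>M M2) (\<lambda>(x, y). F x * K y)"
    by (rule Fubini_integrable) (use F G in \<open>auto simp: abs_mult\<close>)
  thus ?thesis
    by (rule Bochner_Integration.integrable_bound[OF _ f]) (use le F G in \<open>auto simp: abs_mult\<close>)
qed

text \<open>With \<open>s = Complex c t\<close>, \<open>exp (s * u) / s\<close> is the integral of
  \<open>exp (s * w)\<close> over \<open>w < u\<close>. After exchanging the integrals, the one over
  \<open>t\<close> is the Fourier transform of a Gaussian, and what remains is the definition of the
  cutoff.\<close>

lemma smooth_cutoff_fourier:
  assumes l: "l > 0" and c: "c > 0"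
  shows "(LINT t|lborel. exp (Complex c t * of_real u) / Complex c t * of_real (exp (- (l * t)\<^sup>2 / 2))) = of_real (2 * pi * smooth_cutoff l c u)"
proof -
  let ?f = "\<lambda>w t. indicator {..<u} w *\<^sub>R exp (Complex c t * of_real w) * of_real (exp (- (l * t)\<^sup>2 / 2))"
  have cx: "Complex c t = of_real c + \<i> * of_real t" for t by (simp add: complex_eq_iff)
  have ne: "norm (exp (Complex c t * of_real w)) = exp (c * w)" for t w by simp
  have "integrable (lborel \<Otimes>\<^sub>M lborel) (case_prod ?f)"
  proof (rule lborel_pair.integrable_product_bound)
    show "case_prod ?f \<in> borel_measurable (lborel \<Otimes>\<^sub>M lborel)" unfolding cx by measurable
    have "integrable lborel (\<lambda>w. norm (indicator {..<u} w *\<^sub>R exp (of_real c * of_real w :: complex)))"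
    proof (rule integrable_norm)
      have "integrable lborel (\<lambda>v. exp (of_real c * of_real u) * (gamma_density 1 v * exp (- of_real c * of_real v)))"
        using integrable_gamma_laplace[of 1 "of_real c"] c by (intro integrable_mult_right) simp
      also have "(\<lambda>v. exp (of_real c * of_real u) * (gamma_density 1 v * exp (- of_real c * of_real v)))
         = (\<lambda>v. indicator {..<u} (u + (-1) * v) *\<^sub>R exp (of_real c * of_real (u + (-1) * v) :: complex))"
        by (auto simp: fun_eq_iff gamma_density_def indicator_def exp_diff exp_minus field_simps)
      finally show "integrable lborel (\<lambda>w. indicator {..<u} w *\<^sub>R exp (of_real c * of_real w :: complex))"
        by (subst (asm) lborel_integrable_real_affine_iff) auto
    qed
    also have "(\<lambda>w. norm (indicator {..<u} w *\<^sub>R exp (of_real c * of_real w :: complex))) = (\<lambda>w. indicator {..<u} w * exp (c * w))"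
      by (auto simp: fun_eq_iff indicator_def)
    finally show "integrable lborel (\<lambda>w. indicator {..<u} w * exp (c * w))" .
    show "integrable lborel (\<lambda>t. exp (- (l * t)\<^sup>2 / 2))" by (rule gauss_fourier(2)[OF l])
  qed (auto simp: norm_mult indicator_def)
  from lborel_pair.Fubini_integral[OF this]
  have "(LINT t|lborel. LINT w|lborel. ?f w t) = (LINT w|lborel. LINT t|lborel. ?f w t)" .
  also have "(LINT t|lborel. LINT w|lborel. ?f w t) =
     (LINT t|lborel. exp (Complex c t * of_real u) / Complex c t * of_real (exp (- (l * t)\<^sup>2 / 2)))"
  proof (intro Bochner_Integration.integral_cong refl)
    fix t
    have "(LINT w|lborel. ?f w t) = (LINT w|lborel. indicator {..<u} w *\<^sub>R exp (Complex c t * of_real w)) * of_real (exp (- (l * t)\<^sup>2 / 2))"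
      by (rule integral_mult_left_zero)
    thus "(LINT w|lborel. ?f w t) = exp (Complex c t * of_real u) / Complex c t * of_real (exp (- (l * t)\<^sup>2 / 2))"
      using exp_integral_lessThan[of "Complex c t" u] c by simp
  qed
  also have "(LINT w|lborel. LINT t|lborel. ?f w t) =
      (LINT w|lborel. of_real (2 * pi * (indicator {..<u} w * (exp (c * w) * normal_density 0 l w))))"
  proof (intro Bochner_Integration.integral_cong refl)
    fix w :: real
    have "(LINT t|lborel. ?f w t) = (LINT t|lborel. of_real (indicator {..<u} w * exp (c * w)) * (exp (\<i> * of_real (t * w)) * of_real (exp (- (l * t)\<^sup>2 / 2))))"
    proof (intro Bochner_Integration.integral_cong refl)
      fix t
      have "exp (Complex c t * of_real w) = of_real (exp (c * w)) * exp (\<i> * of_real (t * w))"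
        unfolding exp_of_real[symmetric] exp_add[symmetric] by (simp add: cx algebra_simps)
      thus "?f w t = of_real (indicator {..<u} w * exp (c * w)) * (exp (\<i> * of_real (t * w)) * of_real (exp (- (l * t)\<^sup>2 / 2)))"
        by (simp only:) (simp add: scaleR_conv_of_real mult_ac)
    qed
    thus "(LINT t|lborel. ?f w t) = of_real (2 * pi * (indicator {..<u} w * (exp (c * w) * normal_density 0 l w)))"
      by (simp only: integral_mult_right_zero gauss_fourier(1)[OF l]) (simp add: mult_ac)
  qed
  also have "\<dots> = of_real (2 * pi * smooth_cutoff l c u)"
    unfolding smooth_cutoff_def integral_complex_of_real by simp
  finally show ?thesis .
qed

lemma smooth_cutoff_measurable [measurable]: "smooth_cutoff l c \<in> borel_measurable borel"
proof -
  have "(\<lambda>u. LINT w|lborel. (if w < u then 1 else 0) * (exp (c * w) * normal_density 0 l w)) \<in> borel_measurable borel"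
    by measurable
  moreover have "(\<lambda>u. LINT w|lborel. (if w < u then 1 else 0) * (exp (c * w) * normal_density 0 l w)) = smooth_cutoff l c"
    unfolding smooth_cutoff_def[abs_def] by (auto simp: fun_eq_iff indicator_def intro!: Bochner_Integration.integral_cong)
  ultimately show ?thesis by simp
qed

text \<open>Stated for an arbitrary sigma-finite measure so that one formula covers both the
  coefficients (counting measure, \<open>v = ln n\<close>) and the model density (Lebesgue measure,
  \<open>v\<close> the identity). The Gaussian makes the \<open>t\<close>-integral absolutely
  convergent, so Fubini applies to the full line without truncation.\<close>

lemma perron_gauss:
  fixes a :: "'a \<Rightarrow> complex" and v :: "'a \<Rightarrow> real"
  assumes sf: "sigma_finite_measure N" and l: "l > 0" and c: "c > 0"
    and [measurable]: "a \<in> borel_measurable N" "v \<in> borel_measurable N"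
    and int: "integrable N (\<lambda>\<omega>. norm (a \<omega>) * exp (- c * v \<omega>))"
  shows "(LINT t|lborel. (LINT \<omega>|N. a \<omega> * exp (- Complex c t * of_real (v \<omega>))) * (exp (Complex c t * of_real X) / Complex c t * of_real (exp (- (l * t)\<^sup>2 / 2))))
       = of_real (2 * pi) * (LINT \<omega>|N. a \<omega> * of_real (smooth_cutoff l c (X - v \<omega>)))"
    and "integrable lborel (\<lambda>t. (LINT \<omega>|N. a \<omega> * exp (- Complex c t * of_real (v \<omega>))) * (exp (Complex c t * of_real X) / Complex c t * of_real (exp (- (l * t)\<^sup>2 / 2))))"
proof -
  interpret N: sigma_finite_measure N by fact
  interpret pair_sigma_finite N lborel ..
  let ?k = "\<lambda>t. exp (Complex c t * of_real X) / Complex c t * of_real (exp (- (l * t)\<^sup>2 / 2))"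
  let ?f = "\<lambda>\<omega> t. a \<omega> * exp (- Complex c t * of_real (v \<omega>)) * ?k t"
  have cx: "Complex c t = of_real c + \<i> * of_real t" for t by (simp add: complex_eq_iff)
  have ge: "c \<le> norm (Complex c t)" for t using abs_Re_le_cmod[of "Complex c t"] by simp
  have fi: "integrable (N \<Otimes>\<^sub>M lborel) (case_prod ?f)"
  proof (rule integrable_product_bound)
    show "case_prod ?f \<in> borel_measurable (N \<Otimes>\<^sub>M lborel)" unfolding cx by measurable
    show "integrable N (\<lambda>\<omega>. norm (a \<omega>) * exp (- c * v \<omega>))" by fact
    show "integrable lborel (\<lambda>t. exp (c * X) / c * exp (- (l * t)\<^sup>2 / 2))"
      by (intro integrable_mult_right gauss_fourier(2)[OF l])
    fix \<omega> t
    have "norm (?k t) \<le> exp (c * X) / c * exp (- (l * t)\<^sup>2 / 2)"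
      using ge[of t] c by (auto simp: norm_mult norm_divide intro!: mult_right_mono divide_left_mono mult_pos_pos)
    hence "norm (a \<omega>) * exp (- c * v \<omega>) * norm (?k t) \<le> norm (a \<omega>) * exp (- c * v \<omega>) * (exp (c * X) / c * exp (- (l * t)\<^sup>2 / 2))"
      by (intro mult_left_mono) auto
    moreover have "norm (exp (- Complex c t * of_real (v \<omega>))) = exp (- c * v \<omega>)" by simp
    hence "norm (case_prod ?f (\<omega>, t)) = norm (a \<omega>) * exp (- c * v \<omega>) * norm (?k t)"
      by (simp only: case_prod_conv norm_mult[of "a \<omega> * exp (- Complex c t * of_real (v \<omega>))"] norm_mult[of "a \<omega>"])
    ultimately show "norm (case_prod ?f (\<omega>, t)) \<le> norm (a \<omega>) * exp (- c * v \<omega>) * (exp (c * X) / c * exp (- (l * t)\<^sup>2 / 2))"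
      by (simp only:)
  qed (use c in auto)
  have k: "(LINT \<omega>|N. ?f \<omega> t) = (LINT \<omega>|N. a \<omega> * exp (- Complex c t * of_real (v \<omega>))) * ?k t" for t
    by (rule integral_mult_left_zero)
  show "integrable lborel (\<lambda>t. (LINT \<omega>|N. a \<omega> * exp (- Complex c t * of_real (v \<omega>))) * ?k t)"
    using integrable_snd[OF fi] unfolding k .
  have "(LINT t|lborel. (LINT \<omega>|N. a \<omega> * exp (- Complex c t * of_real (v \<omega>))) * ?k t) = (LINT t|lborel. LINT \<omega>|N. ?f \<omega> t)"
    unfolding k ..
  also have "\<dots> = (LINT \<omega>|N. LINT t|lborel. ?f \<omega> t)" by (rule Fubini_integral[OF fi])
  also have "\<dots> = (LINT \<omega>|N. of_real (2 * pi) * (a \<omega> * of_real (smooth_cutoff l c (X - v \<omega>))))"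
  proof (intro Bochner_Integration.integral_cong refl)
    fix \<omega>
    have "(LINT t|lborel. ?f \<omega> t) = (LINT t|lborel. a \<omega> * (exp (Complex c t * of_real (X - v \<omega>)) / Complex c t * of_real (exp (- (l * t)\<^sup>2 / 2))))"
    proof (intro Bochner_Integration.integral_cong refl)
      fix t
      have "exp (Complex c t * of_real (X - v \<omega>)) = exp (- Complex c t * of_real (v \<omega>)) * exp (Complex c t * of_real X)"
        by (simp add: exp_add[symmetric] algebra_simps)
      thus "?f \<omega> t = a \<omega> * (exp (Complex c t * of_real (X - v \<omega>)) / Complex c t * of_real (exp (- (l * t)\<^sup>2 / 2)))"
        by (simp only:) (simp add: mult_ac)
    qed
    thus "(LINT t|lborel. ?f \<omega> t) = of_real (2 * pi) * (a \<omega> * of_real (smooth_cutoff l c (X - v \<omega>)))"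
      by (simp only: integral_mult_right_zero smooth_cutoff_fourier[OF l c]) (simp add: mult_ac)
  qed
  also have "\<dots> = of_real (2 * pi) * (LINT \<omega>|N. a \<omega> * of_real (smooth_cutoff l c (X - v \<omega>)))" by simp
  finally show "(LINT t|lborel. (LINT \<omega>|N. a \<omega> * exp (- Complex c t * of_real (v \<omega>))) * ?k t)
       = of_real (2 * pi) * (LINT \<omega>|N. a \<omega> * of_real (smooth_cutoff l c (X - v \<omega>)))" .
qed

lemma exp_neg_abs_le:
  fixes l c u :: real
  assumes "0 < l" "l * c \<le> 1" "0 \<le> c"
  shows "exp (- \<bar>u\<bar> / l) \<le> exp (c * u)"
proof -
  have "c \<le> 1 / l" using assms by (simp add: field_simps)
  hence "c * \<bar>u\<bar> \<le> (1 / l) * \<bar>u\<bar>" by (intro mult_right_mono) auto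
  moreover have "- (c * \<bar>u\<bar>) \<le> c * u" using assms mult_left_mono[of "- \<bar>u\<bar>" u c] by simp
  ultimately show ?thesis by simp
qed

text \<open>Integrates \<open>smooth_cutoff_bound\<close>. Since \<open>l * c \<le> 1\<close>, the
  decay \<open>exp (- \<bar>u\<bar> / l)\<close> lies below \<open>exp (c * u)\<close> on both
  sides, and the weight is dominated by a multiple of the given integrable function.\<close>

lemma smoothing_error:
  fixes a :: "'a \<Rightarrow> complex" and v :: "'a \<Rightarrow> real"
  assumes l: "0 < l" "l \<le> 1/2" and c: "1 \<le> c" "c \<le> 2"
    and [measurable]: "a \<in> borel_measurable N" "v \<in> borel_measurable N"
    and int: "integrable N (\<lambda>\<omega>. norm (a \<omega>) * exp (- c * v \<omega>))"
  shows "integrable N (\<lambda>\<omega>. norm (a \<omega>) * (exp (- \<bar>X - v \<omega>\<bar> / l) + (if v \<omega> \<le> X then l\<^sup>2 else 0)))"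
    and "norm ((LINT \<omega>|N. a \<omega> * of_real (smooth_cutoff l c (X - v \<omega>))) - (LINT \<omega>|N. (if v \<omega> \<le> X then a \<omega> else 0)))
      \<le> exp 5 * (LINT \<omega>|N. norm (a \<omega>) * (exp (- \<bar>X - v \<omega>\<bar> / l) + (if v \<omega> \<le> X then l\<^sup>2 else 0)))"
proof -
  have dom: "integrable N (\<lambda>\<omega>. K * exp (c * X) * (norm (a \<omega>) * exp (- c * v \<omega>)))" for K using int by simp
  have eX: "exp (c * X) * exp (- c * v \<omega>) = exp (c * (X - v \<omega>))" for \<omega> by (simp add: exp_add[symmetric] algebra_simps)
  have l2: "l\<^sup>2 \<le> 1" using l by (simp add: power_le_one)
  have le1: "exp (- \<bar>X - v \<omega>\<bar> / l) \<le> exp (c * (X - v \<omega>))" for \<omega>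
  proof (rule exp_neg_abs_le)
    show "l * c \<le> 1" using mult_mono[OF l(2) c(2)] l c by simp
  qed (use l c in auto)
  have le2: "(if v \<omega> \<le> X then l\<^sup>2 else 0) \<le> exp (c * (X - v \<omega>))" for \<omega>
    using l2 c one_le_exp_iff[of "c * (X - v \<omega>)"] by (auto intro: order_trans)
  have sum_le: "exp (- \<bar>X - v \<omega>\<bar> / l) + (if v \<omega> \<le> X then l\<^sup>2 else 0) \<le> 2 * exp (c * (X - v \<omega>))" for \<omega>
    using le1[of \<omega>] le2[of \<omega>] by linarith
  show I: "integrable N (\<lambda>\<omega>. norm (a \<omega>) * (exp (- \<bar>X - v \<omega>\<bar> / l) + (if v \<omega> \<le> X then l\<^sup>2 else 0)))"
  proof (rule Bochner_Integration.integrable_bound[OF dom[of 2]])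
    show "(\<lambda>\<omega>. norm (a \<omega>) * (exp (- \<bar>X - v \<omega>\<bar> / l) + (if v \<omega> \<le> X then l\<^sup>2 else 0))) \<in> borel_measurable N" by measurable
    have "norm (norm (a \<omega>) * (exp (- \<bar>X - v \<omega>\<bar> / l) + (if v \<omega> \<le> X then l\<^sup>2 else 0))) \<le> norm (2 * exp (c * X) * (norm (a \<omega>) * exp (- c * v \<omega>)))" for \<omega>
    proof -
      have "norm (a \<omega>) * (exp (- \<bar>X - v \<omega>\<bar> / l) + (if v \<omega> \<le> X then l\<^sup>2 else 0)) \<le> norm (a \<omega>) * (2 * exp (c * (X - v \<omega>)))"
        by (intro mult_left_mono sum_le) auto
      also have "\<dots> = 2 * exp (c * X) * (norm (a \<omega>) * exp (- c * v \<omega>))" unfolding eX[symmetric] by simp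
      finally show ?thesis by (simp add: abs_mult)
    qed
    thus "AE \<omega> in N. norm (norm (a \<omega>) * (exp (- \<bar>X - v \<omega>\<bar> / l) + (if v \<omega> \<le> X then l\<^sup>2 else 0))) \<le> norm (2 * exp (c * X) * (norm (a \<omega>) * exp (- c * v \<omega>)))" by simp
  qed
  have I2: "integrable N (\<lambda>\<omega>. if v \<omega> \<le> X then a \<omega> else 0)"
  proof (rule Bochner_Integration.integrable_bound[OF dom[of 1]])
    have "norm (if v \<omega> \<le> X then a \<omega> else 0) \<le> norm (1 * exp (c * X) * (norm (a \<omega>) * exp (- c * v \<omega>)))" for \<omega>
    proof -
      have "norm (a \<omega>) * 1 \<le> norm (a \<omega>) * exp (c * (X - v \<omega>))" if "v \<omega> \<le> X"
        using that c by (intro mult_left_mono) auto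
      thus ?thesis unfolding eX[symmetric] by (auto simp: abs_mult mult_ac)
    qed
    thus "AE \<omega> in N. norm (if v \<omega> \<le> X then a \<omega> else 0) \<le> norm (1 * exp (c * X) * (norm (a \<omega>) * exp (- c * v \<omega>)))" by simp
  qed measurable
  have diff: "norm (a \<omega> * of_real (smooth_cutoff l c (X - v \<omega>)) - (if v \<omega> \<le> X then a \<omega> else 0)) \<le>
      exp 5 * (norm (a \<omega>) * (exp (- \<bar>X - v \<omega>\<bar> / l) + (if v \<omega> \<le> X then l\<^sup>2 else 0)))" for \<omega>
  proof -
    have "a \<omega> * of_real (smooth_cutoff l c (X - v \<omega>)) - (if v \<omega> \<le> X then a \<omega> else 0) =
        a \<omega> * of_real (smooth_cutoff l c (X - v \<omega>) - (if X - v \<omega> \<ge> 0 then 1 else 0))"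
      by (simp add: algebra_simps)
    hence "norm (a \<omega> * of_real (smooth_cutoff l c (X - v \<omega>)) - (if v \<omega> \<le> X then a \<omega> else 0)) =
        norm (a \<omega>) * \<bar>smooth_cutoff l c (X - v \<omega>) - (if X - v \<omega> \<ge> 0 then 1 else 0)\<bar>"
      by (simp only: norm_mult norm_of_real)
    also have "\<dots> \<le> norm (a \<omega>) * (exp 5 * (exp (- \<bar>X - v \<omega>\<bar> / l) + (if X - v \<omega> \<ge> 0 then l\<^sup>2 else 0)))"
      using l c by (intro mult_left_mono smooth_cutoff_bound) auto
    finally show ?thesis by (simp add: mult_ac)
  qed
  have I3: "integrable N (\<lambda>\<omega>. a \<omega> * of_real (smooth_cutoff l c (X - v \<omega>)) - (if v \<omega> \<le> X then a \<omega> else 0))"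
  proof (rule Bochner_Integration.integrable_bound[OF integrable_mult_right[OF I, of "exp 5"]])
    show "(\<lambda>\<omega>. a \<omega> * of_real (smooth_cutoff l c (X - v \<omega>)) - (if v \<omega> \<le> X then a \<omega> else 0)) \<in> borel_measurable N" by measurable
    show "AE \<omega> in N. norm (a \<omega> * of_real (smooth_cutoff l c (X - v \<omega>)) - (if v \<omega> \<le> X then a \<omega> else 0)) \<le>
       norm (exp 5 * (norm (a \<omega>) * (exp (- \<bar>X - v \<omega>\<bar> / l) + (if v \<omega> \<le> X then l\<^sup>2 else 0))))"
      using diff by (auto intro!: AE_I2 order_trans[OF diff])
  qed
  have I4: "integrable N (\<lambda>\<omega>. a \<omega> * of_real (smooth_cutoff l c (X - v \<omega>)))"
    using Bochner_Integration.integrable_add[OF I3 I2] by simp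
  have "(LINT \<omega>|N. a \<omega> * of_real (smooth_cutoff l c (X - v \<omega>))) - (LINT \<omega>|N. (if v \<omega> \<le> X then a \<omega> else 0)) =
     (LINT \<omega>|N. a \<omega> * of_real (smooth_cutoff l c (X - v \<omega>)) - (if v \<omega> \<le> X then a \<omega> else 0))"
    by (rule Bochner_Integration.integral_diff[OF I4 I2, symmetric])
  also have "norm \<dots> \<le> (LINT \<omega>|N. exp 5 * (norm (a \<omega>) * (exp (- \<bar>X - v \<omega>\<bar> / l) + (if v \<omega> \<le> X then l\<^sup>2 else 0))))"
  proof -
    have "norm (LINT \<omega>|N. f \<omega>) \<le> (LINT \<omega>|N. g \<omega>)"
      if "integrable N f" "integrable N g" "\<And>\<omega>. norm (f \<omega>) \<le> g \<omega>" for f :: "'a \<Rightarrow> complex" and g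
    proof -
      have "norm (LINT \<omega>|N. f \<omega>) \<le> (LINT \<omega>|N. norm (f \<omega>))" by (rule integral_norm_bound)
      also have "\<dots> \<le> (LINT \<omega>|N. g \<omega>)" by (rule integral_mono) (use that in auto)
      finally show ?thesis .
    qed
    from this[OF I3 _ diff] show ?thesis using I by simp
  qed
  finally show "norm ((LINT \<omega>|N. a \<omega> * of_real (smooth_cutoff l c (X - v \<omega>))) - (LINT \<omega>|N. (if v \<omega> \<le> X then a \<omega> else 0)))
      \<le> exp 5 * (LINT \<omega>|N. norm (a \<omega>) * (exp (- \<bar>X - v \<omega>\<bar> / l) + (if v \<omega> \<le> X then l\<^sup>2 else 0)))" by simp
qed

section \<open>The weighted sum\<close>

text \<open>With \<open>a = 1 / X\<close> this integrates \<open>1 / norm (s - 1) ^ 2\<close> along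
  the line \<open>Re s = 1 + 1 / X\<close>.\<close>

lemma cauchy_kernel:
  assumes "a > 0"
  shows "has_bochner_integral lborel (\<lambda>t. 1 / (a\<^sup>2 + t\<^sup>2)) (pi / a)"
proof -
  have e: "einterval (- \<infinity>) \<infinity> = UNIV" by (auto simp: einterval_def)
  have "has_bochner_integral lborel (\<lambda>t::real. inverse (1 + t\<^sup>2)) pi"
    using integrable_inverse_1_plus_square LBINT_inverse_1_plus_square
    by (simp add: e set_integrable_def interval_lebesgue_integral_def set_lebesgue_integral_def has_bochner_integral_iff)
  hence "has_bochner_integral lborel (\<lambda>t. inverse (1 + (0 + 1 / a * t)\<^sup>2)) (pi /\<^sub>R \<bar>1 / a\<bar>)"
    using assms by (subst lborel_has_bochner_integral_real_affine_iff[symmetric]) auto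
  from has_bochner_integral_mult_right[OF this, of "1 / a\<^sup>2"]
  have "has_bochner_integral lborel (\<lambda>t. 1 / a\<^sup>2 * inverse (1 + (0 + 1 / a * t)\<^sup>2)) (1 / a\<^sup>2 * (pi /\<^sub>R \<bar>1 / a\<bar>))" by simp
  moreover have "1 / a\<^sup>2 * inverse (1 + (0 + 1 / a * t)\<^sup>2) = 1 / (a\<^sup>2 + t\<^sup>2)" for t
    using assms by (simp add: field_simps)
  moreover have "1 / a\<^sup>2 * (pi /\<^sub>R \<bar>1 / a\<bar>) = pi / a" using assms by (simp add: power2_eq_square field_simps)
  ultimately show ?thesis by simp
qed

text \<open>Chosen so that its Laplace transform is \<open>(-1) ^ k\<close> times the \<open>k\<close>-th derivative of
  \<open>\<Sum>j<m. c\<^sub>j * (s - 1) powr (j - z)\<close>.\<close>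

definition model_density :: "prime_counter \<Rightarrow> real \<Rightarrow> complex \<Rightarrow> nat \<Rightarrow> nat \<Rightarrow> real \<Rightarrow> complex" where
  "model_density \<nu> y z k m v =
     (\<Sum>j<m. sd_coeff \<nu> y z j * rGamma (z - of_nat j) * (gamma_density (z - of_nat j + of_nat k) v * of_real (exp v)))"

lemma model_density_measurable [measurable]: "model_density \<nu> y z k m \<in> borel_measurable borel"
  unfolding model_density_def[abs_def] by measurable

text \<open>The transform of the \<open>j\<close>-th term carries
  \<open>\<Gamma>(z - j + k) / \<Gamma>(z - j)\<close>, which is the Pochhammer symbol of
  \<open>model_transform\<close>; writing it with \<open>rGamma\<close> keeps it correct where
  \<open>\<Gamma>(z - j)\<close> has a pole. Convergence at 0 needs
  \<open>Re (z - j + k) > 0\<close>, which follows from \<open>norm z < 2\<close> and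
  \<open>m + 3 \<le> k\<close>.\<close>

lemma model_density_laplace:
  assumes z: "norm z < 2" and km: "m + 3 \<le> k" and s: "Re s > 1"
  shows "(LINT v|lborel. model_density \<nu> y z k m v * exp (- s * of_real v)) = model_transform \<nu> y z k m s"
    and "integrable lborel (\<lambda>v. norm (model_density \<nu> y z k m v) * exp (- Re s * v))"
proof -
  have Rez: "Re z > - 2" using abs_Re_le_cmod[of z] z by linarith
  have w: "Re (z - of_nat j + of_nat k) > 0" if "j < m" for j using Rez km that by simp
  have i: "integrable lborel (\<lambda>v. sd_coeff \<nu> y z j * rGamma (z - of_nat j) * (gamma_density (z - of_nat j + of_nat k) v * exp (- (s - 1) * of_real v)))" if "j < m" for j
    using integrable_gamma_laplace[OF w[OF that], of "s - 1"] s by (intro integrable_mult_right) simp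
  have eq: "model_density \<nu> y z k m v * exp (- s * of_real v) =
     (\<Sum>j<m. sd_coeff \<nu> y z j * rGamma (z - of_nat j) * (gamma_density (z - of_nat j + of_nat k) v * exp (- (s - 1) * of_real v)))" for v
  proof -
    have "of_real (exp v) * exp (- s * of_real v) = exp (- (s - 1) * of_real v)"
      unfolding exp_of_real[symmetric] exp_add[symmetric] by (simp add: algebra_simps)
    thus ?thesis unfolding model_density_def sum_distrib_right by (simp only: mult.assoc)
  qed
  have "(LINT v|lborel. model_density \<nu> y z k m v * exp (- s * of_real v)) =
     (\<Sum>j<m. LINT v|lborel. sd_coeff \<nu> y z j * rGamma (z - of_nat j) * (gamma_density (z - of_nat j + of_nat k) v * exp (- (s - 1) * of_real v)))"
    unfolding eq by (rule Bochner_Integration.integral_sum) (use i in auto)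
  also have "\<dots> = model_transform \<nu> y z k m s"
    unfolding model_transform_def
  proof (intro sum.cong refl)
    fix j assume "j \<in> {..<m}"
    hence j: "j < m" by simp
    let ?w = "z - of_nat j"
    have "?w + of_nat k \<notin> \<int>\<^sub>\<le>\<^sub>0"
    proof
      assume "?w + of_nat k \<in> \<int>\<^sub>\<le>\<^sub>0"
      then obtain i where i: "?w + of_nat k = of_int i" "i \<le> 0" by (elim nonpos_Ints_cases)
      have "Re (?w + of_nat k) = real_of_int i" unfolding i(1) by simp
      thus False using w[OF j] i(2) by linarith
    qed
    hence "Gamma (?w + of_nat k) \<noteq> 0" by (rule Gamma_nonzero)
    hence rg: "rGamma ?w * Gamma (?w + of_nat k) = pochhammer ?w k"
      using pochhammer_rGamma[of ?w k] by (simp add: rGamma_inverse_Gamma)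
    have "(LINT v|lborel. sd_coeff \<nu> y z j * rGamma ?w * (gamma_density (?w + of_nat k) v * exp (- (s - 1) * of_real v)))
       = sd_coeff \<nu> y z j * rGamma ?w * (LINT v|lborel. gamma_density (?w + of_nat k) v * exp (- (s - 1) * of_real v))"
      by (rule integral_mult_right_zero)
    also have "\<dots> = sd_coeff \<nu> y z j * (rGamma ?w * Gamma (?w + of_nat k)) * (s - 1) powr (- (?w + of_nat k))"
      using s by (subst gamma_laplace[OF w[OF j]]) auto
    also have "- (?w + of_nat k) = of_nat j - z - of_nat k" by simp
    finally show "(LINT v|lborel. sd_coeff \<nu> y z j * rGamma ?w * (gamma_density (?w + of_nat k) v * exp (- (s - 1) * of_real v)))
       = sd_coeff \<nu> y z j * pochhammer ?w k * (s - 1) powr (of_nat j - z - of_nat k)" by (simp only: rg)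
  qed
  finally show "(LINT v|lborel. model_density \<nu> y z k m v * exp (- s * of_real v)) = model_transform \<nu> y z k m s" .
  have "integrable lborel (\<lambda>v. norm (model_density \<nu> y z k m v * exp (- s * of_real v)))"
    unfolding eq by (intro integrable_norm Bochner_Integration.integrable_sum) (use i in auto)
  thus "integrable lborel (\<lambda>v. norm (model_density \<nu> y z k m v) * exp (- Re s * v))" by (simp add: norm_mult)
qed

text \<open>\<open>L ^ e \<le> fact e * exp L\<close> and \<open>exp L = \<bar>t\<bar> + 3\<close>:
  the factor \<open>1 / s\<close> of the Perron kernel pays for all powers of the logarithm of the
  height, so that the Gaussian alone remains to be integrated.\<close>

lemma log_height_power_le:
  assumes "1 \<le> c"
  shows "log_height (Complex c t) ^ e / norm (Complex c t) \<le> 6 * fact e"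
proof -
  have "log_height (Complex c t) ^ e \<le> fact e * exp (log_height (Complex c t))"
    using log_height_ge_1[of "Complex c t"] by (intro power_le_fact_exp) auto
  also have "exp (log_height (Complex c t)) = \<bar>t\<bar> + 3" by (simp add: log_height_def)
  finally have a: "log_height (Complex c t) ^ e \<le> fact e * (\<bar>t\<bar> + 3)" .
  have "1 \<le> norm (Complex c t)" "\<bar>t\<bar> \<le> norm (Complex c t)"
    using abs_Re_le_cmod[of "Complex c t"] abs_Im_le_cmod[of "Complex c t"] assms by auto
  hence "\<bar>t\<bar> + 3 \<le> 6 * norm (Complex c t)" "norm (Complex c t) > 0" by linarith+
  hence "fact e * (\<bar>t\<bar> + 3) \<le> fact e * (6 * norm (Complex c t))" by (intro mult_left_mono) auto
  with a have "log_height (Complex c t) ^ e \<le> fact e * (6 * norm (Complex c t))" by (rule order_trans)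
  hence "log_height (Complex c t) ^ e \<le> 6 * fact e * norm (Complex c t)" by (simp only: mult_ac)
  thus ?thesis using \<open>norm (Complex c t) > 0\<close> by (simp only: pos_divide_le_eq)
qed

lemma weighted_coeff_facts:
  fixes z :: complex and \<nu> :: prime_counter and y :: real and k :: nat
  assumes r: "1 \<le> r" "r < 2" and z: "norm z \<le> r" and c: "c > 1"
  defines "a \<equiv> \<lambda>n. rough_coeff \<nu> y z n * of_real (ln (real n) ^ k)"
  shows "integrable (count_space UNIV) (\<lambda>n. norm (a n) * exp (- c * ln (real n)))"
    and "(LINT n|count_space UNIV. a n * exp (- Complex c t * of_real (ln (real n)))) = (-1) ^ k * (deriv ^^ k) (rough_series \<nu> y z) (Complex c t)"
proof -
  have e: "a n * exp (- s * of_real (ln (real n))) = a n * of_nat n powr (- s)" for n s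
    by (cases "n = 0") (auto simp: a_def powr_def Ln_of_nat)
  have n1: "norm (a n) * exp (- c * ln (real n)) = norm (a n * of_nat n powr (- Complex c 0))" for n
    by (cases "n = 0") (auto simp: a_def norm_mult norm_of_nat_powr powr_def)
  obtain K where "summable (\<lambda>n. r ^ size (prime_factorization n) * ln (real n) ^ k * real n powr (- (1 + 1 / X)))" if "X \<ge> 1" for X
    using rankin_bound[OF r, of k] by metis
  note rk = this
  define X where "X = max 1 (1 / (c - 1))"
  have X: "X \<ge> 1" "1 + 1 / X \<le> c"
  proof -
    have "1 / X \<le> 1 / (1 / (c - 1))" using c by (intro divide_left_mono mult_pos_pos) (auto simp: X_def)
    thus "1 + 1 / X \<le> c" using c by simp
  qed (simp add: X_def)
  have "summable (\<lambda>n. norm (a n * of_nat n powr (- Complex c 0)))"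
  proof (rule summable_comparison_test[OF _ rk[OF X(1)]], intro exI allI impI)
    fix n :: nat
    show "norm (norm (a n * of_nat n powr (- Complex c 0))) \<le> r ^ size (prime_factorization n) * ln (real n) ^ k * real n powr (- (1 + 1 / X))"
    proof (cases "n = 0")
      case False
      thus ?thesis unfolding a_def norm_mult norm_of_nat_powr using X r
        by (auto simp: norm_mult norm_power norm_of_nat_powr abs_mult simp del: of_real_power intro!: mult_mono norm_rough_coeff_le[OF z] powr_mono)
    qed (auto simp: a_def)
  qed
  thus "integrable (count_space UNIV) (\<lambda>n. norm (a n) * exp (- c * ln (real n)))"
    unfolding n1 by (simp add: integrable_count_space_nat_iff)
  have sm: "summable (\<lambda>n. norm (a n * of_nat n powr (- Complex c t)))"
    using \<open>summable (\<lambda>n. norm (a n * of_nat n powr (- Complex c 0)))\<close> by (simp add: norm_mult norm_of_nat_powr)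
  have "(LINT n|count_space UNIV. a n * of_nat n powr (- Complex c t)) = (\<Sum>n. a n * of_nat n powr (- Complex c t))"
    using sm by (intro integral_count_space_nat) (simp add: integrable_count_space_nat_iff)
  also have "\<dots> = (-1) ^ k * (deriv ^^ k) (rough_series \<nu> y z) (Complex c t)"
    using weighted_rough_series[OF r z, of "Complex c t" \<nu> y k] c unfolding a_def by (simp add: sums_iff)
  finally show "(LINT n|count_space UNIV. a n * exp (- Complex c t * of_real (ln (real n)))) = (-1) ^ k * (deriv ^^ k) (rough_series \<nu> y z) (Complex c t)"
    unfolding e .
qed

text \<open>Both Perron integrals run over \<open>Re s = 1 + 1 / X\<close>, where
  \<open>exp (c * X) = exp 1 * exp X\<close>. In the near part two powers of
  \<open>1 / norm (s - 1)\<close> are kept and integrate to \<open>pi * X\<close>, the others are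
  bounded by powers of \<open>X\<close>; in the far part the Gaussian integrates to
  \<open>O(1 / l)\<close>.\<close>

lemma smoothed_difference_bound:
  assumes r: "1 \<le> r" "r < 2" and km: "m + 4 \<le> k"
  shows "\<exists>K X0. 0 < K \<and> 1 \<le> X0 \<and> (\<forall>\<nu> y z X l. norm z \<le> r \<longrightarrow> 3/2 \<le> y \<longrightarrow> X0 \<le> X \<longrightarrow> 0 < l \<longrightarrow> l \<le> 1/2 \<longrightarrow>
     norm ((LINT n|count_space UNIV. rough_coeff \<nu> y z n * of_real (ln (real n) ^ k) * of_real (smooth_cutoff l (1 + 1 / X) (X - ln (real n))))
         - (LINT v|lborel. model_density \<nu> y z k m v * of_real (smooth_cutoff l (1 + 1 / X) (X - v))))
       \<le> K * exp X * (ln y ^ (3 + m) * X powr (real k + Re z - real m - 1) + ln y ^ (k + 5) / l))"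
proof -
  have km': "m + 3 \<le> k" using km by simp
  obtain K \<delta>0 where K: "0 < K" "0 < \<delta>0" "\<delta>0 \<le> 1/2" and td: "\<forall>\<nu> y z s. norm z \<le> r \<longrightarrow> 3/2 \<le> y \<longrightarrow> 1 < Re s \<longrightarrow> Re s \<le> 1 + \<delta>0 \<longrightarrow>
     norm ((-1) ^ k * (deriv ^^ k) (rough_series \<nu> y z) s - model_transform \<nu> y z k m s)
       \<le> K * (ln y ^ (3 + m) * norm (s - 1) powr (real m - Re z - real k) + ln y ^ (k + 5) * log_height s ^ (18 + 9 * k))"
    using transform_difference_bound[OF r km'] by (elim exE conjE) (rule that; assumption)
  define E where "E = (6 * fact (18 + 9 * k) :: real)"
  have E: "E > 0" by (simp add: E_def)
  define K' where "K' = K * exp 1 * (1 + E)"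
  have main: "norm ((LINT n|count_space UNIV. rough_coeff \<nu> y z n * of_real (ln (real n) ^ k) * of_real (smooth_cutoff l (1 + 1 / X) (X - ln (real n))))
         - (LINT v|lborel. model_density \<nu> y z k m v * of_real (smooth_cutoff l (1 + 1 / X) (X - v))))
       \<le> K' * exp X * (ln y ^ (3 + m) * X powr (real k + Re z - real m - 1) + ln y ^ (k + 5) / l)" (is "norm (?A - ?B) \<le> _")
    if z: "norm z \<le> r" and y: "3/2 \<le> y" and X: "1 / \<delta>0 \<le> X" and l: "0 < l" "l \<le> 1/2" for \<nu> y z X l
  proof -
    have X1: "X \<ge> 2" "X > 0"
    proof -
      have "2 \<le> 1 / \<delta>0" using K by (simp add: field_simps)
      thus "X \<ge> 2" "X > 0" using X by linarith+
    qed
    define c where "c = 1 + 1 / X"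
    have c: "1 < c" "c \<le> 1 + \<delta>0" using X X1 K by (auto simp: c_def field_simps)
    have c0: "0 < c" using c by simp
    have ly: "1/3 \<le> ln y" by (rule ln_ge_third[OF y])
    have rez: "\<bar>Re z\<bar> \<le> 2" using z r abs_Re_le_cmod[of z] by linarith
    let ?a = "\<lambda>n. rough_coeff \<nu> y z n * of_real (ln (real n) ^ k)"
    let ?kern = "\<lambda>t. exp (Complex c t * of_real X) / Complex c t * of_real (exp (- (l * t)\<^sup>2 / 2))"
    let ?L1 = "\<lambda>t. (-1) ^ k * (deriv ^^ k) (rough_series \<nu> y z) (Complex c t)"
    let ?L2 = "\<lambda>t. model_transform \<nu> y z k m (Complex c t)"
    note wf = weighted_coeff_facts[OF r z c(1), of \<nu> y k]
    have sf1: "sigma_finite_measure (count_space (UNIV :: nat set))" by (rule sigma_finite_measure_count_space)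
    have p1: "(LINT t|lborel. ?L1 t * ?kern t) = of_real (2 * pi) * ?A" "integrable lborel (\<lambda>t. ?L1 t * ?kern t)"
      using perron_gauss[OF sf1 l(1) c0 _ _ wf(1), of X] unfolding wf(2) by (auto simp: c_def)
    note ml = model_density_laplace[OF le_less_trans[OF z r(2)] km', of "Complex c _" \<nu> y]
    have sf2: "sigma_finite_measure (lborel :: real measure)" by (rule lborel.sigma_finite_measure_axioms)
    have mlt: "(LINT v|lborel. model_density \<nu> y z k m v * exp (- Complex c t * of_real v)) = ?L2 t" for t using ml(1)[of t] c by simp
    have mli: "integrable lborel (\<lambda>v. norm (model_density \<nu> y z k m v) * exp (- c * v))" using ml(2)[of 0] c by simp
    have p2: "(LINT t|lborel. ?L2 t * ?kern t) = of_real (2 * pi) * ?B" "integrable lborel (\<lambda>t. ?L2 t * ?kern t)"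
      using perron_gauss[OF sf2 l(1) c0 _ _ mli, of X] unfolding mlt by (auto simp: c_def)
    have int: "integrable lborel (\<lambda>t. (?L1 t - ?L2 t) * ?kern t)"
      using Bochner_Integration.integrable_diff[OF p1(2) p2(2)] by (simp only: left_diff_distrib)
    have eq: "of_real (2 * pi) * (?A - ?B) = (LINT t|lborel. (?L1 t - ?L2 t) * ?kern t)"
      unfolding left_diff_distrib Bochner_Integration.integral_diff[OF p1(2) p2(2)] p1(1) p2(1) by (simp only: right_diff_distrib)
    \<comment> \<open>\<open>m + 4 \<le> k\<close> and \<open>Re z \<ge> - 2\<close> give
      \<open>q \<ge> 2\<close>, so that two powers can be set aside for the integrable
      kernel.\<close>
    define q where "q = real k + Re z - real m"
    have q: "q \<ge> 2" using rez km by (simp add: q_def)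
    define b where "b t = K * exp (c * X) * (ln y ^ (3 + m) * X powr (q - 2) * (1 / ((1 / X)\<^sup>2 + t\<^sup>2)) + ln y ^ (k + 5) * E * exp (- (l * t)\<^sup>2 / 2))" for t
    have bint: "has_bochner_integral lborel b (K * exp (c * X) * (ln y ^ (3 + m) * X powr (q - 2) * (pi / (1 / X)) + ln y ^ (k + 5) * E * (2 * pi * normal_density 0 l 0)))"
      unfolding b_def
    proof (intro has_bochner_integral_mult_right has_bochner_integral_add)
      show "has_bochner_integral lborel (\<lambda>t. 1 / ((1 / X)\<^sup>2 + t\<^sup>2)) (pi / (1 / X))" by (rule cauchy_kernel) (use X1 in auto)
      have "(LINT t|lborel. of_real (exp (- (l * t)\<^sup>2 / 2))) = (of_real (2 * pi * normal_density 0 l 0) :: complex)"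
        using gauss_fourier(1)[OF l(1), of 0] by simp
      hence "(LINT t|lborel. exp (- (l * t)\<^sup>2 / 2)) = 2 * pi * normal_density 0 l 0"
        unfolding integral_complex_of_real of_real_eq_iff .
      thus "has_bochner_integral lborel (\<lambda>t. exp (- (l * t)\<^sup>2 / 2)) (2 * pi * normal_density 0 l 0)"
        using gauss_fourier(2)[OF l(1)] by (simp add: has_bochner_integral_iff)
    qed
    have pt: "norm ((?L1 t - ?L2 t) * ?kern t) \<le> b t" for t
    proof -
      let ?s = "Complex c t"
      define n where "n = norm (?s - 1)"
      have s1: "?s - 1 = Complex (1 / X) t" by (simp add: complex_eq_iff c_def)
      have n2: "n\<^sup>2 = (1 / X)\<^sup>2 + t\<^sup>2" unfolding n_def s1 cmod_power2 by simp
      have n: "n \<ge> 1 / X" "n > 0" using abs_Re_le_cmod[of "?s - 1"] X1 unfolding n_def s1 by (auto intro: less_le_trans[of 0 "1 / X"])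
      have s1': "1 \<le> norm ?s" using abs_Re_le_cmod[of ?s] c by simp
      have "norm (?s - 1) powr (real m - Re z - real k) = n powr (- (q - 2)) * n powr (- 2)"
        unfolding powr_add[symmetric] by (simp add: n_def q_def)
      also have "\<dots> \<le> (1 / X) powr (- (q - 2)) * n powr (- 2)" using n X1 q by (intro mult_right_mono powr_mono2') auto
      also have "(1 / X) powr (- (q - 2)) = X powr (q - 2)"
        using X1 powr_minus_divide[of X "2 - q"] by (simp add: powr_divide)
      also have "n powr (- 2) = 1 / ((1 / X)\<^sup>2 + t\<^sup>2)" using n n2 by (simp add: powr_minus_divide powr_numeral)
      finally have b1: "norm (?s - 1) powr (real m - Re z - real k) \<le> X powr (q - 2) * (1 / ((1 / X)\<^sup>2 + t\<^sup>2))" .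
      have "norm (?L1 t - ?L2 t) \<le> K * (ln y ^ (3 + m) * norm (?s - 1) powr (real m - Re z - real k) + ln y ^ (k + 5) * log_height ?s ^ (18 + 9 * k))"
        using td z y c by simp
      also have "\<dots> \<le> K * (ln y ^ (3 + m) * (X powr (q - 2) * (1 / ((1 / X)\<^sup>2 + t\<^sup>2))) + ln y ^ (k + 5) * log_height ?s ^ (18 + 9 * k))"
        using b1 K ly by (intro mult_left_mono add_mono) auto
      finally have b2: "norm (?L1 t - ?L2 t) \<le> K * (ln y ^ (3 + m) * (X powr (q - 2) * (1 / ((1 / X)\<^sup>2 + t\<^sup>2))) + ln y ^ (k + 5) * log_height ?s ^ (18 + 9 * k))" .
      define P where "P = ln y ^ (3 + m) * (X powr (q - 2) * (1 / ((1 / X)\<^sup>2 + t\<^sup>2)))"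
      define Q where "Q = ln y ^ (k + 5)"
      define g where "g = exp (- (l * t)\<^sup>2 / 2)"
      have PQ: "0 \<le> P" "0 \<le> Q" "0 \<le> g" "g \<le> 1" using ly by (auto simp: P_def Q_def g_def)
      have nk: "norm (?kern t) = exp (c * X) / norm ?s * g" by (simp add: norm_mult norm_divide g_def)
      have "norm ((?L1 t - ?L2 t) * ?kern t) \<le> K * (P + Q * log_height ?s ^ (18 + 9 * k)) * (exp (c * X) / norm ?s * g)"
        unfolding norm_mult[of "?L1 t - ?L2 t"] nk using b2 PQ by (intro mult_right_mono) (auto simp: P_def Q_def)
      also have "\<dots> = K * exp (c * X) * (P * (g / norm ?s) + Q * (log_height ?s ^ (18 + 9 * k) / norm ?s) * g)"
        by (simp add: algebra_simps add_divide_distrib)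
      also have "\<dots> \<le> K * exp (c * X) * (P * 1 + Q * E * g)"
      proof (intro mult_left_mono add_mono mult_right_mono)
        show "g / norm ?s \<le> 1" using PQ s1' by (simp add: divide_le_eq)
        show "log_height ?s ^ (18 + 9 * k) / norm ?s \<le> E" unfolding E_def by (rule log_height_power_le) (use c in auto)
      qed (use PQ K in auto)
      finally show ?thesis by (simp add: b_def P_def Q_def g_def mult_ac)
    qed
    have "2 * pi * norm (?A - ?B) = norm (of_real (2 * pi) * (?A - ?B))" unfolding norm_mult by simp
    also have "\<dots> \<le> (LINT t|lborel. norm ((?L1 t - ?L2 t) * ?kern t))" unfolding eq by (rule integral_norm_bound)
    also have "\<dots> \<le> (LINT t|lborel. b t)" using bint int pt by (intro integral_mono) (auto simp: has_bochner_integral_iff)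
    also have "\<dots> = K * exp (c * X) * (ln y ^ (3 + m) * X powr (q - 2) * (pi / (1 / X)) + ln y ^ (k + 5) * E * (2 * pi * normal_density 0 l 0))"
      using bint by (simp add: has_bochner_integral_iff)
    also have "exp (c * X) = exp 1 * exp X" using X1 by (simp add: c_def exp_add[symmetric] algebra_simps)
    finally have "2 * pi * norm (?A - ?B) \<le> K * (exp 1 * exp X) * (ln y ^ (3 + m) * X powr (q - 2) * (pi / (1 / X)) + ln y ^ (k + 5) * E * (2 * pi * normal_density 0 l 0))"
      by simp
    also have "ln y ^ (3 + m) * X powr (q - 2) * (pi / (1 / X)) = ln y ^ (3 + m) * (pi * X powr (q - 1))"
      using X1 powr_add[of X "q - 2" 1] by simp
    also have "K * (exp 1 * exp X) * (ln y ^ (3 + m) * (pi * X powr (q - 1)) + ln y ^ (k + 5) * E * (2 * pi * normal_density 0 l 0))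
       \<le> K * (exp 1 * exp X) * (ln y ^ (3 + m) * (2 * pi * X powr (q - 1)) + ln y ^ (k + 5) * E * (2 * pi * (1 / l)))"
    proof (intro mult_left_mono add_mono)
      have "sqrt (2 * pi * l\<^sup>2) \<ge> sqrt (1 * l\<^sup>2)" using pi_gt3 by (intro real_sqrt_le_mono mult_right_mono) auto
      hence "l \<le> sqrt (2 * pi * l\<^sup>2)" using l by simp
      hence "1 / sqrt (2 * pi * l\<^sup>2) \<le> 1 / l" using l by (intro divide_left_mono mult_pos_pos) auto
      thus "normal_density 0 l 0 \<le> 1 / l" by (simp add: normal_density_def)
    qed (use K E ly X1 in auto)
    also have "\<dots> \<le> 2 * pi * (K' * exp X * (ln y ^ (3 + m) * X powr (q - 1) + ln y ^ (k + 5) / l))"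
    proof -
      define P where "P = ln y ^ (3 + m) * X powr (q - 1)"
      define Q where "Q = ln y ^ (k + 5) / l"
      have PQ: "0 \<le> P" "0 \<le> Q" using ly l by (auto simp: P_def Q_def)
      have "P + E * Q \<le> (1 + E) * (P + Q)" using PQ E by (simp add: algebra_simps)
      hence "2 * pi * (K * exp 1 * exp X) * (P + E * Q) \<le> 2 * pi * (K * exp 1 * exp X) * ((1 + E) * (P + Q))"
        using K by (intro mult_left_mono) auto
      thus ?thesis by (simp add: K'_def P_def Q_def field_simps)
    qed
    finally have "norm (?A - ?B) \<le> K' * exp X * (ln y ^ (3 + m) * X powr (q - 1) + ln y ^ (k + 5) / l)" by simp
    thus ?thesis by (simp add: q_def algebra_simps)
  qed
  have "K' > 0" unfolding K'_def using K E by (intro mult_pos_pos add_pos_pos) auto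
  moreover have "1 \<le> 1 / \<delta>0" using K by (simp add: field_simps)
  ultimately show ?thesis using main by (intro exI[of _ K'] exI[of _ "1 / \<delta>0"]) auto
qed

section \<open>Sums and integrals against the smoothing weight\<close>

lemma power_Suc_diff_ge:
  assumes "n > 0"
  shows "real (Suc p) * real n ^ p \<le> real (Suc n) ^ Suc p - real n ^ Suc p"
proof -
  have "1 + real (Suc p) * (1 / real n) \<le> (1 + 1 / real n) ^ Suc p"
    by (rule Bernoulli_inequality) (use assms in \<open>auto intro: order_trans[of _ 0]\<close>)
  hence "real n ^ Suc p * (1 + real (Suc p) * (1 / real n)) \<le> real n ^ Suc p * (1 + 1 / real n) ^ Suc p"
    by (intro mult_left_mono) auto
  also have "\<dots> = (real n * (1 + 1 / real n)) ^ Suc p" by (simp only: power_mult_distrib)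
  also have "real n * (1 + 1 / real n) = real (Suc n)" using assms by (simp add: field_simps)
  finally have "real n ^ Suc p * (1 + real (Suc p) * (1 / real n)) \<le> real (Suc n) ^ Suc p" .
  moreover have "real n ^ Suc p * (1 + real (Suc p) * (1 / real n)) = real n ^ Suc p + real (Suc p) * real n ^ p"
    using assms by (simp add: field_simps)
  ultimately show ?thesis by linarith
qed

lemma inverse_power_diff_ge:
  assumes "n > 0"
  shows "real p / real (Suc n) ^ Suc p \<le> 1 / real n ^ p - 1 / real (Suc n) ^ p"
proof -
  have "1 + real p * (1 / real (Suc n)) \<le> 1 + real p * (1 / real n)"
    using assms by (intro add_left_mono mult_left_mono divide_left_mono) auto
  also have "\<dots> \<le> (1 + 1 / real n) ^ p"
    by (rule Bernoulli_inequality) (use assms in \<open>auto intro: order_trans[of _ 0]\<close>)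
  finally have "1 / real (Suc n) ^ p * (1 + real p * (1 / real (Suc n))) \<le> 1 / real (Suc n) ^ p * (1 + 1 / real n) ^ p"
    by (intro mult_left_mono) auto
  also have "1 + 1 / real n = real (Suc n) / real n" using assms by (simp add: field_simps)
  also have "1 / real (Suc n) ^ p * (real (Suc n) / real n) ^ p = 1 / real n ^ p"
    by (simp add: power_divide del: of_nat_Suc)
  finally show ?thesis by (simp add: algebra_simps del: of_nat_Suc)
qed

text \<open>With \<open>x = exp X\<close> the summand is \<open>(n / x) ^ p\<close> below
  \<open>x\<close> and \<open>(x / n) ^ p\<close> above. Both parts telescope against Bernoulli's
  inequality and give \<open>x / p\<close> and \<open>2 * x / p\<close>; the two integers next to
  \<open>x\<close> are bounded by 1 each, whence the summand 2.\<close>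

lemma kernel_sum:
  fixes X :: real and p :: nat
  assumes X: "X \<ge> 0" and p: "p \<ge> 2"
  defines "f \<equiv> \<lambda>n. if n = 0 then 0 else exp (- real p * \<bar>X - ln (real n)\<bar>)"
  shows "summable f" "suminf f \<le> 2 + 3 * exp X / real p"
proof -
  define x where "x = exp X"
  have x1: "x \<ge> 1" using X by (simp add: x_def)
  have lnx: "ln x = X" by (simp add: x_def)
  define N where "N = nat \<lfloor>x\<rfloor>"
  have N: "real N \<le> x" "x < real N + 1" "N \<ge> 1" using x1 unfolding N_def by linarith+
  have f0: "0 \<le> f n" "f n \<le> 1" for n using p by (auto simp: f_def)
  have low: "f n = (real n / x) ^ p" if "n > 0" "real n \<le> x" for n
  proof -
    have "ln (real n) \<le> X" using that unfolding lnx[symmetric] by (intro ln_mono) auto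
    hence "f n = exp (real p * (ln (real n) - X))" using that by (simp add: f_def algebra_simps)
    also have "\<dots> = exp (ln (real n) - X) ^ p" by (simp add: exp_of_nat_mult)
    also have "exp (ln (real n) - X) = real n / x" using that by (simp add: exp_diff x_def)
    finally show ?thesis .
  qed
  have high: "f n = (x / real n) ^ p" if "n > 0" "real n \<ge> x" for n
  proof -
    have "ln (real n) \<ge> X" using that x1 unfolding lnx[symmetric] by (intro ln_mono) auto
    hence "f n = exp (real p * (X - ln (real n)))" using that by (simp add: f_def algebra_simps)
    also have "\<dots> = exp (X - ln (real n)) ^ p" by (simp add: exp_of_nat_mult)
    also have "exp (X - ln (real n)) = x / real n" using that by (simp add: exp_diff x_def)
    finally show ?thesis .
  qed
  have s1: "(\<Sum>n=1..<N. f n) \<le> x / real p"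
  proof -
    have "(\<Sum>n=1..<N. f n) \<le> (\<Sum>n=1..<N. (real (Suc n) ^ Suc p - real n ^ Suc p) / (real (Suc p) * x ^ p))"
    proof (intro sum_mono)
      fix n assume n: "n \<in> {1..<N}"
      have "f n = (real (Suc p) * real n ^ p) / (real (Suc p) * x ^ p)"
        using n N low[of n] by (simp add: power_divide del: of_nat_Suc)
      also have "\<dots> \<le> (real (Suc n) ^ Suc p - real n ^ Suc p) / (real (Suc p) * x ^ p)"
        using n x1 by (intro divide_right_mono power_Suc_diff_ge) auto
      finally show "f n \<le> (real (Suc n) ^ Suc p - real n ^ Suc p) / (real (Suc p) * x ^ p)" .
    qed
    also have "\<dots> = (real N ^ Suc p - 1 ^ Suc p) / (real (Suc p) * x ^ p)"
      unfolding sum_divide_distrib[symmetric] using N sum_Suc_diff'[of 1 N "\<lambda>n. real n ^ Suc p"] by simp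
    also have "\<dots> \<le> x ^ Suc p / (real p * x ^ p)"
    proof (rule frac_le)
      have "real N ^ Suc p \<le> x ^ Suc p" using N by (intro power_mono) auto
      thus "real N ^ Suc p - 1 ^ Suc p \<le> x ^ Suc p" by simp
    qed (use x1 p in \<open>auto intro: mult_right_mono\<close>)
    also have "\<dots> = x / real p" using x1 by simp
    finally show ?thesis .
  qed
  have s2: "(\<Sum>n=N+2..<K. f n) \<le> 2 * x / real p" for K
  proof (cases "K \<le> N + 2")
    case True
    thus ?thesis using x1 by simp
  next
    case False
    obtain q where q: "p = Suc q" "q \<ge> 1" using p by (cases p) auto
    have "(\<Sum>n=N+2..<K. f n) = (\<Sum>n=N+1..<K-1. f (Suc n))"
      using False sum.shift_bounds_Suc_ivl[of f "N+1" "K-1"] by simp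
    also have "\<dots> \<le> (\<Sum>n=N+1..<K-1. x ^ p / real q * (1 / real n ^ q - 1 / real (Suc n) ^ q))"
    proof (intro sum_mono)
      fix n assume n: "n \<in> {N+1..<K-1}"
      have "f (Suc n) = x ^ p / real q * (real q / real (Suc n) ^ Suc q)"
        using n N q high[of "Suc n"] by (simp add: power_divide del: of_nat_Suc)
      also have "\<dots> \<le> x ^ p / real q * (1 / real n ^ q - 1 / real (Suc n) ^ q)"
        using n x1 by (intro mult_left_mono inverse_power_diff_ge) auto
      finally show "f (Suc n) \<le> x ^ p / real q * (1 / real n ^ q - 1 / real (Suc n) ^ q)" .
    qed
    also have "\<dots> = x ^ p / real q * (1 / real (N+1) ^ q - 1 / real (K-1) ^ q)"
    proof -
      have "(\<Sum>n=N+1..<K-1. (- (1 / real (Suc n) ^ q)) - (- (1 / real n ^ q))) = (- (1 / real (K-1) ^ q)) - (- (1 / real (N+1) ^ q))"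
        using False by (intro sum_Suc_diff') auto
      hence "(\<Sum>n=N+1..<K-1. 1 / real n ^ q - 1 / real (Suc n) ^ q) = 1 / real (N+1) ^ q - 1 / real (K-1) ^ q"
        by (simp only: minus_diff_minus minus_diff_eq)
      thus ?thesis by (simp only: sum_distrib_left[symmetric])
    qed
    also have "\<dots> \<le> x ^ p / real q * (1 / x ^ q)"
    proof (intro mult_left_mono)
      have "1 / real (N+1) ^ q \<le> 1 / x ^ q" using N x1 by (intro divide_left_mono power_mono mult_pos_pos) auto
      moreover have "0 \<le> 1 / real (K-1) ^ q" by simp
      ultimately show "1 / real (N+1) ^ q - 1 / real (K-1) ^ q \<le> 1 / x ^ q" by linarith
    qed (use x1 in auto)
    also have "\<dots> = x / real q" using x1 q by simp
    \<comment> \<open>\<open>q = p - 1 \<ge> p / 2\<close> because \<open>p \<ge> 2\<close>.\<close>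
    also have "\<dots> \<le> x / (real p / 2)" using q x1 by (intro divide_left_mono) auto
    finally show ?thesis by (simp add: mult.commute)
  qed
  have partial: "(\<Sum>n<K. f n) \<le> 2 + 3 * exp X / real p" for K
  proof -
    have "(\<Sum>n<K. f n) \<le> (\<Sum>n\<in>{0} \<union> {1..<N} \<union> {N, N+1} \<union> {N+2..<K}. f n)"
      using f0 by (intro sum_mono2) auto
    also have "\<dots> = (\<Sum>n\<in>{0} \<union> {1..<N} \<union> {N, N+1}. f n) + (\<Sum>n=N+2..<K. f n)"
      by (intro sum.union_disjoint) auto
    also have "(\<Sum>n\<in>{0} \<union> {1..<N} \<union> {N, N+1}. f n) = (\<Sum>n\<in>{0} \<union> {1..<N}. f n) + (\<Sum>n\<in>{N, N+1}. f n)"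
      using N by (intro sum.union_disjoint) auto
    also have "(\<Sum>n\<in>{0} \<union> {1..<N}. f n) = f 0 + (\<Sum>n=1..<N. f n)" by (subst sum.union_disjoint) auto
    also have "f 0 = 0" by (simp add: f_def)
    also have "(\<Sum>n\<in>{N, N+1}. f n) = f N + f (N+1)" by simp
    finally have "(\<Sum>n<K. f n) \<le> x / real p + (1 + 1) + 2 * x / real p"
      using s1 s2[of K] f0(2)[of N] f0(2)[of "N+1"] by linarith
    thus ?thesis by (simp add: x_def add_divide_distrib[symmetric])
  qed
  show "summable f" by (rule summableI_nonneg_bounded[OF f0(1) partial])
  thus "suminf f \<le> 2 + 3 * exp X / real p" by (rule suminf_le_const[OF _ partial])
qed

lemma has_bochner_integral_affine:
  fixes f :: "real \<Rightarrow> real"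
  assumes "has_bochner_integral lborel f x" "c \<noteq> 0"
  shows "has_bochner_integral lborel (\<lambda>v. f (t + c * v)) (x /\<^sub>R \<bar>c\<bar>)"
  using lborel_has_bochner_integral_real_affine_iff[OF assms(2), of f x t] assms(1) by simp

lemma exp_half_line:
  fixes \<sigma> :: real
  assumes "\<sigma> > 0"
  shows "has_bochner_integral lborel (\<lambda>v. if v > 0 then exp (- \<sigma> * v) else 0) (1 / \<sigma>)"
proof -
  have eq: "norm (gamma_density 1 v) * exp (- \<sigma> * v) = (if v > 0 then exp (- \<sigma> * v) else 0)" for v
    by (auto simp: norm_gamma_density)
  have i: "integrable lborel (\<lambda>v. if v > 0 then exp (- \<sigma> * v) else 0)"
    using integrable_gamma_density[of 1 \<sigma>] assms unfolding eq by simp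
  have "gamma_density 1 v * exp (- of_real \<sigma> * of_real v) = of_real (if v > 0 then exp (- \<sigma> * v) else 0)" for v
    by (auto simp: gamma_density_def simp flip: exp_of_real)
  hence "(LINT v|lborel. of_real (if v > 0 then exp (- \<sigma> * v) else 0)) = (of_real (1 / \<sigma>) :: complex)"
    using gamma_laplace_real[of 1 \<sigma>] assms by (simp add: powr_minus inverse_eq_divide)
  hence "(LINT v|lborel. (if v > 0 then exp (- \<sigma> * v) else 0)) = 1 / \<sigma>"
    unfolding integral_complex_of_real of_real_eq_iff .
  thus ?thesis using i by (simp add: has_bochner_integral_iff)
qed

lemma exp_ray_integral:
  fixes X :: real
  shows "has_bochner_integral lborel (\<lambda>v. if v < X then exp v else 0) (exp X)"
proof -
  have "has_bochner_integral lborel (\<lambda>v. if v > 0 then exp (- 1 * v) else (0::real)) (1 / 1)" by (rule exp_half_line) simp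
  from has_bochner_integral_affine[OF this, of "-1" X]
  have "has_bochner_integral lborel (\<lambda>v. exp X * (if X + (-1) * v > 0 then exp (- 1 * (X + (-1) * v)) else 0)) (exp X * (1 /\<^sub>R \<bar>-1\<bar>))"
    by (intro has_bochner_integral_mult_right) auto
  also have "(\<lambda>v. exp X * (if X + (-1) * v > 0 then exp (- 1 * (X + (-1) * v)) else 0)) = (\<lambda>v. if v < X then exp v else 0)"
    by (auto simp: fun_eq_iff exp_add[symmetric])
  finally show ?thesis by simp
qed

text \<open>Splitting at \<open>v = X\<close> leaves two exponentials with masses
  \<open>exp X / (p + 1)\<close> and \<open>exp X / (p - 1)\<close>. Unlike the sum there is no
  contribution of isolated points.\<close>

lemma kernel_integral:
  assumes p: "p \<ge> (2::nat)"
  shows "integrable lborel (\<lambda>v. exp (v - real p * \<bar>X - v\<bar>))"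
    and "(LINT v|lborel. exp (v - real p * \<bar>X - v\<bar>)) \<le> 3 * exp X / real p"
proof -
  have p1: "real p + 1 > 0" "real p - 1 > 0" using p by auto
  let ?h = "\<lambda>\<sigma> v. if v > (0::real) then exp (- \<sigma> * v) else 0"
  have a: "has_bochner_integral lborel (\<lambda>v. exp X * (?h (real p + 1) (X + (-1) * v))) (exp X * ((1 / (real p + 1)) /\<^sub>R \<bar>-1\<bar>))"
    by (intro has_bochner_integral_mult_right has_bochner_integral_affine exp_half_line[OF p1(1)]) auto
  have b: "has_bochner_integral lborel (\<lambda>v. exp X * (?h (real p - 1) (- X + 1 * v))) (exp X * ((1 / (real p - 1)) /\<^sub>R \<bar>1\<bar>))"
    by (intro has_bochner_integral_mult_right has_bochner_integral_affine exp_half_line[OF p1(2)]) auto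
  have "has_bochner_integral lborel (\<lambda>v. exp (v - real p * \<bar>X - v\<bar>)) (exp X * ((1 / (real p + 1)) /\<^sub>R \<bar>-1\<bar>) + exp X * ((1 / (real p - 1)) /\<^sub>R \<bar>1\<bar>))"
  proof (subst has_bochner_integral_cong_AE)
    show "AE v in lborel. exp (v - real p * \<bar>X - v\<bar>) = exp X * (?h (real p + 1) (X + (-1) * v)) + exp X * (?h (real p - 1) (- X + 1 * v))"
      using AE_lborel_singleton[of X]
    proof eventually_elim
      case (elim v)
      show ?case
      proof (cases "v < X")
        case True
        thus ?thesis by (simp add: exp_add[symmetric] algebra_simps)
      next
        case False
        thus ?thesis using elim by (simp add: exp_add[symmetric] algebra_simps)
      qed
    qed
  qed (use has_bochner_integral_add[OF a b] in auto)
  moreover have "exp X * ((1 / (real p + 1)) /\<^sub>R \<bar>-1\<bar>) + exp X * ((1 / (real p - 1)) /\<^sub>R \<bar>1\<bar>) \<le> 3 * exp X / real p"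
  proof -
    have e3: "exp X * (1 / real p + 2 / real p) = 3 * exp X / real p" by (simp add: add_divide_distrib[symmetric])
    have "1 / (real p + 1) \<le> 1 / real p" "1 / (real p - 1) \<le> 2 / real p" using p by (auto simp: field_simps)
    hence "1 / (real p + 1) + 1 / (real p - 1) \<le> 1 / real p + 2 / real p" by linarith
    hence "exp X * (1 / (real p + 1) + 1 / (real p - 1)) \<le> exp X * (1 / real p + 2 / real p)" by (intro mult_left_mono) auto
    thus ?thesis unfolding e3 by (simp add: distrib_left)
  qed
  ultimately show "integrable lborel (\<lambda>v. exp (v - real p * \<bar>X - v\<bar>))"
    "(LINT v|lborel. exp (v - real p * \<bar>X - v\<bar>)) \<le> 3 * exp X / real p"
    by (simp_all only: has_bochner_integral_iff)
qed

text \<open>Half of the decay pays for replacing \<open>v\<close> by \<open>X\<close>: with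
  \<open>u = \<bar>X - v\<bar>\<close>, \<open>v \<le> X * (1 + u)\<close> and
  \<open>(1 + u) ^ k \<le> fact k * exp (1 + u)\<close>, and \<open>p \<ge> 1\<close> absorbs
  \<open>exp u\<close>.\<close>

lemma weight_absorb:
  assumes v: "0 \<le> v" and X: "1 \<le> X" and p: "1 \<le> p" and a: "0 \<le> a" "a \<le> real k"
  shows "v powr a * exp (- (2 * p) * \<bar>X - v\<bar>) \<le> fact k * exp 1 * X powr a * exp (- p * \<bar>X - v\<bar>)"
proof -
  define u where "u = \<bar>X - v\<bar>"
  have u: "u \<ge> 0" by (simp add: u_def)
  have "v \<le> X + u" by (simp add: u_def)
  also have "\<dots> \<le> X * (1 + u)" using X u mult_right_mono[OF X u] by (simp add: distrib_left)
  finally have "v powr a \<le> (X * (1 + u)) powr a" using v a by (intro powr_mono2) auto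
  also have "\<dots> = X powr a * (1 + u) powr a" using X u by (intro powr_mult)
  also have "(1 + u) powr a \<le> (1 + u) powr real k" using u a by (intro powr_mono) auto
  also have "\<dots> = (1 + u) ^ k" using u by (intro powr_realpow) auto
  also have "\<dots> \<le> fact k * exp (1 + u)" using u by (intro power_le_fact_exp) auto
  finally have 1: "v powr a \<le> X powr a * (fact k * exp (1 + u))" by (simp add: mult_left_mono)
  have "v powr a * exp (- (2 * p) * u) \<le> X powr a * (fact k * exp (1 + u)) * exp (- (2 * p) * u)"
    using 1 by (intro mult_right_mono) auto
  also have "\<dots> = fact k * X powr a * exp (1 + u - 2 * p * u)" by (simp add: exp_add[symmetric] mult_ac)
  also have "\<dots> \<le> fact k * X powr a * exp (1 - p * u)"
    using mult_right_mono[OF p u] by (intro mult_left_mono) auto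
  also have "\<dots> = fact k * exp 1 * X powr a * exp (- p * u)" by (simp add: exp_diff exp_minus field_simps)
  finally show ?thesis by (simp add: u_def)
qed

text \<open>The weight of \<open>smoothing_error\<close> at \<open>l = 1 / (2 * p)\<close>, written
  in the shape that matches it. An integral \<open>p\<close> turns the exponential at
  \<open>v = ln n\<close> into an integral power of \<open>n / exp X\<close> or its inverse.\<close>

definition smoothing_weight :: "nat \<Rightarrow> real \<Rightarrow> real \<Rightarrow> real" where
  "smoothing_weight p X v = exp (- \<bar>X - v\<bar> / (1 / (2 * real p))) + (if v \<le> X then (1 / (2 * real p))\<^sup>2 else 0)"

lemma smoothing_weight_altdef:
  "smoothing_weight p X v = exp (- (2 * real p) * \<bar>X - v\<bar>) + (if v \<le> X then 1 / (4 * real p ^ 2) else 0)"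
  by (simp add: smoothing_weight_def power_divide power_mult_distrib mult_ac)

lemma smoothing_weight_nonneg: "0 \<le> smoothing_weight p X v"
  by (simp add: smoothing_weight_altdef)

lemma smoothing_weight_le_exp:
  assumes "1 \<le> c" "c \<le> 2" "1 \<le> p"
  shows "smoothing_weight p X v \<le> 2 * exp (c * (X - v))"
proof -
  have "exp (- \<bar>X - v\<bar> / (1 / (2 * real p))) \<le> exp (c * (X - v))"
    using assms by (intro exp_neg_abs_le) (auto simp: field_simps)
  moreover have "(if v \<le> X then 1 / (4 * real p ^ 2) else 0) \<le> exp (c * (X - v))"
  proof (cases "v \<le> X")
    case True
    have "1 * 1 \<le> 4 * real p ^ 2" using assms by (intro mult_mono one_le_power) auto
    hence "1 / (4 * real p ^ 2) \<le> 1" using frac_le[of 1 1 1 "4 * real p ^ 2"] by simp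
    also have "1 \<le> exp (c * (X - v))" using True assms by simp
    finally show ?thesis using True by simp
  qed simp
  moreover have "exp (- \<bar>X - v\<bar> / (1 / (2 * real p))) = exp (- (2 * real p) * \<bar>X - v\<bar>)" by (simp add: mult_ac)
  ultimately show ?thesis unfolding smoothing_weight_altdef by linarith
qed

text \<open>\<open>weight_absorb\<close> replaces the logarithms by \<open>X\<close>; what is left
  is \<open>kernel_sum\<close> plus the number of \<open>n \<le> exp X\<close> with the small factor
  \<open>1 / (4 * p ^ 2)\<close>. As \<open>ln 0 = 0\<close>, a positive \<open>k\<close> makes the
  term at \<open>n = 0\<close> vanish.\<close>

lemma log_power_weight_sum:
  fixes X :: real and p k :: nat
  assumes X: "1 \<le> X" and p: "2 \<le> p"
  defines "f \<equiv> \<lambda>n. ln (real n) ^ k * smoothing_weight p X (ln (real n))"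
  assumes k: "k > 0"
  shows "summable f" "suminf f \<le> 12 * fact k * X ^ k * (1 + exp X / real p)"
proof -
  define g where "g n = (if n = 0 then 0 else exp (- real p * \<bar>X - ln (real n)\<bar>))" for n :: nat
  define h' where "h' n = (if n > 0 \<and> ln (real n) \<le> X then (1::real) else 0)" for n :: nat
  have gs: "summable g" "suminf g \<le> 2 + 3 * exp X / real p"
    using kernel_sum[of X p] X p unfolding g_def by auto
  have h'fin: "{n. n > 0 \<and> ln (real n) \<le> X} \<subseteq> {1..nat \<lfloor>exp X\<rfloor>}"
  proof
    fix n :: nat assume n: "n \<in> {n. n > 0 \<and> ln (real n) \<le> X}"
    hence "real n \<le> exp X" by (metis (mono_tags, lifting) exp_le_cancel_iff exp_ln mem_Collect_eq of_nat_0_less_iff)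
    thus "n \<in> {1..nat \<lfloor>exp X\<rfloor>}" using n by (auto simp: le_nat_floor)
  qed
  have finh: "finite {n. n > 0 \<and> ln (real n) \<le> X}" by (rule finite_subset[OF h'fin]) auto
  have hs: "h' sums (\<Sum>n | n > 0 \<and> ln (real n) \<le> X. 1)"
    unfolding h'_def using sums_If_finite[OF finh, of "\<lambda>_. 1::real"] by simp
  have hle: "suminf h' \<le> exp X"
  proof -
    have "suminf h' = real (card {n. n > 0 \<and> ln (real n) \<le> X})" using hs by (simp add: sums_iff)
    also have "card {n. n > 0 \<and> ln (real n) \<le> X} \<le> card {1..nat \<lfloor>exp X\<rfloor>}" by (intro card_mono h'fin) auto
    also have "real (card {1..nat \<lfloor>exp X\<rfloor>}) \<le> exp X" by simp
    finally show ?thesis by simp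
  qed
  let ?u = "\<lambda>n. fact k * exp 1 * X ^ k * g n + X ^ k / (4 * real p ^ 2) * h' n"
  have f0: "0 \<le> f n" for n
    unfolding f_def by (cases "n = 0") (use k in \<open>auto intro!: mult_nonneg_nonneg smoothing_weight_nonneg\<close>)
  have le: "f n \<le> ?u n" for n
  proof (cases "n = 0")
    case True
    thus ?thesis using k by (simp add: f_def g_def h'_def zero_power)
  next
    case False
    define v where "v = ln (real n)"
    have v: "v \<ge> 0" using False by (simp add: v_def)
    have pk: "v ^ k = v powr real k" using k v by (cases "v = 0") (auto simp: powr_realpow)
    have "v powr real k * exp (- (2 * real p) * \<bar>X - v\<bar>) \<le> fact k * exp 1 * X powr real k * exp (- real p * \<bar>X - v\<bar>)"
      using v X p by (intro weight_absorb) auto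
    hence 1: "v ^ k * exp (- (2 * real p) * \<bar>X - v\<bar>) \<le> fact k * exp 1 * X ^ k * g n"
      unfolding pk using X False by (simp add: g_def v_def powr_realpow)
    have 2: "v ^ k * (if v \<le> X then 1 / (4 * real p ^ 2) else 0) \<le> X ^ k / (4 * real p ^ 2) * h' n"
      using False v by (auto simp: h'_def v_def intro!: divide_right_mono power_mono)
    show ?thesis unfolding f_def smoothing_weight_altdef v_def[symmetric] distrib_left using 1 2 by linarith
  qed
  have us: "summable ?u" using gs hs by (intro summable_add summable_mult) (auto simp: sums_iff)
  show "summable f" by (rule summable_comparison_test[OF _ us]) (use le f0 in auto)
  hence "suminf f \<le> suminf ?u" by (intro suminf_le le us)
  also have "\<dots> = fact k * exp 1 * X ^ k * suminf g + X ^ k / (4 * real p ^ 2) * suminf h'"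
    by (intro sums_unique[symmetric] sums_add sums_mult summable_sums) (use gs hs in \<open>auto simp: sums_iff\<close>)
  also have "\<dots> \<le> fact k * 3 * X ^ k * (2 + 3 * exp X / real p) + fact k * X ^ k * (exp X / real p)"
  proof (rule add_mono)
    have "2 + 3 * exp X / real p \<ge> 0" by simp
    thus "fact k * exp 1 * X ^ k * suminf g \<le> fact k * 3 * X ^ k * (2 + 3 * exp X / real p)"
      using gs exp_le X suminf_nonneg[OF gs(1)] by (intro mult_mono) (auto simp: g_def)
    have "X ^ k / (4 * real p ^ 2) * suminf h' \<le> X ^ k / (4 * real p ^ 2) * exp X"
      using hle X by (intro mult_left_mono) auto
    also have "\<dots> = 1 * X ^ k * (exp X / (4 * real p ^ 2))" by simp
    also have "\<dots> \<le> fact k * X ^ k * (exp X / real p)"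
    proof (intro mult_mono divide_left_mono)
      have "real p * 1 \<le> real p * (4 * real p)" using p by (intro mult_left_mono) auto
      thus "real p \<le> 4 * real p ^ 2" by (simp add: power2_eq_square)
    qed (use X p in \<open>auto simp: fact_ge_1\<close>)
    finally show "X ^ k / (4 * real p ^ 2) * suminf h' \<le> fact k * X ^ k * (exp X / real p)" .
  qed
  also have "\<dots> = fact k * X ^ k * (6 + 10 * (exp X / real p))" by (simp add: algebra_simps)
  also have "\<dots> \<le> fact k * X ^ k * (12 * (1 + exp X / real p))"
  proof (rule mult_left_mono)
    have "6 + 10 * q \<le> 12 * (1 + q)" if "0 \<le> q" for q :: real using that by simp
    thus "6 + 10 * (exp X / real p) \<le> 12 * (1 + exp X / real p)" by this simp
  qed (use X in auto)
  finally show "suminf f \<le> 12 * fact k * X ^ k * (1 + exp X / real p)" by (simp add: mult_ac)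
qed

lemma exists_larger_base:
  assumes "1 \<le> r" "r < (2::real)"
  shows "\<exists>\<theta>>0. r powr (1 + \<theta>) < 2"
proof -
  define \<theta> where "\<theta> = (if r = 1 then 1 else (ln 2 / ln r - 1) / 2)"
  show ?thesis
  proof (cases "r = 1")
    case False
    hence r: "1 < r" "0 < ln r" "ln r < ln 2" using assms by auto
    have t: "\<theta> > 0" "(1 + \<theta>) * ln r < ln 2" using r False by (auto simp: \<theta>_def field_simps)
    hence "exp ((1 + \<theta>) * ln r) < exp (ln 2)" by (simp only: exp_less_cancel_iff)
    hence "r powr (1 + \<theta>) < 2" using r by (simp add: powr_def)
    thus ?thesis using t by blast
  qed (auto intro: exI[of _ 1])
qed

text \<open>Sums of \<open>r ^ \<Omega>(n)\<close> over short intervals are avoided by splitting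
  \<open>r ^ \<Omega> \<le> M + M powr (- \<theta>) * r powr ((1 + \<theta>) * \<Omega>)\<close>: the first part is trivial to count, and Rankin's trick
  handles the second because \<open>r powr (1 + \<theta>) < 2\<close>.\<close>

lemma sum_smoothing_bound:
  assumes r: "1 \<le> r" "r < 2" and \<theta>: "\<theta> > 0" "r powr (1 + \<theta>) < 2" and k: "k > 0"
  shows "\<exists>C>0. \<forall>\<nu> y z X p M. norm z \<le> r \<longrightarrow> 1 \<le> X \<longrightarrow> 2 \<le> p \<longrightarrow> 1 \<le> M \<longrightarrow>
    (LINT n|count_space UNIV. norm (rough_coeff \<nu> y z n * of_real (ln (real n) ^ k)) * smoothing_weight p X (ln (real n)))
      \<le> C * X ^ k * (M * (1 + exp X / real p) + M powr (- \<theta>) * exp X * X\<^sup>2)"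
proof -
  define r1 where "r1 = r powr (1 + \<theta>)"
  have r1: "1 \<le> r1" "r1 < 2" using r \<theta> by (auto simp: r1_def ge_one_powr_ge_zero)
  obtain K where K: "K > 0" and rk0: "\<forall>X\<ge>1. summable (\<lambda>n. r1 ^ size (prime_factorization n) * ln (real n) ^ k * real n powr (- (1 + 1 / X))) \<and>
     (\<Sum>n. r1 ^ size (prime_factorization n) * ln (real n) ^ k * real n powr (- (1 + 1 / X))) \<le> K * X powr (r1 + real k)"
    using rankin_bound[OF r1, of k] by (elim exE conjE) (rule that; assumption)
  note rk = rk0[rule_format]
  define C where "C = 12 * fact k + 2 * exp 1 * K"
  have C: "C > 0" using K by (simp add: C_def add_pos_pos)
  have main: "(LINT n|count_space UNIV. norm (rough_coeff \<nu> y z n * of_real (ln (real n) ^ k)) * smoothing_weight p X (ln (real n)))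
      \<le> C * X ^ k * (M * (1 + exp X / real p) + M powr (- \<theta>) * exp X * X\<^sup>2)"
    if z: "norm z \<le> r" and X: "1 \<le> X" and p: "2 \<le> p" and M: "1 \<le> M" for \<nu> y z X p M
  proof -
    define c where "c = 1 + 1 / X"
    have c: "1 \<le> c" "c \<le> 2" using X by (auto simp: c_def)
    let ?w = "\<lambda>n. smoothing_weight p X (ln (real n))"
    let ?t = "\<lambda>n. norm (rough_coeff \<nu> y z n * of_real (ln (real n) ^ k)) * ?w n"
    let ?a = "\<lambda>n. ln (real n) ^ k * ?w n"
    let ?b = "\<lambda>n. r1 ^ size (prime_factorization n) * ln (real n) ^ k * real n powr (- (1 + 1 / X))"
    let ?u = "\<lambda>n. M * ?a n + M powr (- \<theta>) * (2 * exp (c * X)) * ?b n"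
    note lw = log_power_weight_sum[OF X p k]
    have le: "?t n \<le> ?u n" for n
    proof (cases "n = 0")
      case True
      thus ?thesis using k by (simp add: zero_power)
    next
      case False
      define om where "om = size (prime_factorization n)"
      have l0: "0 \<le> ln (real n)" using False by simp
      \<comment> \<open>If \<open>R = r ^ om\<close> exceeds \<open>M\<close>, then
        \<open>(R / M) powr \<theta> \<ge> 1\<close>, so multiplying \<open>R\<close> by it gives
        \<open>M powr (- \<theta>) * R powr (1 + \<theta>) \<ge> R\<close>.\<close>
      have split: "r ^ om \<le> M + M powr (- \<theta>) * r1 ^ om"
      proof (cases "r ^ om \<le> M")
        case True
        have "0 \<le> M powr (- \<theta>) * r1 ^ om" using r1 by simp
        thus ?thesis using True by linarith
      next
        case False
        define R where "R = r ^ om"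
        have R: "R > 0" "R \<ge> M" using False r by (auto simp: R_def)
        have "r1 ^ om = R powr (1 + \<theta>)"
          unfolding R_def r1_def using r by (simp add: powr_realpow[symmetric] powr_powr mult.commute)
        also have "\<dots> = R * R powr \<theta>" using R by (simp add: powr_add)
        finally have "M powr (- \<theta>) * r1 ^ om = R * (M powr (- \<theta>) * R powr \<theta>)" by simp
        also have "M powr (- \<theta>) * R powr \<theta> \<ge> M powr (- \<theta>) * M powr \<theta>"
          using R M \<theta> by (intro mult_left_mono powr_mono2) auto
        hence "R * (M powr (- \<theta>) * R powr \<theta>) \<ge> R * 1"
          using R M by (intro mult_left_mono) (auto simp: powr_add[symmetric])
        finally show ?thesis using M R by (simp add: R_def)
      qed
      have w2: "?w n \<le> 2 * exp (c * X) * real n powr (- (1 + 1 / X))"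
      proof -
        have "?w n \<le> 2 * exp (c * (X - ln (real n)))" using c p by (intro smoothing_weight_le_exp) auto
        also have "exp (c * (X - ln (real n))) = exp (c * X) * exp (- c * ln (real n))"
          by (simp add: exp_add[symmetric] algebra_simps)
        also have "exp (- c * ln (real n)) = real n powr (- (1 + 1 / X))" using False by (simp add: powr_def c_def)
        finally show ?thesis by simp
      qed
      have "?t n \<le> r ^ om * ln (real n) ^ k * ?w n"
        unfolding norm_mult om_def using l0 r
        by (intro mult_right_mono mult_mono norm_rough_coeff_le[OF z] smoothing_weight_nonneg) (auto simp: norm_power)
      also have "\<dots> \<le> (M + M powr (- \<theta>) * r1 ^ om) * ln (real n) ^ k * ?w n"
        using split l0 by (intro mult_right_mono smoothing_weight_nonneg) auto
      also have "\<dots> = M * ?a n + M powr (- \<theta>) * (r1 ^ om * ln (real n) ^ k * ?w n)" by (simp add: algebra_simps)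
      also have "\<dots> \<le> M * ?a n + M powr (- \<theta>) * (r1 ^ om * ln (real n) ^ k * (2 * exp (c * X) * real n powr (- (1 + 1 / X))))"
        using w2 l0 r1 by (intro add_left_mono mult_left_mono) auto
      finally show ?thesis by (simp add: om_def mult_ac)
    qed
    have us: "summable ?u" using lw rk[OF X] by (intro summable_add summable_mult) auto
    have t0: "0 \<le> ?t n" for n by (intro mult_nonneg_nonneg smoothing_weight_nonneg) auto
    have ts: "summable ?t" by (rule summable_comparison_test[OF _ us]) (use le t0 in auto)
    have "(LINT n|count_space UNIV. ?t n) = suminf ?t"
      using ts t0 by (intro integral_count_space_nat) (simp only: integrable_count_space_nat_iff real_norm_def abs_of_nonneg[OF t0])
    also have "\<dots> \<le> suminf ?u" by (intro suminf_le le ts us)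
    also have "\<dots> = M * suminf ?a + M powr (- \<theta>) * (2 * exp (c * X)) * suminf ?b"
      by (intro sums_unique[symmetric] sums_add sums_mult summable_sums) (use lw rk[OF X] in auto)
    also have "\<dots> \<le> M * (12 * fact k * X ^ k * (1 + exp X / real p)) + M powr (- \<theta>) * (2 * exp (c * X)) * (K * X powr (r1 + real k))"
      using lw rk[OF X] M by (intro add_mono mult_left_mono) auto
    also have "exp (c * X) = exp 1 * exp X" using X by (simp add: c_def exp_add[symmetric] algebra_simps)
    also have "M * (12 * fact k * X ^ k * (1 + exp X / real p)) + M powr (- \<theta>) * (2 * (exp 1 * exp X)) * (K * X powr (r1 + real k))
       \<le> M * (12 * fact k * X ^ k * (1 + exp X / real p)) + M powr (- \<theta>) * (2 * (exp 1 * exp X)) * (K * (X\<^sup>2 * X ^ k))"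
    proof (intro add_left_mono mult_left_mono)
      have "X powr (r1 + real k) \<le> X powr (real (2 + k))" using X r1 by (intro powr_mono) auto
      also have "\<dots> = X\<^sup>2 * X ^ k" using X by (subst powr_realpow) (auto simp: power_add power2_eq_square)
      finally show "X powr (r1 + real k) \<le> X\<^sup>2 * X ^ k" .
    qed (use K in auto)
    also have "\<dots> = 12 * fact k * (X ^ k * (M * (1 + exp X / real p))) + 2 * exp 1 * K * (X ^ k * (M powr (- \<theta>) * exp X * X\<^sup>2))"
      by (simp add: algebra_simps)
    also have "\<dots> \<le> C * (X ^ k * (M * (1 + exp X / real p))) + C * (X ^ k * (M powr (- \<theta>) * exp X * X\<^sup>2))"
      using M X K unfolding C_def by (intro add_mono mult_right_mono mult_nonneg_nonneg) auto
    finally show ?thesis by (simp add: algebra_simps)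
  qed
  show ?thesis by (rule exI[of _ C]) (use main C in auto)
qed

lemma rGamma_bounded: "\<exists>C>0. \<forall>z::complex. norm z \<le> 2 \<longrightarrow> norm (rGamma (z - of_nat j)) \<le> C"
proof -
  have "compact ((\<lambda>z. rGamma (z - of_nat j)) ` cball (0::complex) 2)"
    by (intro compact_continuous_image compact_cball holomorphic_on_imp_continuous_on holomorphic_intros holomorphic_rGamma')
  then obtain C where "\<And>w. w \<in> (\<lambda>z. rGamma (z - of_nat j)) ` cball (0::complex) 2 \<Longrightarrow> norm w \<le> C"
    by (meson compact_imp_bounded bounded_iff)
  thus ?thesis by (intro exI[of _ "max C 1"]) (force simp: le_max_iff_disj)
qed

text \<open>The counterpart of the coefficient bound for the density. The exponents
  \<open>Re z - j + k - 1\<close> of \<open>v\<close> lie between 0 and \<open>k + 1\<close>, so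
  \<open>weight_absorb\<close> applies; the point \<open>v = X\<close>, at which the two cutoffs
  disagree, is a null set.\<close>

lemma model_smoothing_bound:
  assumes r: "1 \<le> r" "r < 2" and km: "m + 3 \<le> k"
  shows "\<exists>C>0. \<forall>\<nu> y z X p. norm z \<le> r \<longrightarrow> 3/2 \<le> y \<longrightarrow> 1 \<le> X \<longrightarrow> 2 \<le> p \<longrightarrow>
    (LINT v|lborel. norm (model_density \<nu> y z k m v) * smoothing_weight p X v) \<le> C * ln y ^ (3 + m) * X ^ (k + 1) * (exp X / real p)"
proof -
  have "\<exists>K. \<forall>j. \<forall>\<nu> y z. norm z \<le> r \<longrightarrow> 3/2 \<le> y \<longrightarrow> norm (sd_coeff \<nu> y z j) \<le> K j * ln y ^ (3 + j)"
    by (rule choice) (use sd_coeff_bound[OF r] in blast)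
  then obtain K where K: "\<And>j \<nu> y z. norm z \<le> r \<Longrightarrow> 3/2 \<le> y \<Longrightarrow> norm (sd_coeff \<nu> y z j) \<le> K j * ln y ^ (3 + j)"
    by blast
  have "\<exists>g. \<forall>j. g j > 0 \<and> (\<forall>z::complex. norm z \<le> 2 \<longrightarrow> norm (rGamma (z - of_nat j)) \<le> g j)"
    by (rule choice) (use rGamma_bounded in blast)
  then obtain g where g: "\<And>j. g j > 0" "\<And>j z. norm (z::complex) \<le> 2 \<Longrightarrow> norm (rGamma (z - of_nat j)) \<le> g j"
    by blast
  define A where "A = (fact (k + 1) * exp 1 * 3 + 1 :: real)"
  have A: "A > 0" by (simp add: A_def add_pos_pos)
  define C where "C = (\<Sum>j<m. \<bar>K j\<bar> * 3 ^ m * g j * A) + 1"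
  have C: "C > 0" unfolding C_def using A g(1) by (intro add_nonneg_pos sum_nonneg mult_nonneg_nonneg less_imp_le[OF g(1)]) auto
  have main: "(LINT v|lborel. norm (model_density \<nu> y z k m v) * smoothing_weight p X v) \<le> C * ln y ^ (3 + m) * X ^ (k + 1) * (exp X / real p)"
    if z: "norm z \<le> r" and y: "3/2 \<le> y" and X: "1 \<le> X" and p: "2 \<le> p" for \<nu> y z X p
  proof -
    have ly: "1/3 \<le> ln y" by (rule ln_ge_third[OF y])
    have rez: "\<bar>Re z\<bar> \<le> 2" using z r abs_Re_le_cmod[of z] by linarith
    define E where "E v = fact (k + 1) * exp 1 * X ^ (k + 1) * exp (v - real p * \<bar>X - v\<bar>) + X ^ (k + 1) / (4 * real p ^ 2) * (if v < X then exp v else 0)" for v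
    have Ei: "integrable lborel E" unfolding E_def
      using kernel_integral(1)[OF p, of X] exp_ray_integral[of X]
      by (intro Bochner_Integration.integrable_add integrable_mult_right) (auto simp: has_bochner_integral_iff)
    have "(LINT v|lborel. E v) = fact (k + 1) * exp 1 * X ^ (k + 1) * (LINT v|lborel. exp (v - real p * \<bar>X - v\<bar>)) + X ^ (k + 1) / (4 * real p ^ 2) * exp X"
      unfolding E_def using kernel_integral(1)[OF p, of X] exp_ray_integral[of X]
      by (subst Bochner_Integration.integral_add) (auto simp: has_bochner_integral_iff)
    also have "\<dots> \<le> fact (k + 1) * exp 1 * X ^ (k + 1) * (3 * exp X / real p) + X ^ (k + 1) * (exp X / real p)"
    proof (rule add_mono)
      show "fact (k + 1) * exp 1 * X ^ (k + 1) * (LINT v|lborel. exp (v - real p * \<bar>X - v\<bar>)) \<le> fact (k + 1) * exp 1 * X ^ (k + 1) * (3 * exp X / real p)"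
        using X by (intro mult_left_mono kernel_integral(2)[OF p]) auto
      have "real p * 1 \<le> real p * (4 * real p)" using p by (intro mult_left_mono) auto
      hence "real p \<le> 4 * real p ^ 2" by (simp add: power2_eq_square)
      hence "exp X / (4 * real p ^ 2) \<le> exp X / real p" using p by (intro divide_left_mono) auto
      hence "X ^ (k + 1) * (exp X / (4 * real p ^ 2)) \<le> X ^ (k + 1) * (exp X / real p)" using X by (intro mult_left_mono) auto
      thus "X ^ (k + 1) / (4 * real p ^ 2) * exp X \<le> X ^ (k + 1) * (exp X / real p)" by simp
    qed
    also have "\<dots> = A * X ^ (k + 1) * (exp X / real p)" unfolding A_def by (simp add: algebra_simps)
    finally have Eb: "(LINT v|lborel. E v) \<le> A * X ^ (k + 1) * (exp X / real p)" .
    have E0: "0 \<le> E v" for v unfolding E_def using X by (intro add_nonneg_nonneg mult_nonneg_nonneg) auto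
    have pt: "norm (gamma_density (z - of_nat j + of_nat k) v * of_real (exp v)) * smoothing_weight p X v \<le> E v"
      if j: "j < m" and vX: "v \<noteq> X" for j v
    proof (cases "v > 0")
      case True
      define a where "a = Re z - real j + real k - 1"
      have a: "0 \<le> a" "a \<le> real (k + 1)" using rez j km by (auto simp: a_def)
      have Xa: "X powr a \<le> X ^ (k + 1)"
      proof -
        have "X powr a \<le> X powr real (k + 1)" using X a by (intro powr_mono) auto
        also have "\<dots> = X ^ (k + 1)" using X by (intro powr_realpow) auto
        finally show ?thesis .
      qed
      have n: "norm (gamma_density (z - of_nat j + of_nat k) v * of_real (exp v)) = v powr a * exp v"
        using True by (simp add: norm_mult norm_gamma_density a_def)
      have "v powr a * exp (- (2 * real p) * \<bar>X - v\<bar>) \<le> fact (k + 1) * exp 1 * X powr a * exp (- real p * \<bar>X - v\<bar>)"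
        using True X p a by (intro weight_absorb) auto
      also have "\<dots> \<le> fact (k + 1) * exp 1 * X ^ (k + 1) * exp (- real p * \<bar>X - v\<bar>)"
        using Xa by (intro mult_right_mono mult_left_mono) auto
      finally have "exp v * (v powr a * exp (- (2 * real p) * \<bar>X - v\<bar>)) \<le> exp v * (fact (k + 1) * exp 1 * X ^ (k + 1) * exp (- real p * \<bar>X - v\<bar>))"
        by (intro mult_left_mono) auto
      also have "\<dots> = fact (k + 1) * exp 1 * X ^ (k + 1) * exp (v - real p * \<bar>X - v\<bar>)"
        by (simp add: exp_diff exp_minus field_simps)
      finally have 1: "exp v * (v powr a * exp (- (2 * real p) * \<bar>X - v\<bar>)) \<le> fact (k + 1) * exp 1 * X ^ (k + 1) * exp (v - real p * \<bar>X - v\<bar>)" .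
      have 2: "exp v * (v powr a * (if v \<le> X then 1 / (4 * real p ^ 2) else 0)) \<le> X ^ (k + 1) / (4 * real p ^ 2) * (if v < X then exp v else 0)"
      proof (cases "v < X")
        case vl: True
        have "v powr a \<le> X powr a" using True vl a by (intro powr_mono2) auto
        hence "v powr a \<le> X ^ (k + 1)" using Xa by linarith
        hence "v powr a * (exp v / (4 * real p ^ 2)) \<le> X ^ (k + 1) * (exp v / (4 * real p ^ 2))" by (intro mult_right_mono) auto
        thus ?thesis using vl by (simp add: mult_ac)
      qed (use vX in auto)
      have "norm (gamma_density (z - of_nat j + of_nat k) v * of_real (exp v)) * smoothing_weight p X v =
        exp v * (v powr a * exp (- (2 * real p) * \<bar>X - v\<bar>)) + exp v * (v powr a * (if v \<le> X then 1 / (4 * real p ^ 2) else 0))"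
        unfolding n smoothing_weight_altdef by (simp add: algebra_simps)
      thus ?thesis unfolding E_def using 1 2 by linarith
    qed (use E0 in \<open>auto simp: gamma_density_def\<close>)
    let ?T = "\<Sum>j<m. \<bar>K j\<bar> * 3 ^ m * g j"
    have T0: "0 \<le> ?T" by (intro sum_nonneg mult_nonneg_nonneg less_imp_le[OF g(1)]) auto
    have "norm (model_density \<nu> y z k m v) * smoothing_weight p X v \<le> ?T * ln y ^ (3 + m) * E v" if vX: "v \<noteq> X" for v
    proof -
      have "norm (model_density \<nu> y z k m v) \<le> (\<Sum>j<m. norm (sd_coeff \<nu> y z j * rGamma (z - of_nat j) * (gamma_density (z - of_nat j + of_nat k) v * of_real (exp v))))"
        unfolding model_density_def by (rule norm_sum)
      hence "norm (model_density \<nu> y z k m v) * smoothing_weight p X v \<le>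
         (\<Sum>j<m. norm (sd_coeff \<nu> y z j * rGamma (z - of_nat j) * (gamma_density (z - of_nat j + of_nat k) v * of_real (exp v)))) * smoothing_weight p X v"
        by (intro mult_right_mono smoothing_weight_nonneg)
      also have "\<dots> = (\<Sum>j<m. (norm (sd_coeff \<nu> y z j) * norm (rGamma (z - of_nat j))) * (norm (gamma_density (z - of_nat j + of_nat k) v * of_real (exp v)) * smoothing_weight p X v))"
        unfolding sum_distrib_right norm_mult by (simp only: mult_ac)
      also have "\<dots> \<le> (\<Sum>j<m. (\<bar>K j\<bar> * 3 ^ m * ln y ^ (3 + m) * g j) * E v)"
      proof (intro sum_mono mult_mono)
        fix j assume j: "j \<in> {..<m}"
        have "norm (sd_coeff \<nu> y z j) \<le> K j * ln y ^ (3 + j)" by (rule K[OF z y])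
        also have "\<dots> \<le> \<bar>K j\<bar> * ln y ^ (3 + j)" using ly by (intro mult_right_mono) auto
        also have "\<dots> = \<bar>K j\<bar> * ln y ^ (3 + j) * 1" by simp
        \<comment> \<open>Raises all powers of \<open>ln y\<close> to the common exponent
          \<open>3 + m\<close>; \<open>1 \<le> 3 * ln y\<close> is needed because
          \<open>ln y\<close> may be below 1.\<close>
        also have "\<dots> \<le> \<bar>K j\<bar> * ln y ^ (3 + j) * (3 ^ m * ln y ^ (m - j))"
        proof (intro mult_left_mono)
          have "1 \<le> (3 * ln y) ^ (m - j)" using ly by (intro one_le_power) auto
          also have "\<dots> = 3 ^ (m - j) * ln y ^ (m - j)" by (rule power_mult_distrib)
          also have "\<dots> \<le> 3 ^ m * ln y ^ (m - j)" using ly by (intro mult_right_mono power_increasing) auto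
          finally show "1 \<le> 3 ^ m * ln y ^ (m - j)" .
        qed (use ly in auto)
        also have "\<dots> = \<bar>K j\<bar> * 3 ^ m * (ln y ^ (3 + j) * ln y ^ (m - j))" by simp
        also have "ln y ^ (3 + j) * ln y ^ (m - j) = ln y ^ (3 + m)" using j by (simp add: power_add[symmetric])
        finally show "norm (sd_coeff \<nu> y z j) \<le> \<bar>K j\<bar> * 3 ^ m * ln y ^ (3 + m)" .
        show "norm (rGamma (z - of_nat j)) \<le> g j" using z r by (intro g(2)) auto
        show "norm (gamma_density (z - of_nat j + of_nat k) v * of_real (exp v)) * smoothing_weight p X v \<le> E v"
          by (rule pt) (use j vX in auto)
        show "0 \<le> \<bar>K j\<bar> * 3 ^ m * ln y ^ (3 + m) * g j" using ly g(1)[of j] by simp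
      qed (use ly smoothing_weight_nonneg in auto)
      also have "\<dots> = ?T * ln y ^ (3 + m) * E v" unfolding sum_distrib_right by (simp only: mult_ac)
      finally show ?thesis .
    qed
    hence ae: "AE v in lborel. norm (model_density \<nu> y z k m v) * smoothing_weight p X v \<le> ?T * ln y ^ (3 + m) * E v"
      using AE_lborel_singleton[of X] by auto
    have "(LINT v|lborel. norm (model_density \<nu> y z k m v) * smoothing_weight p X v) \<le> (LINT v|lborel. ?T * ln y ^ (3 + m) * E v)"
      by (rule integral_mono_AE'[OF _ ae]) (use Ei E0 T0 ly in auto)
    also have "\<dots> = ?T * ln y ^ (3 + m) * (LINT v|lborel. E v)" by simp
    also have "\<dots> \<le> ?T * ln y ^ (3 + m) * (A * X ^ (k + 1) * (exp X / real p))"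
      using Eb T0 ly by (intro mult_left_mono) auto
    also have "\<dots> = (?T * A) * (ln y ^ (3 + m) * X ^ (k + 1) * (exp X / real p))" by (simp only: mult_ac)
    also have "?T * A = (\<Sum>j<m. \<bar>K j\<bar> * 3 ^ m * g j * A)" by (rule sum_distrib_right)
    also have "\<dots> * (ln y ^ (3 + m) * X ^ (k + 1) * (exp X / real p)) \<le> C * (ln y ^ (3 + m) * X ^ (k + 1) * (exp X / real p))"
      unfolding C_def using ly X by (intro mult_right_mono) auto
    finally show ?thesis by (simp add: mult_ac)
  qed
  show ?thesis by (rule exI[of _ C]) (use main C in auto)
qed

text \<open>\<open>m\<close> is the length of the expansion: \<open>m * (1 - \<tau>) \<ge> 9\<close>
  makes its remainder, with \<open>(ln y) ^ (3 + m)\<close>, five powers below \<open>X ^ k\<close>.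
  \<open>D\<close> gives the threshold \<open>M = X ^ D\<close> for large coefficients, and
  \<open>\<theta> * D \<ge> 7\<close> beats Rankin's loss \<open>X ^ 2\<close> by five powers.
  \<open>X ^ B\<close> is the fineness of the smoothing and must beat \<open>X ^ D\<close> and the
  \<open>X ^ (m + 4)\<close> lost in the model, again by five powers. The choice of \<open>k\<close>
  comes last, so that the far part \<open>(ln y) ^ (k + 5) * X ^ B\<close> is small as well.\<close>

lemma smoothing_parameters:
  assumes "\<tau> < 1" "\<theta> > (0::real)"
  obtains m D B k :: nat where "2 \<le> m" "m + 4 \<le> k" "9 \<le> real m * (1 - \<tau>)" "7 \<le> \<theta> * real D" "D + 5 \<le> B" "m + 9 \<le> B"
    "real B + 10 \<le> real k * (1 - \<tau>)"
proof -
  have ex: "\<exists>n::nat. a \<le> real n * b \<and> N \<le> n" if "b > 0" for a b :: real and N :: nat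
  proof -
    obtain n :: nat where n: "a / b \<le> real n" using real_arch_simple by blast
    have "a / b \<le> real (max n N)" using n by simp
    hence "a \<le> real (max n N) * b" using that by (simp only: pos_divide_le_eq)
    thus ?thesis by (intro exI[of _ "max n N"]) auto
  qed
  obtain m where m: "9 \<le> real m * (1 - \<tau>)" "2 \<le> m" using ex[of "1 - \<tau>" 9 2] assms by auto
  obtain D where D: "7 \<le> real D * \<theta>" using ex[of \<theta> 7 0] assms by auto
  define B where "B = max (D + 5) (m + 9)"
  obtain k where k: "real B + 10 \<le> real k * (1 - \<tau>)" "m + 4 \<le> k" using ex[of "1 - \<tau>" "real B + 10" "m + 4"] assms by auto
  show ?thesis by (rule that[OF m(2) k(2) m(1) _ _ _ k(1), of D]) (use D in \<open>auto simp: B_def mult.commute\<close>)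
qed

text \<open>Every contribution is pushed to \<open>exp X * X powr (k - 5)\<close>. Five powers are
  what is needed later: without the weight they leave \<open>X powr (- 5)\<close>, which is at most
  \<open>X powr (Re z - 3)\<close> for all \<open>Re z \<ge> - 2\<close>.\<close>

lemma weighted_sum_asymp:
  assumes r: "1 \<le> r" "r < 2" and \<tau>: "0 < \<tau>" "\<tau> < 1"
  shows "\<exists>k m C X0. 2 \<le> m \<and> m + 4 \<le> k \<and> 0 < C \<and> 1 \<le> X0 \<and> (\<forall>\<nu> y z X. norm z \<le> r \<longrightarrow> 3/2 \<le> y \<longrightarrow> X0 \<le> X \<longrightarrow> ln y \<le> X powr \<tau> \<longrightarrow>
    norm ((LINT n|count_space UNIV. (if ln (real n) \<le> X then rough_coeff \<nu> y z n * of_real (ln (real n) ^ k) else 0))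
        - (LINT v|lborel. (if v \<le> X then model_density \<nu> y z k m v else 0))) \<le> C * exp X * X powr (real k - 5))"
proof -
  obtain \<theta> where \<theta>: "\<theta> > 0" "r powr (1 + \<theta>) < 2" using exists_larger_base[OF r] by blast
  obtain m D B k :: nat where par: "2 \<le> m" "m + 4 \<le> k" "9 \<le> real m * (1 - \<tau>)" "7 \<le> \<theta> * real D" "D + 5 \<le> B" "m + 9 \<le> B"
    "real B + 10 \<le> real k * (1 - \<tau>)" by (rule smoothing_parameters[OF \<tau>(2) \<theta>(1)])
  have k0: "k > 0" and km: "m + 3 \<le> k" using par by auto
  obtain K X0 where K: "0 < K" "1 \<le> X0" and sd: "\<forall>\<nu> y z X l. norm z \<le> r \<longrightarrow> 3/2 \<le> y \<longrightarrow> X0 \<le> X \<longrightarrow> 0 < l \<longrightarrow> l \<le> 1/2 \<longrightarrow>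
     norm ((LINT n|count_space UNIV. rough_coeff \<nu> y z n * of_real (ln (real n) ^ k) * of_real (smooth_cutoff l (1 + 1 / X) (X - ln (real n))))
         - (LINT v|lborel. model_density \<nu> y z k m v * of_real (smooth_cutoff l (1 + 1 / X) (X - v))))
       \<le> K * exp X * (ln y ^ (3 + m) * X powr (real k + Re z - real m - 1) + ln y ^ (k + 5) / l)"
    using smoothed_difference_bound[OF r par(2)] by (elim exE conjE) (rule that; assumption)
  obtain C1 where C1: "C1 > 0" and ss: "\<forall>\<nu> y z X p M. norm z \<le> r \<longrightarrow> 1 \<le> X \<longrightarrow> 2 \<le> p \<longrightarrow> 1 \<le> M \<longrightarrow>
    (LINT n|count_space UNIV. norm (rough_coeff \<nu> y z n * of_real (ln (real n) ^ k)) * smoothing_weight p X (ln (real n)))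
      \<le> C1 * X ^ k * (M * (1 + exp X / real p) + M powr (- \<theta>) * exp X * X\<^sup>2)"
    using sum_smoothing_bound[OF r \<theta> k0] by (elim exE conjE) (rule that; assumption)
  obtain C2 where C2: "C2 > 0" and ms: "\<forall>\<nu> y z X p. norm z \<le> r \<longrightarrow> 3/2 \<le> y \<longrightarrow> 1 \<le> X \<longrightarrow> 2 \<le> p \<longrightarrow>
    (LINT v|lborel. norm (model_density \<nu> y z k m v) * smoothing_weight p X v) \<le> C2 * ln y ^ (3 + m) * X ^ (k + 1) * (exp X / real p)"
    using model_smoothing_bound[OF r km] by (elim exE conjE) (rule that; assumption)
  define C where "C = exp 5 * (C1 * (fact B + 2)) + K * 5 + exp 5 * C2"
  have C: "C > 0" unfolding C_def using C1 C2 K by (intro add_pos_pos mult_pos_pos) auto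
  have main: "norm ((LINT n|count_space UNIV. (if ln (real n) \<le> X then rough_coeff \<nu> y z n * of_real (ln (real n) ^ k) else 0))
        - (LINT v|lborel. (if v \<le> X then model_density \<nu> y z k m v else 0))) \<le> C * exp X * X powr (real k - 5)"
    if z: "norm z \<le> r" and y: "3/2 \<le> y" and X: "max X0 2 \<le> X" and ly: "ln y \<le> X powr \<tau>" for \<nu> y z X
  proof -
    define W where "W = X powr (real k - 5)"
    have X2: "X \<ge> 2" "X0 \<le> X" using X by auto
    have l3: "1/3 \<le> ln y" by (rule ln_ge_third[OF y])
    have rez: "\<bar>Re z\<bar> \<le> 2" using z r abs_Re_le_cmod[of z] by linarith
    \<comment> \<open>Smoothing on the scale \<open>X powr (- B)\<close> in the logarithm of
      \<open>n\<close>, with \<open>l = 1 / (2 * p)\<close>.\<close>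
    define p where "p = nat \<lceil>X ^ B\<rceil>"
    have XB: "X ^ B \<ge> 2"
    proof -
      have "X ^ 1 \<le> X ^ B" using X2 par by (intro power_increasing) auto
      thus ?thesis using X2 by simp
    qed
    have p: "X ^ B \<le> real p" "real p \<le> 2 * X ^ B" "2 \<le> p"
    proof -
      show "X ^ B \<le> real p" unfolding p_def by (rule real_nat_ceiling_ge)
      thus "2 \<le> p" using XB by linarith
      have "0 \<le> \<lceil>X ^ B\<rceil>" using XB by linarith
      hence "real p = of_int \<lceil>X ^ B\<rceil>" unfolding p_def by simp
      thus "real p \<le> 2 * X ^ B" using of_int_ceiling_le_add_one[of "X ^ B"] XB by linarith
    qed
    define l where "l = 1 / (2 * real p)"
    have l: "0 < l" "l \<le> 1/2" using p by (auto simp: l_def field_simps)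
    define c where "c = 1 + 1 / X"
    have c: "1 < c" "1 \<le> c" "c \<le> 2" using X2 by (auto simp: c_def)
    let ?a = "\<lambda>n. rough_coeff \<nu> y z n * of_real (ln (real n) ^ k)"
    let ?md = "model_density \<nu> y z k m"
    define A where "A = (LINT n|count_space UNIV. (if ln (real n) \<le> X then ?a n else 0))"
    define A' where "A' = (LINT n|count_space UNIV. ?a n * of_real (smooth_cutoff l c (X - ln (real n))))"
    define E where "E = (LINT v|lborel. (if v \<le> X then ?md v else 0))"
    define E' where "E' = (LINT v|lborel. ?md v * of_real (smooth_cutoff l c (X - v)))"
    have 1: "norm (A' - A) \<le> exp 5 * (LINT n|count_space UNIV. norm (?a n) * smoothing_weight p X (ln (real n)))"
      unfolding A'_def A_def smoothing_weight_def l_def[symmetric]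
      by (rule smoothing_error(2)[OF l c(2,3) _ _ weighted_coeff_facts(1)[OF r z c(1)]]) auto
    have mli: "integrable lborel (\<lambda>v. norm (?md v) * exp (- c * v))"
      using model_density_laplace(2)[OF le_less_trans[OF z r(2)] km, of "Complex c 0" \<nu> y] c by simp
    have 2: "norm (E' - E) \<le> exp 5 * (LINT v|lborel. norm (?md v) * smoothing_weight p X v)"
      unfolding E'_def E_def smoothing_weight_def l_def[symmetric]
      by (rule smoothing_error(2)[OF l c(2,3) _ _ mli]) auto
    have 3: "norm (A' - E') \<le> K * exp X * (ln y ^ (3 + m) * X powr (real k + Re z - real m - 1) + ln y ^ (k + 5) / l)"
      unfolding A'_def E'_def c_def using sd z y X2(2) l by blast
    have lyp: "ln y ^ q \<le> X powr (\<tau> * real q)" for q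
    proof -
      have "ln y ^ q \<le> (X powr \<tau>) ^ q" using ly l3 by (intro power_mono) auto
      also have "\<dots> = X powr (\<tau> * real q)" using X2 by (simp add: powr_realpow[symmetric] powr_powr)
      finally show ?thesis .
    qed
    have W0: "W \<ge> 0" by (simp add: W_def)
    have mono: "X powr e \<le> W" if "e \<le> real k - 5" for e unfolding W_def using X2 that by (intro powr_mono) auto
    have pp: "X ^ q = X powr real q" for q using X2 by (simp add: powr_realpow)
    have T1: "ln y ^ (3 + m) * X powr (real k + Re z - real m - 1) \<le> W"
    proof -
      have "ln y ^ (3 + m) * X powr (real k + Re z - real m - 1) \<le> X powr (\<tau> * real (3 + m)) * X powr (real k + Re z - real m - 1)"
        by (intro mult_right_mono lyp) auto
      also have "\<dots> = X powr (\<tau> * real (3 + m) + (real k + Re z - real m - 1))" by (rule powr_add[symmetric])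
      also have "\<dots> \<le> W"
      proof (rule mono)
        have "\<tau> * real (3 + m) = 3 * \<tau> + real m - real m * (1 - \<tau>)" by (simp add: algebra_simps)
        thus "\<tau> * real (3 + m) + (real k + Re z - real m - 1) \<le> real k - 5" using par(3) \<tau> rez by linarith
      qed
      finally show ?thesis .
    qed
    have T2: "ln y ^ (k + 5) / l \<le> 4 * W"
    proof -
      have "ln y ^ (k + 5) / l = ln y ^ (k + 5) * (2 * real p)" by (simp add: l_def)
      also have "\<dots> \<le> X powr (\<tau> * real (k + 5)) * (2 * (2 * X powr real B))"
        using p l3 unfolding pp by (intro mult_mono lyp) auto
      also have "\<dots> = 4 * X powr (\<tau> * real (k + 5) + real B)" by (simp add: powr_add)
      also have "\<dots> \<le> 4 * W"
      proof (intro mult_left_mono mono)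
        have "\<tau> * real (k + 5) = 5 * \<tau> + real k - real k * (1 - \<tau>)" by (simp add: algebra_simps)
        thus "\<tau> * real (k + 5) + real B \<le> real k - 5" using par(7) \<tau> by linarith
      qed auto
      finally show ?thesis .
    qed
    have expp: "exp X / real p \<le> exp X * X powr (- real B)"
    proof -
      have "exp X / real p \<le> exp X / X ^ B" using p XB by (intro divide_left_mono mult_pos_pos) auto
      thus ?thesis unfolding pp by (simp add: powr_minus_divide)
    qed
    \<comment> \<open>The isolated integers next to \<open>exp X\<close> are harmless, since any
      power of \<open>X\<close> is dominated by \<open>exp X\<close>.\<close>
    have one_le: "1 \<le> fact B * (exp X * X powr (- real B))"
    proof -
      have "X ^ B \<le> fact B * exp X" using X2 by (intro power_le_fact_exp) auto
      hence "X ^ B * X powr (- real B) \<le> fact B * exp X * X powr (- real B)" by (intro mult_right_mono) auto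
      moreover have "X ^ B * X powr (- real B) = 1" unfolding pp powr_add[symmetric] using X2 by simp
      ultimately show ?thesis by (simp add: mult.assoc)
    qed
    have T34: "X ^ k * (X ^ D * (1 + exp X / real p) + (X ^ D) powr (- \<theta>) * exp X * X\<^sup>2) \<le> (fact B + 2) * (exp X * W)"
    proof -
      have "X ^ k * (X ^ D * (1 + exp X / real p)) \<le> X powr real k * (X powr real D * ((fact B + 1) * (exp X * X powr (- real B))))"
        unfolding pp
      proof (intro mult_left_mono)
        show "1 + exp X / real p \<le> (fact B + 1) * (exp X * X powr (- real B))"
          using one_le expp by (simp add: distrib_right)
      qed auto
      also have "\<dots> = (fact B + 1) * (exp X * X powr (real k + real D - real B))"
        by (simp add: powr_add powr_diff powr_minus_divide)
      also have "\<dots> \<le> (fact B + 1) * (exp X * W)" using par(5) by (intro mult_left_mono mono) auto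
      finally have a: "X ^ k * (X ^ D * (1 + exp X / real p)) \<le> (fact B + 1) * (exp X * W)" .
      have "X ^ k * ((X ^ D) powr (- \<theta>) * exp X * X\<^sup>2) = exp X * (X powr real k * X powr (- (\<theta> * real D)) * X powr real 2)"
        unfolding pp powr_powr by (simp add: mult_ac)
      also have "X powr real k * X powr (- (\<theta> * real D)) * X powr real 2 = X powr (real k + - (\<theta> * real D) + real 2)"
        by (simp only: powr_add)
      also have "exp X * X powr (real k + - (\<theta> * real D) + real 2) \<le> exp X * W"
        using par(4) by (intro mult_left_mono mono) auto
      finally have b: "X ^ k * ((X ^ D) powr (- \<theta>) * exp X * X\<^sup>2) \<le> exp X * W" .
      have "(fact B + 1) * (exp X * W) + exp X * W = (fact B + 2) * (exp X * W)" by (simp add: algebra_simps)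
      thus ?thesis unfolding distrib_left[of "X ^ k"] using add_mono[OF a b] by linarith
    qed
    have S1: "(LINT n|count_space UNIV. norm (?a n) * smoothing_weight p X (ln (real n))) \<le> C1 * ((fact B + 2) * (exp X * W))"
    proof -
      have "1 \<le> X ^ D" using X2 by (intro one_le_power) auto
      hence "(LINT n|count_space UNIV. norm (?a n) * smoothing_weight p X (ln (real n)))
        \<le> C1 * X ^ k * (X ^ D * (1 + exp X / real p) + (X ^ D) powr (- \<theta>) * exp X * X\<^sup>2)"
        using ss z X2 p by simp
      also have "\<dots> \<le> C1 * ((fact B + 2) * (exp X * W))"
        unfolding mult.assoc[of C1] using T34 C1 by (intro mult_left_mono) auto
      finally show ?thesis .
    qed
    have S2: "(LINT v|lborel. norm (?md v) * smoothing_weight p X v) \<le> C2 * (exp X * W)"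
    proof -
      have "(LINT v|lborel. norm (?md v) * smoothing_weight p X v) \<le> C2 * ln y ^ (3 + m) * X ^ (k + 1) * (exp X / real p)"
        using ms z y X2 p by simp
      also have "\<dots> = C2 * (ln y ^ (3 + m) * X ^ (k + 1) * (exp X / real p))" by simp
      also have "\<dots> \<le> C2 * (X powr real (3 + m) * X powr real (k + 1) * (exp X * X powr (- real B)))"
      proof (intro mult_left_mono mult_mono)
        have "ln y ^ (3 + m) \<le> X powr (\<tau> * real (3 + m))" by (rule lyp)
        also have "\<dots> \<le> X powr real (3 + m)" using X2 \<tau> by (intro powr_mono mult_left_le_one_le) auto
        finally show "ln y ^ (3 + m) \<le> X powr real (3 + m)" .
        show "X ^ (k + 1) \<le> X powr real (k + 1)" by (simp only: pp order_refl)
      qed (use expp C2 l3 X2 in auto)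
      also have "\<dots> = C2 * (exp X * X powr (real (3 + m) + real (k + 1) - real B))"
        by (simp only: powr_add diff_conv_add_uminus mult_ac)
      also have "\<dots> \<le> C2 * (exp X * W)" using par(6) C2 by (intro mult_left_mono mono) auto
      finally show ?thesis .
    qed
    have "norm (A - E) \<le> norm (A' - A) + norm (A' - E') + norm (E' - E)"
    proof -
      have "A - E = (A' - E') - (A' - A) + (E' - E)" by simp
      thus ?thesis by (metis (no_types, opaque_lifting) add.commute add_mono_thms_linordered_semiring(3) norm_triangle_ineq norm_triangle_ineq4 order_trans)
    qed
    also have "\<dots> \<le> exp 5 * (C1 * ((fact B + 2) * (exp X * W))) + K * exp X * (W + 4 * W) + exp 5 * (C2 * (exp X * W))"
    proof (intro add_mono)
      show "norm (A' - A) \<le> exp 5 * (C1 * ((fact B + 2) * (exp X * W)))"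
        by (rule order_trans[OF 1]) (intro mult_left_mono S1, simp)
      show "norm (A' - E') \<le> K * exp X * (W + 4 * W)"
        by (rule order_trans[OF 3]) (intro mult_left_mono add_mono T1 T2, use K in simp)
      show "norm (E' - E) \<le> exp 5 * (C2 * (exp X * W))"
        by (rule order_trans[OF 2]) (intro mult_left_mono S2, simp)
    qed
    also have "\<dots> = C * exp X * W" by (simp add: C_def algebra_simps)
    finally show ?thesis by (simp add: A_def E_def W_def)
  qed
  show ?thesis
    by (rule exI[of _ k], rule exI[of _ m], rule exI[of _ C], rule exI[of _ "max X0 2"]) (use main par C in auto)
qed

section \<open>Removing the weight\<close>

lemma inverse_power_integral:
  fixes k :: nat
  assumes l: "0 < l" "l \<le> X" and k: "k > 0"
  shows "has_bochner_integral lborel (\<lambda>u. indicator {l..X} u * (real k * u powr (- real k - 1))) (l powr (- real k) - X powr (- real k))"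
proof -
  have "has_bochner_integral lborel (\<lambda>u. indicator {l..X} u *\<^sub>R (real k * u powr (- real k - 1))) (- (X powr (- real k)) - (- (l powr (- real k))))"
  proof (rule has_bochner_integral_FTC_Icc)
    fix u assume "l \<le> u" "u \<le> X"
    hence u: "u > 0" using l by simp
    show "((\<lambda>u. - (u powr (- real k))) has_vector_derivative real k * u powr (- real k - 1)) (at u within {l..X})"
      unfolding has_real_derivative_iff_has_vector_derivative[symmetric] using u
      by (auto intro!: derivative_eq_intros)
  next
    show "continuous_on {l..X} (\<lambda>u. real k * u powr (- real k - 1))" using l by (intro continuous_intros) auto
  qed (use l in auto)
  thus ?thesis by (simp add: mult_ac)
qed

text \<open>Partial summation: \<open>v powr (- k) = X powr (- k)\<close> plus the integral of
  \<open>k * u powr (- k - 1)\<close> from \<open>v\<close> to \<open>X\<close>, and Fubini. As with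
  the Perron formula, a general measure lets the sum and its model go through the same identity. The
  lower cut \<open>Y > 0\<close> avoids the singularity of the weight at 0.\<close>

lemma remove_power_weight:
  fixes g :: "'a \<Rightarrow> complex" and v :: "'a \<Rightarrow> real" and k :: nat
  assumes sf: "sigma_finite_measure N" and k: "k > 0" and Y: "0 < Y" "Y \<le> X"
    and [measurable]: "g \<in> borel_measurable N" "v \<in> borel_measurable N"
    and int: "integrable N (\<lambda>\<omega>. if v \<omega> \<le> X then g \<omega> else 0)"
  defines "S \<equiv> \<lambda>u. LINT \<omega>|N. (if v \<omega> \<le> u then g \<omega> else 0)"
  shows "(LINT \<omega>|N. (if Y < v \<omega> \<and> v \<omega> \<le> X then g \<omega> * of_real (v \<omega> powr (- real k)) else 0))
       = of_real (X powr (- real k)) * (S X - S Y)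
         + (LINT u|lborel. of_real (indicator {Y..X} u * (real k * u powr (- real k - 1))) * (S u - S Y))"
    and "integrable lborel (\<lambda>u. of_real (indicator {Y..X} u * (real k * u powr (- real k - 1))) * (S u - S Y))"
proof -
  interpret N: sigma_finite_measure N by fact
  interpret pair_sigma_finite N lborel ..
  let ?w = "\<lambda>u. indicator {Y..X} u * (real k * u powr (- real k - 1))"
  let ?g = "\<lambda>u \<omega>. if Y < v \<omega> \<and> v \<omega> \<le> u then g \<omega> else 0"
  let ?f = "\<lambda>\<omega> u. of_real (?w u) * ?g u \<omega>"
  have wi: "integrable lborel ?w"
    using inverse_power_integral[OF Y k] by (simp add: has_bochner_integral_iff)
  have fi: "integrable (N \<Otimes>\<^sub>M lborel) (case_prod ?f)"
  proof (rule integrable_product_bound)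
    show "case_prod ?f \<in> borel_measurable (N \<Otimes>\<^sub>M lborel)" by measurable
    show "integrable N (\<lambda>\<omega>. norm (if v \<omega> \<le> X then g \<omega> else 0))" by (rule integrable_norm[OF int])
    show "integrable lborel ?w" by (rule wi)
    show "norm (case_prod ?f (\<omega>, u)) \<le> norm (if v \<omega> \<le> X then g \<omega> else 0) * ?w u" for \<omega> u
      by (auto simp: indicator_def norm_mult abs_mult)
  qed (auto simp: indicator_def)
  have iS: "integrable N (\<lambda>\<omega>. if v \<omega> \<le> u then g \<omega> else 0)" if "u \<le> X" for u
    by (rule Bochner_Integration.integrable_bound[OF int]) (use that in auto)
  have diff: "(LINT \<omega>|N. ?g u \<omega>) = S u - S Y" if "Y \<le> u" "u \<le> X" for u
  proof -
    have "S u - S Y = (LINT \<omega>|N. (if v \<omega> \<le> u then g \<omega> else 0) - (if v \<omega> \<le> Y then g \<omega> else 0))"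
      unfolding S_def by (rule Bochner_Integration.integral_diff[symmetric]) (use iS that Y in auto)
    also have "\<dots> = (LINT \<omega>|N. ?g u \<omega>)" by (intro Bochner_Integration.integral_cong) (use that in auto)
    finally show ?thesis by simp
  qed
  have in1: "(LINT \<omega>|N. ?f \<omega> u) = of_real (?w u) * (S u - S Y)" for u
  proof (cases "u \<in> {Y..X}")
    case True
    have "(LINT \<omega>|N. ?f \<omega> u) = of_real (?w u) * (LINT \<omega>|N. ?g u \<omega>)" by (rule integral_mult_right_zero)
    thus ?thesis using diff[of u] True by simp
  qed auto
  show "integrable lborel (\<lambda>u. of_real (?w u) * (S u - S Y))" using integrable_snd[OF fi] unfolding in1 .
  have in2: "(LINT u|lborel. ?f \<omega> u) = (if Y < v \<omega> \<and> v \<omega> \<le> X then g \<omega> * of_real (v \<omega> powr (- real k) - X powr (- real k)) else 0)" for \<omega>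
  proof (cases "Y < v \<omega> \<and> v \<omega> \<le> X")
    case True
    have "(LINT u|lborel. ?f \<omega> u) = (LINT u|lborel. of_real (indicator {v \<omega>..X} u * (real k * u powr (- real k - 1))) * g \<omega>)"
      by (intro Bochner_Integration.integral_cong) (use True in \<open>auto simp: indicator_def\<close>)
    also have "\<dots> = of_real (LINT u|lborel. indicator {v \<omega>..X} u * (real k * u powr (- real k - 1))) * g \<omega>"
      by (simp only: integral_mult_left_zero integral_complex_of_real)
    also have "(LINT u|lborel. indicator {v \<omega>..X} u * (real k * u powr (- real k - 1))) = v \<omega> powr (- real k) - X powr (- real k)"
      using inverse_power_integral[of "v \<omega>" X k] True Y k by (auto simp: has_bochner_integral_iff)
    finally show ?thesis using True by (simp only: if_True mult.commute simp_thms)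
  next
    case False
    have f0: "?f \<omega> u = 0" for u using False by (auto simp: indicator_def)
    have "(LINT u|lborel. ?f \<omega> u) = 0" unfolding f0 by simp
    thus ?thesis using False by (simp only: if_False)
  qed
  let ?h = "\<lambda>\<omega>. if Y < v \<omega> \<and> v \<omega> \<le> X then g \<omega> * of_real (v \<omega> powr (- real k) - X powr (- real k)) else 0"
  have hi: "integrable N ?h" using integrable_fst[OF fi] unfolding in2 .
  have gi: "integrable N (?g X)" by (rule Bochner_Integration.integrable_bound[OF int]) auto
  have "(LINT u|lborel. of_real (?w u) * (S u - S Y)) = (LINT \<omega>|N. ?h \<omega>)"
    using Fubini_integral[OF fi] unfolding in1 in2 .
  moreover have "(LINT \<omega>|N. of_real (X powr (- real k)) * ?g X \<omega>) = of_real (X powr (- real k)) * (S X - S Y)"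
    using diff[of X] Y by (simp only: integral_mult_right_zero order_refl)
  moreover have "(LINT \<omega>|N. (if Y < v \<omega> \<and> v \<omega> \<le> X then g \<omega> * of_real (v \<omega> powr (- real k)) else 0))
     = (LINT \<omega>|N. of_real (X powr (- real k)) * ?g X \<omega> + ?h \<omega>)"
    by (intro Bochner_Integration.integral_cong refl) (auto simp: algebra_simps)
  moreover have "\<dots> = (LINT \<omega>|N. of_real (X powr (- real k)) * ?g X \<omega>) + (LINT \<omega>|N. ?h \<omega>)"
    by (intro Bochner_Integration.integral_add integrable_mult_right hi gi)
  ultimately show "(LINT \<omega>|N. (if Y < v \<omega> \<and> v \<omega> \<le> X then g \<omega> * of_real (v \<omega> powr (- real k)) else 0))
       = of_real (X powr (- real k)) * (S X - S Y) + (LINT u|lborel. of_real (?w u) * (S u - S Y))" by simp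
qed

text \<open>The boundary weight \<open>X powr (- k)\<close> and the mass
  \<open>(X/2) powr (- k) - X powr (- k)\<close> of the integral add up to
  \<open>2 ^ k * X powr (- k)\<close>; one more factor 2 comes from subtracting the values at
  \<open>X / 2\<close>.\<close>

lemma remove_power_weight_difference:
  fixes S T :: "real \<Rightarrow> complex" and k :: nat
  assumes k: "k \<ge> 5" and X: "0 < X" and D: "D \<ge> 0"
    and le: "\<And>u. X / 2 \<le> u \<Longrightarrow> u \<le> X \<Longrightarrow> norm (S u - T u) \<le> D * X powr (real k - 5)"
    and iS: "integrable lborel (\<lambda>u. of_real (indicator {X/2..X} u * (real k * u powr (- real k - 1))) * (S u - S (X/2)))"
    and iT: "integrable lborel (\<lambda>u. of_real (indicator {X/2..X} u * (real k * u powr (- real k - 1))) * (T u - T (X/2)))"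
  shows "norm ((of_real (X powr (- real k)) * (S X - S (X/2))
         + (LINT u|lborel. of_real (indicator {X/2..X} u * (real k * u powr (- real k - 1))) * (S u - S (X/2))))
      - (of_real (X powr (- real k)) * (T X - T (X/2))
         + (LINT u|lborel. of_real (indicator {X/2..X} u * (real k * u powr (- real k - 1))) * (T u - T (X/2)))))
      \<le> 2 ^ Suc k * D * X powr (- 5)"
proof -
  define w where "w = (\<lambda>u. indicator {X/2..X} u * (real k * u powr (- real k - 1)))"
  define V where "V = (\<lambda>u. (S u - T u) - (S (X/2) - T (X/2)))"
  define B where "B = 2 * D * X powr (real k - 5)"
  have V: "norm (V u) \<le> B" if "X / 2 \<le> u" "u \<le> X" for u
    unfolding V_def B_def using order_trans[OF norm_triangle_ineq4 add_mono[OF le[OF that] le[of "X/2"]]] X by simp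
  have wi: "has_bochner_integral lborel w ((X/2) powr (- real k) - X powr (- real k))"
    unfolding w_def by (rule inverse_power_integral) (use X k in auto)
  have w0: "w u \<ge> 0" for u by (simp add: w_def)
  have eqV: "of_real (w u) * V u = of_real (w u) * (S u - S (X/2)) - of_real (w u) * (T u - T (X/2))" for u
    by (simp add: V_def algebra_simps)
  have iV: "integrable lborel (\<lambda>u. of_real (w u) * V u)"
    unfolding eqV by (intro Bochner_Integration.integrable_diff) (use iS iT in \<open>simp_all add: w_def\<close>)
  have "norm (LINT u|lborel. of_real (w u) * V u) \<le> (LINT u|lborel. w u * B)"
  proof (rule order_trans[OF Bochner_Integration.integral_norm_bound Bochner_Integration.integral_mono])
    show "integrable lborel (\<lambda>u. w u * B)" using wi by (intro integrable_mult_left) (auto simp: has_bochner_integral_iff)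
    show "norm (of_real (w u) * V u) \<le> w u * B" for u
    proof (cases "u \<in> {X/2..X}")
      case True
      thus ?thesis using V[of u] w0[of u] by (auto simp: norm_mult intro!: mult_left_mono)
    qed (auto simp: w_def)
  qed (rule integrable_norm[OF iV])
  also have "\<dots> = ((X/2) powr (- real k) - X powr (- real k)) * B"
    using wi by (simp add: has_bochner_integral_iff)
  finally have I: "norm (LINT u|lborel. of_real (w u) * V u) \<le> ((X/2) powr (- real k) - X powr (- real k)) * B" .
  have F: "norm (of_real (X powr (- real k)) * V X) \<le> X powr (- real k) * B"
    using V[of X] X by (auto simp: norm_mult intro!: mult_left_mono)
  have "((of_real (X powr (- real k)) * (S X - S (X/2))
         + (LINT u|lborel. of_real (w u) * (S u - S (X/2))))
      - (of_real (X powr (- real k)) * (T X - T (X/2))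
         + (LINT u|lborel. of_real (w u) * (T u - T (X/2)))))
     = of_real (X powr (- real k)) * V X + (LINT u|lborel. of_real (w u) * V u)"
    unfolding eqV using iS iT by (subst Bochner_Integration.integral_diff) (auto simp: w_def V_def algebra_simps)
  also have "norm \<dots> \<le> X powr (- real k) * B + ((X/2) powr (- real k) - X powr (- real k)) * B"
    by (intro order_trans[OF norm_triangle_ineq] add_mono I F)
  also have "\<dots> = (X/2) powr (- real k) * B" by (simp add: algebra_simps)
  also have "(X/2) powr (- real k) = 2 ^ k * X powr (- real k)"
    using X by (simp add: powr_divide powr_minus_divide powr_realpow)
  also have "2 ^ k * X powr (- real k) * B = 2 ^ Suc k * D * (X powr (- real k) * X powr (real k - 5))"
    by (simp add: B_def)
  also have "X powr (- real k) * X powr (real k - 5) = X powr (- 5)" by (simp add: powr_add[symmetric])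
  finally show ?thesis by (simp add: w_def)
qed

section \<open>Integrals of \<open>exp v * v powr w\<close> by parts\<close>

definition exp_power_integral :: "complex \<Rightarrow> real \<Rightarrow> complex" where
  "exp_power_integral w X = (LINT v|lborel. indicator {X/2..X} v *\<^sub>R (of_real (exp v) * of_real v powr w))"

lemma continuous_exp_powr:
  assumes "X > 0"
  shows "continuous_on {X/2..X} (\<lambda>v. of_real (exp v) * of_real v powr (w::complex))"
proof (intro continuous_intros)
qed (use assms in \<open>auto simp: complex_nonpos_Reals_iff\<close>)

lemma integrable_exp_powr:
  assumes "X > 0"
  shows "integrable lborel (\<lambda>v. indicator {X/2..X} v *\<^sub>R (of_real (exp v) * of_real v powr (w::complex)))"
  using borel_integrable_compact[OF _ continuous_exp_powr[OF assms], of w] by (simp add: set_integrable_def)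

lemma exp_power_integral_parts:
  assumes X: "X > 0"
  shows "exp_power_integral w X = of_real (exp X) * of_real X powr w - of_real (exp (X/2)) * of_real (X/2) powr w
     - w * exp_power_integral (w - 1) X"
proof -
  let ?f = "\<lambda>v. of_real (exp v) * of_real v powr w + w * (of_real (exp v) * of_real v powr (w - 1))"
  have "(LINT v|lborel. indicator {X/2..X} v *\<^sub>R ?f v) = of_real (exp X) * of_real X powr w - of_real (exp (X/2)) * of_real (X/2) powr w"
  proof (rule integral_FTC_Icc)
    show "X / 2 \<le> X" using X by simp
    fix v assume "X / 2 \<le> v" "v \<le> X"
    hence v: "v > 0" using X by simp
    have "((\<lambda>s. exp s * s powr w) has_field_derivative ?f v) (at (of_real v :: complex))"
      using v by (auto intro!: derivative_eq_intros simp: complex_nonpos_Reals_iff exp_of_real algebra_simps)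
    from has_vector_derivative_real_field[OF this]
    show "((\<lambda>v. of_real (exp v) * of_real v powr w) has_vector_derivative ?f v) (at v within {X/2..X})"
      by (simp add: exp_of_real)
  next
    show "continuous_on {X/2..X} ?f" by (intro continuous_on_add continuous_on_mult_left continuous_exp_powr X)
  qed
  moreover have "(LINT v|lborel. indicator {X/2..X} v *\<^sub>R ?f v) = exp_power_integral w X + w * exp_power_integral (w - 1) X"
  proof -
    have "(LINT v|lborel. indicator {X/2..X} v *\<^sub>R ?f v) =
       (LINT v|lborel. indicator {X/2..X} v *\<^sub>R (of_real (exp v) * of_real v powr w) + w * (indicator {X/2..X} v *\<^sub>R (of_real (exp v) * of_real v powr (w - 1))))"
      by (intro Bochner_Integration.integral_cong refl) (simp add: scaleR_conv_of_real algebra_simps)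
    also have "\<dots> = exp_power_integral w X + (LINT v|lborel. w * (indicator {X/2..X} v *\<^sub>R (of_real (exp v) * of_real v powr (w - 1))))"
      unfolding exp_power_integral_def by (intro Bochner_Integration.integral_add integrable_mult_right integrable_exp_powr X)
    also have "\<dots> = exp_power_integral w X + w * exp_power_integral (w - 1) X"
      unfolding exp_power_integral_def by (simp only: integral_mult_right_zero)
    finally show ?thesis .
  qed
  ultimately show ?thesis by (simp add: algebra_simps)
qed

lemma norm_exp_power_integral_le:
  assumes X: "X > 0" and w: "\<bar>Re w\<bar> \<le> M"
  shows "norm (exp_power_integral w X) \<le> 2 powr M * exp X * X powr Re w"
proof -
  define B where "B = 2 powr M * X powr Re w"
  have e: "has_bochner_integral lborel (\<lambda>v. indicator {X/2..X} v *\<^sub>R exp v) (exp X - exp (X/2))"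
    by (rule has_bochner_integral_FTC_Icc) (use X in \<open>auto intro!: derivative_eq_intros continuous_intros simp: has_real_derivative_iff_has_vector_derivative[symmetric]\<close>)
  have "norm (exp_power_integral w X) \<le> (LINT v|lborel. indicator {X/2..X} v *\<^sub>R exp v * B)"
    unfolding exp_power_integral_def
  proof (rule order_trans[OF Bochner_Integration.integral_norm_bound Bochner_Integration.integral_mono])
    show "integrable lborel (\<lambda>v. indicator {X/2..X} v *\<^sub>R exp v * B)"
      using e by (intro integrable_mult_left) (auto simp: has_bochner_integral_iff)
    fix v
    have "v powr Re w \<le> B" if "X / 2 \<le> v" "v \<le> X"
      unfolding B_def by (rule powr_comparable) (use that X w in auto)
    thus "norm (indicator {X/2..X} v *\<^sub>R (of_real (exp v) * of_real v powr w)) \<le> indicator {X/2..X} v *\<^sub>R exp v * B"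
      using X by (auto simp: indicator_def norm_mult norm_powr_real_powr)
  qed (rule integrable_norm[OF integrable_exp_powr[OF X]])
  also have "\<dots> = (exp X - exp (X/2)) * B" using e by (simp add: has_bochner_integral_iff)
  also have "\<dots> \<le> exp X * B" by (intro mult_right_mono) (auto simp: B_def)
  finally show ?thesis by (simp add: B_def mult_ac)
qed

text \<open>After two integrations by parts the boundary terms at \<open>X\<close> form the main
  term. Those at \<open>X / 2\<close> are smaller by \<open>exp (- X / 2)\<close>, which beats
  \<open>X ^ 2\<close> because \<open>X ^ 2 \<le> 8 * exp (X / 2)\<close>, and the remaining
  integral has exponent \<open>w - 2\<close>.\<close>

lemma exp_power_integral_asymp:
  assumes X: "X \<ge> 1" and w: "norm w \<le> M" and M: "M \<ge> 1"
  shows "norm (exp_power_integral w X - of_real (exp X) * of_real X powr w * (1 - w / of_real X))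
     \<le> 100 * (M + 1) ^ 2 * 2 powr (M + 2) * exp X * X powr (Re w - 2)"
proof -
  have X0: "X > 0" using X by simp
  have Rw: "\<bar>Re w\<bar> \<le> M" using abs_Re_le_cmod[of w] w by linarith
  define E where "E = 2 powr (M + 2) * exp X * X powr (Re w - 2)"
  have E0: "E \<ge> 0" by (simp add: E_def)
  have small: "norm (of_real (exp (X/2)) * of_real (X/2) powr (w - of_nat j)) \<le> 8 * E" if "j \<le> 1" for j :: nat
  proof -
    have "norm (of_real (exp (X/2)) * of_real (X/2) powr (w - of_nat j)) = exp (X/2) * (X/2) powr (Re w - real j)"
      using X by (simp add: norm_mult norm_powr_real_powr)
    also have "(X/2) powr (Re w - real j) \<le> 2 powr (M + 2) * X powr (Re w - real j)"
      by (rule powr_comparable) (use X Rw that in auto)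
    also have "X powr (Re w - real j) \<le> X powr (Re w - 2 + real 2)" using X by (intro powr_mono) auto
    also have "X powr (Re w - 2 + real 2) = X powr (Re w - 2) * X ^ 2" using X by (simp only: powr_add powr_realpow)
    also have "X ^ 2 \<le> 8 * exp (X/2)"
      using power_le_fact_exp[of "X/2" 2] X by (simp add: power_divide eval_nat_numeral)
    finally have "norm (of_real (exp (X/2)) * of_real (X/2) powr (w - of_nat j))
       \<le> exp (X/2) * (2 powr (M + 2) * (X powr (Re w - 2) * (8 * exp (X/2))))" by (simp add: mult_left_mono)
    also have "\<dots> = 8 * (2 powr (M + 2) * (exp (X/2) * exp (X/2)) * X powr (Re w - 2))" by (simp only: mult_ac)
    also have "exp (X/2) * exp (X/2) = exp X" by (simp add: exp_add[symmetric])
    finally show ?thesis by (simp only: E_def)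
  qed
  have tail: "norm (exp_power_integral (w - 2) X) \<le> E"
    unfolding E_def using norm_exp_power_integral_le[OF X0, of "w - 2" "M + 2"] Rw by simp
  have "exp_power_integral w X - of_real (exp X) * of_real X powr w * (1 - w / of_real X)
     = - (of_real (exp (X/2)) * of_real (X/2) powr (w - of_nat 0)) + w * (of_real (exp (X/2)) * of_real (X/2) powr (w - of_nat 1))
       + w * (w - 1) * exp_power_integral (w - 2) X"
  proof -
    have p: "of_real X powr (w - 1) = of_real X powr w / of_real X" using X by (simp add: powr_diff)
    have w2: "w - 1 - 1 = w - 2" by simp
    show ?thesis unfolding exp_power_integral_parts[OF X0, of w] exp_power_integral_parts[OF X0, of "w - 1"] p w2
      by (simp add: algebra_simps)
  qed
  also have "norm \<dots> \<le> 8 * E + M * (8 * E) + M * (M + 1) * E"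
  proof (intro order_trans[OF norm_triangle_ineq] add_mono)
    show "norm (- (of_real (exp (X/2)) * of_real (X/2) powr (w - of_nat 0))) \<le> 8 * E"
      unfolding norm_minus_cancel by (rule small) auto
    show "norm (w * (of_real (exp (X/2)) * of_real (X/2) powr (w - of_nat 1))) \<le> M * (8 * E)"
      unfolding norm_mult[of w] by (intro mult_mono small w) (use M in auto)
    have "norm (w - 1) \<le> M + 1" using norm_triangle_ineq4[of w 1] w by simp
    thus "norm (w * (w - 1) * exp_power_integral (w - 2) X) \<le> M * (M + 1) * E"
      unfolding norm_mult by (intro mult_mono tail w) (use M in auto)
  qed
  also have "\<dots> = (8 * (M + 1) + M * (M + 1)) * E" by (simp add: algebra_simps)
  also have "\<dots> \<le> (100 * (M + 1) ^ 2) * E"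
  proof (intro mult_right_mono E0)
    have "0 \<le> M * M" by simp
    hence "8 * (M + 1) + M * (M + 1) \<le> 100 * ((M + 1) * (M + 1))" using M by (simp add: algebra_simps)
    thus "8 * (M + 1) + M * (M + 1) \<le> 100 * (M + 1) ^ 2" by (simp only: power2_eq_square)
  qed
  finally show ?thesis by (simp add: E_def mult_ac)
qed

section \<open>The coefficients of the main term\<close>

text \<open>At \<open>y = 1\<close> no prime is at most \<open>y\<close>, so every correction factor
  is a full twisted factor.\<close>

lemma H_eq_correction: "H \<nu> s z = correction \<nu> 1 z s"
proof -
  have "(if prime p then inverse (1 - z / of_nat p powr s) * (1 - 1 / of_nat p powr s) powr z else 1) = corr_factor Big_Omega 1 z p s" for p
    using prime_gt_1_nat[of p] by (auto simp: corr_factor_def twisted_factor_def prime_recip_altdef)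
  moreover have "(if prime p then (1 + z / (of_nat p powr s - 1)) * (1 - 1 / of_nat p powr s) powr z else 1) = corr_factor Small_Omega 1 z p s" for p
  proof (cases "prime p")
    case True
    define a :: complex where "a = of_nat p powr s"
    have "a \<noteq> 0" using prime_gt_0_nat[OF True] by (simp add: a_def)
    hence "z / (a - 1) = z * (1 / a) / (1 - 1 / a)" by (simp add: divide_simps)
    thus ?thesis using True prime_gt_1_nat[OF True]
      by (simp add: corr_factor_def twisted_factor_def prime_recip_altdef a_def)
  qed (simp add: corr_factor_def)
  ultimately show ?thesis by (cases \<nu>) (simp_all only: H.simps correction_def)
qed

lemma G_eq_prod: "G \<nu> s y z = (\<Prod>p | prime p \<and> real p \<le> y. inverse (euler_factor \<nu> z (prime_recip p s)))"
proof -
  have e: "z / (of_nat p powr s - 1) = z * prime_recip p s / (1 - prime_recip p s)" if "prime p" for p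
  proof -
    have "of_nat p powr s \<noteq> (0::complex)" using prime_gt_0_nat[OF that] by simp
    thus ?thesis by (simp add: divide_simps prime_recip_altdef)
  qed
  show ?thesis by (cases \<nu>) (auto simp: prime_recip_altdef e intro!: prod.cong)
qed

text \<open>For \<open>\<omega>\<close> the factor is \<open>(p - 1 + z) / (p - 1)\<close>, which
  vanishes only at \<open>z = 1 - p\<close>; with \<open>norm z < 2\<close> that leaves
  \<open>p = 2\<close> and \<open>z = -1\<close>. For \<open>\<Omega>\<close> it is
  \<open>p / (p - z)\<close>.\<close>

lemma euler_factor_nonzero:
  assumes z: "norm z < 2" and p: "prime p" and nz: "\<not> (\<nu> = Small_Omega \<and> z = -1)"
  shows "euler_factor \<nu> z (prime_recip p 1) \<noteq> 0"
proof -
  define a where "a = complex_of_nat p"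
  have na: "norm a \<ge> 2" using prime_ge_2_nat[OF p] by (simp add: a_def)
  have a0: "a \<noteq> 0" "a \<noteq> 1" using na by auto
  have w: "prime_recip p 1 = 1 / a" by (simp add: prime_recip_altdef a_def)
  show ?thesis
  proof (cases \<nu>)
    case Big_Omega
    have "z \<noteq> a" using na z by auto
    thus ?thesis using Big_Omega a0 by (simp add: w divide_simps)
  next
    case Small_Omega
    have "1 + z * (1 / a) / (1 - 1 / a) = (a - 1 + z) / (a - 1)" using a0 by (simp add: divide_simps)
    moreover have "a - 1 + z \<noteq> 0"
    proof
      assume "a - 1 + z = 0"
      hence z1: "z = 1 - a" by (simp add: algebra_simps eq_neg_iff_add_eq_0)
      hence "norm (of_real (real p - 1) :: complex) < 2" using z
        by (metis a_def minus_diff_eq norm_minus_cancel of_real_1 of_real_diff of_real_of_nat_eq)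
      hence "real p < 3" by (simp only: norm_of_real)
      hence "p = 2" using prime_ge_2_nat[OF p] by simp
      thus False using z1 nz Small_Omega by (simp add: a_def)
    qed
    ultimately show ?thesis using Small_Omega a0 by (simp add: w)
  qed
qed

lemma convergent_corr_factor:
  assumes "1 \<le> r" "r < 2"
  shows "\<exists>\<eta>>0. \<eta> \<le> 1/4 \<and> (\<forall>\<nu> y z s. norm z \<le> r \<longrightarrow> Re s > 1 - \<eta> \<longrightarrow> convergent_prod (\<lambda>p. corr_factor \<nu> y z p s))"
proof -
  obtain C \<eta> where "0 < \<eta>" "\<eta> \<le> 1/4" and f: "\<forall>\<nu> y z. norm z \<le> r \<longrightarrow>
     correction \<nu> y z holomorphic_on {s. Re s > 1 - \<eta>} \<and>
     (\<forall>s. Re s > 1 - \<eta> \<longrightarrow> convergent_prod (\<lambda>p. corr_factor \<nu> y z p s) \<and>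
        norm (correction \<nu> y z s) \<le> exp (r * (\<Sum>p | prime p \<and> real p \<le> y. real p powr (- Re s)) + C))"
    using correction_facts[OF assms] by (elim exE conjE) (rule that; assumption)
  thus ?thesis by (intro exI[of _ \<eta>]) blast
qed

lemma finite_primes_le: "finite {p::nat. prime p \<and> real p \<le> y}"
  by (rule finite_subset[of _ "{..nat \<lfloor>y\<rfloor>}"]) (auto simp: le_nat_floor)

text \<open>Passing from \<open>y\<close> to 1 only changes the factors of the primes up to
  \<open>y\<close>. The relation is stated with Euler factors and not with their inverses, so that
  it remains true where one of them vanishes.\<close>

lemma correction_times_euler:
  assumes "1 \<le> r" "r < 2" "norm z \<le> r"
  shows "\<exists>\<eta>>0. \<forall>s. Re s > 1 - \<eta> \<longrightarrow>
    correction \<nu> 1 z s = correction \<nu> y z s * (\<Prod>p | prime p \<and> real p \<le> y. euler_factor \<nu> z (prime_recip p s))"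
proof -
  obtain \<eta> where \<eta>: "\<eta> > 0" and conv: "\<And>\<nu> y s. Re s > 1 - \<eta> \<Longrightarrow> convergent_prod (\<lambda>p. corr_factor \<nu> y z p s)"
    using convergent_corr_factor[OF assms(1,2)] assms(3) by blast
  have "correction \<nu> 1 z s = correction \<nu> y z s * (\<Prod>p | prime p \<and> real p \<le> y. euler_factor \<nu> z (prime_recip p s))"
    if s: "Re s > 1 - \<eta>" for s
  proof -
    let ?e = "\<lambda>p. if p \<in> {p. prime p \<and> real p \<le> y} then euler_factor \<nu> z (prime_recip p s) else 1"
    have ce: "?e has_prod (\<Prod>p | prime p \<and> real p \<le> y. euler_factor \<nu> z (prime_recip p s))"
      if "\<And>p. prime p \<Longrightarrow> real p \<le> y \<Longrightarrow> euler_factor \<nu> z (prime_recip p s) \<noteq> 0"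
      by (rule has_prod_If_finite_set[OF finite_primes_le])
    have lim: "(\<lambda>N. \<Prod>p\<le>N. corr_factor \<nu> y z p s * ?e p) \<longlonglongrightarrow>
       correction \<nu> y z s * (\<Prod>p | prime p \<and> real p \<le> y. euler_factor \<nu> z (prime_recip p s))"
      unfolding prod.distrib correction_def
    proof (intro tendsto_mult convergent_prod_LIMSEQ conv s)
      obtain N0 where N0: "\<And>p. real p \<le> y \<Longrightarrow> p \<le> N0" by (metis le_nat_floor)
      have "(\<Prod>p\<le>N. ?e p) = (\<Prod>p | prime p \<and> real p \<le> y. euler_factor \<nu> z (prime_recip p s))" if "N \<ge> N0" for N
        by (rule prod.mono_neutral_cong_right) (use N0 that in \<open>auto intro: order_trans\<close>)
      hence "eventually (\<lambda>N. (\<Prod>p\<le>N. ?e p) = (\<Prod>p | prime p \<and> real p \<le> y. euler_factor \<nu> z (prime_recip p s))) sequentially"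
        by (intro eventually_sequentiallyI[of N0])
      thus "(\<lambda>N. \<Prod>p\<le>N. ?e p) \<longlonglongrightarrow> (\<Prod>p | prime p \<and> real p \<le> y. euler_factor \<nu> z (prime_recip p s))"
        by (rule tendsto_eventually)
    qed
    have "corr_factor \<nu> y z p s * ?e p = corr_factor \<nu> 1 z p s" for p
      using prime_gt_1_nat[of p] by (auto simp: corr_factor_def twisted_factor_def)
    hence "(\<lambda>N. \<Prod>p\<le>N. corr_factor \<nu> 1 z p s) \<longlonglongrightarrow>
       correction \<nu> y z s * (\<Prod>p | prime p \<and> real p \<le> y. euler_factor \<nu> z (prime_recip p s))" using lim by simp
    moreover have "(\<lambda>N. \<Prod>p\<le>N. corr_factor \<nu> 1 z p s) \<longlonglongrightarrow> correction \<nu> 1 z s"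
      unfolding correction_def by (intro convergent_prod_LIMSEQ conv s)
    ultimately show ?thesis by (rule LIMSEQ_unique[symmetric])
  qed
  thus ?thesis using \<eta> by blast
qed

lemma correction_1_nonzero:
  assumes "1 \<le> r" "r < 2" "norm z \<le> r" "\<not> (\<nu> = Small_Omega \<and> z = -1)"
  shows "correction \<nu> y z 1 \<noteq> 0"
proof -
  obtain \<eta> where "\<eta> > 0" and conv: "\<And>\<nu> y s. Re s > 1 - \<eta> \<Longrightarrow> convergent_prod (\<lambda>p. corr_factor \<nu> y z p s)"
    using convergent_corr_factor[OF assms(1,2)] assms(3) by blast
  show ?thesis unfolding correction_def
  proof (rule prodinf_nonzero[OF conv])
    fix p
    show "corr_factor \<nu> y z p 1 \<noteq> 0"
    proof (cases "prime p")
      case True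
      have "1 - prime_recip p 1 \<noteq> 0" using one_minus_not_nonpos(2)[OF norm_prime_recip_less[OF True]] by simp
      thus ?thesis using True euler_factor_nonzero[OF le_less_trans[OF assms(3,2)] True assms(4)]
        by (auto simp: corr_factor_def twisted_factor_def)
    qed (simp add: corr_factor_def)
  qed (use \<open>\<eta> > 0\<close> in simp)
qed

lemma field_differentiable_prod:
  fixes f :: "'a \<Rightarrow> complex \<Rightarrow> complex"
  assumes "\<And>i. i \<in> A \<Longrightarrow> f i field_differentiable at s"
  shows "(\<lambda>s. \<Prod>i\<in>A. f i s) field_differentiable at s"
  using assms
proof (induction A rule: infinite_finite_induct)
  case (insert i A)
  thus ?case by (auto intro!: field_differentiable_mult)
qed (auto intro: field_differentiable_const)

text \<open>The product rule at 1, with \<open>zeta_reg\<close> equal to 1 there and its derivative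
  equal to Euler's constant.\<close>

lemma sd_coeff_01:
  assumes r: "1 \<le> r" "r < 2" and z: "norm z \<le> r" and y: "3/2 \<le> y"
  shows "sd_coeff \<nu> y z 0 = correction \<nu> y z 1"
    and "sd_coeff \<nu> y z 1 = euler_mascheroni * z * correction \<nu> y z 1 + deriv (correction \<nu> y z) 1"
    and "correction \<nu> y z field_differentiable at 1"
proof -
  obtain K c where "0 < K" "0 < c" and f: "\<forall>\<nu> y z. norm z \<le> r \<longrightarrow> 3/2 \<le> y \<longrightarrow>
     correction \<nu> y z holomorphic_on {s. Re s > 1 - c / ln y} \<and>
     (\<forall>s. Re s > 1 - c / ln y \<longrightarrow> norm (correction \<nu> y z s) \<le> K * ln y ^ 3)"
    using correction_log_bound[OF r] by (elim exE conjE) (rule that; assumption)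
  have "ln y > 0" using ln_ge_third[OF y] by linarith
  hence "1 \<in> {s. Re s > 1 - c / ln y}" using \<open>c > 0\<close> by simp
  moreover have "correction \<nu> y z holomorphic_on {s. Re s > 1 - c / ln y}" using f z y by blast
  ultimately show fd: "correction \<nu> y z field_differentiable at 1"
    by (intro holomorphic_on_imp_differentiable_at[OF _ open_halfspace_Re_gt])
  show "sd_coeff \<nu> y z 0 = correction \<nu> y z 1" by (simp add: sd_coeff_def near_factor_def)
  have "((\<lambda>s. exp (z * Ln (zeta_reg s)) * correction \<nu> y z s) has_field_derivative
     euler_mascheroni * z * correction \<nu> y z 1 + deriv (correction \<nu> y z) 1) (at 1)"
    by (rule derivative_eq_intros zeta_reg_deriv_1 field_differentiable_derivI[OF fd] refl | simp)+
  hence "deriv (near_factor \<nu> y z) 1 = euler_mascheroni * z * correction \<nu> y z 1 + deriv (correction \<nu> y z) 1"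
    unfolding near_factor_def[abs_def] by (rule DERIV_imp_deriv)
  thus "sd_coeff \<nu> y z 1 = euler_mascheroni * z * correction \<nu> y z 1 + deriv (correction \<nu> y z) 1"
    by (simp add: sd_coeff_def)
qed

text \<open>With \<open>E\<close> the product of the Euler factors over \<open>p \<le> y\<close>,
  \<open>H = correction * E\<close> and \<open>G = 1 / E\<close>. In \<open>h\<close> the factor
  \<open>E\<close> cancels, and in \<open>J\<close> its logarithmic derivative does, leaving
  \<open>correction' / correction + \<gamma> z - 1\<close>. The second claim is about the product
  \<open>h1 * J\<close>, the only way in which \<open>J\<close> enters, so that it also makes sense
  where \<open>J\<close> alone does not.\<close>

lemma main_coefficients:
  assumes r: "1 \<le> r" "r < 2" and z: "norm z \<le> r" and y: "3/2 \<le> y"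
  shows "h1 \<nu> y z = rGamma z * sd_coeff \<nu> y z 0"
    and "h1 \<nu> y z * J \<nu> y z = rGamma z * (sd_coeff \<nu> y z 1 - sd_coeff \<nu> y z 0)"
proof -
  note sd = sd_coeff_01[OF r z y, of \<nu>]
  have "h1 \<nu> y z = rGamma z * sd_coeff \<nu> y z 0 \<and> h1 \<nu> y z * J \<nu> y z = rGamma z * (sd_coeff \<nu> y z 1 - sd_coeff \<nu> y z 0)"
  proof (cases "\<nu> = Small_Omega \<and> z = -1")
    case True
    \<comment> \<open>At the exceptional point both sides of both claims contain the factor
      \<open>rGamma z\<close> and are 0, whatever value the vanishing denominators produce.\<close>
    hence "rGamma z = 0" by (simp add: rGamma_eq_zero_iff)
    thus ?thesis by (simp add: h1_def h_def)
  next
    case False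
    define E where "E s = (\<Prod>p | prime p \<and> real p \<le> y. euler_factor \<nu> z (prime_recip p s))" for s
    have GE: "(\<lambda>s. G \<nu> s y z) = (\<lambda>s. inverse (E s))" by (simp add: G_eq_prod E_def prod_inversef[unfolded o_def])
    obtain \<eta> where \<eta>: "\<eta> > 0" and eq: "\<And>s. Re s > 1 - \<eta> \<Longrightarrow> correction \<nu> 1 z s = correction \<nu> y z s * E s"
      using correction_times_euler[OF r z, of \<nu> y] unfolding E_def by blast
    have E1: "E 1 \<noteq> 0"
      using euler_factor_nonzero[OF le_less_trans[OF z r(2)] _ False] finite_primes_le[of y] by (auto simp: E_def prod_zero_iff)
    have Ed: "E field_differentiable at 1"
    proof -
      have w: "1 - prime_recip p 1 \<noteq> 0" "1 - z * prime_recip p 1 \<noteq> 0" if p: "prime p" for p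
      proof -
        show "1 - prime_recip p 1 \<noteq> 0" using one_minus_not_nonpos(2)[OF norm_prime_recip_less[OF p]] by simp
        have "norm (z * prime_recip p 1) \<le> r * (1/2)"
          unfolding norm_mult using z r norm_prime_recip_le[OF p, of 1 1] by (intro mult_mono) (auto simp: powr_minus_divide)
        hence "norm (z * prime_recip p 1) < 1" using r by linarith
        thus "1 - z * prime_recip p 1 \<noteq> 0" using one_minus_not_nonpos(2) by blast
      qed
      have pd: "prime_recip p field_differentiable at 1" if "prime p" for p
        using prime_recip_holomorphic[OF that, of UNIV] holomorphic_on_imp_differentiable_at by blast
      have "(\<lambda>s. euler_factor \<nu> z (prime_recip p s)) field_differentiable at 1" if "prime p" for p
        using w[OF that] pd[OF that]
        by (cases \<nu>) (auto intro!: field_differentiable_inverse field_differentiable_diff field_differentiable_add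
          field_differentiable_mult field_differentiable_divide)
      thus ?thesis unfolding E_def[abs_def] by (intro field_differentiable_prod) auto
    qed
    define c where "c = correction \<nu> y z 1"
    define c' where "c' = deriv (correction \<nu> y z) 1"
    have cd: "(correction \<nu> y z has_field_derivative c') (at 1)"
      unfolding c'_def by (rule field_differentiable_derivI[OF sd(3)])
    have Ed': "(E has_field_derivative deriv E 1) (at 1)" by (rule field_differentiable_derivI[OF Ed])
    have H1: "H \<nu> 1 z = c * E 1" using eq[of 1] \<eta> by (simp add: H_eq_correction c_def)
    have c0: "c \<noteq> 0" unfolding c_def by (rule correction_1_nonzero[OF r z False])
    have "((\<lambda>s. correction \<nu> y z s * E s) has_field_derivative c' * E 1 + deriv E 1 * c) (at 1)"
      using DERIV_mult[OF cd Ed'] by (simp add: c_def)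
    hence "((\<lambda>s. H \<nu> s z) has_field_derivative c' * E 1 + deriv E 1 * c) (at 1)"
      by (rule has_field_derivative_transform_within_open[of _ _ _ "{s. Re s > 1 - \<eta>}"])
         (use \<eta> eq in \<open>auto simp: H_eq_correction open_halfspace_Re_gt\<close>)
    hence dH: "deriv (\<lambda>s. H \<nu> s z) 1 = c' * E 1 + deriv E 1 * c" by (rule DERIV_imp_deriv)
    have "((\<lambda>s. inverse (E s)) has_field_derivative - (inverse (E 1) * deriv E 1 * inverse (E 1))) (at 1)"
      by (rule DERIV_inverse'[OF Ed' E1])
    hence dG: "deriv (\<lambda>s. G \<nu> s y z) 1 = - (inverse (E 1) * deriv E 1 * inverse (E 1))"
      unfolding GE by (rule DERIV_imp_deriv)
    have G1: "G \<nu> 1 y z = inverse (E 1)" using fun_cong[OF GE] .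
    have h: "h1 \<nu> y z = rGamma z * c" using E1 by (simp add: h1_def h_def H1 G1)
    have "J \<nu> y z = (c' * E 1 + deriv E 1 * c) / (c * E 1) + - (inverse (E 1) * deriv E 1 * inverse (E 1)) / inverse (E 1) + euler_mascheroni * z - 1"
      by (simp only: J_def dH dG H1 G1)
    also have "\<dots> = c' / c + euler_mascheroni * z - 1" using E1 c0 by (simp add: field_simps)
    finally have J: "J \<nu> y z = c' / c + euler_mascheroni * z - 1" .
    have "c * (c' / c + euler_mascheroni * z - 1) = euler_mascheroni * z * c + c' - c" using c0 by (simp add: field_simps)
    thus ?thesis using sd(1,2) by (simp add: h J c_def[symmetric] c'_def[symmetric] mult.assoc)
  qed
  thus "h1 \<nu> y z = rGamma z * sd_coeff \<nu> y z 0"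
    and "h1 \<nu> y z * J \<nu> y z = rGamma z * (sd_coeff \<nu> y z 1 - sd_coeff \<nu> y z 0)" by blast+
qed

section \<open>The asymptotic formula\<close>

lemma Phi_eq_sum: "Phi \<nu> x y z = (\<Sum>n | 0 < n \<and> real n \<le> x. rough_coeff \<nu> y z n)"
proof -
  have fin: "finite {n. 0 < n \<and> real n \<le> x}"
    by (rule finite_subset[of _ "{..nat \<lfloor>x\<rfloor>}"]) (auto simp: le_nat_floor)
  show ?thesis unfolding Phi_def
    by (rule sum.mono_neutral_cong_left[OF fin]) (auto simp: rough_coeff_def)
qed

lemma integral_count_space_finite_support:
  fixes f :: "nat \<Rightarrow> 'b::{banach, second_countable_topology}"
  assumes "finite A" "\<And>i. i \<notin> A \<Longrightarrow> f i = 0"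
  shows "(LINT i|count_space UNIV. f i) = sum f A" "integrable (count_space UNIV) f"
proof -
  have sub: "{i. f i \<noteq> 0} \<subseteq> A" using assms(2) by auto
  have fin: "finite {i \<in> UNIV. f i \<noteq> 0}" using finite_subset[OF sub assms(1)] by simp
  show "(LINT i|count_space UNIV. f i) = sum f A"
    unfolding lebesgue_integral_count_space_finite_support[OF fin]
    by (rule sum.mono_neutral_left[OF assms(1)]) (use sub in auto)
  show "integrable (count_space UNIV) f"
    unfolding integrable_count_space_nat_iff by (rule summable_finite[OF assms(1)]) (simp add: assms(2))
qed

lemma Phi_exp_eq_integral:
  assumes "X \<ge> 0"
  shows "Phi \<nu> (exp X) y z = (LINT n|count_space UNIV. (if ln (real n) \<le> X then rough_coeff \<nu> y z n else 0))"
proof -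
  have fin: "finite {n. 0 < n \<and> real n \<le> exp X}"
    by (rule finite_subset[of _ "{..nat \<lfloor>exp X\<rfloor>}"]) (auto simp: le_nat_floor)
  have e: "ln (real n) \<le> X \<longleftrightarrow> real n \<le> exp X" if "n > 0" for n :: nat
    using that by (metis exp_le_cancel_iff exp_ln of_nat_0_less_iff)
  have "(LINT n|count_space UNIV. (if ln (real n) \<le> X then rough_coeff \<nu> y z n else 0))
     = (\<Sum>n | 0 < n \<and> real n \<le> exp X. if ln (real n) \<le> X then rough_coeff \<nu> y z n else 0)"
  proof (rule integral_count_space_finite_support(1)[OF fin])
    fix n assume "n \<notin> {n. 0 < n \<and> real n \<le> exp X}"
    \<comment> \<open>\<open>n = 0\<close> passes the test because \<open>ln 0 = 0 \<le> X\<close>,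
      but its coefficient is 0.\<close>
    thus "(if ln (real n) \<le> X then rough_coeff \<nu> y z n else 0) = 0" using e[of n] by (cases "n = 0") auto
  qed
  also have "\<dots> = Phi \<nu> (exp X) y z" unfolding Phi_eq_sum by (intro sum.cong) (use e in auto)
  finally show ?thesis by simp
qed

text \<open>Rankin's trick with exponent \<open>1 + 1 / Y\<close>. Taking \<open>Y = max X 1\<close>
  includes the range \<open>1/3 \<le> X < 1\<close>; there \<open>Y \<le> 3 * X\<close>, and
  \<open>3 powr r \<le> 9\<close>.\<close>

lemma Phi_trivial_bound:
  assumes r: "1 \<le> r" "r < 2"
  shows "\<exists>C>0. \<forall>\<nu> y z X. norm z \<le> r \<longrightarrow> 1/3 \<le> X \<longrightarrow> norm (Phi \<nu> (exp X) y z) \<le> C * exp X * X powr r"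
proof -
  let ?b = "\<lambda>Y n. r ^ size (prime_factorization n) * real n powr (- (1 + 1 / Y))"
  obtain K where K: "K > 0" and rk: "\<And>Y. Y \<ge> 1 \<Longrightarrow> summable (?b Y) \<and> suminf (?b Y) \<le> K * Y powr r"
    using rankin_bound[OF r, of 0] by auto
  have "norm (Phi \<nu> (exp X) y z) \<le> (exp 2 * K * 9) * exp X * X powr r" if z: "norm z \<le> r" and X: "1/3 \<le> X" for \<nu> y z X
  proof -
    define Y where "Y = max X 1"
    have Y: "Y \<ge> 1" "X \<le> Y" "Y \<le> 3 * X" "Y \<le> X + 1" using X by (auto simp: Y_def)
    have fin: "finite {n. 0 < n \<and> real n \<le> exp X}"
      by (rule finite_subset[of _ "{..nat \<lfloor>exp X\<rfloor>}"]) (auto simp: le_nat_floor)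
    have "norm (Phi \<nu> (exp X) y z) \<le> (\<Sum>n | 0 < n \<and> real n \<le> exp X. exp (Y + 1) * ?b Y n)"
      unfolding Phi_eq_sum
    proof (rule sum_norm_le)
      fix n assume "n \<in> {n. 0 < n \<and> real n \<le> exp X}"
      hence n: "n > 0" "real n \<le> exp X" by auto
      have "ln (real n) \<le> Y" using n Y by (metis dual_order.trans exp_le_cancel_iff exp_ln of_nat_0_less_iff)
      define c where "c = 1 + 1 / Y"
      have "c * ln (real n) \<le> c * Y" using \<open>ln (real n) \<le> Y\<close> Y by (intro mult_left_mono) (auto simp: c_def)
      also have "\<dots> = Y + 1" using Y by (simp add: c_def distrib_right)
      finally have "1 \<le> exp (Y + 1 + (- c) * ln (real n))" by simp
      hence "1 \<le> exp (Y + 1) * real n powr (- c)" using n by (simp only: powr_def exp_add) simp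
      hence "1 \<le> exp (Y + 1) * real n powr (- (1 + 1 / Y))" by (simp only: c_def)
      hence "r ^ size (prime_factorization n) * 1 \<le> r ^ size (prime_factorization n) * (exp (Y + 1) * real n powr (- (1 + 1 / Y)))"
        using r by (intro mult_left_mono) auto
      with norm_rough_coeff_le[OF z r(1), of \<nu> y n]
      show "norm (rough_coeff \<nu> y z n) \<le> exp (Y + 1) * ?b Y n" by (simp add: mult_ac)
    qed
    also have "\<dots> \<le> exp (Y + 1) * suminf (?b Y)"
      unfolding sum_distrib_left[symmetric] using rk[OF Y(1)] fin r by (intro mult_left_mono sum_le_suminf) auto
    also have "\<dots> \<le> exp (Y + 1) * (K * Y powr r)" using rk[OF Y(1)] by (intro mult_left_mono) auto
    also have "\<dots> \<le> exp (X + 2) * (K * (9 * X powr r))"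
    proof (intro mult_mono)
      have "Y powr r \<le> (3 * X) powr r" using Y r by (intro powr_mono2) auto
      also have "\<dots> = 3 powr r * X powr r" using X by (simp add: powr_mult)
      also have "\<dots> \<le> 3 powr 2 * X powr r" using r by (intro mult_right_mono powr_mono) auto
      finally show "Y powr r \<le> 9 * X powr r" by simp
    qed (use Y K in auto)
    finally show ?thesis by (simp add: exp_add mult_ac)
  qed
  thus ?thesis using K by (intro exI[of _ "exp 2 * K * 9"]) auto
qed

lemma sd_terms_bounded:
  assumes r: "1 \<le> r" "r < 2"
  shows "\<exists>B>0. \<forall>j<m. \<forall>\<nu> y z. norm z \<le> r \<longrightarrow> 3/2 \<le> y \<longrightarrow>
    norm (sd_coeff \<nu> y z j * rGamma (z - of_nat j)) \<le> B * ln y ^ (3 + j)"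
proof (induction m)
  case 0
  show ?case by (intro exI[of _ 1]) auto
next
  case (Suc m)
  then obtain B where B: "B > 0" "\<forall>j<m. \<forall>\<nu> y z. norm z \<le> r \<longrightarrow> 3/2 \<le> y \<longrightarrow>
    norm (sd_coeff \<nu> y z j * rGamma (z - of_nat j)) \<le> B * ln y ^ (3 + j)" by blast
  obtain K where K: "\<forall>\<nu> y z. norm z \<le> r \<longrightarrow> 3/2 \<le> y \<longrightarrow> norm (sd_coeff \<nu> y z m) \<le> K * ln y ^ (3 + m)"
    using sd_coeff_bound[OF r] by blast
  obtain D where D: "D > 0" "\<forall>z::complex. norm z \<le> 2 \<longrightarrow> norm (rGamma (z - of_nat m)) \<le> D"
    using rGamma_bounded by blast
  have l0: "0 \<le> ln y ^ i" if "3/2 \<le> y" for y :: real and i using ln_ge_third[OF that] by simp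
  have "norm (sd_coeff \<nu> y z j * rGamma (z - of_nat j)) \<le> (B + \<bar>K\<bar> * D) * ln y ^ (3 + j)"
    if j: "j < Suc m" and z: "norm z \<le> r" and y: "3/2 \<le> y" for j \<nu> y z
  proof (cases "j = m")
    case True
    have "norm (sd_coeff \<nu> y z m * rGamma (z - of_nat m)) \<le> (\<bar>K\<bar> * ln y ^ (3 + m)) * D"
      unfolding norm_mult
    proof (intro mult_mono)
      have "norm (sd_coeff \<nu> y z m) \<le> K * ln y ^ (3 + m)" using K z y by blast
      also have "\<dots> \<le> \<bar>K\<bar> * ln y ^ (3 + m)" using l0[OF y] by (intro mult_right_mono) auto
      finally show "norm (sd_coeff \<nu> y z m) \<le> \<bar>K\<bar> * ln y ^ (3 + m)" .
      show "norm (rGamma (z - of_nat m)) \<le> D" using D z r by auto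
    qed (use l0[OF y] in auto)
    moreover have "0 \<le> B * ln y ^ (3 + m)" using B l0[OF y] by (intro mult_nonneg_nonneg) auto
    ultimately show ?thesis using True by (simp add: algebra_simps)
  next
    case False
    hence "norm (sd_coeff \<nu> y z j * rGamma (z - of_nat j)) \<le> B * ln y ^ (3 + j)" using B j z y by auto
    also have "\<dots> \<le> (B + \<bar>K\<bar> * D) * ln y ^ (3 + j)" using D l0[OF y] by (intro mult_right_mono) auto
    finally show ?thesis .
  qed
  moreover have "B + \<bar>K\<bar> * D > 0" using B D by (intro add_pos_nonneg) auto
  ultimately show ?case by blast
qed

text \<open>The claimed main term at \<open>x = exp X\<close>, written through the first two
  expansion coefficients instead of \<open>h\<close> and \<open>J\<close>.\<close>

definition main_term :: "prime_counter \<Rightarrow> real \<Rightarrow> complex \<Rightarrow> real \<Rightarrow> complex" where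
  "main_term \<nu> y z X = of_real (exp X) * of_real X powr (z - 1) *
     (rGamma z * sd_coeff \<nu> y z 0 + (z - 1) / of_real X * (rGamma z * (sd_coeff \<nu> y z 1 - sd_coeff \<nu> y z 0)))"

text \<open>\<open>ln y\<close> may be less than 1, so raising an exponent costs a constant, at most
  \<open>2187 = 3 ^ 7\<close>.\<close>

lemma power_le_power_7:
  assumes "1/3 \<le> l" "q \<le> 7"
  shows "l ^ q \<le> 2187 * (l::real) ^ 7"
proof -
  have "(1/3) ^ 7 \<le> (1/3::real) ^ (7 - q)" by (rule power_decreasing) auto
  also have "\<dots> \<le> l ^ (7 - q)" using assms by (intro power_mono) auto
  finally have "1 \<le> 2187 * l ^ (7 - q)" by (simp add: eval_nat_numeral)
  hence "l ^ q * 1 \<le> l ^ q * (2187 * l ^ (7 - q))" using assms by (intro mult_left_mono) auto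
  also have "\<dots> = 2187 * l ^ (q + (7 - q))" by (simp add: power_add)
  finally show ?thesis using assms by simp
qed

text \<open>Each step in \<open>j\<close> gains \<open>1 / X\<close> and costs one
  \<open>ln y \<le> X\<close>. Hence \<open>j = 0\<close> is expanded to two terms,
  \<open>j = 1\<close> to one, and for \<open>j \<ge> 2\<close> the trivial bound suffices: the
  surplus \<open>(ln y) ^ (j - 2)\<close> is paid by \<open>X ^ (j - 2)\<close>, leaving
  \<open>(ln y) ^ 5 * X powr (Re z - 3)\<close>.\<close>

lemma model_sum_asymp:
  assumes r: "1 \<le> r" "r < 2" and m: "2 \<le> m"
  shows "\<exists>C>0. \<forall>\<nu> y z X. norm z \<le> r \<longrightarrow> 3/2 \<le> y \<longrightarrow> 1 \<le> X \<longrightarrow> ln y \<le> X \<longrightarrow>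
    norm ((\<Sum>j<m. sd_coeff \<nu> y z j * rGamma (z - of_nat j) * exp_power_integral (z - 1 - of_nat j) X) - main_term \<nu> y z X)
      \<le> C * ln y ^ 7 * exp X * X powr (Re z - 3)"
proof -
  obtain B where B: "B > 0" and bnd: "\<And>j \<nu> y z. j < m \<Longrightarrow> norm z \<le> r \<Longrightarrow> 3/2 \<le> y \<Longrightarrow>
    norm (sd_coeff \<nu> y z j * rGamma (z - of_nat j)) \<le> B * ln y ^ (3 + j)"
    using sd_terms_bounded[OF r, of m] by blast
  define A where "A = 100 * (4 + 1) ^ 2 * 2 powr (4 + 2) + (4::real)"
  define Q where "Q = 2 powr (3 + real m)"
  have A: "A > 0" and Q: "Q > 0" by (simp_all add: A_def Q_def add_pos_pos)
  define C where "C = 2187 * (B * A + B * A + real m * (B * Q))"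
  have main: "norm ((\<Sum>j<m. sd_coeff \<nu> y z j * rGamma (z - of_nat j) * exp_power_integral (z - 1 - of_nat j) X) - main_term \<nu> y z X)
      \<le> C * ln y ^ 7 * exp X * X powr (Re z - 3)"
    if z: "norm z \<le> r" and y: "3/2 \<le> y" and X: "1 \<le> X" and lX: "ln y \<le> X" for \<nu> y z X
  proof -
    define l where "l = ln y"
    define E where "E = exp X * X powr (Re z - 3)"
    have l: "1/3 \<le> l" "l \<le> X" using ln_ge_third[OF y] lX by (simp_all add: l_def)
    have E: "E \<ge> 0" by (simp add: E_def)
    let ?c = "\<lambda>j. sd_coeff \<nu> y z j * rGamma (z - of_nat j)"
    let ?I = "\<lambda>j. exp_power_integral (z - 1 - of_nat j) X"
    let ?M = "\<lambda>w. of_real (exp X) * of_real X powr w * (1 - w / of_real X) :: complex"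
    have Rz: "\<bar>Re z\<bar> \<le> 2" using abs_Re_le_cmod[of z] z r by linarith
    have Pw: "norm (of_real (exp X) * of_real X powr w) = exp X * X powr Re w" for w :: complex
      using X by (simp add: norm_mult norm_powr_real_powr)
    have asym: "norm (exp_power_integral w X - ?M w) \<le> (A - 4) * E" if w: "norm w \<le> 4" "Re w - 2 \<le> Re z - 3" for w
    proof -
      have "norm (exp_power_integral w X - ?M w) \<le> (A - 4) * exp X * X powr (Re w - 2)"
        using exp_power_integral_asymp[OF X w(1)] by (simp add: A_def)
      also have "\<dots> \<le> (A - 4) * exp X * X powr (Re z - 3)"
        using w X by (intro mult_left_mono powr_mono) (auto simp: A_def)
      finally show ?thesis by (simp add: E_def mult_ac)
    qed
    have nz1: "norm (z - 1) \<le> 3" and nz2: "norm (z - 2) \<le> 4"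
      using norm_triangle_ineq4[of z 1] norm_triangle_ineq4[of z 2] z r by simp_all
    have b0: "norm (?I 0 - ?M (z - 1)) \<le> A * E"
    proof -
      have "norm (?I 0 - ?M (z - 1)) \<le> (A - 4) * E" using asym[of "z - 1"] nz1 by simp
      also have "\<dots> \<le> A * E" using E by (intro mult_right_mono) auto
      finally show ?thesis .
    qed
    have b1: "norm (?I 1 - of_real (exp X) * of_real X powr (z - 2)) \<le> A * E"
    proof -
      have z2: "z - 1 - of_nat 1 = z - 2" by simp
      have "norm (?I 1 - ?M (z - 2)) \<le> (A - 4) * E" unfolding z2 using asym[of "z - 2"] nz2 by simp
      note h1 = this
      have h2: "norm (of_real (exp X) * of_real X powr (z - 2) * ((z - 2) / of_real X)) \<le> 4 * E"
      proof -
        have "norm (of_real (exp X) * of_real X powr (z - 2) * ((z - 2) / of_real X)) = exp X * X powr (Re z - 2) * (norm (z - 2) / X)"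
          unfolding norm_mult[of "of_real (exp X) * of_real X powr (z - 2)"] Pw norm_divide using X by simp
        also have "\<dots> \<le> exp X * X powr (Re z - 2) * (4 / X)" using nz2 X by (intro mult_left_mono divide_right_mono) auto
        also have "\<dots> = 4 * (exp X * (X powr (Re z - 2) / X powr 1))" using X by simp
        also have "X powr (Re z - 2) / X powr 1 = X powr (Re z - 3)" unfolding powr_diff[symmetric] by simp
        finally show ?thesis by (simp add: E_def)
      qed
      have eq: "?I 1 - of_real (exp X) * of_real X powr (z - 2)
         = (?I 1 - ?M (z - 2)) - of_real (exp X) * of_real X powr (z - 2) * ((z - 2) / of_real X)" by (simp add: algebra_simps)
      have "norm (?I 1 - of_real (exp X) * of_real X powr (z - 2)) \<le> (A - 4) * E + 4 * E"
        by (subst eq) (rule order_trans[OF norm_triangle_ineq4 add_mono[OF h1 h2]])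
      thus ?thesis by (simp add: algebra_simps)
    qed
    have b2: "norm (?c j * ?I j) \<le> B * Q * (l ^ 5 * E)" if j: "2 \<le> j" "j < m" for j
    proof -
      have "\<bar>Re (z - 1 - of_nat j)\<bar> \<le> 3 + real m" using Rz j by simp
      hence "norm (?I j) \<le> Q * exp X * X powr Re (z - 1 - of_nat j)"
        unfolding Q_def using X by (intro norm_exp_power_integral_le) auto
      hence "norm (?c j * ?I j) \<le> (B * l ^ (3 + j)) * (Q * exp X * X powr Re (z - 1 - of_nat j))"
        unfolding norm_mult[of "?c j"] l_def using B ln_ge_third[OF y] by (intro mult_mono bnd j z y) auto
      also have "\<dots> \<le> (B * (l ^ 5 * X ^ (j - 2))) * (Q * exp X * X powr Re (z - 1 - of_nat j))"
      proof (intro mult_right_mono mult_left_mono)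
        have "l ^ (3 + j) = l ^ 5 * l ^ (j - 2)" using j by (simp add: power_add[symmetric])
        also have "\<dots> \<le> l ^ 5 * X ^ (j - 2)" using l by (intro mult_left_mono power_mono) auto
        finally show "l ^ (3 + j) \<le> l ^ 5 * X ^ (j - 2)" .
      qed (use B Q in auto)
      also have "\<dots> = B * Q * (l ^ 5 * (exp X * (X powr real (j - 2) * X powr Re (z - 1 - of_nat j))))"
        using X by (simp add: powr_realpow)
      also have "X powr real (j - 2) * X powr Re (z - 1 - of_nat j) = X powr (Re z - 3)"
        unfolding powr_add[symmetric] using j by (intro arg_cong2[of _ _ _ _ "(powr)"] refl) (simp add: of_nat_diff)
      finally show ?thesis by (simp only: E_def)
    qed
    obtain n where "m = 2 + n" using m le_Suc_ex by blast
    hence mn: "m = Suc (Suc n)" by simp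
    have split: "(\<Sum>j<m. ?c j * ?I j) = ?c 0 * ?I 0 + ?c 1 * ?I 1 + (\<Sum>j<n. ?c (Suc (Suc j)) * ?I (Suc (Suc j)))"
      unfolding mn sum.lessThan_Suc_shift by simp
    have mt: "main_term \<nu> y z X = ?c 0 * ?M (z - 1) + ?c 1 * (of_real (exp X) * of_real X powr (z - 2))"
    proof -
      \<comment> \<open>This recurrence turns the coefficient \<open>1 / \<Gamma>(z - 1)\<close> of
        the second term into the factor \<open>z - 1\<close> in front of \<open>J\<close>.\<close>
      have rg: "rGamma (z - 1) = (z - 1) * rGamma z" using rGamma_plus1[of "z - 1"] by simp
      have "z - 2 = z - 1 - 1" by simp
      hence p: "of_real X powr (z - 2) = of_real X powr (z - 1) / of_real X"
        using X by (simp only: powr_diff) simp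
      define u where "u = complex_of_real X powr (z - 1)"
      show ?thesis unfolding main_term_def p of_nat_1 rg u_def[symmetric] using X by (simp add: field_simps)
    qed
    have "(\<Sum>j<m. ?c j * ?I j) - main_term \<nu> y z X = ?c 0 * (?I 0 - ?M (z - 1)) + ?c 1 * (?I 1 - of_real (exp X) * of_real X powr (z - 2))
       + (\<Sum>j<n. ?c (Suc (Suc j)) * ?I (Suc (Suc j)))" unfolding split mt right_diff_distrib by (simp only: add_diff_eq diff_add_eq diff_diff_eq add_ac)
    also have "norm \<dots> \<le> (B * l ^ 3) * (A * E) + (B * l ^ 4) * (A * E) + real n * (B * Q * (l ^ 5 * E))"
    proof (intro order_trans[OF norm_triangle_ineq] add_mono)
      show "norm (?c 0 * (?I 0 - ?M (z - 1))) \<le> (B * l ^ 3) * (A * E)"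
        unfolding norm_mult[of "?c 0"] using bnd[of 0 z y \<nu>] z y m B l by (intro mult_mono b0) (auto simp: l_def)
      show "norm (?c 1 * (?I 1 - of_real (exp X) * of_real X powr (z - 2))) \<le> (B * l ^ 4) * (A * E)"
        unfolding norm_mult[of "?c 1"] using bnd[of 1 z y \<nu>] z y m B l by (intro mult_mono b1) (auto simp: l_def)
      show "norm (\<Sum>j<n. ?c (Suc (Suc j)) * ?I (Suc (Suc j))) \<le> real n * (B * Q * (l ^ 5 * E))"
      proof -
        have "norm (\<Sum>j\<in>{..<n}. ?c (Suc (Suc j)) * ?I (Suc (Suc j))) \<le> of_nat (card {..<n}) * (B * Q * (l ^ 5 * E))"
          by (rule sum_norm_bound, rule b2) (use mn in auto)
        thus ?thesis by (simp only: card_lessThan)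
      qed
    qed
    also have "\<dots> \<le> (B * (2187 * l ^ 7)) * (A * E) + (B * (2187 * l ^ 7)) * (A * E) + real m * (B * Q * ((2187 * l ^ 7) * E))"
    proof -
      have 7: "l ^ 3 \<le> 2187 * l ^ 7" "l ^ 4 \<le> 2187 * l ^ 7" "l ^ 5 \<le> 2187 * l ^ 7"
        by (intro power_le_power_7 l; simp)+
      have AE0: "0 \<le> A * E" "0 \<le> B * Q" using A B Q E by (auto intro: mult_nonneg_nonneg)
      have l5: "0 \<le> l ^ 5 * E" using l E by (intro mult_nonneg_nonneg) auto
      have "(B * l ^ 3) * (A * E) \<le> (B * (2187 * l ^ 7)) * (A * E)"
        using 7(1) B by (intro mult_right_mono[OF _ AE0(1)] mult_left_mono) auto
      moreover have "(B * l ^ 4) * (A * E) \<le> (B * (2187 * l ^ 7)) * (A * E)"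
        using 7(2) B by (intro mult_right_mono[OF _ AE0(1)] mult_left_mono) auto
      moreover have "real n * (B * Q * (l ^ 5 * E)) \<le> real m * (B * Q * (l ^ 5 * E))"
        using mn by (intro mult_right_mono mult_nonneg_nonneg[OF AE0(2) l5]) simp
      moreover have "real m * (B * Q * (l ^ 5 * E)) \<le> real m * (B * Q * ((2187 * l ^ 7) * E))"
        using 7(3) by (intro mult_left_mono[OF _ of_nat_0_le_iff] mult_left_mono[OF _ AE0(2)] mult_right_mono[OF _ E])
      ultimately show ?thesis by linarith
    qed
    also have "\<dots> = C * l ^ 7 * E" by (simp add: C_def algebra_simps)
    finally show ?thesis by (simp add: l_def E_def mult_ac)
  qed
  have "C > 0" unfolding C_def using A B Q by (intro mult_pos_pos add_pos_nonneg) auto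
  thus ?thesis using main by blast
qed

lemma gamma_density_times_powr:
  assumes "v > 0"
  shows "gamma_density (w + of_nat k) v * of_real (v powr (- real k)) = of_real v powr (w - 1)"
proof -
  have "of_real (v powr (- real k)) = complex_of_real v powr (- of_nat k)"
    using powr_of_real[of v "- real k"] assms by simp
  thus ?thesis using assms by (simp add: gamma_density_def powr_add[symmetric])
qed

text \<open>The weight \<open>v powr (- k)\<close> undoes the shift by \<open>k\<close> in the
  exponent of \<open>gamma_density\<close>; the endpoint \<open>X / 2\<close> is a null set.\<close>

lemma model_part_eq:
  assumes X: "X > 0"
  shows "(LINT v|lborel. (if X / 2 < v \<and> v \<le> X then model_density \<nu> y z k m v * of_real (v powr (- real k)) else 0))
     = (\<Sum>j<m. sd_coeff \<nu> y z j * rGamma (z - of_nat j) * exp_power_integral (z - 1 - of_nat j) X)"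
proof -
  let ?c = "\<lambda>j. sd_coeff \<nu> y z j * rGamma (z - of_nat j)"
  let ?g = "\<lambda>j v. indicator {X/2..X} v *\<^sub>R (of_real (exp v) * of_real v powr (z - 1 - of_nat j))"
  have "(LINT v|lborel. (if X / 2 < v \<and> v \<le> X then model_density \<nu> y z k m v * of_real (v powr (- real k)) else 0))
      = (LINT v|lborel. (\<Sum>j<m. ?c j * ?g j v))"
  proof (rule integral_cong_AE)
    have "(\<lambda>v. indicator {X/2..X} v *\<^sub>R (of_real (exp v) * of_real v powr (z - 1 - of_nat j))) \<in> borel_measurable lborel" for j
      by (rule borel_measurable_integrable[OF integrable_exp_powr[OF X]])
    thus "(\<lambda>v. \<Sum>j<m. ?c j * ?g j v) \<in> borel_measurable lborel" by (intro borel_measurable_sum borel_measurable_times) auto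
    have "AE v in lborel. v \<noteq> X / 2" by (rule AE_lborel_singleton)
    thus "AE v in lborel. ((if X / 2 < v \<and> v \<le> X then model_density \<nu> y z k m v * of_real (v powr (- real k)) else 0) = (\<Sum>j<m. ?c j * ?g j v))"
    proof eventually_elim
      case (elim v)
      show ?case
      proof (cases "X / 2 < v \<and> v \<le> X")
        case True
        hence v: "v > 0" using X by linarith
        have "model_density \<nu> y z k m v * of_real (v powr (- real k)) =
            (\<Sum>j<m. ?c j * (of_real (exp v) * (gamma_density (z - of_nat j + of_nat k) v * of_real (v powr (- real k)))))"
          unfolding model_density_def sum_distrib_right by (intro sum.cong refl) (simp only: mult_ac)
        also have "\<dots> = (\<Sum>j<m. ?c j * ?g j v)"
          unfolding gamma_density_times_powr[OF v] using True by (intro sum.cong refl) (simp add: diff_diff_eq add.commute)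
        finally show ?thesis using True by simp
      next
        case False
        hence "v \<notin> {X/2..X}" using elim by auto
        thus ?thesis using False by auto
      qed
    qed
  qed measurable
  also have "\<dots> = (\<Sum>j<m. ?c j * exp_power_integral (z - 1 - of_nat j) X)"
    unfolding exp_power_integral_def
    by (subst Bochner_Integration.integral_sum) (intro integrable_mult_right integrable_exp_powr X, simp only: integral_mult_right_zero)
  finally show ?thesis .
qed

text \<open>Partial summation over \<open>X / 2 < ln n \<le> X\<close> calls on the weighted
  estimate at every \<open>u\<close> in that range, hence the hypothesis at \<open>X / 2\<close>.
  The integers up to \<open>exp (X / 2)\<close> fall to the trivial bound, as the saving
  \<open>exp (- X / 2)\<close> is smaller than any power of \<open>X\<close>.\<close>

lemma Phi_asymp:
  assumes r: "1 \<le> r" "r < 2" and \<tau>: "0 < \<tau>" "\<tau> < 1"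
  shows "\<exists>C X0. 0 < C \<and> 2 \<le> X0 \<and> (\<forall>\<nu> y z X. norm z \<le> r \<longrightarrow> 3/2 \<le> y \<longrightarrow> X0 \<le> X \<longrightarrow> ln y \<le> (X / 2) powr \<tau> \<longrightarrow>
    norm (Phi \<nu> (exp X) y z - main_term \<nu> y z X) \<le> C * ln y ^ 7 * exp X * X powr (Re z - 3))"
proof -
  obtain k m C1 X1 where m: "2 \<le> m" and k: "m + 4 \<le> k" and C1: "0 < C1" and X1: "1 \<le> X1"
    and ws: "\<forall>\<nu> y z X. norm z \<le> r \<longrightarrow> 3/2 \<le> y \<longrightarrow> X1 \<le> X \<longrightarrow> ln y \<le> X powr \<tau> \<longrightarrow>
    norm ((LINT n|count_space UNIV. (if ln (real n) \<le> X then rough_coeff \<nu> y z n * of_real (ln (real n) ^ k) else 0))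
        - (LINT v|lborel. (if v \<le> X then model_density \<nu> y z k m v else 0))) \<le> C1 * exp X * X powr (real k - 5)"
    using weighted_sum_asymp[OF r \<tau>] by (elim exE conjE) (rule that; assumption)
  obtain C2 where C2: "0 < C2" and mod: "\<forall>\<nu> y z X. norm z \<le> r \<longrightarrow> 3/2 \<le> y \<longrightarrow> 1 \<le> X \<longrightarrow> ln y \<le> X \<longrightarrow>
    norm ((\<Sum>j<m. sd_coeff \<nu> y z j * rGamma (z - of_nat j) * exp_power_integral (z - 1 - of_nat j) X) - main_term \<nu> y z X)
      \<le> C2 * ln y ^ 7 * exp X * X powr (Re z - 3)"
    using model_sum_asymp[OF r m] by (elim exE conjE) (rule that; assumption)
  obtain C3 where C3: "0 < C3" and triv: "\<forall>\<nu> y z X. norm z \<le> r \<longrightarrow> 1/3 \<le> X \<longrightarrow> norm (Phi \<nu> (exp X) y z) \<le> C3 * exp X * X powr r"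
    using Phi_trivial_bound[OF r] by (elim exE conjE) (rule that; assumption)
  define X0 where "X0 = max (2 * X1) 2"
  define C where "C = C2 + 2187 * (2 ^ Suc k * C1 + C3 * (fact 7 * 2 ^ 7))"
  have "norm (Phi \<nu> (exp X) y z - main_term \<nu> y z X) \<le> C * ln y ^ 7 * exp X * X powr (Re z - 3)"
    if z: "norm z \<le> r" and y: "3/2 \<le> y" and X: "X0 \<le> X" and ly: "ln y \<le> (X / 2) powr \<tau>" for \<nu> y z X
  proof -
    have X2: "2 \<le> X" "X1 \<le> X / 2" using X by (auto simp: X0_def)
    have l: "1/3 \<le> ln y" by (rule ln_ge_third[OF y])
    have lX: "ln y \<le> X"
    proof -
      have "(X / 2) powr \<tau> \<le> (X / 2) powr 1" using X2 \<tau> by (intro powr_mono) auto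
      thus ?thesis using ly X2 by simp
    qed
    let ?a = "rough_coeff \<nu> y z"
    let ?g = "\<lambda>n. ?a n * of_real (ln (real n) ^ k)"
    let ?md = "model_density \<nu> y z k m"
    define S where "S = (\<lambda>u. LINT n|count_space UNIV. (if ln (real n) \<le> u then ?g n else 0))"
    define T where "T = (\<lambda>u. LINT v|lborel. (if v \<le> u then ?md v else 0))"
    have fin: "finite {n. ln (real n) \<le> X}"
    proof (rule finite_subset[of _ "{..nat \<lfloor>exp X\<rfloor>}"])
      show "{n. ln (real n) \<le> X} \<subseteq> {..nat \<lfloor>exp X\<rfloor>}"
      proof
        fix n assume n: "n \<in> {n. ln (real n) \<le> X}"
        have "real n \<le> exp X" if "n > 0" using n that by (metis exp_le_cancel_iff exp_ln mem_Collect_eq of_nat_0_less_iff)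
        thus "n \<in> {..nat \<lfloor>exp X\<rfloor>}" by (cases "n = 0") (auto simp: le_nat_floor)
      qed
    qed simp
    have iS: "integrable (count_space UNIV) (\<lambda>n. if ln (real n) \<le> X then ?g n else 0)"
      by (rule integral_count_space_finite_support(2)[OF fin]) auto
    have ia: "integrable (count_space UNIV) (\<lambda>n. if ln (real n) \<le> u then ?a n else 0)" if "u \<le> X" for u
      by (rule integral_count_space_finite_support(2)[OF fin]) (use that in auto)
    have iT: "integrable lborel (\<lambda>v. if v \<le> X then ?md v else 0)"
    proof (rule Bochner_Integration.integrable_bound)
      show "integrable lborel (\<lambda>v. exp (2 * X) * (norm (?md v) * exp (- Re 2 * v)))"
        using model_density_laplace(2)[OF le_less_trans[OF z r(2)], of m k 2 \<nu> y] k by (intro integrable_mult_right) simp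
      show "AE v in lborel. norm (if v \<le> X then ?md v else 0) \<le> norm (exp (2 * X) * (norm (?md v) * exp (- Re 2 * v)))"
      proof (intro always_eventually allI)
        fix v
        have "1 \<le> exp (2 * X) * exp (- 2 * v)" if "v \<le> X" unfolding exp_add[symmetric] using that by simp
        hence "norm (?md v) * 1 \<le> norm (?md v) * (exp (2 * X) * exp (- 2 * v))" if "v \<le> X"
          using that by (intro mult_left_mono) auto
        thus "norm (if v \<le> X then ?md v else 0) \<le> norm (exp (2 * X) * (norm (?md v) * exp (- Re 2 * v)))"
          by (auto simp: abs_mult mult_ac)
      qed
    qed measurable
    have k0: "k > 0" "k \<ge> 5" using k m by auto
    have Y: "0 < X / 2" "X / 2 \<le> X" using X2 by auto
    have ST: "norm (S u - T u) \<le> C1 * exp X * X powr (real k - 5)" if u: "X / 2 \<le> u" "u \<le> X" for u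
    proof -
      have "(X / 2) powr \<tau> \<le> u powr \<tau>" using u X2 \<tau> by (intro powr_mono2) auto
      hence "ln y \<le> u powr \<tau>" using ly by linarith
      hence "norm (S u - T u) \<le> C1 * exp u * u powr (real k - 5)" unfolding S_def T_def using ws z y X2 u by auto
      also have "\<dots> \<le> C1 * exp X * X powr (real k - 5)"
        using C1 u X2 k0 by (intro mult_mono powr_mono2) auto
      finally show ?thesis .
    qed
    have D: "norm ((LINT n|count_space UNIV. (if X / 2 < ln (real n) \<and> ln (real n) \<le> X then ?g n * of_real (ln (real n) powr (- real k)) else 0))
       - (LINT v|lborel. (if X / 2 < v \<and> v \<le> X then ?md v * of_real (v powr (- real k)) else 0)))
       \<le> 2 ^ Suc k * (C1 * exp X) * X powr (- 5)"
    proof -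
      have sfS: "sigma_finite_measure (count_space (UNIV :: nat set))" by (rule sigma_finite_measure_count_space)
      have sfT: "sigma_finite_measure (lborel :: real measure)" by (rule sigma_finite_lborel)
      have mS: "?g \<in> borel_measurable (count_space UNIV)" "(\<lambda>n. ln (real n)) \<in> borel_measurable (count_space UNIV)" by simp_all
      have mT: "?md \<in> borel_measurable lborel" "(\<lambda>v::real. v) \<in> borel_measurable lborel" by measurable
      have S: "S u = (LINT n|count_space UNIV. (if ln (real n) \<le> u then ?g n else 0))" for u by (simp only: S_def)
      have T: "T u = (LINT v|lborel. (if v \<le> u then ?md v else 0))" for u by (simp only: T_def)
      note RS = remove_power_weight[OF sfS k0(1) Y mS iS, folded S]
      note RT = remove_power_weight[OF sfT k0(1) Y mT iT, folded T]
      have D0: "0 \<le> C1 * exp X" "0 < X" using C1 X2 by auto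
      show ?thesis unfolding RS(1) RT(1)
        by (rule remove_power_weight_difference[OF k0(2) D0(2,1) ST RS(2) RT(2)])
    qed
    have PS: "(LINT n|count_space UNIV. (if X / 2 < ln (real n) \<and> ln (real n) \<le> X then ?g n * of_real (ln (real n) powr (- real k)) else 0))
       = Phi \<nu> (exp X) y z - Phi \<nu> (exp (X / 2)) y z"
    proof -
      have X0': "0 \<le> X" "0 \<le> X / 2" using X2 by auto
      have "Phi \<nu> (exp X) y z - Phi \<nu> (exp (X / 2)) y z =
          (LINT n|count_space UNIV. (if ln (real n) \<le> X then ?a n else 0) - (if ln (real n) \<le> X / 2 then ?a n else 0))"
        unfolding Phi_exp_eq_integral[OF X0'(1)] Phi_exp_eq_integral[OF X0'(2)]
        by (rule Bochner_Integration.integral_diff[symmetric, OF ia[OF order_refl] ia[OF Y(2)]])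
      also have "\<dots> = (LINT n|count_space UNIV. (if X / 2 < ln (real n) \<and> ln (real n) \<le> X then ?g n * of_real (ln (real n) powr (- real k)) else 0))"
      proof (intro Bochner_Integration.integral_cong refl)
        fix n :: nat
        show "(if ln (real n) \<le> X then ?a n else 0) - (if ln (real n) \<le> X / 2 then ?a n else 0) =
          (if X / 2 < ln (real n) \<and> ln (real n) \<le> X then ?g n * of_real (ln (real n) powr (- real k)) else 0)"
        proof (cases "X / 2 < ln (real n) \<and> ln (real n) \<le> X")
          case True
          hence "ln (real n) > 0" using Y by linarith
          hence "ln (real n) ^ k * ln (real n) powr (- real k) = 1"
            by (simp add: powr_realpow[symmetric] powr_add[symmetric])
          hence "?g n * of_real (ln (real n) powr (- real k)) = ?a n"
            by (metis (no_types, opaque_lifting) mult.assoc mult.right_neutral of_real_1 of_real_mult)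
          thus ?thesis using True by simp
        qed (use Y in auto)
      qed
      finally show ?thesis by simp
    qed
    define W where "W = X powr (Re z - 3)"
    have Rz: "\<bar>Re z\<bar> \<le> 2" using abs_Re_le_cmod[of z] z r by linarith
    have W5: "X powr (- 5) \<le> W" unfolding W_def using X2 Rz by (intro powr_mono) auto
    have l7: "1 \<le> 2187 * ln y ^ 7" using power_le_power_7[OF l, of 0] by simp
    have sm: "norm (Phi \<nu> (exp (X / 2)) y z) \<le> C3 * (fact 7 * 2 ^ 7) * (exp X * X powr (- 5))"
    proof -
      have "norm (Phi \<nu> (exp (X / 2)) y z) \<le> C3 * exp (X / 2) * (X / 2) powr r" using triv z X2 by auto
      also have "\<dots> \<le> C3 * exp (X / 2) * (X ^ 7 * X powr (- 5))"
      proof (intro mult_left_mono)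
        have "(X / 2) powr r \<le> X powr r" using X2 r by (intro powr_mono2) auto
        also have "\<dots> \<le> X powr (real 7 + (- 5))" using X2 r by (intro powr_mono) auto
        also have "\<dots> = X ^ 7 * X powr (- 5)" unfolding powr_add using X2 by (subst powr_realpow) auto
        finally show "(X / 2) powr r \<le> X ^ 7 * X powr (- 5)" .
      qed (use C3 in auto)
      also have "\<dots> \<le> C3 * exp (X / 2) * (fact 7 * 2 ^ 7 * exp (X / 2) * X powr (- 5))"
      proof (intro mult_left_mono mult_right_mono)
        have "(X / 2) ^ 7 \<le> fact 7 * exp (X / 2)" using X2 by (intro power_le_fact_exp) auto
        hence "2 ^ 7 * (X / 2) ^ 7 \<le> 2 ^ 7 * (fact 7 * exp (X / 2))" by (intro mult_left_mono) auto
        thus "X ^ 7 \<le> fact 7 * 2 ^ 7 * exp (X / 2)" by (simp add: power_divide mult_ac)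
      qed (use C3 in auto)
      also have "\<dots> = C3 * (fact 7 * 2 ^ 7) * ((exp (X / 2) * exp (X / 2)) * X powr (- 5))" by (simp only: mult_ac)
      also have "exp (X / 2) * exp (X / 2) = exp X" by (simp add: exp_add[symmetric])
      finally show ?thesis .
    qed
    define L where "L = (\<Sum>j<m. sd_coeff \<nu> y z j * rGamma (z - of_nat j) * exp_power_integral (z - 1 - of_nat j) X)"
    have D': "norm ((Phi \<nu> (exp X) y z - Phi \<nu> (exp (X / 2)) y z) - L) \<le> 2 ^ Suc k * C1 * (exp X * X powr (- 5))"
    proof -
      have "X > 0" using X2 by simp
      from D[unfolded PS model_part_eq[OF this]] show ?thesis by (simp add: L_def mult_ac)
    qed
    have M: "norm (L - main_term \<nu> y z X) \<le> C2 * ln y ^ 7 * exp X * W" unfolding L_def W_def using mod z y lX X2 by auto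
    have "Phi \<nu> (exp X) y z - main_term \<nu> y z X = ((Phi \<nu> (exp X) y z - Phi \<nu> (exp (X / 2)) y z) - L)
       + Phi \<nu> (exp (X / 2)) y z + (L - main_term \<nu> y z X)" by simp
    also have "norm \<dots> \<le> 2 ^ Suc k * C1 * (exp X * X powr (- 5)) + C3 * (fact 7 * 2 ^ 7) * (exp X * X powr (- 5)) + C2 * ln y ^ 7 * exp X * W"
      by (intro order_trans[OF norm_triangle_ineq] add_mono D' sm M)
    also have "\<dots> = (2 ^ Suc k * C1 + C3 * (fact 7 * 2 ^ 7)) * (exp X * (1 * X powr (- 5))) + C2 * ln y ^ 7 * exp X * W"
      by (simp only: distrib_right mult_1_left)
    also have "\<dots> \<le> (2 ^ Suc k * C1 + C3 * (fact 7 * 2 ^ 7)) * (exp X * ((2187 * ln y ^ 7) * W)) + C2 * ln y ^ 7 * exp X * W"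
      using l l7 W5 C1 C3 by (intro add_right_mono mult_left_mono mult_mono add_nonneg_nonneg) auto
    also have "\<dots> = C * ln y ^ 7 * exp X * W" unfolding C_def by (simp only: distrib_left distrib_right mult_ac add_ac)
    finally show ?thesis by (simp only: W_def)
  qed
  moreover have "C > 0" unfolding C_def using C1 C2 C3 by (intro add_pos_pos mult_pos_pos) auto
  moreover have "2 \<le> X0" by (simp add: X0_def)
  ultimately show ?thesis by blast
qed

section \<open>Large y, where the error term dominates\<close>

lemma main_term_bound:
  assumes r: "1 \<le> r" "r < 2"
  shows "\<exists>C>0. \<forall>\<nu> y z X. norm z \<le> r \<longrightarrow> 3/2 \<le> y \<longrightarrow> 1/3 \<le> X \<longrightarrow>
    norm (main_term \<nu> y z X) \<le> C * ln y ^ 4 * exp X * X powr (Re z - 1)"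
proof -
  obtain B where B: "B > 0" and bnd: "\<And>j \<nu> y z. j < 2 \<Longrightarrow> norm z \<le> r \<Longrightarrow> 3/2 \<le> y \<Longrightarrow>
    norm (sd_coeff \<nu> y z j * rGamma (z - of_nat j)) \<le> B * ln y ^ (3 + j)"
    using sd_terms_bounded[OF r, of 2] by blast
  have "norm (main_term \<nu> y z X) \<le> (33 * B) * ln y ^ 4 * exp X * X powr (Re z - 1)"
    if z: "norm z \<le> r" and y: "3/2 \<le> y" and X: "1/3 \<le> X" for \<nu> y z X
  proof -
    define l where "l = ln y"
    have l: "1/3 \<le> l" using ln_ge_third[OF y] by (simp add: l_def)
    define a where "a = sd_coeff \<nu> y z 0 * rGamma z"
    define b where "b = sd_coeff \<nu> y z 1 * rGamma (z - 1)"
    have a: "norm a \<le> B * l ^ 3" using bnd[of 0 z y \<nu>] z y by (simp add: a_def l_def)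
    have b: "norm b \<le> B * l ^ 4" using bnd[of 1 z y \<nu>] z y by (simp add: b_def l_def)
    have rg: "rGamma (z - 1) = (z - 1) * rGamma z" using rGamma_plus1[of "z - 1"] by simp
    have "main_term \<nu> y z X = of_real (exp X) * of_real X powr (z - 1) * (a + (b - (z - 1) * a) / of_real X)"
      unfolding main_term_def a_def b_def rg by (simp add: divide_inverse algebra_simps)
    also have "norm \<dots> = exp X * X powr (Re z - 1) * norm (a + (b - (z - 1) * a) / of_real X)"
      using X by (simp add: norm_mult norm_powr_real_powr)
    also have "\<dots> \<le> exp X * X powr (Re z - 1) * (33 * B * l ^ 4)"
    proof (intro mult_left_mono)
      have "norm (z - 1) \<le> 3" using norm_triangle_ineq4[of z 1] z r by simp
      hence za: "norm ((z - 1) * a) \<le> 3 * (B * l ^ 3)" unfolding norm_mult using a by (intro mult_mono) auto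
      have n1: "norm (b - (z - 1) * a) \<le> B * l ^ 4 + 3 * (B * l ^ 3)"
        by (intro order_trans[OF norm_triangle_ineq4] add_mono b za)
      have "norm ((b - (z - 1) * a) / of_real X) = norm (b - (z - 1) * a) * (1 / X)" using X by (simp add: norm_divide)
      also have "\<dots> \<le> (B * l ^ 4 + 3 * (B * l ^ 3)) * 3"
        using X n1 by (intro mult_mono) (auto simp: field_simps intro: order_trans[OF norm_ge_zero])
      finally have n2: "norm ((b - (z - 1) * a) / of_real X) \<le> 3 * (B * l ^ 4) + 9 * (B * l ^ 3)" by (simp add: algebra_simps)
      have "B * l ^ 3 * 1 \<le> B * l ^ 3 * (3 * l)" using l B by (intro mult_left_mono) auto
      hence l34: "B * l ^ 3 \<le> 3 * (B * l ^ 4)" by (simp add: eval_nat_numeral mult_ac)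
      \<comment> \<open>Ten terms of size \<open>B * l ^ 3\<close> and three of size
        \<open>B * l ^ 4\<close>; with \<open>l ^ 3 \<le> 3 * l ^ 4\<close> this gives
        \<open>30 + 3 = 33\<close>.\<close>
      have "norm (a + (b - (z - 1) * a) / of_real X) \<le> B * l ^ 3 + (3 * (B * l ^ 4) + 9 * (B * l ^ 3))"
        by (intro order_trans[OF norm_triangle_ineq] add_mono a n2)
      also have "\<dots> \<le> 33 * (B * l ^ 4)" using l34 by linarith
      finally show "norm (a + (b - (z - 1) * a) / of_real X) \<le> 33 * B * l ^ 4" by simp
    qed auto
    finally show ?thesis by (simp add: l_def mult_ac)
  qed
  thus ?thesis using B by (intro exI[of _ "33 * B"]) auto
qed

lemma powr_ge_const:
  assumes "1/3 \<le> X" "0 \<le> a" "a \<le> 4"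
  shows "1/81 \<le> X powr (a::real)"
proof -
  have "(1/3) powr 4 \<le> (1/3::real) powr a" using assms by (intro powr_mono') auto
  also have "\<dots> \<le> X powr a" using assms by (intro powr_mono2) auto
  finally show ?thesis by (simp add: powr_numeral power_divide)
qed

text \<open>Here \<open>(ln y) ^ 7 * X powr (Re z - 3)\<close> is at least of order
  \<open>X powr (2 * r + Re z)\<close>, and \<open>r + Re z \<ge> 0\<close> makes this at least of
  order \<open>X powr r\<close>. For the main term \<open>(ln y) ^ 3\<close> must beat
  \<open>X ^ 2\<close>, and three times the exponent is at least 2 because
  \<open>r \<ge> 1\<close>.\<close>

lemma Phi_large_y_range:
  assumes r: "1 \<le> r" "r < 2" and c: "c > 0"
  shows "\<exists>C>0. \<forall>\<nu> y z X. norm z \<le> r \<longrightarrow> 3/2 \<le> y \<longrightarrow> 1/3 \<le> X \<longrightarrow> c * X powr ((2 * r + 3) / 7) \<le> ln y \<longrightarrow>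
    norm (Phi \<nu> (exp X) y z - main_term \<nu> y z X) \<le> C * ln y ^ 7 * exp X * X powr (Re z - 3)"
proof -
  obtain C1 where C1: "C1 > 0" and triv: "\<forall>\<nu> y z X. norm z \<le> r \<longrightarrow> 1/3 \<le> X \<longrightarrow> norm (Phi \<nu> (exp X) y z) \<le> C1 * exp X * X powr r"
    using Phi_trivial_bound[OF r] by (elim exE conjE) (rule that; assumption)
  obtain C2 where C2: "C2 > 0" and mtb: "\<forall>\<nu> y z X. norm z \<le> r \<longrightarrow> 3/2 \<le> y \<longrightarrow> 1/3 \<le> X \<longrightarrow>
    norm (main_term \<nu> y z X) \<le> C2 * ln y ^ 4 * exp X * X powr (Re z - 1)"
    using main_term_bound[OF r] by (elim exE conjE) (rule that; assumption)
  define \<tau> where "\<tau> = (2 * r + 3) / 7"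
  define C where "C = C1 * (81 / c ^ 7) + C2 * (81 / c ^ 3)"
  have "norm (Phi \<nu> (exp X) y z - main_term \<nu> y z X) \<le> C * ln y ^ 7 * exp X * X powr (Re z - 3)"
    if z: "norm z \<le> r" and y: "3/2 \<le> y" and X: "1/3 \<le> X" and ly: "c * X powr \<tau> \<le> ln y" for \<nu> y z X
  proof -
    define l where "l = ln y"
    have l: "1/3 \<le> l" using ln_ge_third[OF y] by (simp add: l_def)
    have X0: "X > 0" using X by linarith
    have Rz: "\<bar>Re z\<bar> \<le> r" using abs_Re_le_cmod[of z] z by linarith
    have lp: "c ^ q * X powr (\<tau> * real q) \<le> l ^ q" for q
    proof -
      have "(c * X powr \<tau>) ^ q \<le> l ^ q" using ly c by (intro power_mono) (auto simp: l_def)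
      moreover have "(X powr \<tau>) ^ q = X powr (\<tau> * real q)" using X0 by (simp add: powr_realpow[symmetric] powr_powr)
      ultimately show ?thesis by (simp add: power_mult_distrib)
    qed
    have a: "X powr r \<le> 81 / c ^ 7 * (l ^ 7 * X powr (Re z - 3))"
    proof -
      have "X powr r * (1/81) \<le> X powr r * X powr (r + Re z)"
        using X Rz r by (intro mult_left_mono powr_ge_const) auto
      also have "\<dots> = X powr (\<tau> * real 7) * X powr (Re z - 3)"
      proof -
        have "\<tau> * real 7 = 2 * r + 3" by (simp add: \<tau>_def)
        hence "r + (r + Re z) = \<tau> * real 7 + (Re z - 3)" by linarith
        thus ?thesis unfolding powr_add[symmetric] by (simp only:)
      qed
      finally have "c ^ 7 * (X powr r * (1/81)) \<le> c ^ 7 * (X powr (\<tau> * real 7) * X powr (Re z - 3))"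
        using c by (intro mult_left_mono) auto
      also have "\<dots> \<le> l ^ 7 * X powr (Re z - 3)"
        unfolding mult.assoc[symmetric] by (intro mult_right_mono lp) auto
      finally show ?thesis using c by (simp add: field_simps)
    qed
    have b: "l ^ 4 * X powr (Re z - 1) \<le> 81 / c ^ 3 * (l ^ 7 * X powr (Re z - 3))"
    proof -
      have "X powr (Re z - 1) * (1/81) \<le> X powr (Re z - 1) * X powr (\<tau> * real 3 - 2)"
        using X r by (intro mult_left_mono powr_ge_const) (auto simp: \<tau>_def)
      also have "\<dots> = X powr (\<tau> * real 3) * X powr (Re z - 3)"
      proof -
        have "Re z - 1 + (\<tau> * real 3 - 2) = \<tau> * real 3 + (Re z - 3)" by linarith
        thus ?thesis unfolding powr_add[symmetric] by (simp only:)
      qed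
      finally have "c ^ 3 * (X powr (Re z - 1) * (1/81)) \<le> c ^ 3 * (X powr (\<tau> * real 3) * X powr (Re z - 3))"
        using c by (intro mult_left_mono) auto
      also have "\<dots> \<le> l ^ 3 * X powr (Re z - 3)"
        unfolding mult.assoc[symmetric] by (intro mult_right_mono lp) auto
      finally have "l ^ 4 * (c ^ 3 * (X powr (Re z - 1) * (1/81))) \<le> l ^ 4 * (l ^ 3 * X powr (Re z - 3))"
        using l by (intro mult_left_mono) auto
      also have "\<dots> = l ^ 7 * X powr (Re z - 3)" by (simp add: power_add[symmetric])
      finally show ?thesis using c by (simp add: field_simps)
    qed
    have "norm (Phi \<nu> (exp X) y z - main_term \<nu> y z X) \<le> C1 * exp X * X powr r + C2 * l ^ 4 * exp X * X powr (Re z - 1)"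
      by (intro order_trans[OF norm_triangle_ineq4] add_mono) (use triv mtb z y X in \<open>auto simp: l_def\<close>)
    also have "\<dots> = C1 * exp X * (X powr r) + C2 * exp X * (l ^ 4 * X powr (Re z - 1))" by simp
    also have "\<dots> \<le> C1 * exp X * (81 / c ^ 7 * (l ^ 7 * X powr (Re z - 3))) + C2 * exp X * (81 / c ^ 3 * (l ^ 7 * X powr (Re z - 3)))"
      using C1 C2 by (intro add_mono mult_left_mono a b) auto
    also have "\<dots> = C * l ^ 7 * exp X * X powr (Re z - 3)" by (simp add: C_def algebra_simps)
    finally show ?thesis by (simp only: l_def)
  qed
  moreover have "C > 0" unfolding C_def using C1 C2 c by (intro add_pos_pos mult_pos_pos divide_pos_pos) auto
  ultimately show ?thesis unfolding \<tau>_def by blast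
qed

text \<open>The two ranges overlap and leave no gap, including all bounded \<open>X\<close>: below
  any fixed threshold \<open>ln y \<ge> 1/3\<close> already counts as large.\<close>

lemma Phi_main_term:
  assumes r: "1 \<le> r" "r < 2"
  shows "\<exists>C. \<forall>\<nu> y z X. norm z \<le> r \<longrightarrow> 3/2 \<le> y \<longrightarrow> ln y \<le> X \<longrightarrow>
    norm (Phi \<nu> (exp X) y z - main_term \<nu> y z X) \<le> C * ln y ^ 7 * exp X * X powr (Re z - 3)"
proof -
  define \<tau> where "\<tau> = (2 * r + 3) / 7"
  have \<tau>: "0 < \<tau>" "\<tau> < 1" using r by (simp_all add: \<tau>_def)
  obtain C1 X0 where C1: "0 < C1" "2 \<le> X0" and asy: "\<forall>\<nu> y z X. norm z \<le> r \<longrightarrow> 3/2 \<le> y \<longrightarrow> X0 \<le> X \<longrightarrow> ln y \<le> (X / 2) powr \<tau> \<longrightarrow>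
    norm (Phi \<nu> (exp X) y z - main_term \<nu> y z X) \<le> C1 * ln y ^ 7 * exp X * X powr (Re z - 3)"
    using Phi_asymp[OF r \<tau>] by (elim exE conjE) (rule that; assumption)
  \<comment> \<open>Small enough for two reasons: \<open>c * X0 = 1/3 \<le> ln y\<close> puts every
    \<open>X < X0\<close> into the large range, and
    \<open>c \<le> 1/2 \<le> (1/2) powr \<tau>\<close> does so for every \<open>y\<close> with
    \<open>ln y > (X / 2) powr \<tau>\<close>.\<close>
  define c where "c = 1 / (3 * X0)"
  have c: "c > 0" using C1 by (simp add: c_def)
  obtain C2 where C2: "0 < C2" and lrg: "\<forall>\<nu> y z X. norm z \<le> r \<longrightarrow> 3/2 \<le> y \<longrightarrow> 1/3 \<le> X \<longrightarrow> c * X powr \<tau> \<le> ln y \<longrightarrow>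
    norm (Phi \<nu> (exp X) y z - main_term \<nu> y z X) \<le> C2 * ln y ^ 7 * exp X * X powr (Re z - 3)"
    using Phi_large_y_range[OF r c, folded \<tau>_def] by (elim exE conjE) (rule that; assumption)
  have "norm (Phi \<nu> (exp X) y z - main_term \<nu> y z X) \<le> (C1 + C2) * ln y ^ 7 * exp X * X powr (Re z - 3)"
    if z: "norm z \<le> r" and y: "3/2 \<le> y" and lX: "ln y \<le> X" for \<nu> y z X
  proof -
    define E where "E = ln y ^ 7 * exp X * X powr (Re z - 3)"
    have l: "1/3 \<le> ln y" by (rule ln_ge_third[OF y])
    hence X: "1/3 \<le> X" using lX by linarith
    have E: "E \<ge> 0" unfolding E_def using l by (intro mult_nonneg_nonneg) auto
    have "norm (Phi \<nu> (exp X) y z - main_term \<nu> y z X) \<le> C1 * E \<or> norm (Phi \<nu> (exp X) y z - main_term \<nu> y z X) \<le> C2 * E"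
    proof (cases "X0 \<le> X \<and> ln y \<le> (X / 2) powr \<tau>")
      case True
      thus ?thesis using asy z y by (simp add: E_def mult.assoc)
    next
      case False
      have "c * X powr \<tau> \<le> ln y"
      proof (cases "X0 \<le> X")
        case True
        have "c * X powr \<tau> \<le> (1/2) powr \<tau> * X powr \<tau>"
        proof (intro mult_right_mono)
          have "c \<le> 1/2" using C1 by (simp add: c_def field_simps)
          also have "\<dots> = (1/2) powr 1" by simp
          also have "\<dots> \<le> (1/2) powr \<tau>" using \<tau> by (intro powr_mono') auto
          finally show "c \<le> (1/2) powr \<tau>" .
        qed auto
        also have "\<dots> = (X / 2) powr \<tau>" using X powr_mult[of "1/2" X \<tau>] by simp
        finally show ?thesis using False True by linarith
      next
        case lt: False
        have "X powr \<tau> \<le> X0 powr \<tau>" using lt X \<tau> by (intro powr_mono2) auto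
        also have "\<dots> \<le> X0 powr 1" using C1 \<tau> by (intro powr_mono) auto
        finally have "c * X powr \<tau> \<le> c * X0" using C1 c by (intro mult_left_mono) auto
        also have "\<dots> = 1/3" using C1 by (simp add: c_def)
        finally show ?thesis using l by linarith
      qed
      thus ?thesis using lrg z y X by (simp add: E_def mult.assoc)
    qed
    moreover have "C1 * E \<le> (C1 + C2) * E" "C2 * E \<le> (C1 + C2) * E" using E C1 C2 by (intro mult_right_mono; simp)+
    ultimately have "norm (Phi \<nu> (exp X) y z - main_term \<nu> y z X) \<le> (C1 + C2) * E" by linarith
    thus ?thesis by (simp only: E_def mult.assoc)
  qed
  thus ?thesis by blast
qed

theorem theorem2p3:
  fixes \<nu> :: prime_counter and r :: real
  assumes "r < 2"
  shows "\<exists>C::real. \<forall>(x::real) (y::real) (z::complex).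
           norm z \<le> r \<longrightarrow> 3 / 2 \<le> y \<longrightarrow> y \<le> x \<longrightarrow>
           (\<exists>R::complex.
              Phi \<nu> x y z =
                of_real x * of_real (ln x) powr (z - 1) *
                  (h1 \<nu> y z * (1 + (z - 1) / of_real (ln x) * J \<nu> y z) + R) \<and>
              norm R \<le> C * ((ln y) ^ 7 / (ln x) ^ 2))"
proof -
  \<comment> \<open>The estimates above are for radii at least 1, whereas \<open>r\<close> may be
    smaller or even negative.\<close>
  define r' where "r' = max r 1"
  have r': "1 \<le> r'" "r' < 2" "r \<le> r'" using assms by (auto simp: r'_def)
  obtain C where C: "\<forall>\<nu> y z X. norm z \<le> r' \<longrightarrow> 3/2 \<le> y \<longrightarrow> ln y \<le> X \<longrightarrow>
    norm (Phi \<nu> (exp X) y z - main_term \<nu> y z X) \<le> C * ln y ^ 7 * exp X * X powr (Re z - 3)"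
    using Phi_main_term[OF r'(1,2)] by blast
  have "\<exists>R::complex.
              Phi \<nu> x y z =
                of_real x * of_real (ln x) powr (z - 1) *
                  (h1 \<nu> y z * (1 + (z - 1) / of_real (ln x) * J \<nu> y z) + R) \<and>
              norm R \<le> C * ((ln y) ^ 7 / (ln x) ^ 2)"
    if z: "norm z \<le> r" and y: "3/2 \<le> y" "y \<le> x" for x y z
  proof -
    define X where "X = ln x"
    have zr: "norm z \<le> r'" using z r' by linarith
    have lX: "ln y \<le> X" unfolding X_def using y by (intro ln_mono) auto
    hence X: "X > 0" using ln_ge_third[OF y(1)] by linarith
    have x: "exp X = x" using y by (simp add: X_def)
    define P where "P = complex_of_real x * of_real X powr (z - 1)"
    have nP: "norm P = exp X * X powr (Re z - 1)"
      using X y by (simp add: P_def norm_mult norm_powr_real_powr x)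
    have P0: "P \<noteq> 0" using X y by (auto simp: P_def)
    define Q where "Q = h1 \<nu> y z * (1 + (z - 1) / of_real X * J \<nu> y z)"
    \<comment> \<open>Multiplying out makes \<open>J\<close> appear only in the product
      \<open>h1 * J\<close>, which is under control for every \<open>z\<close>.\<close>
    have "Q = h1 \<nu> y z + (z - 1) / of_real X * (h1 \<nu> y z * J \<nu> y z)" by (simp add: Q_def algebra_simps)
    hence "Q = rGamma z * sd_coeff \<nu> y z 0 + (z - 1) / of_real X * (rGamma z * (sd_coeff \<nu> y z 1 - sd_coeff \<nu> y z 0))"
      unfolding main_coefficients(2)[OF r'(1,2) zr y(1)] unfolding main_coefficients(1)[OF r'(1,2) zr y(1)] .
    hence mt: "main_term \<nu> y z X = P * Q" by (simp only: main_term_def P_def x)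
    define R where "R = Phi \<nu> x y z / P - Q"
    have "R = (Phi \<nu> x y z - P * Q) / P" using P0 by (simp add: R_def diff_divide_distrib)
    hence "norm R = norm (Phi \<nu> x y z - P * Q) / norm P" by (simp add: norm_divide)
    also have "\<dots> \<le> (C * ln y ^ 7 * exp X * X powr (Re z - 3)) / norm P"
    proof (rule divide_right_mono)
      have "norm (Phi \<nu> (exp X) y z - main_term \<nu> y z X) \<le> C * ln y ^ 7 * exp X * X powr (Re z - 3)"
        using C zr y(1) lX by blast
      thus "norm (Phi \<nu> x y z - P * Q) \<le> C * ln y ^ 7 * exp X * X powr (Re z - 3)" by (simp only: mt x)
    qed simp
    also have "\<dots> = C * (ln y ^ 7 * (X powr (Re z - 3) / X powr (Re z - 1)))" unfolding nP by simp
    also have "X powr (Re z - 3) / X powr (Re z - 1) = X powr (- real 2)" unfolding powr_diff[symmetric] by simp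
    also have "\<dots> = 1 / X ^ 2" using X by (simp only: powr_minus_divide powr_realpow)
    finally have "norm R \<le> C * (ln y ^ 7 / X ^ 2)" by simp
    moreover have "Phi \<nu> x y z = P * (Q + R)" using P0 by (simp add: R_def)
    ultimately show ?thesis unfolding P_def Q_def X_def by blast
  qed
  thus ?thesis by blast
qed

end
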